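(* For any small join restriction category $\mathbf{X}$, the Yoneda embedding $\mathbf{y}_{jr}\colon\mathbf{X}\to\mathsf{PSh}_{jr}(\mathbf{X})$ exhibits the category of join restriction presheaves $\mathsf{PSh}_{jr}(\mathbf{X})$ as the free cocompletion of $\mathbf{X}$, in the sense that the functor $$(-)\circ\mathbf{y}_{jr}\colon\mathbf{jrCocomp}(\mathsf{PSh}_{jr}(\mathbf{X}),\mathcal{E})\to\mathbf{jrCat}(\mathbf{X},\mathcal{E})$$ is an equivalence of categories for any cocomplete join restriction category $\mathcal{E}$.
   Context: All categories are locally small unless stated otherwise. Restriction categories. A restriction category is a category $\mathbf{X}$ with an assignment $f\mapsto \bar f$, $\mathbf{X}(A,B)\to\mathbf{X}(A,A)$, satisfying, for suitable maps, (R1) $f\bar f=f$; (R2) $\bar g\bar f=\bar f\bar g$; (R3) $\overline{g\bar f}=\bar g\bar f$; (R4) $\bar h f=f\,\overline{hf}$. A map $f$ is a restriction idempotent if $f=\bar f$, and total if $\bar f=1$; $\mathsf{Total}(\mathbf{X})$ is the subcategory of total maps. Hom-sets are partially ordered by $f\le g$ iff $f=g\bar f$. Maps $f,g\in\mathbf{X}(A,B)$ are compatible if $f\bar g=g\bar f$; a set of parallel maps is compatible if its elements are pairwise compatible. A join restriction category is a restriction category in which every compatible set $S\subset\mathbf{X}(A,B)$ has a join $\bigvee_{s\in S}s$ in the poset $\mathbf{X}(A,B)$ satisfying (J1) $\overline{\bigvee_{s\in S}s}=\bigvee_{s\in S}\bar s$ and (J2) $(\bigvee_{s\in S}s)\circ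 g=\bigvee_{s\in S}(s\circ g)$. A restriction functor is a functor preserving $f\mapsto\bar f$; a join restriction functor also preserves joins of compatible sets; a restriction transformation is a natural transformation with total components. $\mathbf{jrCat}$ is the 2-category of join restriction categories, join restriction functors and restriction transformations. Cocompleteness. A restriction category $\mathbf{X}$ is cocomplete if it is split (every restriction idempotent splits), $\mathsf{Total}(\mathbf{X})$ is cocomplete, and the inclusion $\mathsf{Total}(\mathbf{X})\hookrightarrow\mathbf{X}$ preserves colimits. A restriction functor $F\colon\mathbf{X}\to\mathbf{Y}$ is cocontinuous if the induced functor $\mathsf{Total}(F)\colon\mathsf{Total}(\mathbf{X})\to\mathsf{Total}(\mathbf{Y})$ is cocontinuous. A join restriction category is cocomplete if it is cocomplete as a restriction category. $\mathbf{jrCocomp}$ is the 2-category of cocomplete join restriction categories, cocontinuous restriction functors and restriction transformations. Join restriction presheaves. A restriction presheaf on a restriction category $\mathbf{X}$ is a presheaf $P\colon\mathbf{X}^{\mathrm{op}}\to\mathbf{Set}$ with maps $PA\to\mathbf{X}(A,A)$, $x\mapsto\bar x$, where each $\bar x$ is a restriction idempotent, satisfying (RP1) $x\cdot\bar x=x$; (RP2) $\overline{x\cdot\bar f}=\bar x\circ\bar f$ for $f$ with domain $A$; (RP3) $\bar x\circ g=g\circ\overline{x\cdot g}$ for $g\colon B\to A$. $PA$ is partially ordered by $x\le y$ iff $x=y\cdot\bar x$; $x,y\in PA$ are compatible if $x\cdot\bar y=y\cdot\bar x$, and a subset of $PA$ is compatible if its elements are pairwise compatible. If $\mathbf{X}$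 is a join restriction category, a join restriction presheaf is a restriction presheaf $P$ such that every compatible $S\subset PA$ has a join in the poset $PA$, with (JRP1) $\overline{\bigvee_{s\in S}s}=\bigvee_{s\in S}\bar s$ and (JRP2) $(\bigvee_{s\in S}s)\cdot g=\bigvee_{s\in S}(s\cdot g)$ for all $g\colon B\to A$. $\mathsf{PSh}_{jr}(\mathbf{X})$ has join restriction presheaves as objects and all natural transformations as morphisms, with the restriction $\bar\alpha$ of $\alpha\colon P\Rightarrow Q$ given by $\bar\alpha_A(x)=x\cdot\overline{\alpha_A(x)}$; it is a join restriction category. The Yoneda embedding $\mathbf{y}_{jr}$ sends $A$ to the representable $\mathbf{X}(-,A)$ with $f\mapsto\bar f$ the restriction of $\mathbf{X}$, and acts on maps by postcomposition. *)

theory Defs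
  imports "HOL-Library.FuncSet" "HOL-Library.Equipollence"
begin

text \<open>
  Smallness is measured by a type \<open>'u\<close>: a set is small if it has strictly fewer elements than
  \<open>'u\<close>. The condition \<open>universe TYPE('u)\<close> says that the cardinality of \<open>'u\<close> is an infinite regular
  strong limit, so the small subsets of \<open>'u\<close> (the objects of the category Set) have the closure
  properties of a Grothendieck universe. Uncountability is not needed and not demanded, so the
  condition also holds for \<open>'u = nat\<close>.
\<close>

definition small :: "'u itself \<Rightarrow> 'x set \<Rightarrow> bool" where
  "small U S \<longleftrightarrow> S \<prec> (UNIV :: 'u set)"

definition universe :: "'u itself \<Rightarrow> bool" where
  "universe U \<longleftrightarrow>
     infinite (UNIV :: 'u set) \<and>
     (\<forall>S :: 'u set. small U S \<longrightarrow> small U (Pow S)) \<and>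
     (\<forall>(I :: 'u set) (F :: 'u \<Rightarrow> 'u set).
        small U I \<and> (\<forall>i\<in>I. small U (F i)) \<longrightarrow> small U (\<Union>i\<in>I. F i))"

lemma universe_nat: "universe TYPE(nat)"
proof -
  have *: "S \<prec> (UNIV :: nat set) \<longleftrightarrow> finite S" for S :: "'x set"
    by (metis finite_lesspoll_infinite infinite_UNIV_nat infinite_le_lepoll lesspoll_def
        lepoll_antisym)
  show ?thesis
    by (auto simp: universe_def small_def *)
qed

record ('o, 'a) precat =
  Obj :: "'o set"
  Arr :: "'a set"
  Dom :: "'a \<Rightarrow> 'o"
  Cod :: "'a \<Rightarrow> 'o"
  Idn :: "'o \<Rightarrow> 'a"
  Comp :: "'a \<Rightarrow> 'a \<Rightarrow> 'a" (infixl "\<cdot>\<index>" 70)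

definition Hom :: "('o, 'a, 'c) precat_scheme \<Rightarrow> 'o \<Rightarrow> 'o \<Rightarrow> 'a set" where
  "Hom C A B = {f \<in> Arr C. Dom C f = A \<and> Cod C f = B}"

locale category =
  fixes C :: "('o, 'a, 'c) precat_scheme" (structure)
  assumes dom_in_Obj: "f \<in> Arr C \<Longrightarrow> Dom C f \<in> Obj C"
    and cod_in_Obj: "f \<in> Arr C \<Longrightarrow> Cod C f \<in> Obj C"
    and idn_in_Hom: "A \<in> Obj C \<Longrightarrow> Idn C A \<in> Hom C A A"
    and comp_in_Hom: "f \<in> Hom C A B \<Longrightarrow> g \<in> Hom C B D \<Longrightarrow> g \<cdot> f \<in> Hom C A D"
    and comp_assoc: "f \<in> Hom C A B \<Longrightarrow> g \<in> Hom C B D \<Longrightarrow> h \<in> Hom C D E \<Longrightarrow>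
                       (h \<cdot> g) \<cdot> f = h \<cdot> (g \<cdot> f)"
    and comp_idn_right: "f \<in> Hom C A B \<Longrightarrow> f \<cdot> Idn C A = f"
    and comp_idn_left: "f \<in> Hom C A B \<Longrightarrow> Idn C B \<cdot> f = f"

definition locally_small :: "'u itself \<Rightarrow> ('o, 'a, 'c) precat_scheme \<Rightarrow> bool" where
  "locally_small U C \<longleftrightarrow> (\<forall>A\<in>Obj C. \<forall>B\<in>Obj C. small U (Hom C A B))"

definition small_category :: "'u itself \<Rightarrow> ('o, 'a, 'c) precat_scheme \<Rightarrow> bool" where
  "small_category U C \<longleftrightarrow> category C \<and> small U (Obj C) \<and> small U (Arr C)"

definition isomorphism :: "('o, 'a, 'c) precat_scheme \<Rightarrow> 'a \<Rightarrow> bool" where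
  "isomorphism C f \<longleftrightarrow> f \<in> Arr C \<and>
     (\<exists>g \<in> Hom C (Cod C f) (Dom C f).
        g \<cdot>\<^bsub>C\<^esub> f = Idn C (Dom C f) \<and> f \<cdot>\<^bsub>C\<^esub> g = Idn C (Cod C f))"

text \<open>
  Functors, presheaves and transformations are kept extensional (undefined outside their domain),
  so that HOL equality is the mathematical equality.
\<close>

record ('o, 'a, 'p, 'b) func =
  Fo :: "'o \<Rightarrow> 'p"
  Fa :: "'a \<Rightarrow> 'b"

definition is_functor ::
  "('o, 'a, 'c) precat_scheme \<Rightarrow> ('p, 'b, 'd) precat_scheme \<Rightarrow> ('o, 'a, 'p, 'b) func \<Rightarrow> bool"
  where
  "is_functor C D F \<longleftrightarrow>
     Fo F \<in> Obj C \<rightarrow>\<^sub>E Obj D \<and>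
     Fa F \<in> Arr C \<rightarrow>\<^sub>E Arr D \<and>
     (\<forall>f\<in>Arr C. Dom D (Fa F f) = Fo F (Dom C f) \<and> Cod D (Fa F f) = Fo F (Cod C f)) \<and>
     (\<forall>A\<in>Obj C. Fa F (Idn C A) = Idn D (Fo F A)) \<and>
     (\<forall>f\<in>Arr C. \<forall>g\<in>Arr C. Dom C g = Cod C f \<longrightarrow>
        Fa F (g \<cdot>\<^bsub>C\<^esub> f) = Fa F g \<cdot>\<^bsub>D\<^esub> Fa F f)"

definition id_functor :: "('o, 'a, 'c) precat_scheme \<Rightarrow> ('o, 'a, 'o, 'a) func" where
  "id_functor C = \<lparr>Fo = (\<lambda>A\<in>Obj C. A), Fa = (\<lambda>f\<in>Arr C. f)\<rparr>"

text \<open>The first argument is the domain of the composite \<open>G \<circ> F\<close>.\<close>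

definition comp_functor ::
  "('o, 'a, 'c) precat_scheme \<Rightarrow> ('p, 'b, 'q, 'e) func \<Rightarrow> ('o, 'a, 'p, 'b) func
     \<Rightarrow> ('o, 'a, 'q, 'e) func" where
  "comp_functor C G F =
     \<lparr>Fo = (\<lambda>A\<in>Obj C. Fo G (Fo F A)), Fa = (\<lambda>f\<in>Arr C. Fa G (Fa F f))\<rparr>"

definition nat_trans ::
  "('o, 'a, 'c) precat_scheme \<Rightarrow> ('p, 'b, 'd) precat_scheme \<Rightarrow>
     ('o, 'a, 'p, 'b) func \<Rightarrow> ('o, 'a, 'p, 'b) func \<Rightarrow> ('o \<Rightarrow> 'b) \<Rightarrow> bool" where
  "nat_trans C D F G t \<longleftrightarrow>
     is_functor C D F \<and> is_functor C D G \<and>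
     t \<in> (\<Pi>\<^sub>E A\<in>Obj C. Hom D (Fo F A) (Fo G A)) \<and>
     (\<forall>f\<in>Arr C. t (Cod C f) \<cdot>\<^bsub>D\<^esub> Fa F f = Fa G f \<cdot>\<^bsub>D\<^esub> t (Dom C f))"

definition naturally_isomorphic ::
  "('o, 'a, 'c) precat_scheme \<Rightarrow> ('p, 'b, 'd) precat_scheme \<Rightarrow>
     ('o, 'a, 'p, 'b) func \<Rightarrow> ('o, 'a, 'p, 'b) func \<Rightarrow> bool" where
  "naturally_isomorphic C D F G \<longleftrightarrow>
     (\<exists>t. nat_trans C D F G t \<and> (\<forall>A\<in>Obj C. isomorphism D (t A)))"

definition is_equivalence ::
  "('o, 'a, 'c) precat_scheme \<Rightarrow> ('p, 'b, 'd) precat_scheme \<Rightarrow> ('o, 'a, 'p, 'b) func \<Rightarrow> bool"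
  where
  "is_equivalence C D F \<longleftrightarrow>
     category C \<and> category D \<and> is_functor C D F \<and>
     (\<exists>G. is_functor D C G \<and>
          naturally_isomorphic C C (comp_functor C G F) (id_functor C) \<and>
          naturally_isomorphic D D (comp_functor D F G) (id_functor D))"

definition is_cocone ::
  "('o, 'a, 'c) precat_scheme \<Rightarrow> ('i, 'j, 'k) precat_scheme \<Rightarrow> ('i, 'j, 'o, 'a) func \<Rightarrow>
     'o \<Rightarrow> ('i \<Rightarrow> 'a) \<Rightarrow> bool" where
  "is_cocone C J D c leg \<longleftrightarrow>
     c \<in> Obj C \<and>
     (\<forall>i\<in>Obj J. leg i \<in> Hom C (Fo D i) c) \<and>
     (\<forall>u\<in>Arr J. leg (Cod J u) \<cdot>\<^bsub>C\<^esub> Fa D u = leg (Dom J u))"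

definition is_colimit ::
  "('o, 'a, 'c) precat_scheme \<Rightarrow> ('i, 'j, 'k) precat_scheme \<Rightarrow> ('i, 'j, 'o, 'a) func \<Rightarrow>
     'o \<Rightarrow> ('i \<Rightarrow> 'a) \<Rightarrow> bool" where
  "is_colimit C J D c leg \<longleftrightarrow>
     is_cocone C J D c leg \<and>
     (\<forall>d leg'. is_cocone C J D d leg' \<longrightarrow>
        (\<exists>!h. h \<in> Hom C c d \<and> (\<forall>i\<in>Obj J. h \<cdot>\<^bsub>C\<^esub> leg i = leg' i)))"

text \<open>
  Every small category is isomorphic to one whose objects and arrows are elements of \<open>'u\<close>, so it
  suffices to let the shapes range over those.
\<close>

definition cocomplete_category :: "'u itself \<Rightarrow> ('o, 'a, 'c) precat_scheme \<Rightarrow> bool" where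
  "cocomplete_category U C \<longleftrightarrow>
     (\<forall>(J :: ('u, 'u) precat) D. small_category U J \<and> is_functor J C D \<longrightarrow>
        (\<exists>c leg. is_colimit C J D c leg))"

definition preserves_colimits ::
  "'u itself \<Rightarrow> ('o, 'a, 'c) precat_scheme \<Rightarrow> ('p, 'b, 'd) precat_scheme \<Rightarrow>
     ('o, 'a, 'p, 'b) func \<Rightarrow> bool" where
  "preserves_colimits U C D F \<longleftrightarrow>
     (\<forall>(J :: ('u, 'u) precat) K c leg.
        small_category U J \<and> is_functor J C K \<and> is_colimit C J K c leg \<longrightarrow>
        is_colimit D J (comp_functor J F K) (Fo F c) (\<lambda>i. Fa F (leg i)))"

record ('o, 'a) rcat = "('o, 'a) precat" +
  Rst :: "'a \<Rightarrow> 'a"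

locale restriction_category = category X
  for X :: "('o, 'a, 'c) rcat_scheme" (structure) +
  assumes rst_in_Hom: "f \<in> Hom X A B \<Longrightarrow> Rst X f \<in> Hom X A A"
    and R1: "f \<in> Hom X A B \<Longrightarrow> f \<cdot> Rst X f = f"
    and R2: "f \<in> Hom X A B \<Longrightarrow> g \<in> Hom X A D \<Longrightarrow> Rst X g \<cdot> Rst X f = Rst X f \<cdot> Rst X g"
    and R3: "f \<in> Hom X A B \<Longrightarrow> g \<in> Hom X A D \<Longrightarrow> Rst X (g \<cdot> Rst X f) = Rst X g \<cdot> Rst X f"
    and R4: "f \<in> Hom X A B \<Longrightarrow> h \<in> Hom X B D \<Longrightarrow> Rst X h \<cdot> f = f \<cdot> Rst X (h \<cdot> f)"

definition restriction_idempotent :: "('o, 'a, 'c) rcat_scheme \<Rightarrow> 'a \<Rightarrow> bool" where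
  "restriction_idempotent X e \<longleftrightarrow> e \<in> Arr X \<and> e = Rst X e"

definition total :: "('o, 'a, 'c) rcat_scheme \<Rightarrow> 'a \<Rightarrow> bool" where
  "total X f \<longleftrightarrow> f \<in> Arr X \<and> Rst X f = Idn X (Dom X f)"

definition Total :: "('o, 'a, 'c) rcat_scheme \<Rightarrow> ('o, 'a) precat" where
  "Total X = \<lparr>Obj = Obj X, Arr = {f. total X f}, Dom = Dom X, Cod = Cod X,
              Idn = Idn X, Comp = Comp X\<rparr>"

definition Total_inclusion :: "('o, 'a, 'c) rcat_scheme \<Rightarrow> ('o, 'a, 'o, 'a) func" where
  "Total_inclusion X = id_functor (Total X)"

definition rle :: "('o, 'a, 'c) rcat_scheme \<Rightarrow> 'a \<Rightarrow> 'a \<Rightarrow> bool" where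
  "rle X f g \<longleftrightarrow> f = g \<cdot>\<^bsub>X\<^esub> Rst X f"

definition compatible :: "('o, 'a, 'c) rcat_scheme \<Rightarrow> 'a set \<Rightarrow> bool" where
  "compatible X S \<longleftrightarrow> (\<forall>f\<in>S. \<forall>g\<in>S. f \<cdot>\<^bsub>X\<^esub> Rst X g = g \<cdot>\<^bsub>X\<^esub> Rst X f)"

definition is_join :: "('o, 'a, 'c) rcat_scheme \<Rightarrow> 'o \<Rightarrow> 'o \<Rightarrow> 'a set \<Rightarrow> 'a \<Rightarrow> bool" where
  "is_join X A B S j \<longleftrightarrow>
     j \<in> Hom X A B \<and> (\<forall>s\<in>S. rle X s j) \<and>
     (\<forall>k\<in>Hom X A B. (\<forall>s\<in>S. rle X s k) \<longrightarrow> rle X j k)"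

locale join_restriction_category = restriction_category X
  for X :: "('o, 'a, 'c) rcat_scheme" (structure) +
  assumes join_exists: "A \<in> Obj X \<Longrightarrow> B \<in> Obj X \<Longrightarrow> S \<subseteq> Hom X A B \<Longrightarrow> compatible X S \<Longrightarrow>
                          \<exists>j. is_join X A B S j"
    and J1: "A \<in> Obj X \<Longrightarrow> B \<in> Obj X \<Longrightarrow> S \<subseteq> Hom X A B \<Longrightarrow> compatible X S \<Longrightarrow>
               is_join X A B S j \<Longrightarrow> is_join X A A (Rst X ` S) (Rst X j)"
    and J2: "A \<in> Obj X \<Longrightarrow> B \<in> Obj X \<Longrightarrow> S \<subseteq> Hom X A B \<Longrightarrow> compatible X S \<Longrightarrow>
               is_join X A B S j \<Longrightarrow> g \<in> Hom X D A \<Longrightarrow>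
               is_join X D B ((\<lambda>s. s \<cdot> g) ` S) (j \<cdot> g)"

definition is_restriction_functor ::
  "('o, 'a, 'c) rcat_scheme \<Rightarrow> ('p, 'b, 'd) rcat_scheme \<Rightarrow> ('o, 'a, 'p, 'b) func \<Rightarrow> bool" where
  "is_restriction_functor X Y F \<longleftrightarrow>
     is_functor X Y F \<and> (\<forall>f\<in>Arr X. Fa F (Rst X f) = Rst Y (Fa F f))"

definition is_join_restriction_functor ::
  "('o, 'a, 'c) rcat_scheme \<Rightarrow> ('p, 'b, 'd) rcat_scheme \<Rightarrow> ('o, 'a, 'p, 'b) func \<Rightarrow> bool" where
  "is_join_restriction_functor X Y F \<longleftrightarrow>
     is_restriction_functor X Y F \<and>
     (\<forall>A\<in>Obj X. \<forall>B\<in>Obj X. \<forall>S j. S \<subseteq> Hom X A B \<and> compatible X S \<and> is_join X A B S j \<longrightarrow>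
        is_join Y (Fo F A) (Fo F B) (Fa F ` S) (Fa F j))"

definition Total_functor ::
  "('o, 'a, 'c) rcat_scheme \<Rightarrow> ('o, 'a, 'p, 'b) func \<Rightarrow> ('o, 'a, 'p, 'b) func" where
  "Total_functor X F = comp_functor (Total X) F (Total_inclusion X)"

definition split_category :: "('o, 'a, 'c) rcat_scheme \<Rightarrow> bool" where
  "split_category X \<longleftrightarrow>
     (\<forall>e. restriction_idempotent X e \<longrightarrow>
        (\<exists>B\<in>Obj X. \<exists>r\<in>Hom X (Dom X e) B. \<exists>m\<in>Hom X B (Dom X e).
           m \<cdot>\<^bsub>X\<^esub> r = e \<and> r \<cdot>\<^bsub>X\<^esub> m = Idn X B))"

definition cocomplete :: "'u itself \<Rightarrow> ('o, 'a, 'c) rcat_scheme \<Rightarrow> bool" where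
  "cocomplete U X \<longleftrightarrow>
     split_category X \<and> cocomplete_category U (Total X) \<and>
     preserves_colimits U (Total X) X (Total_inclusion X)"

definition cocontinuous ::
  "'u itself \<Rightarrow> ('o, 'a, 'c) rcat_scheme \<Rightarrow> ('p, 'b, 'd) rcat_scheme \<Rightarrow>
     ('o, 'a, 'p, 'b) func \<Rightarrow> bool" where
  "cocontinuous U X Y F \<longleftrightarrow> preserves_colimits U (Total X) (Total Y) (Total_functor X F)"

text \<open>
  Local smallness is part of the definition because all categories are locally small by convention.
\<close>

definition cocomplete_join_restriction_category ::
  "'u itself \<Rightarrow> ('o, 'a, 'c) rcat_scheme \<Rightarrow> bool" where
  "cocomplete_join_restriction_category U X \<longleftrightarrow>
     join_restriction_category X \<and> locally_small U X \<and> cocomplete U X"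

definition small_join_restriction_category ::
  "'u itself \<Rightarrow> ('o, 'a, 'c) rcat_scheme \<Rightarrow> bool" where
  "small_join_restriction_category U X \<longleftrightarrow>
     join_restriction_category X \<and> small_category U X"

record ('x, 't) transf =
  TDom :: 'x
  TCod :: 'x
  TMap :: 't

definition restriction_transformation ::
  "('o, 'a, 'c) rcat_scheme \<Rightarrow> ('p, 'b, 'd) rcat_scheme \<Rightarrow>
     ('o, 'a, 'p, 'b) func \<Rightarrow> ('o, 'a, 'p, 'b) func \<Rightarrow> ('o \<Rightarrow> 'b) \<Rightarrow> bool" where
  "restriction_transformation X Y F G t \<longleftrightarrow>
     nat_trans X Y F G t \<and> (\<forall>A\<in>Obj X. total Y (t A))"

text \<open>
  \<open>transformation_category X Y \<F>\<close> is the category of functors in \<open>\<F>\<close> and restriction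
  transformations; it gives the hom-categories of the 2-categories jrCat and jrCocomp.
\<close>

definition transformation_category ::
  "('o, 'a, 'c) rcat_scheme \<Rightarrow> ('p, 'b, 'd) rcat_scheme \<Rightarrow> ('o, 'a, 'p, 'b) func set \<Rightarrow>
     (('o, 'a, 'p, 'b) func, (('o, 'a, 'p, 'b) func, 'o \<Rightarrow> 'b) transf) precat" where
  "transformation_category X Y \<F> =
     \<lparr>Obj = \<F>,
      Arr = {t. TDom t \<in> \<F> \<and> TCod t \<in> \<F> \<and>
                restriction_transformation X Y (TDom t) (TCod t) (TMap t)},
      Dom = TDom,
      Cod = TCod,
      Idn = (\<lambda>F. \<lparr>TDom = F, TCod = F, TMap = (\<lambda>A\<in>Obj X. Idn Y (Fo F A))\<rparr>),
      Comp = (\<lambda>s t. \<lparr>TDom = TDom t, TCod = TCod s,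
                     TMap = (\<lambda>A\<in>Obj X. TMap s A \<cdot>\<^bsub>Y\<^esub> TMap t A)\<rparr>)\<rparr>"

definition jrCat ::
  "('o, 'a, 'c) rcat_scheme \<Rightarrow> ('p, 'b, 'd) rcat_scheme \<Rightarrow>
     (('o, 'a, 'p, 'b) func, (('o, 'a, 'p, 'b) func, 'o \<Rightarrow> 'b) transf) precat" where
  "jrCat X Y = transformation_category X Y {F. is_join_restriction_functor X Y F}"

definition jrCocomp ::
  "'u itself \<Rightarrow> ('o, 'a, 'c) rcat_scheme \<Rightarrow> ('p, 'b, 'd) rcat_scheme \<Rightarrow>
     (('o, 'a, 'p, 'b) func, (('o, 'a, 'p, 'b) func, 'o \<Rightarrow> 'b) transf) precat" where
  "jrCocomp U X Y =
     transformation_category X Y {F. is_restriction_functor X Y F \<and> cocontinuous U X Y F}"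

definition precomposition ::
  "(('p, 'b, 'q, 'e) func, (('p, 'b, 'q, 'e) func, 'p \<Rightarrow> 'e) transf) precat \<Rightarrow>
     ('o, 'a, 'c) rcat_scheme \<Rightarrow> ('o, 'a, 'p, 'b) func \<Rightarrow>
     (('p, 'b, 'q, 'e) func, (('p, 'b, 'q, 'e) func, 'p \<Rightarrow> 'e) transf,
      ('o, 'a, 'q, 'e) func, (('o, 'a, 'q, 'e) func, 'o \<Rightarrow> 'e) transf) func" where
  "precomposition \<A> X K =
     \<lparr>Fo = (\<lambda>F\<in>Obj \<A>. comp_functor X F K),
      Fa = (\<lambda>t\<in>Arr \<A>. \<lparr>TDom = comp_functor X (TDom t) K, TCod = comp_functor X (TCod t) K,
                         TMap = (\<lambda>A\<in>Obj X. TMap t (Fo K A))\<rparr>)\<rparr>"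

text \<open>
  \<open>PEl P A\<close> is the set \<open>PA\<close>, \<open>PAct P f x\<close> is \<open>x \<cdot> f\<close>, and \<open>PRst P A x\<close> is the restriction of
  \<open>x \<in> PA\<close>; the index \<open>A\<close> is needed because the sets \<open>PA\<close> need not be disjoint.
\<close>

record ('o, 'a, 'u) psh =
  PEl :: "'o \<Rightarrow> 'u set"
  PAct :: "'a \<Rightarrow> 'u \<Rightarrow> 'u"
  PRst :: "'o \<Rightarrow> 'u \<Rightarrow> 'a"

locale presheaf =
  fixes X :: "('o, 'a, 'c) rcat_scheme" (structure) and P :: "('o, 'a, 'u) psh"
  assumes PEl_small: "A \<in> Obj X \<Longrightarrow> small TYPE('u) (PEl P A)"
    and PEl_undefined: "PEl P \<in> extensional (Obj X)"
    and PAct_undefined: "PAct P \<in> extensional (Arr X)"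
    and PAct_in: "f \<in> Arr X \<Longrightarrow> PAct P f \<in> PEl P (Cod X f) \<rightarrow>\<^sub>E PEl P (Dom X f)"
    and PAct_idn: "A \<in> Obj X \<Longrightarrow> x \<in> PEl P A \<Longrightarrow> PAct P (Idn X A) x = x"
    and PAct_comp: "g \<in> Hom X D B \<Longrightarrow> f \<in> Hom X B A \<Longrightarrow> x \<in> PEl P A \<Longrightarrow>
                      PAct P (f \<cdot> g) x = PAct P g (PAct P f x)"

locale restriction_presheaf = presheaf X P
  for X :: "('o, 'a, 'c) rcat_scheme" (structure) and P :: "('o, 'a, 'u) psh" +
  assumes PRst_undefined: "PRst P \<in> extensional (Obj X)"
    and PRst_in: "A \<in> Obj X \<Longrightarrow> PRst P A \<in> PEl P A \<rightarrow>\<^sub>E Hom X A A"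
    and PRst_idem: "A \<in> Obj X \<Longrightarrow> x \<in> PEl P A \<Longrightarrow> restriction_idempotent X (PRst P A x)"
    and RP1: "A \<in> Obj X \<Longrightarrow> x \<in> PEl P A \<Longrightarrow> PAct P (PRst P A x) x = x"
    and RP2: "A \<in> Obj X \<Longrightarrow> x \<in> PEl P A \<Longrightarrow> f \<in> Hom X A B \<Longrightarrow>
                PRst P A (PAct P (Rst X f) x) = PRst P A x \<cdot> Rst X f"
    and RP3: "A \<in> Obj X \<Longrightarrow> x \<in> PEl P A \<Longrightarrow> g \<in> Hom X B A \<Longrightarrow>
                PRst P A x \<cdot> g = g \<cdot> PRst P B (PAct P g x)"

definition ple :: "('o, 'a, 'u) psh \<Rightarrow> 'o \<Rightarrow> 'u \<Rightarrow> 'u \<Rightarrow> bool" where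
  "ple P A x y \<longleftrightarrow> x = PAct P (PRst P A x) y"

definition pcompatible :: "('o, 'a, 'u) psh \<Rightarrow> 'o \<Rightarrow> 'u set \<Rightarrow> bool" where
  "pcompatible P A S \<longleftrightarrow>
     (\<forall>x\<in>S. \<forall>y\<in>S. PAct P (PRst P A y) x = PAct P (PRst P A x) y)"

definition is_pjoin :: "('o, 'a, 'u) psh \<Rightarrow> 'o \<Rightarrow> 'u set \<Rightarrow> 'u \<Rightarrow> bool" where
  "is_pjoin P A S j \<longleftrightarrow>
     j \<in> PEl P A \<and> (\<forall>s\<in>S. ple P A s j) \<and>
     (\<forall>k\<in>PEl P A. (\<forall>s\<in>S. ple P A s k) \<longrightarrow> ple P A j k)"

locale join_restriction_presheaf = restriction_presheaf X P
  for X :: "('o, 'a, 'c) rcat_scheme" (structure) and P :: "('o, 'a, 'u) psh" +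
  assumes pjoin_exists: "A \<in> Obj X \<Longrightarrow> S \<subseteq> PEl P A \<Longrightarrow> pcompatible P A S \<Longrightarrow>
                           \<exists>j. is_pjoin P A S j"
    and JRP1: "A \<in> Obj X \<Longrightarrow> S \<subseteq> PEl P A \<Longrightarrow> pcompatible P A S \<Longrightarrow> is_pjoin P A S j \<Longrightarrow>
                 is_join X A A (PRst P A ` S) (PRst P A j)"
    and JRP2: "A \<in> Obj X \<Longrightarrow> S \<subseteq> PEl P A \<Longrightarrow> pcompatible P A S \<Longrightarrow> is_pjoin P A S j \<Longrightarrow>
                 g \<in> Hom X B A \<Longrightarrow> is_pjoin P B (PAct P g ` S) (PAct P g j)"

definition presheaf_morphism ::
  "('o, 'a, 'c) rcat_scheme \<Rightarrow> ('o, 'a, 'u) psh \<Rightarrow> ('o, 'a, 'u) psh \<Rightarrow>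
     ('o \<Rightarrow> 'u \<Rightarrow> 'u) \<Rightarrow> bool" where
  "presheaf_morphism X P Q t \<longleftrightarrow>
     t \<in> (\<Pi>\<^sub>E A\<in>Obj X. PEl P A \<rightarrow>\<^sub>E PEl Q A) \<and>
     (\<forall>f\<in>Arr X. \<forall>x\<in>PEl P (Cod X f). t (Dom X f) (PAct P f x) = PAct Q f (t (Cod X f) x))"

definition PSh_jr ::
  "('o, 'a, 'c) rcat_scheme \<Rightarrow>
     (('o, 'a, 'u) psh, (('o, 'a, 'u) psh, 'o \<Rightarrow> 'u \<Rightarrow> 'u) transf) rcat" where
  "PSh_jr X =
     \<lparr>Obj = {P. join_restriction_presheaf X P},
      Arr = {t. join_restriction_presheaf X (TDom t) \<and> join_restriction_presheaf X (TCod t) \<and>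
                presheaf_morphism X (TDom t) (TCod t) (TMap t)},
      Dom = TDom,
      Cod = TCod,
      Idn = (\<lambda>P. \<lparr>TDom = P, TCod = P, TMap = (\<lambda>A\<in>Obj X. \<lambda>x\<in>PEl P A. x)\<rparr>),
      Comp = (\<lambda>s t. \<lparr>TDom = TDom t, TCod = TCod s,
                     TMap = (\<lambda>A\<in>Obj X. \<lambda>x\<in>PEl (TDom t) A. TMap s A (TMap t A x))\<rparr>),
      Rst = (\<lambda>t. \<lparr>TDom = TDom t, TCod = TDom t,
                  TMap = (\<lambda>A\<in>Obj X. \<lambda>x\<in>PEl (TDom t) A.
                            PAct (TDom t) (PRst (TCod t) A (TMap t A x)) x)\<rparr>)\<rparr>"

text \<open>
  The arrows of a small category are taken to be elements of \<open>'u\<close>, so that its hom-sets are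
  literally objects of the category Set of small subsets of \<open>'u\<close>.
\<close>

definition representable :: "('o, 'u, 'c) rcat_scheme \<Rightarrow> 'o \<Rightarrow> ('o, 'u, 'u) psh" where
  "representable X A =
     \<lparr>PEl = (\<lambda>B\<in>Obj X. Hom X B A),
      PAct = (\<lambda>f\<in>Arr X. \<lambda>x\<in>Hom X (Cod X f) A. x \<cdot>\<^bsub>X\<^esub> f),
      PRst = (\<lambda>B\<in>Obj X. \<lambda>x\<in>Hom X B A. Rst X x)\<rparr>"

definition yoneda_jr ::
  "('o, 'u, 'c) rcat_scheme \<Rightarrow>
     ('o, 'u, ('o, 'u, 'u) psh, (('o, 'u, 'u) psh, 'o \<Rightarrow> 'u \<Rightarrow> 'u) transf) func"
  where
  "yoneda_jr X =
     \<lparr>Fo = (\<lambda>A\<in>Obj X. representable X A),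
      Fa = (\<lambda>f\<in>Arr X. \<lparr>TDom = representable X (Dom X f), TCod = representable X (Cod X f),
                        TMap = (\<lambda>B\<in>Obj X. \<lambda>x\<in>Hom X B (Dom X f). f \<cdot>\<^bsub>X\<^esub> x)\<rparr>)\<rparr>"

end

(*
  For a join restriction functor F into E, its extension sends a presheaf P to the colimit of F
  weighted by P, that is, the universal object with partial maps F A --> c for the elements of P at
  A. Presheaves are themselves such colimits of representables, and cocontinuous functors preserve
  weighted colimits because splitting restriction idempotents turns them into ordinary colimits of
  total maps; this makes restriction along the Yoneda embedding fully faithful. The extension is
  cocontinuous because on total maps it has a right adjoint, the nerve along F. The restriction of a
  cocontinuous functor preserves joins because a join of restriction idempotents splits as the
  colimit weighted by the sieve that they generate.
*)
theory Submission
  imports Defs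
begin

section \<open>Small sets\<close>

text \<open>Two mismatches shape the development. Cocompleteness and cocontinuity speak of total
  maps only, whereas the elements of a presheaf name partial maps. The gap closes because a
  cocomplete category keeps its colimits universal against partial cocones, and because R4 makes a
  map out of a colimit total once its composites with the legs have the restrictions of the legs.
  Weighted colimits are therefore tested against partial cocones throughout, and only existence and
  preservation pass through total maps. Joins are the other difficulty: they are defined by an
  order, so equations do not transport them. They are replaced by gluings: an element that restricts
  to every member of a family and whose restriction is the join of their restrictions. This is
  equational except for joins of restriction idempotents, and it is a sheaf condition for the
  topology on \<open>X\<close> in which a set of idempotents covers its join. Hom-sets of any join
  restriction category satisfy it, so \<open>X\<close>, \<open>E\<close>, the presheaves and the
  nerve are treated alike, and preservation of joins by a functor reduces to idempotents.\<close>

lemma small_lepoll: "S \<lesssim> T \<Longrightarrow> small U T \<Longrightarrow> small U S"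
  by (simp add: small_def lesspoll_trans1)

lemma small_subset: "S \<subseteq> T \<Longrightarrow> small U T \<Longrightarrow> small U S"
  by (meson small_lepoll subset_imp_lepoll)

lemma small_image: "small U S \<Longrightarrow> small U (f ` S)"
  by (meson image_lepoll small_lepoll)

lemma small_inj_on: "inj_on f S \<Longrightarrow> f ` S \<subseteq> T \<Longrightarrow> small U T \<Longrightarrow> small U S"
  by (meson lepoll_def small_lepoll)

lemma small_obtain_inj:
  assumes "small TYPE('u) (S :: 'x set)"
  obtains f :: "'x \<Rightarrow> 'u" where "inj_on f S"
  using assms unfolding small_def lesspoll_def lepoll_def by blast

text \<open>\<open>universe\<close> constrains subsets of \<open>'u\<close> only, so the set is
  first embedded in \<open>'u\<close>.\<close>

lemma small_Pow:
  assumes "universe TYPE('u)" and S: "small TYPE('u) (S :: 'x set)"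
  shows "small TYPE('u) (Pow S)"
proof -
  obtain f :: "'x \<Rightarrow> 'u" where f: "inj_on f S"
    using S by (rule small_obtain_inj)
  have "small TYPE('u) (Pow (f ` S))"
    using assms(1) small_image[OF S, of f] by (auto simp: universe_def)
  moreover have "inj_on ((`) f) (Pow S)" "(`) f ` Pow S \<subseteq> Pow (f ` S)"
    using f by (auto simp: inj_on_image_Pow)
  ultimately show ?thesis
    by (meson small_inj_on)
qed

text \<open>Regularity of the universe: after coding indices and fibres in \<open>'u\<close>, the
  sum embeds in a small union of small subsets of \<open>'u\<close>.\<close>

lemma small_Sigma:
  assumes U: "universe TYPE('u)" and I: "small TYPE('u) (I :: 'i set)"
    and F: "\<And>i. i \<in> I \<Longrightarrow> small TYPE('u) (F i :: 'x set)"
  shows "small TYPE('u) (Sigma I F)"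
proof -
  obtain c :: "'i \<Rightarrow> 'u" where c: "inj_on c I"
    using I by (rule small_obtain_inj)
  have "\<exists>f :: 'x \<Rightarrow> 'u. inj_on f (F i)" if "i \<in> I" for i
    using F[OF that] small_obtain_inj by metis
  then obtain f :: "'i \<Rightarrow> 'x \<Rightarrow> 'u" where f: "inj_on (f i) (F i)" if "i \<in> I" for i
    by metis
  have "infinite (UNIV :: 'u set)"
    using U by (simp add: universe_def)
  then obtain p :: "'u \<times> 'u \<Rightarrow> 'u" where "bij_betw p (UNIV \<times> UNIV) UNIV"
    using card_of_Times_same_infinite card_of_ordIso by (metis UNIV_Times_UNIV)
  then have p: "inj p"
    by (simp add: bij_betw_def)
  \<comment> \<open>\<open>p\<close> pairs inside \<open>'u\<close>, which exists because
    \<open>'u\<close> is infinite. Keeping the code of the index makes the union below disjoint in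
    effect, so \<open>h\<close> is injective.\<close>
  define h where "h = (\<lambda>(i, x). p (c i, f i x))"
  have "inj_on h (Sigma I F)"
  proof (rule inj_onI)
    fix z z' assume z: "z \<in> Sigma I F" "z' \<in> Sigma I F" "h z = h z'"
    obtain i x i' x' where *: "z = (i, x)" "z' = (i', x')"
      by fastforce
    then have "c i = c i'" "f i x = f i' x'"
      using injD[OF p] z(3) by (auto simp: h_def)
    then show "z = z'"
      using inj_onD[OF c] inj_onD[OF f] z * by (metis mem_Sigma_iff)
  qed
  \<comment> \<open>The union runs over codes rather than over \<open>I\<close>, because
    \<open>universe\<close> only admits index sets inside \<open>'u\<close>.\<close>
  moreover have "h ` Sigma I F \<subseteq> (\<Union>k \<in> c ` I. (\<lambda>x. p (k, f (inv_into I c k) x)) ` F (inv_into I c k))"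
  proof (intro image_subsetI)
    fix z assume "z \<in> Sigma I F"
    then obtain i x where "z = (i, x)" "i \<in> I" "x \<in> F i"
      by blast
    then have "h z \<in> (\<lambda>x. p (c i, f (inv_into I c (c i)) x)) ` F (inv_into I c (c i))"
      using c by (simp add: h_def)
    then show "h z \<in> (\<Union>k \<in> c ` I. (\<lambda>x. p (k, f (inv_into I c k) x)) ` F (inv_into I c k))"
      using \<open>i \<in> I\<close> by blast
  qed
  moreover have "small TYPE('u) (\<Union>k \<in> c ` I. (\<lambda>x. p (k, f (inv_into I c k) x)) ` F (inv_into I c k))"
  proof -
    have "small TYPE('u) (\<Union>k\<in>K. G k)"
      if "small TYPE('u) K" "\<forall>k\<in>K. small TYPE('u) (G k)" for K :: "'u set" and G :: "'u \<Rightarrow> 'u set"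
      using U that unfolding universe_def by metis
    note union = this
    show ?thesis
      by (rule union[OF small_image[OF I]]) (intro ballI small_image F inv_into_into)
  qed
  ultimately show ?thesis
    by (rule small_inj_on)
qed

lemma small_Times:
  assumes "universe TYPE('u)" "small TYPE('u) A" "small TYPE('u) B"
  shows "small TYPE('u) (A \<times> B)"
  using assms by (simp add: small_Sigma)

section \<open>Categories and colimits\<close>

lemma HomD:
  assumes "f \<in> Hom C A B"
  shows "f \<in> Arr C" "Dom C f = A" "Cod C f = B"
  using assms by (auto simp: Hom_def)

lemma Arr_Hom: "f \<in> Arr C \<Longrightarrow> f \<in> Hom C (Dom C f) (Cod C f)"
  by (simp add: Hom_def)

lemma (in category) Hom_Obj:
  assumes "f \<in> Hom C A B"
  shows "A \<in> Obj C" "B \<in> Obj C"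
  using assms dom_in_Obj cod_in_Obj by (auto simp: Hom_def)

lemma is_functorD:
  assumes "is_functor C D F"
  shows "A \<in> Obj C \<Longrightarrow> Fo F A \<in> Obj D"
    and "f \<in> Hom C A B \<Longrightarrow> Fa F f \<in> Hom D (Fo F A) (Fo F B)"
    and "A \<in> Obj C \<Longrightarrow> Fa F (Idn C A) = Idn D (Fo F A)"
    and "f \<in> Hom C A B \<Longrightarrow> g \<in> Hom C B E \<Longrightarrow> Fa F (g \<cdot>\<^bsub>C\<^esub> f) = Fa F g \<cdot>\<^bsub>D\<^esub> Fa F f"
    and "Fo F \<in> extensional (Obj C)"
    and "Fa F \<in> extensional (Arr C)"
  using assms unfolding is_functor_def Hom_def by (auto simp: PiE_def Pi_def)

lemma is_functorI:
  assumes "Fo F \<in> extensional (Obj C)" "Fa F \<in> extensional (Arr C)"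
    and "\<And>A. A \<in> Obj C \<Longrightarrow> Fo F A \<in> Obj D"
    and "\<And>f A B. f \<in> Hom C A B \<Longrightarrow> Fa F f \<in> Hom D (Fo F A) (Fo F B)"
    and "\<And>A. A \<in> Obj C \<Longrightarrow> Fa F (Idn C A) = Idn D (Fo F A)"
    and "\<And>f g A B E. f \<in> Hom C A B \<Longrightarrow> g \<in> Hom C B E \<Longrightarrow>
           Fa F (g \<cdot>\<^bsub>C\<^esub> f) = Fa F g \<cdot>\<^bsub>D\<^esub> Fa F f"
  shows "is_functor C D F"
  using assms unfolding is_functor_def Hom_def by (auto simp: PiE_def Pi_def)

lemma func_eqI:
  assumes "Fo F \<in> extensional S" "Fo G \<in> extensional S" "\<And>A. A \<in> S \<Longrightarrow> Fo F A = Fo G A"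
    and "Fa F \<in> extensional T" "Fa G \<in> extensional T" "\<And>f. f \<in> T \<Longrightarrow> Fa F f = Fa G f"
  shows "(F :: ('a, 'b, 'c, 'd) func) = G"
  using assms extensionalityI[of "Fo F" S "Fo G"] extensionalityI[of "Fa F" T "Fa G"]
  by (cases F, cases G) auto

lemma comp_functor_simps [simp]:
  "A \<in> Obj C \<Longrightarrow> Fo (comp_functor C G F) A = Fo G (Fo F A)"
  "f \<in> Arr C \<Longrightarrow> Fa (comp_functor C G F) f = Fa G (Fa F f)"
  "Fo (comp_functor C G F) \<in> extensional (Obj C)"
  "Fa (comp_functor C G F) \<in> extensional (Arr C)"
  by (auto simp: comp_functor_def)

lemma id_functor_simps [simp]:
  "A \<in> Obj C \<Longrightarrow> Fo (id_functor C) A = A"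
  "f \<in> Arr C \<Longrightarrow> Fa (id_functor C) f = f"
  "Fo (id_functor C) \<in> extensional (Obj C)"
  "Fa (id_functor C) \<in> extensional (Arr C)"
  by (auto simp: id_functor_def)

lemma is_functor_comp:
  assumes "category C" and F: "is_functor C D F" and G: "is_functor D E G"
  shows "is_functor C E (comp_functor C G F)"
proof -
  interpret category C by fact
  note FD = is_functorD[OF F] and GD = is_functorD[OF G]
  show ?thesis
  proof (rule is_functorI)
    fix f g A B E'
    assume f: "f \<in> Hom C A B" and g: "g \<in> Hom C B E'"
    have "g \<cdot>\<^bsub>C\<^esub> f \<in> Arr C"
      using comp_in_Hom[OF f g] by (simp add: HomD)
    then show "Fa (comp_functor C G F) (g \<cdot>\<^bsub>C\<^esub> f)
        = Fa (comp_functor C G F) g \<cdot>\<^bsub>E\<^esub> Fa (comp_functor C G F) f"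
      using f g FD(4)[OF f g] GD(4)[OF FD(2)[OF f] FD(2)[OF g]] by (simp add: HomD)
  next
    fix A assume A: "A \<in> Obj C"
    then have "Idn C A \<in> Arr C"
      by (rule HomD(1)[OF idn_in_Hom])
    then show "Fa (comp_functor C G F) (Idn C A) = Idn E (Fo (comp_functor C G F) A)"
      using A FD GD by simp
  next
    fix f A B assume f: "f \<in> Hom C A B"
    then show "Fa (comp_functor C G F) f
        \<in> Hom E (Fo (comp_functor C G F) A) (Fo (comp_functor C G F) B)"
      using FD(2)[OF f] GD(2) Hom_Obj[OF f] by (simp add: HomD)
  qed (use FD GD in auto)
qed

lemma is_functor_id: "category C \<Longrightarrow> is_functor C C (id_functor C)"
  by (rule is_functorI)
    (simp_all add: HomD category.Hom_Obj HomD(1)[OF category.idn_in_Hom]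
      HomD(1)[OF category.comp_in_Hom])

lemma is_coconeD:
  assumes "is_cocone C J D c leg"
  shows "c \<in> Obj C"
    and "i \<in> Obj J \<Longrightarrow> leg i \<in> Hom C (Fo D i) c"
    and "u \<in> Hom J i j \<Longrightarrow> leg j \<cdot>\<^bsub>C\<^esub> Fa D u = leg i"
  using assms unfolding is_cocone_def Hom_def by auto

lemma is_coconeI:
  assumes "c \<in> Obj C"
    and "\<And>i. i \<in> Obj J \<Longrightarrow> leg i \<in> Hom C (Fo D i) c"
    and "\<And>u i j. u \<in> Hom J i j \<Longrightarrow> leg j \<cdot>\<^bsub>C\<^esub> Fa D u = leg i"
  shows "is_cocone C J D c leg"
  using assms unfolding is_cocone_def Hom_def by auto

text \<open>Legs are not kept extensional and diagrams arise by composing functors, so cocones must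
  be known to depend only on values at objects and arrows of the shape.\<close>

lemma is_cocone_cong:
  assumes "category J"
    and "\<And>i. i \<in> Obj J \<Longrightarrow> Fo D i = Fo D' i \<and> leg i = leg' i"
    and "\<And>u. u \<in> Arr J \<Longrightarrow> Fa D u = Fa D' u"
  shows "is_cocone C J D c leg \<longleftrightarrow> is_cocone C J D' c leg'"
  using assms category.dom_in_Obj category.cod_in_Obj unfolding is_cocone_def
  by (metis (no_types, lifting))

lemma is_colimit_cong:
  assumes "category J"
    and "\<And>i. i \<in> Obj J \<Longrightarrow> Fo D i = Fo D' i \<and> leg i = leg' i"
    and "\<And>u. u \<in> Arr J \<Longrightarrow> Fa D u = Fa D' u"
  shows "is_colimit C J D c leg \<longleftrightarrow> is_colimit C J D' c leg'"
proof -
  have "is_cocone C J D d k \<longleftrightarrow> is_cocone C J D' d k" for d k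
    using assms by (intro is_cocone_cong) auto
  moreover have "is_cocone C J D c leg \<longleftrightarrow> is_cocone C J D' c leg'"
    using assms by (rule is_cocone_cong)
  ultimately show ?thesis
    unfolding is_colimit_def using assms(2) by auto
qed

text \<open>Any small shape is isomorphic to one on the universe type, so it may be used in colimits.\<close>

definition transport_cat ::
  "('i \<Rightarrow> 'u) \<Rightarrow> ('j \<Rightarrow> 'u) \<Rightarrow> ('i, 'j, 'k) precat_scheme \<Rightarrow> ('u, 'u) precat" where
  "transport_cat a b J =
     \<lparr>Obj = a ` Obj J, Arr = b ` Arr J,
      Dom = (\<lambda>v. a (Dom J (inv_into (Arr J) b v))), Cod = (\<lambda>v. a (Cod J (inv_into (Arr J) b v))),
      Idn = (\<lambda>p. b (Idn J (inv_into (Obj J) a p))),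
      Comp = (\<lambda>v w. b (inv_into (Arr J) b v \<cdot>\<^bsub>J\<^esub> inv_into (Arr J) b w))\<rparr>"

definition transport_diagram ::
  "('i \<Rightarrow> 'u) \<Rightarrow> ('j \<Rightarrow> 'u) \<Rightarrow> ('i, 'j, 'k) precat_scheme \<Rightarrow> ('i, 'j, 'o, 'a) func
     \<Rightarrow> ('u, 'u, 'o, 'a) func" where
  "transport_diagram a b J D =
     \<lparr>Fo = (\<lambda>p \<in> a ` Obj J. Fo D (inv_into (Obj J) a p)),
      Fa = (\<lambda>v \<in> b ` Arr J. Fa D (inv_into (Arr J) b v))\<rparr>"

locale transport = category J
  for a :: "'i \<Rightarrow> 'u" and b :: "'j \<Rightarrow> 'u" and J :: "('i, 'j, 'k) precat_scheme" (structure) +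
  assumes inj_a: "inj_on a (Obj J)" and inj_b: "inj_on b (Arr J)"
begin

lemma transport_simps [simp]:
  "Obj (transport_cat a b J) = a ` Obj J"
  "Arr (transport_cat a b J) = b ` Arr J"
  "u \<in> Arr J \<Longrightarrow> Dom (transport_cat a b J) (b u) = a (Dom J u)"
  "u \<in> Arr J \<Longrightarrow> Cod (transport_cat a b J) (b u) = a (Cod J u)"
  "i \<in> Obj J \<Longrightarrow> Idn (transport_cat a b J) (a i) = b (Idn J i)"
  "u \<in> Arr J \<Longrightarrow> v \<in> Arr J \<Longrightarrow> Comp (transport_cat a b J) (b v) (b u) = b (v \<cdot> u)"
  "i \<in> Obj J \<Longrightarrow> Fo (transport_diagram a b J D) (a i) = Fo D i"
  "u \<in> Arr J \<Longrightarrow> Fa (transport_diagram a b J D) (b u) = Fa D u"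
  using inj_a inj_b by (auto simp: transport_cat_def transport_diagram_def)

lemma transport_Hom:
  "x \<in> Hom (transport_cat a b J) p q \<longleftrightarrow>
     (\<exists>i j u. x = b u \<and> p = a i \<and> q = a j \<and> u \<in> Hom J i j)"
  by (force simp: Hom_def)

lemma transport_Hom_iff:
  "i \<in> Obj J \<Longrightarrow> j \<in> Obj J \<Longrightarrow> x \<in> Hom (transport_cat a b J) (a i) (a j) \<longleftrightarrow>
     (\<exists>u. x = b u \<and> u \<in> Hom J i j)"
  unfolding transport_Hom using inj_a Hom_Obj by (metis inj_onD)

lemma category_transport: "category (transport_cat a b J)"
proof
  fix f p q g r
  assume "f \<in> Hom (transport_cat a b J) p q" "g \<in> Hom (transport_cat a b J) q r"
  then show "Comp (transport_cat a b J) g f \<in> Hom (transport_cat a b J) p r"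
    using Hom_Obj comp_in_Hom unfolding transport_Hom
    by (smt (verit) HomD(1) inj_a inj_onD transport_simps(6))
next
  fix f p q g r h s
  assume f: "f \<in> Hom (transport_cat a b J) p q" and g: "g \<in> Hom (transport_cat a b J) q r"
    and h: "h \<in> Hom (transport_cat a b J) r s"
  obtain i j u where u: "f = b u" "p = a i" "q = a j" "u \<in> Hom J i j"
    using f unfolding transport_Hom by blast
  obtain k v where v: "g = b v" "r = a k" "v \<in> Hom J j k"
    using g Hom_Obj inj_a u unfolding transport_Hom by (metis inj_onD)
  obtain l w where w: "h = b w" "s = a l" "w \<in> Hom J k l"
    using h Hom_Obj inj_a v unfolding transport_Hom by (metis inj_onD)
  show "Comp (transport_cat a b J) (Comp (transport_cat a b J) h g) f =
      Comp (transport_cat a b J) h (Comp (transport_cat a b J) g f)"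
    using u v w comp_assoc comp_in_Hom[of u i j v k] comp_in_Hom[of v j k w l]
    by (simp add: HomD)
next
  fix f p q assume f: "f \<in> Hom (transport_cat a b J) p q"
  then obtain i j u where u: "f = b u" "p = a i" "q = a j" "u \<in> Hom J i j"
    unfolding transport_Hom by blast
  show "Comp (transport_cat a b J) f (Idn (transport_cat a b J) p) = f"
    using u comp_idn_right[of u i j] idn_in_Hom[of i] Hom_Obj[of u i j] by (simp add: HomD)
  show "Comp (transport_cat a b J) (Idn (transport_cat a b J) q) f = f"
    using u comp_idn_left[of u i j] idn_in_Hom[of j] Hom_Obj[of u i j] by (simp add: HomD)
next
  fix p assume "p \<in> Obj (transport_cat a b J)"
  then show "Idn (transport_cat a b J) p \<in> Hom (transport_cat a b J) p p"
    using idn_in_Hom by (fastforce simp: transport_Hom_iff)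
qed (auto simp: dom_in_Obj cod_in_Obj)

lemma functor_transport:
  assumes D: "is_functor J C D"
  shows "is_functor (transport_cat a b J) C (transport_diagram a b J D)"
proof (rule is_functorI)
  fix f p q assume "f \<in> Hom (transport_cat a b J) p q"
  then show "Fa (transport_diagram a b J D) f
      \<in> Hom C (Fo (transport_diagram a b J D) p) (Fo (transport_diagram a b J D) q)"
    using is_functorD(2)[OF D] Hom_Obj unfolding transport_Hom by (auto simp: HomD)
next
  fix p assume "p \<in> Obj (transport_cat a b J)"
  then show "Fa (transport_diagram a b J D) (Idn (transport_cat a b J) p)
      = Idn C (Fo (transport_diagram a b J D) p)"
    using is_functorD(3)[OF D] by (auto simp: HomD(1)[OF idn_in_Hom])
next
  fix f p q g r
  assume f: "f \<in> Hom (transport_cat a b J) p q" and g: "g \<in> Hom (transport_cat a b J) q r"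
  obtain i j u where u: "f = b u" "p = a i" "q = a j" "u \<in> Hom J i j"
    using f unfolding transport_Hom by blast
  obtain k v where v: "g = b v" "r = a k" "v \<in> Hom J j k"
    using g Hom_Obj inj_a u unfolding transport_Hom by (metis inj_onD)
  show "Fa (transport_diagram a b J D) (Comp (transport_cat a b J) g f) =
      Fa (transport_diagram a b J D) g \<cdot>\<^bsub>C\<^esub> Fa (transport_diagram a b J D) f"
    using u v is_functorD(4)[OF D] comp_in_Hom[of u i j v k] by (simp add: HomD)
qed (use inj_a is_functorD(1)[OF D] in \<open>auto simp: transport_diagram_def\<close>)

lemma is_cocone_transport:
  "is_cocone C (transport_cat a b J) (transport_diagram a b J D) c leg
     \<longleftrightarrow> is_cocone C J D c (leg \<circ> a)"
  by (simp add: is_cocone_def dom_in_Obj cod_in_Obj)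

lemma is_colimit_transport:
  "is_colimit C (transport_cat a b J) (transport_diagram a b J D) c leg
     \<longleftrightarrow> is_colimit C J D c (leg \<circ> a)"
proof -
  have "(\<forall>d k. is_cocone C J D d (k \<circ> a) \<longrightarrow> (\<exists>!h. h \<in> Hom C c d \<and> (\<forall>i\<in>Obj J. h \<cdot>\<^bsub>C\<^esub> leg (a i) = k (a i))))
    \<longleftrightarrow> (\<forall>d k. is_cocone C J D d k \<longrightarrow> (\<exists>!h. h \<in> Hom C c d \<and> (\<forall>i\<in>Obj J. h \<cdot>\<^bsub>C\<^esub> leg (a i) = k i)))"
    (is "?L \<longleftrightarrow> ?R")
  proof
    assume L: ?L
    show ?R
    proof (intro allI impI)
      fix d k assume k: "is_cocone C J D d k"
      \<comment> \<open>Legs on \<open>J\<close> are decoded into legs on the transported shape; the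
        two families agree on \<open>Obj J\<close>, where \<open>a\<close> is injective.\<close>
      have *: "\<forall>i\<in>Obj J. ((k \<circ> inv_into (Obj J) a) \<circ> a) i = k i"
        using inj_a by simp
      have "is_cocone C J D d k \<longleftrightarrow> is_cocone C J D d ((k \<circ> inv_into (Obj J) a) \<circ> a)"
        by (rule is_cocone_cong[OF category_axioms]) (use * in auto)
      then have "is_cocone C J D d ((k \<circ> inv_into (Obj J) a) \<circ> a)"
        using k by simp
      from L[rule_format, OF this] * show "\<exists>!h. h \<in> Hom C c d \<and> (\<forall>i\<in>Obj J. h \<cdot>\<^bsub>C\<^esub> leg (a i) = k i)"
        by (simp add: o_def)
    qed
  qed (simp add: o_def)
  then show ?thesis
    by (simp add: is_colimit_def is_cocone_transport)
qed

lemma comp_functor_transport: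
  assumes "is_functor J C D"
  shows "comp_functor (transport_cat a b J) F (transport_diagram a b J D)
     = transport_diagram a b J (comp_functor J F D)"
  by (rule func_eqI[where S = "a ` Obj J" and T = "b ` Arr J"])
    (use inj_a inj_b in \<open>auto simp: transport_diagram_def comp_functor_def inv_into_into\<close>)

end

lemma small_category_transport:
  assumes "small_category TYPE('u) (J :: ('i, 'j, 'k) precat_scheme)"
  obtains a :: "'i \<Rightarrow> 'u" and b where "transport a b J"
    "small_category TYPE('u) (transport_cat a b J)"
proof -
  obtain a :: "'i \<Rightarrow> 'u" and b :: "'j \<Rightarrow> 'u" where "inj_on a (Obj J)" "inj_on b (Arr J)"
    using assms small_obtain_inj unfolding small_category_def by metis
  then interpret transport a b J
    using assms by (simp add: transport_def transport_axioms_def small_category_def)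
  have "small_category TYPE('u) (transport_cat a b J)"
    using assms by (simp add: small_category_def category_transport small_image)
  then show ?thesis
    using that transport_axioms by blast
qed

text \<open>The shapes used below are categories of elements, whose objects and arrows are pairs,
  while \<open>cocomplete_category\<close> only offers shapes inside \<open>'u\<close>.\<close>

lemma cocomplete_category_small:
  assumes "cocomplete_category TYPE('u) C"
    and J: "small_category TYPE('u) (J :: ('i, 'j, 'k) precat_scheme)" and D: "is_functor J C D"
  shows "\<exists>c leg. is_colimit C J D c leg"
proof -
  obtain a :: "'i \<Rightarrow> 'u" and b where *: "transport a b J" "small_category TYPE('u) (transport_cat a b J)"
    using J by (rule small_category_transport)
  interpret transport a b J by fact
  show ?thesis
    using assms(1) *(2) functor_transport[OF D] unfolding cocomplete_category_def
    by (metis is_colimit_transport)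
qed

lemma preserves_colimits_small:
  assumes "preserves_colimits TYPE('u) C C' F"
    and J: "small_category TYPE('u) (J :: ('i, 'j, 'k) precat_scheme)" and D: "is_functor J C D"
    and c: "is_colimit C J D c leg"
  shows "is_colimit C' J (comp_functor J F D) (Fo F c) (\<lambda>i. Fa F (leg i))"
proof -
  obtain a :: "'i \<Rightarrow> 'u" and b where *: "transport a b J" "small_category TYPE('u) (transport_cat a b J)"
    using J by (rule small_category_transport)
  interpret transport a b J by fact
  define leg' where "leg' = leg \<circ> inv_into (Obj J) a"
  have l: "leg' (a i) = leg i" if "i \<in> Obj J" for i
    using that inj_a by (simp add: leg'_def)
  have "is_colimit C J D c leg \<longleftrightarrow> is_colimit C J D c (leg' \<circ> a)"
    by (rule is_colimit_cong[OF category_axioms]) (use l in auto)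
  then have "is_colimit C (transport_cat a b J) (transport_diagram a b J D) c leg'"
    using c by (simp add: is_colimit_transport)
  with assms(1) *(2) functor_transport[OF D]
  have "is_colimit C' (transport_cat a b J)
      (comp_functor (transport_cat a b J) F (transport_diagram a b J D)) (Fo F c) (\<lambda>i. Fa F (leg' i))"
    unfolding preserves_colimits_def by blast
  then have "is_colimit C' J (comp_functor J F D) (Fo F c) ((\<lambda>i. Fa F (leg' i)) \<circ> a)"
    by (simp add: comp_functor_transport[OF D] is_colimit_transport)
  moreover have "is_colimit C' J (comp_functor J F D) (Fo F c) ((\<lambda>i. Fa F (leg' i)) \<circ> a) \<longleftrightarrow> ?thesis"
    by (rule is_colimit_cong[OF category_axioms]) (use l in auto)
  ultimately show ?thesis
    by simp
qed

section \<open>Restriction categories\<close>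

text \<open>Composition is the meet of a semilattice on this set, and \<open>rle\<close> becomes its
  order: \<open>rle X d e\<close> says that \<open>e\<close> absorbs \<open>d\<close>
  (\<open>rle_Idem\<close>). In the language of sheaves these are the open parts of
  \<open>A\<close>.\<close>

definition Idem :: "('o, 'a, 'c) rcat_scheme \<Rightarrow> 'o \<Rightarrow> 'a set" where
  "Idem X A = {e \<in> Hom X A A. Rst X e = e}"

context restriction_category
begin

lemma rst_idn: "A \<in> Obj X \<Longrightarrow> Rst X (Idn X A) = Idn X A"
  using R1[OF idn_in_Hom] comp_idn_left[OF rst_in_Hom[OF idn_in_Hom]] by simp

lemma rst_rst: "f \<in> Hom X A B \<Longrightarrow> Rst X (Rst X f) = Rst X f"
  using R3[OF _ idn_in_Hom, of f A B] comp_idn_left[OF rst_in_Hom, of f A B] Hom_Obj(1)[of f A B]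
  by (simp add: rst_idn comp_idn_left)

lemma rst_Idem: "f \<in> Hom X A B \<Longrightarrow> Rst X f \<in> Idem X A"
  by (simp add: Idem_def rst_in_Hom rst_rst)

lemma Idem_Hom: "e \<in> Idem X A \<Longrightarrow> e \<in> Hom X A A"
  by (simp add: Idem_def)

lemma Idem_rst: "e \<in> Idem X A \<Longrightarrow> Rst X e = e"
  by (simp add: Idem_def)

lemma Idem_commute: "d \<in> Idem X A \<Longrightarrow> e \<in> Idem X A \<Longrightarrow> d \<cdot> e = e \<cdot> d"
  by (metis R2 Idem_Hom Idem_rst)

lemma Idem_idem: "e \<in> Idem X A \<Longrightarrow> e \<cdot> e = e"
  by (metis R1 Idem_Hom Idem_rst)

lemma Idem_comp: "d \<in> Idem X A \<Longrightarrow> e \<in> Idem X A \<Longrightarrow> d \<cdot> e \<in> Idem X A"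
  using R3[of e A A d A] comp_in_Hom[of e A A d A] by (simp add: Idem_def)

lemma Idem_absorb: "d \<in> Idem X A \<Longrightarrow> e \<in> Idem X A \<Longrightarrow> d \<cdot> (e \<cdot> d) = e \<cdot> d"
  using Idem_commute[of e A d] Idem_idem[of d A] comp_assoc[OF Idem_Hom Idem_Hom Idem_Hom, of e A d d]
  by simp

lemma rst_comp_Idem: "g \<in> Hom X A B \<Longrightarrow> e \<in> Idem X A \<Longrightarrow> Rst X (g \<cdot> e) = Rst X g \<cdot> e"
  using R3[of e A A g B] by (simp add: Idem_def)

lemma rst_comp_le:
  assumes f: "f \<in> Hom X A B" and g: "g \<in> Hom X B D"
  shows "Rst X (g \<cdot> f) \<cdot> Rst X f = Rst X (g \<cdot> f)"
  using R3[OF f comp_in_Hom[OF f g]] comp_assoc[OF rst_in_Hom[OF f] f g] R1[OF f] by simp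

text \<open>Only the domain of definition of \<open>g\<close> matters for that of the composite: R4
  moves \<open>Rst X g\<close> across \<open>f\<close>, and R3 then pulls it out of the
  restriction.\<close>

lemma rst_comp_rst:
  assumes "f \<in> Hom X A B" "g \<in> Hom X B D"
  shows "Rst X (Rst X g \<cdot> f) = Rst X (g \<cdot> f)"
proof -
  note gf = comp_in_Hom[OF assms]
  have "Rst X (Rst X g \<cdot> f) = Rst X f \<cdot> Rst X (g \<cdot> f)"
    using R4[OF assms] R3[OF gf assms(1)] by simp
  then show ?thesis
    using R2[OF gf assms(1)] rst_comp_le[OF assms] by simp
qed

lemma rst_comp_total:
  assumes "f \<in> Hom X A B" "g \<in> Hom X B D" "Rst X g = Idn X B"
  shows "Rst X (g \<cdot> f) = Rst X f"
  using rst_comp_rst[OF assms(1,2)] assms by (simp add: comp_idn_left)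

text \<open>The main use is for splittings: if \<open>r\<close> after \<open>m\<close> is an
  identity, then \<open>m\<close> is total.\<close>

lemma total_cancel:
  assumes "f \<in> Hom X A B" "g \<in> Hom X B D" "Rst X (g \<cdot> f) = Idn X A"
  shows "Rst X f = Idn X A"
  using rst_comp_le[OF assms(1,2)] assms(3) comp_idn_left[OF rst_in_Hom[OF assms(1)]] by simp

lemma rle_antisym:
  assumes "f \<in> Hom X A B" "g \<in> Hom X A B" "rle X f g" "rle X g f"
  shows "f = g"
proof -
  have fg: "g \<cdot> Rst X f = f" "f \<cdot> Rst X g = g"
    using assms by (auto simp: rle_def)
  note r = rst_in_Hom[OF assms(1)] rst_in_Hom[OF assms(2)]
  have "f = f \<cdot> (Rst X g \<cdot> Rst X f)"
    using fg comp_assoc[OF r(1) r(2) assms(1)] by simp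
  also have "\<dots> = (f \<cdot> Rst X f) \<cdot> Rst X g"
    using R2[OF assms(1,2)] comp_assoc[OF r(2) r(1) assms(1)] by simp
  also have "\<dots> = g"
    using R1[OF assms(1)] fg by simp
  finally show ?thesis .
qed

lemma is_join_unique:
  assumes "is_join X A B S j" "is_join X A B S k"
  shows "j = k"
  using assms rle_antisym unfolding is_join_def by blast

lemma rle_Idem: "d \<in> Idem X A \<Longrightarrow> rle X d e \<longleftrightarrow> e \<cdot> d = d"
  by (auto simp: rle_def Idem_rst)

lemma compatible_Idem: "D \<subseteq> Idem X A \<Longrightarrow> compatible X D"
  unfolding compatible_def by (metis Idem_commute Idem_rst subsetD)

lemma compatible_comp:
  assumes "S \<subseteq> Hom X A B" "compatible X S" "g \<in> Hom X D A"
  shows "compatible X ((\<lambda>s. s \<cdot> g) ` S)"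
proof -
  have "(s \<cdot> g) \<cdot> Rst X (t \<cdot> g) = (t \<cdot> g) \<cdot> Rst X (s \<cdot> g)" if "s \<in> S" "t \<in> S" for s t
  proof -
    \<comment> \<open>By R4 the restriction of \<open>t\<close> composed with \<open>g\<close> can
      be moved to the left of \<open>g\<close>, where compatibility of \<open>s\<close> and
      \<open>t\<close> applies.\<close>
    have s: "s \<in> Hom X A B" and t: "t \<in> Hom X A B"
      using that assms(1) by auto
    have *: "(s \<cdot> g) \<cdot> Rst X (t \<cdot> g) = (s \<cdot> Rst X t) \<cdot> g"
      if "s \<in> Hom X A B" "t \<in> Hom X A B" for s t
      using R4[OF assms(3) that(2)] comp_assoc[OF assms(3) rst_in_Hom[OF that(2)] that(1)]
        comp_assoc[OF rst_in_Hom[OF comp_in_Hom[OF assms(3) that(2)]] assms(3) that(1)] by simp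
    show ?thesis
      using *[OF s t] *[OF t s] assms(2) \<open>s \<in> S\<close> \<open>t \<in> S\<close> by (simp add: compatible_def)
  qed
  then show ?thesis
    by (auto simp: compatible_def)
qed

end

text \<open>Covers are stable under pullback: J2 gives the join of the composites with
  \<open>g\<close>, and J1 turns these maps back into idempotents on \<open>B\<close>.\<close>

lemma (in join_restriction_category) is_join_Idem_comp:
  assumes D: "D \<subseteq> Idem X A" and e: "is_join X A A D e" and g: "g \<in> Hom X B A"
  shows "is_join X B B ((\<lambda>d. Rst X (d \<cdot> g)) ` D) (Rst X (e \<cdot> g))"
proof -
  have AB: "A \<in> Obj X" "B \<in> Obj X"
    using Hom_Obj[OF g] by auto
  have DH: "D \<subseteq> Hom X A A"
    using D Idem_Hom by blast
  have DC: "compatible X D"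
    using D by (rule compatible_Idem)
  have "is_join X B A ((\<lambda>d. d \<cdot> g) ` D) (e \<cdot> g)"
    by (rule J2[OF AB(1,1) DH DC e g])
  moreover have "(\<lambda>d. d \<cdot> g) ` D \<subseteq> Hom X B A"
    using DH g comp_in_Hom by blast
  ultimately have "is_join X B B (Rst X ` (\<lambda>d. d \<cdot> g) ` D) (Rst X (e \<cdot> g))"
    using J1 AB compatible_comp[OF DH DC g] by blast
  then show ?thesis
    by (simp add: image_image)
qed

text \<open>\<open>D\<close> equals its own set of restrictions, so by J1 both \<open>e\<close> and
  \<open>Rst X e\<close> are its join.\<close>

lemma (in join_restriction_category) is_join_Idem:
  assumes "A \<in> Obj X" "D \<subseteq> Idem X A" "is_join X A A D e"
  shows "e \<in> Idem X A"
proof -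
  have "D \<subseteq> Hom X A A" "Rst X ` D = D"
    using assms(2) by (force simp: Idem_def)+
  then have "is_join X A A D (Rst X e)"
    using J1[OF assms(1,1) _ compatible_Idem[OF assms(2)] assms(3)] by simp
  with assms(3) have "e = Rst X e"
    by (rule is_join_unique)
  then show ?thesis
    using assms(3) by (simp add: Idem_def is_join_def)
qed

lemma (in join_restriction_category) is_join_Idem_Rst:
  assumes D: "D \<subseteq> Idem X A" and e: "is_join X A A D e" and d: "d \<in> Idem X A"
  shows "is_join X A A ((\<lambda>c. c \<cdot> d) ` D) (e \<cdot> d)"
proof -
  have "D \<subseteq> Hom X A A" "A \<in> Obj X"
    using D d Idem_Hom Hom_Obj by blast+
  then show ?thesis
    using J2[OF _ _ _ compatible_Idem[OF D] e Idem_Hom[OF d]] by blast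
qed

lemma (in join_restriction_category) Idem_join_exists:
  assumes "A \<in> Obj X" "D \<subseteq> Idem X A"
  shows "\<exists>e. is_join X A A D e"
  using join_exists[OF assms(1,1) _ compatible_Idem[OF assms(2)]] assms(2) Idem_Hom by blast

section \<open>Restriction presheaves as sheaves\<close>

text \<open>
  The elements may have any type and need not form small sets, so that this applies to the
  representables of an arbitrary restriction category.
\<close>

definition gle :: "('a \<Rightarrow> 'z \<Rightarrow> 'z) \<Rightarrow> ('o \<Rightarrow> 'z \<Rightarrow> 'a) \<Rightarrow> 'o \<Rightarrow> 'z \<Rightarrow> 'z \<Rightarrow> bool" where
  "gle act rst A x y \<longleftrightarrow> x = act (rst A x) y"

definition gcompat :: "('a \<Rightarrow> 'z \<Rightarrow> 'z) \<Rightarrow> ('o \<Rightarrow> 'z \<Rightarrow> 'a) \<Rightarrow> 'o \<Rightarrow> 'z set \<Rightarrow> bool" where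
  "gcompat act rst A S \<longleftrightarrow> (\<forall>x\<in>S. \<forall>y\<in>S. act (rst A y) x = act (rst A x) y)"

definition gjoin ::
  "('o \<Rightarrow> 'z set) \<Rightarrow> ('a \<Rightarrow> 'z \<Rightarrow> 'z) \<Rightarrow> ('o \<Rightarrow> 'z \<Rightarrow> 'a) \<Rightarrow> 'o \<Rightarrow> 'z set \<Rightarrow> 'z \<Rightarrow> bool" where
  "gjoin El act rst A S j \<longleftrightarrow>
     j \<in> El A \<and> (\<forall>s\<in>S. gle act rst A s j) \<and>
     (\<forall>k\<in>El A. (\<forall>s\<in>S. gle act rst A s k) \<longrightarrow> gle act rst A j k)"

text \<open>The order-free counterpart of \<open>gjoin\<close>: minimality among upper bounds is
  replaced by the requirement that the domain of \<open>j\<close> be covered by the domains of the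
  members. In this form it passes through anything that commutes with \<open>act\<close> and
  \<open>rst\<close>.\<close>

definition glued ::
  "('o, 'a, 'c) rcat_scheme \<Rightarrow> ('o \<Rightarrow> 'z set) \<Rightarrow> ('a \<Rightarrow> 'z \<Rightarrow> 'z) \<Rightarrow> ('o \<Rightarrow> 'z \<Rightarrow> 'a) \<Rightarrow> 'o \<Rightarrow>
     'z set \<Rightarrow> 'z \<Rightarrow> bool" where
  "glued X El act rst A S j \<longleftrightarrow>
     j \<in> El A \<and> (\<forall>s\<in>S. act (rst A s) j = s) \<and> is_join X A A (rst A ` S) (rst A j)"

text \<open>The single law \<open>rst_act\<close> stands for RP2 and RP3: RP2 is its case for an
  idempotent, and RP3 follows from it by R4.\<close>

locale rpresheaf = restriction_category X
  for X :: "('o, 'a, 'c) rcat_scheme" (structure) +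
  fixes El :: "'o \<Rightarrow> 'z set" and act :: "'a \<Rightarrow> 'z \<Rightarrow> 'z" and rst :: "'o \<Rightarrow> 'z \<Rightarrow> 'a"
  assumes act_in: "f \<in> Hom X B A \<Longrightarrow> x \<in> El A \<Longrightarrow> act f x \<in> El B"
    and act_idn: "A \<in> Obj X \<Longrightarrow> x \<in> El A \<Longrightarrow> act (Idn X A) x = x"
    and act_comp: "g \<in> Hom X D B \<Longrightarrow> f \<in> Hom X B A \<Longrightarrow> x \<in> El A \<Longrightarrow>
                     act (f \<cdot> g) x = act g (act f x)"
    and rst_el: "A \<in> Obj X \<Longrightarrow> x \<in> El A \<Longrightarrow> rst A x \<in> Idem X A"
    and act_rst: "A \<in> Obj X \<Longrightarrow> x \<in> El A \<Longrightarrow> act (rst A x) x = x"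
    and rst_act: "f \<in> Hom X B A \<Longrightarrow> x \<in> El A \<Longrightarrow> rst B (act f x) = Rst X (rst A x \<cdot> f)"
begin

abbreviation "le \<equiv> gle act rst"
abbreviation "coherent \<equiv> gcompat act rst"
abbreviation "join \<equiv> gjoin El act rst"
abbreviation "glue \<equiv> glued X El act rst"

lemma act_Idem_in: "e \<in> Idem X A \<Longrightarrow> x \<in> El A \<Longrightarrow> act e x \<in> El A"
  using act_in Idem_Hom by blast

lemma act_Idem_comp:
  "d \<in> Idem X A \<Longrightarrow> e \<in> Idem X A \<Longrightarrow> x \<in> El A \<Longrightarrow> act e (act d x) = act (d \<cdot> e) x"
  using act_comp Idem_Hom by metis

lemma rst_act_Idem:
  assumes "e \<in> Idem X A" "x \<in> El A"
  shows "rst A (act e x) = rst A x \<cdot> e"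
proof -
  have "A \<in> Obj X"
    using assms Idem_Hom Hom_Obj by blast
  then show ?thesis
    using rst_act[OF Idem_Hom[OF assms(1)] assms(2)] rst_el[OF _ assms(2)] assms(1)
      Idem_comp Idem_rst by metis
qed

text \<open>This is R4 read through the action: cutting \<open>x\<close> down to \<open>e\<close>
  and then pulling back along \<open>f\<close> is the same as pulling back and cutting down to the
  preimage of \<open>e\<close>.\<close>

lemma act_rst_act:
  assumes "f \<in> Hom X B A" "x \<in> El A" "e \<in> Idem X A"
  shows "act (Rst X (e \<cdot> f)) (act f x) = act f (act e x)"
proof -
  have "e \<cdot> f = f \<cdot> Rst X (e \<cdot> f)"
    using R4[OF assms(1) Idem_Hom[OF assms(3)]] Idem_rst[OF assms(3)] by simp
  moreover have "Rst X (e \<cdot> f) \<in> Hom X B B"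
    using assms Idem_Hom comp_in_Hom rst_in_Hom by blast
  ultimately show ?thesis
    using act_comp assms Idem_Hom by metis
qed

lemma le_antisym:
  assumes A: "A \<in> Obj X" and "x \<in> El A" "y \<in> El A" "le A x y" "le A y x"
  shows "x = y"
proof -
  have x: "x = act (rst A x) y" and y: "y = act (rst A y) x"
    using assms by (auto simp: gle_def)
  note r = rst_el[OF A assms(2)] rst_el[OF A assms(3)]
  have "x = act (rst A x) (act (rst A y) x)"
    using x y by simp
  also have "\<dots> = act (rst A y \<cdot> rst A x) x"
    using act_Idem_comp[OF r(2,1) assms(2)] by simp
  also have "\<dots> = act (rst A x \<cdot> rst A y) x"
    using Idem_commute[OF r] by simp
  also have "\<dots> = act (rst A y) (act (rst A x) x)"
    using act_Idem_comp[OF r assms(2)] by simp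
  also have "\<dots> = y"
    using A assms y by (simp add: act_rst)
  finally show ?thesis .
qed

lemma join_unique:
  assumes "A \<in> Obj X" "join A S j" "join A S k"
  shows "j = k"
  using assms le_antisym unfolding gjoin_def by blast

end

text \<open>The sheaf condition for the topology in which \<open>D\<close> covers its join
  \<open>e\<close>. \<open>coherent\<close> is agreement on overlaps of domains. The empty cover is
  included: over its join all elements agree.\<close>

locale jr_sheaf = rpresheaf X El act rst + join_restriction_category X
  for X :: "('o, 'a, 'c) rcat_scheme" (structure)
    and El :: "'o \<Rightarrow> 'z set" and act :: "'a \<Rightarrow> 'z \<Rightarrow> 'z" and rst :: "'o \<Rightarrow> 'z \<Rightarrow> 'a" +
  assumes sep: "A \<in> Obj X \<Longrightarrow> D \<subseteq> Idem X A \<Longrightarrow> is_join X A A D e \<Longrightarrow> x \<in> El A \<Longrightarrow> y \<in> El A \<Longrightarrow>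
                  (\<And>d. d \<in> D \<Longrightarrow> act d x = act d y) \<Longrightarrow> act e x = act e y"
    and glue: "A \<in> Obj X \<Longrightarrow> S \<subseteq> El A \<Longrightarrow> coherent A S \<Longrightarrow> \<exists>j. glue A S j"
begin

text \<open>Minimality is separation: any upper bound agrees with \<open>j\<close> on the domains of
  the members, and these cover the domain of \<open>j\<close>.\<close>

lemma glue_imp_join:
  assumes A: "A \<in> Obj X" and S: "S \<subseteq> El A" and g: "glue A S j"
  shows "join A S j"
proof -
  have j: "j \<in> El A" "\<And>s. s \<in> S \<Longrightarrow> act (rst A s) j = s" "is_join X A A (rst A ` S) (rst A j)"
    using g by (auto simp: glued_def)
  have D: "rst A ` S \<subseteq> Idem X A"
    using A S rst_el by blast
  have "le A j k" if "k \<in> El A" "\<forall>s\<in>S. le A s k" for k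
  proof -
    have "act (rst A j) j = act (rst A j) k"
      by (rule sep[OF A D j(3) j(1) that(1)]) (use that j in \<open>auto simp: gle_def\<close>)
    then show ?thesis
      using A j by (simp add: gle_def act_rst)
  qed
  then show ?thesis
    using j by (auto simp: gjoin_def gle_def)
qed

text \<open>A coherent family has some gluing, the gluing is a join, and joins are unique by
  antisymmetry; hence every join is that gluing.\<close>

lemma join_iff_glue:
  assumes "A \<in> Obj X" "S \<subseteq> El A" "coherent A S"
  shows "join A S j \<longleftrightarrow> glue A S j"
  using glue[OF assms] glue_imp_join[OF assms(1,2)] join_unique[OF assms(1)] by blast

lemma glue_unique: "A \<in> Obj X \<Longrightarrow> S \<subseteq> El A \<Longrightarrow> glue A S j \<Longrightarrow> glue A S k \<Longrightarrow> j = k"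
  by (meson glue_imp_join join_unique)

text \<open>In this formulation JRP2 is a consequence: \<open>act_rst_act\<close> pulls back the
  defining equations, and \<open>is_join_Idem_comp\<close> pulls back the cover.\<close>

lemma glue_act:
  assumes S: "S \<subseteq> El A" and j: "glue A S j" and g: "g \<in> Hom X B A"
  shows "glue B (act g ` S) (act g j)"
proof -
  have A: "A \<in> Obj X"
    using g Hom_Obj by blast
  have jE: "j \<in> El A" and js: "\<And>s. s \<in> S \<Longrightarrow> act (rst A s) j = s"
    and jj: "is_join X A A (rst A ` S) (rst A j)"
    using j by (auto simp: glued_def)
  have "act (rst B (act g s)) (act g j) = act g s" if "s \<in> S" for s
    using that S js[OF that] act_rst_act[OF g jE rst_el[OF A]] rst_act[OF g] by (metis subsetD)
  moreover have D: "rst A ` S \<subseteq> Idem X A"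
    using A S rst_el by blast
  have "is_join X B B ((\<lambda>d. Rst X (d \<cdot> g)) ` rst A ` S) (Rst X (rst A j \<cdot> g))"
    by (rule is_join_Idem_comp[OF D jj g])
  moreover have "(\<lambda>d. Rst X (d \<cdot> g)) ` rst A ` S = rst B ` act g ` S"
    unfolding image_image using rst_act[OF g] S by (intro image_cong) auto
  ultimately show ?thesis
    using jE g by (auto simp: glued_def rst_act act_in)
qed

text \<open>The usual form of separation, for two elements that already live over
  \<open>e\<close>.\<close>

lemma sep_cover:
  assumes A: "A \<in> Obj X" and D: "D \<subseteq> Idem X A" "is_join X A A D e"
    and x: "x \<in> El A" "y \<in> El A" "act e x = x" "act e y = y"
    and "\<And>d. d \<in> D \<Longrightarrow> act d x = act d y"
  shows "x = y"
  using sep[OF A D x(1,2)] assms by auto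

text \<open>Nothing forces \<open>e\<close> to lie below the domain of \<open>x\<close>, so the
  cover to be checked is \<open>D\<close> intersected with \<open>rst A x\<close>. This is what J1
  for presheaf maps comes down to.\<close>

lemma glue_Idem:
  assumes A: "A \<in> Obj X" and D: "D \<subseteq> Idem X A" "is_join X A A D e" and x: "x \<in> El A"
  shows "glue A ((\<lambda>d. act d x) ` D) (act e x)"
proof -
  have e: "e \<in> Idem X A"
    using A D by (rule is_join_Idem)
  have r: "rst A x \<in> Idem X A"
    using A x by (rule rst_el)
  have "act (rst A (act d x)) (act e x) = act d x" if "d \<in> D" for d
  proof -
    have d: "d \<in> Idem X A"
      using that D by auto
    have ed: "e \<cdot> d = d"
      using D that rle_Idem[OF d] by (auto simp: is_join_def)
    have "act (rst A (act d x)) (act e x) = act (e \<cdot> (rst A x \<cdot> d)) x"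
      using e d r x by (simp add: rst_act_Idem act_Idem_comp Idem_comp)
    also have "e \<cdot> (rst A x \<cdot> d) = rst A x \<cdot> d"
      using ed Idem_commute[OF r d] comp_assoc[OF Idem_Hom[OF r] Idem_Hom[OF d] Idem_Hom[OF e]]
      by simp
    also have "act (rst A x \<cdot> d) x = act d x"
      using e d r x A by (simp add: act_Idem_comp[symmetric] act_rst)
    finally show ?thesis .
  qed
  moreover have "is_join X A A ((\<lambda>c. c \<cdot> rst A x) ` D) (e \<cdot> rst A x)"
    by (rule is_join_Idem_Rst[OF D r])
  moreover have "(\<lambda>c. c \<cdot> rst A x) ` D = rst A ` (\<lambda>d. act d x) ` D"
    unfolding image_image using D r x Idem_commute
    by (intro image_cong) (auto simp: rst_act_Idem subset_iff)
  moreover have "e \<cdot> rst A x = rst A (act e x)"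
    using e r x by (simp add: rst_act_Idem Idem_commute)
  ultimately show ?thesis
    using e x by (auto simp: glued_def act_Idem_in)
qed

end

text \<open>Gluing is immediate, since \<open>gle\<close> is an equation and \<open>RJ\<close>
  supplies the cover. Separation holds because \<open>act e x\<close> is the join of the pieces
  \<open>act d x\<close>, hence determined by them.\<close>

lemma jr_sheaf_of_joins:
  assumes "rpresheaf X El act rst" and "join_restriction_category X"
    and ex: "\<And>A S. A \<in> Obj X \<Longrightarrow> S \<subseteq> El A \<Longrightarrow> gcompat act rst A S \<Longrightarrow> \<exists>j. gjoin El act rst A S j"
    and RJ: "\<And>A S j. A \<in> Obj X \<Longrightarrow> S \<subseteq> El A \<Longrightarrow> gcompat act rst A S \<Longrightarrow> gjoin El act rst A S j \<Longrightarrow>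
               is_join X A A (rst A ` S) (rst A j)"
  shows "jr_sheaf X El act rst"
proof -
  interpret rpresheaf X El act rst by fact
  interpret join_restriction_category X by fact
  show ?thesis
  proof
    fix A S assume A: "A \<in> Obj X" and S: "S \<subseteq> El A" "coherent A S"
    obtain j where j: "join A S j"
      using ex[OF A S] by blast
    show "\<exists>j. glue A S j"
      using j RJ[OF A S j] by (auto simp: glued_def gjoin_def gle_def)
  next
    fix A D e x y
    assume A: "A \<in> Obj X" and D: "D \<subseteq> Idem X A" "is_join X A A D e"
      and xy: "x \<in> El A" "y \<in> El A" and eq: "\<And>d. d \<in> D \<Longrightarrow> act d x = act d y"
    have e: "e \<in> Idem X A"
      using A D by (rule is_join_Idem)
    have *: "join A ((\<lambda>d. act d x) ` D) (act e x)" if x: "x \<in> El A" for x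
    proof -
      have r: "rst A x \<in> Idem X A"
        using A x by (rule rst_el)
      have xd: "act d x = act (rst A x \<cdot>\<^bsub>X\<^esub> d) x" if d: "d \<in> Idem X A" for d
        using A d x r by (simp add: act_Idem_comp[symmetric] act_rst)
      have rd: "rst A (act d x) = rst A x \<cdot>\<^bsub>X\<^esub> d" if d: "d \<in> Idem X A" for d
        using d x by (rule rst_act_Idem)
      let ?S = "(\<lambda>d. act d x) ` D"
      have SE: "?S \<subseteq> El A"
        using D x act_Idem_in by blast
      \<comment> \<open>The overlap of two pieces of \<open>x\<close> depends only on the meet of
        \<open>c\<close> and \<open>d\<close>, which is symmetric; this gives coherence.\<close>
      have "act (rst A (act c x)) (act d x) = act (d \<cdot>\<^bsub>X\<^esub> c) x"
        if c: "c \<in> Idem X A" and d: "d \<in> Idem X A" for c d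
      proof -
        have "act (rst A (act c x)) (act d x) = act (d \<cdot>\<^bsub>X\<^esub> (rst A x \<cdot>\<^bsub>X\<^esub> c)) x"
          using c d r x by (simp add: rd act_Idem_comp Idem_comp)
        also have "d \<cdot>\<^bsub>X\<^esub> (rst A x \<cdot>\<^bsub>X\<^esub> c) = rst A x \<cdot>\<^bsub>X\<^esub> (d \<cdot>\<^bsub>X\<^esub> c)"
          using Idem_commute[OF r d] Idem_Hom[OF c] Idem_Hom[OF d] Idem_Hom[OF r]
          by (simp flip: comp_assoc)
        finally show ?thesis
          using xd[OF Idem_comp[OF d c]] by simp
      qed
      note cd = this
      have SC: "coherent A ?S"
        using D unfolding gcompat_def by (auto simp: cd subset_iff) (metis Idem_commute)
      obtain j where j: "join A ?S j"
        using ex[OF A SE SC] by blast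
      have jE: "j \<in> El A"
        using j by (simp add: gjoin_def)
      have "le A (act d x) (act e x)" if d: "d \<in> D" for d
      proof -
        have "d \<in> Idem X A"
          using d D by auto
        moreover from this have "e \<cdot>\<^bsub>X\<^esub> d = d"
          using D d rle_Idem by (auto simp: is_join_def)
        ultimately show ?thesis
          using cd[of d e] e by (simp add: gle_def)
      qed
      \<comment> \<open>The join \<open>j\<close> of the pieces lies below \<open>act e x\<close>.
        It remains to see that both have the same domain, which follows from uniqueness of joins in
        \<open>X\<close>.\<close>
      then have "le A j (act e x)"
        using j act_Idem_in[OF e x] by (auto simp: gjoin_def)
      then have "j = act (rst A j) (act e x)"
        by (simp add: gle_def)
      moreover have "rst A j = e \<cdot>\<^bsub>X\<^esub> rst A x"
      proof (rule is_join_unique)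
        show "is_join X A A (rst A ` ?S) (rst A j)"
          by (rule RJ[OF A SE SC j])
        have "(\<lambda>c. c \<cdot>\<^bsub>X\<^esub> rst A x) ` D = rst A ` ?S"
          unfolding image_image using D r x Idem_commute
          by (intro image_cong) (auto simp: rd subset_iff)
        then show "is_join X A A (rst A ` ?S) (e \<cdot>\<^bsub>X\<^esub> rst A x)"
          using is_join_Idem_Rst[OF D r] by simp
      qed
      moreover have "act (e \<cdot>\<^bsub>X\<^esub> rst A x) (act e x) = act e x"
        using A e r x act_rst[OF A act_Idem_in[OF e x]] by (simp add: rd Idem_commute)
      ultimately show ?thesis
        using j by simp
    qed
    have "(\<lambda>d. act d x) ` D = (\<lambda>d. act d y) ` D"
      using eq by (intro image_cong) auto
    then show "act e x = act e y"
      using join_unique[OF A] *[OF xy(1)] *[OF xy(2)] by simp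
  qed
qed

text \<open>For hom-sets, \<open>gcompat\<close> and \<open>gjoin\<close> unfold to
  \<open>compatible\<close> and \<open>is_join\<close>, and \<open>RJ\<close> is J1. No smallness is
  required, so the lemma serves the target category as well as \<open>X\<close>.\<close>

lemma (in join_restriction_category) hom_sheaf:
  assumes B: "B \<in> Obj X"
  shows "jr_sheaf X (\<lambda>A. Hom X A B) (\<lambda>f x. x \<cdot> f) (\<lambda>A. Rst X)"
proof (rule jr_sheaf_of_joins)
  show "rpresheaf X (\<lambda>A. Hom X A B) (\<lambda>f x. x \<cdot> f) (\<lambda>A. Rst X)"
    by unfold_locales (simp_all add: comp_in_Hom comp_idn_right comp_assoc rst_Idem R1 rst_comp_rst)
next
  fix A S assume A: "A \<in> Obj X" and S: "S \<subseteq> Hom X A B"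
    and "gcompat (\<lambda>f x. x \<cdot> f) (\<lambda>A. Rst X) A S"
  then have C: "compatible X S"
    by (simp add: gcompat_def compatible_def)
  have e: "gjoin (\<lambda>A. Hom X A B) (\<lambda>f x. x \<cdot> f) (\<lambda>A. Rst X) A S j \<longleftrightarrow> is_join X A B S j" for j
    by (simp add: gjoin_def is_join_def gle_def rle_def)
  show "\<exists>j. gjoin (\<lambda>A. Hom X A B) (\<lambda>f x. x \<cdot> f) (\<lambda>A. Rst X) A S j"
    using join_exists[OF A B S C] by (simp add: e)
  show "is_join X A A (Rst X ` S) (Rst X j)"
    if "gjoin (\<lambda>A. Hom X A B) (\<lambda>f x. x \<cdot> f) (\<lambda>A. Rst X) A S j" for j
    using J1[OF A B S C] that by (simp add: e)
qed (rule join_restriction_category_axioms)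

text \<open>Separates a join of maps into equations, which every restriction functor respects, and a
  join of restriction idempotents. Preservation of joins thereby becomes a question about
  idempotents.\<close>

lemma (in join_restriction_category) glued_hom_iff:
  assumes "A \<in> Obj X" "B \<in> Obj X" "S \<subseteq> Hom X A B" "compatible X S"
  shows "is_join X A B S j \<longleftrightarrow>
    j \<in> Hom X A B \<and> (\<forall>s\<in>S. j \<cdot> Rst X s = s) \<and> is_join X A A (Rst X ` S) (Rst X j)"
  using jr_sheaf.join_iff_glue[OF hom_sheaf[OF assms(2)] assms(1), of S j] assms(3,4)
  by (simp add: gjoin_def is_join_def gle_def rle_def glued_def gcompat_def compatible_def)

section \<open>Comparison with restriction presheaves and join restriction presheaves\<close>

lemma (in restriction_category) rpresheaf_psh:
  assumes "restriction_presheaf X P"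
  shows "rpresheaf X (PEl P) (PAct P) (PRst P)"
proof -
  interpret P: restriction_presheaf X P by fact
  have ain: "PAct P f x \<in> PEl P B" if "f \<in> Hom X B A" "x \<in> PEl P A" for f x A B
    using P.PAct_in[of f] that by (auto simp: Hom_def PiE_def Pi_def)
  have rel: "PRst P A x \<in> Idem X A" if "A \<in> Obj X" "x \<in> PEl P A" for x A
    using P.PRst_in[of A] P.PRst_idem[of A x] that
    by (auto simp: restriction_idempotent_def Idem_def PiE_def Pi_def)
  show ?thesis
  proof
    fix f A B x assume f: "f \<in> Hom X B A" and x: "x \<in> PEl P A"
    have AB: "A \<in> Obj X" "B \<in> Obj X"
      using Hom_Obj[OF f] by auto
    have fx: "PAct P f x \<in> PEl P B"
      using f x by (rule ain)
    \<comment> \<open>Restricting to \<open>Rst X f\<close> changes nothing, so RP2 allows this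
      idempotent to be inserted. R3 and then RP3 turn the result into the restriction of a
      composite.\<close>
    have "PAct P (Rst X f) (PAct P f x) = PAct P f x"
      using P.PAct_comp[OF rst_in_Hom[OF f] f x] R1[OF f] by simp
    then have "PRst P B (PAct P f x) = PRst P B (PAct P f x) \<cdot> Rst X f"
      using P.RP2[OF AB(2) fx f] by simp
    also have "\<dots> = Rst X f \<cdot> PRst P B (PAct P f x)"
      using rel[OF AB(2) fx] rst_Idem[OF f] by (rule Idem_commute)
    also have "\<dots> = Rst X (f \<cdot> PRst P B (PAct P f x))"
      using rst_comp_Idem[OF f rel[OF AB(2) fx]] by simp
    also have "\<dots> = Rst X (PRst P A x \<cdot> f)"
      using P.RP3[OF AB(1) x f] by simp
    finally show "PRst P B (PAct P f x) = Rst X (PRst P A x \<cdot> f)" .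
  qed (use ain rel P.PAct_idn P.PAct_comp P.RP1 in auto)
qed

lemma (in join_restriction_category) jr_sheaf_psh:
  assumes "join_restriction_presheaf X P"
  shows "jr_sheaf X (PEl P) (PAct P) (PRst P)"
proof (rule jr_sheaf_of_joins)
  interpret P: join_restriction_presheaf X P by fact
  show "rpresheaf X (PEl P) (PAct P) (PRst P)"
    using P.restriction_presheaf_axioms by (rule rpresheaf_psh)
  have e: "gjoin (PEl P) (PAct P) (PRst P) A S j \<longleftrightarrow> is_pjoin P A S j" for A S j
    by (simp add: gjoin_def is_pjoin_def gle_def ple_def)
  fix A S assume A: "A \<in> Obj X" and S: "S \<subseteq> PEl P A" and "gcompat (PAct P) (PRst P) A S"
  then have C: "pcompatible P A S"
    by (simp add: gcompat_def pcompatible_def)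
  show "\<exists>j. gjoin (PEl P) (PAct P) (PRst P) A S j"
    using P.pjoin_exists[OF A S C] by (simp add: e)
  show "is_join X A A (PRst P A ` S) (PRst P A j)" if "gjoin (PEl P) (PAct P) (PRst P) A S j" for j
    using P.JRP1[OF A S C] that by (simp add: e)
qed (rule join_restriction_category_axioms)

text \<open>The form in which presheaves are constructed: the sheaf condition yields all laws, JRP1
  and JRP2 included, and only size and extensionality are left to check.\<close>

lemma join_restriction_presheafI:
  fixes P :: "('o, 'a, 'u) psh"
  assumes "jr_sheaf X (PEl P) (PAct P) (PRst P)"
    and small: "\<And>A. A \<in> Obj X \<Longrightarrow> small TYPE('u) (PEl P A)"
    and ext: "PEl P \<in> extensional (Obj X)" "PAct P \<in> extensional (Arr X)"
      "\<And>f. f \<in> Arr X \<Longrightarrow> PAct P f \<in> extensional (PEl P (Cod X f))"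
      "PRst P \<in> extensional (Obj X)" "\<And>A. A \<in> Obj X \<Longrightarrow> PRst P A \<in> extensional (PEl P A)"
  shows "join_restriction_presheaf X P"
proof -
  interpret jr_sheaf X "PEl P" "PAct P" "PRst P" by fact
  show ?thesis
  proof
    fix A x f B assume A: "A \<in> Obj X" and x: "x \<in> PEl P A" and f: "f \<in> Hom X A B"
    show "PRst P A (PAct P (Rst X f) x) = PRst P A x \<cdot>\<^bsub>X\<^esub> Rst X f"
      using rst_act_Idem[OF rst_Idem[OF f] x] .
  next
    fix A x g B assume A: "A \<in> Obj X" and x: "x \<in> PEl P A" and g: "g \<in> Hom X B A"
    show "PRst P A x \<cdot>\<^bsub>X\<^esub> g = g \<cdot>\<^bsub>X\<^esub> PRst P B (PAct P g x)"
      using R4[OF g Idem_Hom[OF rst_el[OF A x]]] rst_act[OF g x] Idem_rst[OF rst_el[OF A x]] by simp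
  next
    fix A S assume A: "A \<in> Obj X" and S: "S \<subseteq> PEl P A" and C: "pcompatible P A S"
    have e: "is_pjoin P A S j \<longleftrightarrow> join A S j" for A S j
      by (simp add: gjoin_def is_pjoin_def gle_def ple_def)
    have C': "coherent A S"
      using C by (simp add: gcompat_def pcompatible_def)
    note g = join_iff_glue[OF A S C', folded e]
    show "\<exists>j. is_pjoin P A S j"
      using glue[OF A S C'] g by blast
    fix j assume j: "is_pjoin P A S j"
    then have j': "glue A S j"
      by (simp add: g)
    then show "is_join X A A (PRst P A ` S) (PRst P A j)"
      by (simp add: glued_def)
    fix h B assume h: "h \<in> Hom X B A"
    have "PAct P h ` S \<subseteq> PEl P B"
      using S h act_in by blast
    then show "is_pjoin P B (PAct P h ` S) (PAct P h j)"
      unfolding e using glue_act[OF S j' h] Hom_Obj[OF h] glue_imp_join by blast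
  next
    fix A x assume "A \<in> Obj X" "x \<in> PEl P A"
    then show "restriction_idempotent X (PRst P A x)"
      using rst_el[of A x] by (auto simp: restriction_idempotent_def Idem_def Hom_def)
  next
    fix A assume "A \<in> Obj X"
    then show "PRst P A \<in> PEl P A \<rightarrow>\<^sub>E Hom X A A"
      using rst_el[of A] ext(5)[of A] by (auto simp: Idem_def PiE_def)
  next
    fix f assume f: "f \<in> Arr X"
    then show "PAct P f \<in> PEl P (Cod X f) \<rightarrow>\<^sub>E PEl P (Dom X f)"
      using act_in[OF Arr_Hom[OF f]] ext(3)[OF f] by (auto simp: PiE_def)
  qed (use small ext act_idn act_comp act_rst in auto)
qed

text \<open>Transport of structure. The domains of elements are untouched, so covers in
  \<open>X\<close> are the same on both sides and only equations need to be carried over.\<close>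

lemma (in jr_sheaf) jr_sheaf_transfer:
  assumes bij: "\<And>A. A \<in> Obj X \<Longrightarrow> bij_betw (c A) (El A) (El' A)"
    and Act: "\<And>A B f x. f \<in> Hom X B A \<Longrightarrow> x \<in> El A \<Longrightarrow> act' f (c A x) = c B (act f x)"
    and Rst: "\<And>A x. A \<in> Obj X \<Longrightarrow> x \<in> El A \<Longrightarrow> rst' A (c A x) = rst A x"
  shows "jr_sheaf X El' act' rst'"
proof -
  have El: "El' A = c A ` El A" and inj: "inj_on (c A) (El A)" if "A \<in> Obj X" for A
    using bij[OF that] by (auto simp: bij_betw_def)
  show ?thesis
  proof
    fix A D e x y
    assume A: "A \<in> Obj X" and D: "D \<subseteq> Idem X A" "is_join X A A D e"
      and xy: "x \<in> El' A" "y \<in> El' A" and eq: "\<And>d. d \<in> D \<Longrightarrow> act' d x = act' d y"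
    obtain x' y' where x': "x = c A x'" "x' \<in> El A" and y': "y = c A y'" "y' \<in> El A"
      using xy El[OF A] by auto
    have "act d x' = act d y'" if d: "d \<in> D" for d
    proof -
      have dI: "d \<in> Idem X A"
        using d D by auto
      then have "c A (act d x') = c A (act d y')"
        using eq[OF d] x' y' Idem_Hom Act by metis
      then show ?thesis
        using inj[OF A] act_Idem_in[OF dI] x' y' by (meson inj_onD)
    qed
    then have "act e x' = act e y'"
      using sep[OF A D x'(2) y'(2)] by blast
    moreover have "e \<in> Hom X A A"
      using D by (simp add: is_join_def)
    ultimately show "act' e x = act' e y"
      using x' y' Act by metis
  next
    fix A S assume A: "A \<in> Obj X" and S: "S \<subseteq> El' A" and C: "gcompat act' rst' A S"
    define T where "T = {x \<in> El A. c A x \<in> S}"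
    have ST: "S = c A ` T"
      using S El[OF A] by (auto simp: T_def)
    have TE: "T \<subseteq> El A"
      by (auto simp: T_def)
    have R: "act' (rst A y) (c A x) = c A (act (rst A y) x)" if "x \<in> El A" "y \<in> El A" for x y
      using that Act Idem_Hom rst_el[OF A] by blast
    have "coherent A T"
      unfolding gcompat_def
    proof (intro ballI)
      fix x y assume xy: "x \<in> T" "y \<in> T"
      then have e: "x \<in> El A" "y \<in> El A"
        using TE by auto
      have "c A (act (rst A y) x) = c A (act (rst A x) y)"
        using C xy e A by (simp add: gcompat_def ST Rst R[symmetric]) (metis Rst A)
      then show "act (rst A y) x = act (rst A x) y"
        using inj[OF A] act_Idem_in[OF rst_el[OF A]] e by (meson inj_onD)
    qed
    then obtain j where j: "glue A T j"
      using glue[OF A TE] by blast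
    have "rst' A ` S = rst A ` T"
      unfolding ST image_image using Rst[OF A] TE by (intro image_cong) auto
    moreover have "act' (rst' A s) (c A j) = s" if s: "s \<in> S" for s
    proof -
      obtain x where x: "s = c A x" "x \<in> T"
        using s unfolding ST by blast
      then show ?thesis
        using j R[of j x] TE Rst[OF A, of x] by (auto simp: glued_def)
    qed
    ultimately have "glued X El' act' rst' A S (c A j)"
      using j El[OF A] Rst[OF A] by (auto simp: glued_def)
    then show "\<exists>j. glued X El' act' rst' A S j" ..
  next
    fix f B A x assume f: "f \<in> Hom X B A" and x: "x \<in> El' A"
    then obtain x' where x': "x = c A x'" "x' \<in> El A"
      using El Hom_Obj by auto
    show "act' f x \<in> El' B" "rst' B (act' f x) = Rst X (rst' A x \<cdot> f)"
      using f x' El Rst Hom_Obj[OF f] Act[OF f x'(2)] act_in[OF f x'(2)] rst_act[OF f x'(2)] by auto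
    fix g D assume g: "g \<in> Hom X D B"
    show "act' (f \<cdot> g) x = act' g (act' f x)"
      using g f x' Act comp_in_Hom[OF g f] act_in[OF f] act_comp[OF g f] by metis
  next
    fix A x assume A: "A \<in> Obj X" and x: "x \<in> El' A"
    then obtain x' where x': "x = c A x'" "x' \<in> El A"
      using El by auto
    show "act' (Idn X A) x = x"
      using Act[OF idn_in_Hom[OF A] x'(2)] x' act_idn[OF A] by simp
    show "rst' A x \<in> Idem X A" "act' (rst' A x) x = x"
      using x' A Rst[OF A x'(2)] rst_el[OF A x'(2)] Act[OF Idem_Hom[OF rst_el[OF A x'(2)]] x'(2)]
        act_rst[OF A x'(2)] by auto
  qed
qed

text \<open>Elements of a presheaf must be elements of \<open>'u\<close>. Constructions are carried
  out with whatever elements are natural and are recoded here through injections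
  \<open>c A\<close>.\<close>

lemma (in jr_sheaf) small_psh:
  assumes "\<And>A. A \<in> Obj X \<Longrightarrow> small TYPE('u) (El A)"
  obtains P :: "('o, 'a, 'u) psh" and c :: "'o \<Rightarrow> 'z \<Rightarrow> 'u" where
    "join_restriction_presheaf X P"
    "\<And>A. A \<in> Obj X \<Longrightarrow> bij_betw (c A) (El A) (PEl P A)"
    "\<And>A B f x. f \<in> Hom X B A \<Longrightarrow> x \<in> El A \<Longrightarrow> PAct P f (c A x) = c B (act f x)"
    "\<And>A x. A \<in> Obj X \<Longrightarrow> x \<in> El A \<Longrightarrow> PRst P A (c A x) = rst A x"
proof -
  have "\<exists>f :: 'z \<Rightarrow> 'u. inj_on f (El A)" if "A \<in> Obj X" for A
    using assms[OF that] small_obtain_inj by metis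
  then obtain c :: "'o \<Rightarrow> 'z \<Rightarrow> 'u" where c: "\<And>A. A \<in> Obj X \<Longrightarrow> inj_on (c A) (El A)"
    by metis
  define P :: "('o, 'a, 'u) psh" where "P =
    \<lparr>PEl = (\<lambda>A\<in>Obj X. c A ` El A),
     PAct = (\<lambda>f\<in>Arr X. \<lambda>u\<in>c (Cod X f) ` El (Cod X f).
       c (Dom X f) (act f (inv_into (El (Cod X f)) (c (Cod X f)) u))),
     PRst = (\<lambda>A\<in>Obj X. \<lambda>u\<in>c A ` El A. rst A (inv_into (El A) (c A) u))\<rparr>"
  have El: "PEl P A = c A ` El A" if "A \<in> Obj X" for A
    using that by (simp add: P_def)
  have Act: "PAct P f (c A x) = c B (act f x)" if "f \<in> Hom X B A" "x \<in> El A" for f A B x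
    using that c Hom_Obj[OF that(1)] by (simp add: P_def Hom_def)
  have Rst: "PRst P A (c A x) = rst A x" if "A \<in> Obj X" "x \<in> El A" for A x
    using that c by (simp add: P_def)
  have bij: "bij_betw (c A) (El A) (PEl P A)" if "A \<in> Obj X" for A
    using that c El by (simp add: bij_betw_def)
  have "jr_sheaf X (PEl P) (PAct P) (PRst P)"
    using bij Act Rst by (rule jr_sheaf_transfer)
  then have "join_restriction_presheaf X P"
    by (rule join_restriction_presheafI)
      (auto simp: El small_image assms cod_in_Obj, auto simp: P_def cod_in_Obj)
  then show ?thesis
    using that bij Act Rst by blast
qed

section \<open>The category of join restriction presheaves\<close>

definition psh_arr ::
  "('o, 'a, 'c) rcat_scheme \<Rightarrow> ('o, 'a, 'u) psh \<Rightarrow> ('o, 'a, 'u) psh \<Rightarrow> ('o \<Rightarrow> 'u \<Rightarrow> 'u) \<Rightarrow>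
     (('o, 'a, 'u) psh, 'o \<Rightarrow> 'u \<Rightarrow> 'u) transf" where
  "psh_arr X P Q t = \<lparr>TDom = P, TCod = Q, TMap = (\<lambda>A\<in>Obj X. \<lambda>x\<in>PEl P A. t A x)\<rparr>"

lemma TMap_psh_arr [simp]:
  "A \<in> Obj X \<Longrightarrow> x \<in> PEl P A \<Longrightarrow> TMap (psh_arr X P Q t) A x = t A x"
  by (simp add: psh_arr_def)

lemma PSh_simps [simp]:
  "Obj (PSh_jr X) = {P. join_restriction_presheaf X P}"
  "Dom (PSh_jr X) = TDom"
  "Cod (PSh_jr X) = TCod"
  by (simp_all add: PSh_jr_def)

lemma PSh_HomD:
  assumes "\<alpha> \<in> Hom (PSh_jr X) P Q"
  shows "join_restriction_presheaf X P" "join_restriction_presheaf X Q"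
    "TDom \<alpha> = P" "TCod \<alpha> = Q" "presheaf_morphism X P Q (TMap \<alpha>)"
  using assms by (auto simp: Hom_def PSh_jr_def)

lemma PSh_in:
  "\<alpha> \<in> Hom (PSh_jr X) P Q \<Longrightarrow> A \<in> Obj X \<Longrightarrow> x \<in> PEl P A \<Longrightarrow> TMap \<alpha> A x \<in> PEl Q A"
  by (drule PSh_HomD(5)) (auto simp: presheaf_morphism_def PiE_def Pi_def)

lemma PSh_nat:
  "\<alpha> \<in> Hom (PSh_jr X) P Q \<Longrightarrow> f \<in> Hom X B A \<Longrightarrow> x \<in> PEl P A \<Longrightarrow>
     TMap \<alpha> B (PAct P f x) = PAct Q f (TMap \<alpha> A x)"
  by (drule PSh_HomD(5)) (auto simp: presheaf_morphism_def Hom_def)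

lemma PSh_eqI:
  assumes "\<alpha> \<in> Hom (PSh_jr X) P Q" "\<beta> \<in> Hom (PSh_jr X) P Q"
    and "\<And>A x. A \<in> Obj X \<Longrightarrow> x \<in> PEl P A \<Longrightarrow> TMap \<alpha> A x = TMap \<beta> A x"
  shows "\<alpha> = \<beta>"
proof -
  have a: "TMap \<alpha> \<in> (\<Pi>\<^sub>E A\<in>Obj X. PEl P A \<rightarrow>\<^sub>E PEl Q A)" "TMap \<beta> \<in> (\<Pi>\<^sub>E A\<in>Obj X. PEl P A \<rightarrow>\<^sub>E PEl Q A)"
    using assms(1,2)[THEN PSh_HomD(5)] by (auto simp: presheaf_morphism_def)
  have "TMap \<alpha> A = TMap \<beta> A" if "A \<in> Obj X" for A
    using PiE_mem[OF a(1) that] PiE_mem[OF a(2) that] assms(3)[OF that]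
    by (intro extensionalityI[of _ "PEl P A"]) (auto simp: PiE_def)
  then have "TMap \<alpha> = TMap \<beta>"
    using a by (intro extensionalityI[of _ "Obj X"]) (auto simp: PiE_def)
  then show ?thesis
    using PSh_HomD(3,4)[OF assms(1)] PSh_HomD(3,4)[OF assms(2)] by simp
qed

lemma psh_arrI:
  assumes "category X" "join_restriction_presheaf X P" "join_restriction_presheaf X Q"
    and "\<And>A x. A \<in> Obj X \<Longrightarrow> x \<in> PEl P A \<Longrightarrow> t A x \<in> PEl Q A"
    and "\<And>A B f x. f \<in> Hom X B A \<Longrightarrow> x \<in> PEl P A \<Longrightarrow> t B (PAct P f x) = PAct Q f (t A x)"
  shows "psh_arr X P Q t \<in> Hom (PSh_jr X) P Q"
proof -
  interpret category X by fact
  interpret P: join_restriction_presheaf X P by fact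
  have "PAct P f x \<in> PEl P (Dom X f)" if "f \<in> Arr X" "x \<in> PEl P (Cod X f)" for f x
    using P.PAct_in[OF that(1)] that(2) by (auto simp: PiE_def Pi_def)
  then show ?thesis
    using assms(2-4) assms(5)[OF Arr_Hom]
    by (auto simp: Hom_def PSh_jr_def psh_arr_def presheaf_morphism_def dom_in_Obj cod_in_Obj)
qed

lemma TMap_comp:
  assumes "\<alpha> \<in> Hom (PSh_jr X) P Q" "A \<in> Obj X" "x \<in> PEl P A"
  shows "TMap (\<beta> \<cdot>\<^bsub>PSh_jr X\<^esub> \<alpha>) A x = TMap \<beta> A (TMap \<alpha> A x)"
  using assms(2,3) PSh_HomD[OF assms(1)] by (simp add: PSh_jr_def)

lemma TMap_idn: "A \<in> Obj X \<Longrightarrow> x \<in> PEl P A \<Longrightarrow> TMap (Idn (PSh_jr X) P) A x = x"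
  by (simp add: PSh_jr_def)

lemma TMap_rst:
  assumes "\<alpha> \<in> Hom (PSh_jr X) P Q" "A \<in> Obj X" "x \<in> PEl P A"
  shows "TMap (Rst (PSh_jr X) \<alpha>) A x = PAct P (PRst Q A (TMap \<alpha> A x)) x"
  using assms(2,3) PSh_HomD[OF assms(1)] by (simp add: PSh_jr_def)

context join_restriction_category
begin

lemma PSh_comp_Hom:
  assumes a: "\<alpha> \<in> Hom (PSh_jr X) P Q" and b: "\<beta> \<in> Hom (PSh_jr X) Q R"
  shows "\<beta> \<cdot>\<^bsub>PSh_jr X\<^esub> \<alpha> \<in> Hom (PSh_jr X) P R"
proof -
  have "\<beta> \<cdot>\<^bsub>PSh_jr X\<^esub> \<alpha> = psh_arr X P R (\<lambda>A x. TMap \<beta> A (TMap \<alpha> A x))"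
    using PSh_HomD[OF a] PSh_HomD[OF b] by (simp add: PSh_jr_def psh_arr_def)
  also have "\<dots> \<in> Hom (PSh_jr X) P R"
    using PSh_HomD[OF a] PSh_HomD[OF b]
    by (intro psh_arrI) (auto simp: category_axioms PSh_in[OF a] PSh_in[OF b] PSh_nat[OF a]
        PSh_nat[OF b] Hom_Obj)
  finally show ?thesis .
qed

lemma PSh_idn_Hom:
  assumes "join_restriction_presheaf X P"
  shows "Idn (PSh_jr X) P \<in> Hom (PSh_jr X) P P"
proof -
  have "Idn (PSh_jr X) P = psh_arr X P P (\<lambda>A x. x)"
    by (simp add: PSh_jr_def psh_arr_def)
  then show ?thesis
    using psh_arrI[OF category_axioms assms assms] by simp
qed

lemma PSh_rst_Hom:
  assumes a: "\<alpha> \<in> Hom (PSh_jr X) P Q"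
  shows "Rst (PSh_jr X) \<alpha> \<in> Hom (PSh_jr X) P P"
proof -
  interpret P: jr_sheaf X "PEl P" "PAct P" "PRst P"
    using PSh_HomD(1)[OF a] by (rule jr_sheaf_psh)
  interpret Q: jr_sheaf X "PEl Q" "PAct Q" "PRst Q"
    using PSh_HomD(2)[OF a] by (rule jr_sheaf_psh)
  have "Rst (PSh_jr X) \<alpha> = psh_arr X P P (\<lambda>A x. PAct P (PRst Q A (TMap \<alpha> A x)) x)"
    using PSh_HomD[OF a] by (simp add: PSh_jr_def psh_arr_def)
  also have "\<dots> \<in> Hom (PSh_jr X) P P"
  proof (intro psh_arrI category_axioms PSh_HomD(1)[OF a])
    fix A x assume "A \<in> Obj X" "x \<in> PEl P A"
    then show "PAct P (PRst Q A (TMap \<alpha> A x)) x \<in> PEl P A"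
      using P.act_Idem_in[OF Q.rst_el] PSh_in[OF a] by blast
  next
    fix A B f x assume f: "f \<in> Hom X B A" and x: "x \<in> PEl P A"
    have A: "A \<in> Obj X"
      using Hom_Obj[OF f] by simp
    have q: "TMap \<alpha> A x \<in> PEl Q A"
      using PSh_in[OF a A x] .
    show "PAct P (PRst Q B (TMap \<alpha> B (PAct P f x))) (PAct P f x)
        = PAct P f (PAct P (PRst Q A (TMap \<alpha> A x)) x)"
      using P.act_rst_act[OF f x Q.rst_el[OF A q]] Q.rst_act[OF f q] PSh_nat[OF a f x] by simp
  qed
  finally show ?thesis .
qed

lemma category_PSh: "category (PSh_jr X)"
proof
  fix P Q R S f g h
  assume f: "f \<in> Hom (PSh_jr X) P Q" and g: "g \<in> Hom (PSh_jr X) Q R" and h: "h \<in> Hom (PSh_jr X) R S"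
  note gf = PSh_comp_Hom[OF f g] and hg = PSh_comp_Hom[OF g h]
  show "h \<cdot>\<^bsub>PSh_jr X\<^esub> g \<cdot>\<^bsub>PSh_jr X\<^esub> f = h \<cdot>\<^bsub>PSh_jr X\<^esub> (g \<cdot>\<^bsub>PSh_jr X\<^esub> f)"
    by (rule PSh_eqI[OF PSh_comp_Hom[OF f hg] PSh_comp_Hom[OF gf h]])
      (simp add: TMap_comp[OF f] TMap_comp[OF gf] TMap_comp[OF g] PSh_in[OF f])
next
  fix P Q f assume f: "f \<in> Hom (PSh_jr X) P Q"
  note i = PSh_idn_Hom[OF PSh_HomD(1)[OF f]] PSh_idn_Hom[OF PSh_HomD(2)[OF f]]
  show "f \<cdot>\<^bsub>PSh_jr X\<^esub> Idn (PSh_jr X) P = f"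
    by (rule PSh_eqI[OF PSh_comp_Hom[OF i(1) f] f]) (simp add: TMap_comp[OF i(1)] TMap_idn)
  show "Idn (PSh_jr X) Q \<cdot>\<^bsub>PSh_jr X\<^esub> f = f"
    by (rule PSh_eqI[OF PSh_comp_Hom[OF f i(2)] f]) (simp add: TMap_comp[OF f] TMap_idn PSh_in[OF f])
next
  show "f \<in> Arr (PSh_jr X) \<Longrightarrow> Dom (PSh_jr X) f \<in> Obj (PSh_jr X)"
    and "f \<in> Arr (PSh_jr X) \<Longrightarrow> Cod (PSh_jr X) f \<in> Obj (PSh_jr X)" for f
    by (auto simp: PSh_jr_def)
qed (auto simp: PSh_comp_Hom PSh_idn_Hom)

text \<open>A transformation can only shrink domains: by RP1 and naturality the image of
  \<open>x\<close> is unchanged when it is restricted to the domain of \<open>x\<close>.\<close>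

lemma PSh_rst_le:
  assumes a: "\<alpha> \<in> Hom (PSh_jr X) P Q" and A: "A \<in> Obj X" and x: "x \<in> PEl P A"
  shows "PRst Q A (TMap \<alpha> A x) \<cdot> PRst P A x = PRst Q A (TMap \<alpha> A x)"
proof -
  interpret P: jr_sheaf X "PEl P" "PAct P" "PRst P"
    using PSh_HomD(1)[OF a] by (rule jr_sheaf_psh)
  interpret Q: jr_sheaf X "PEl Q" "PAct Q" "PRst Q"
    using PSh_HomD(2)[OF a] by (rule jr_sheaf_psh)
  have r: "PRst P A x \<in> Idem X A"
    using A x by (rule P.rst_el)
  have "TMap \<alpha> A x = PAct Q (PRst P A x) (TMap \<alpha> A x)"
    using PSh_nat[OF a Idem_Hom[OF r] x] P.act_rst[OF A x] by simp
  then show ?thesis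
    using Q.rst_act_Idem[OF r PSh_in[OF a A x]] by simp
qed

lemma restriction_category_PSh: "restriction_category (PSh_jr X)"
proof (intro restriction_category.intro restriction_category_axioms.intro category_PSh)
  fix P Q f assume f: "f \<in> Hom (PSh_jr X) P Q"
  interpret P: jr_sheaf X "PEl P" "PAct P" "PRst P"
    using PSh_HomD(1)[OF f] by (rule jr_sheaf_psh)
  interpret Q: jr_sheaf X "PEl Q" "PAct Q" "PRst Q"
    using PSh_HomD(2)[OF f] by (rule jr_sheaf_psh)
  have fr: "PRst Q A (TMap f A x) \<in> Idem X A" if "A \<in> Obj X" "x \<in> PEl P A" for A x
    using that PSh_in[OF f] Q.rst_el by blast
  have fe: "TMap f A (PAct P e x) = PAct Q e (TMap f A x)"
    if "e \<in> Idem X A" "x \<in> PEl P A" for A x e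
    using PSh_nat[OF f Idem_Hom] that by blast
  note rf = PSh_rst_Hom[OF f]
  show "Rst (PSh_jr X) f \<in> Hom (PSh_jr X) P P"
    by (fact rf)
  show "f \<cdot>\<^bsub>PSh_jr X\<^esub> Rst (PSh_jr X) f = f"
    by (rule PSh_eqI[OF PSh_comp_Hom[OF rf f] f])
      (simp add: TMap_comp[OF rf] TMap_rst[OF f] fe[OF fr] Q.act_rst PSh_in[OF f])
  fix R g assume g: "g \<in> Hom (PSh_jr X) P R"
  interpret R: jr_sheaf X "PEl R" "PAct R" "PRst R"
    using PSh_HomD(2)[OF g] by (rule jr_sheaf_psh)
  have gr: "PRst R A (TMap g A x) \<in> Idem X A" if "A \<in> Obj X" "x \<in> PEl P A" for A x
    using that PSh_in[OF g] R.rst_el by blast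
  have ge: "TMap g A (PAct P e x) = PAct R e (TMap g A x)"
    if "e \<in> Idem X A" "x \<in> PEl P A" for A x e
    using PSh_nat[OF g Idem_Hom] that by blast
  note rg = PSh_rst_Hom[OF g]
  \<comment> \<open>Both orders of composing the two restrictions act on \<open>x\<close> by the
    meet of \<open>?d\<close> and \<open>?e\<close>: after \<open>x\<close> has been cut down to one
    idempotent, the other one already contains it and absorbs the repetition.\<close>
  have gf: "TMap (Rst (PSh_jr X) g) A (TMap (Rst (PSh_jr X) f) A x)
      = PAct P (PRst Q A (TMap f A x) \<cdot> PRst R A (TMap g A x)) x"
    if A: "A \<in> Obj X" and x: "x \<in> PEl P A" for A x
  proof -
    let ?d = "PRst Q A (TMap f A x)" and ?e = "PRst R A (TMap g A x)"
    have x': "PAct P ?d x \<in> PEl P A"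
      using P.act_Idem_in[OF fr[OF A x] x] .
    have "TMap (Rst (PSh_jr X) g) A (PAct P ?d x) = PAct P (?e \<cdot> ?d) (PAct P ?d x)"
      using TMap_rst[OF g A x'] ge[OF fr[OF A x] x] R.rst_act_Idem[OF fr[OF A x] PSh_in[OF g A x]]
      by simp
    also have "\<dots> = PAct P (?d \<cdot> (?e \<cdot> ?d)) x"
      using P.act_Idem_comp[OF fr[OF A x] Idem_comp[OF gr[OF A x] fr[OF A x]] x] .
    also have "?d \<cdot> (?e \<cdot> ?d) = ?d \<cdot> ?e"
      using Idem_absorb[OF fr[OF A x] gr[OF A x]] Idem_commute[OF fr[OF A x] gr[OF A x]] by simp
    finally show ?thesis
      using TMap_rst[OF f A x] by simp
  qed
  have fg: "TMap (Rst (PSh_jr X) f) A (TMap (Rst (PSh_jr X) g) A x)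
      = PAct P (PRst Q A (TMap f A x) \<cdot> PRst R A (TMap g A x)) x"
    if A: "A \<in> Obj X" and x: "x \<in> PEl P A" for A x
  proof -
    let ?d = "PRst Q A (TMap f A x)" and ?e = "PRst R A (TMap g A x)"
    have x': "PAct P ?e x \<in> PEl P A"
      using P.act_Idem_in[OF gr[OF A x] x] .
    have "TMap (Rst (PSh_jr X) f) A (PAct P ?e x) = PAct P (?d \<cdot> ?e) (PAct P ?e x)"
      using TMap_rst[OF f A x'] fe[OF gr[OF A x] x] Q.rst_act_Idem[OF gr[OF A x] PSh_in[OF f A x]]
      by simp
    also have "\<dots> = PAct P (?e \<cdot> (?d \<cdot> ?e)) x"
      using P.act_Idem_comp[OF gr[OF A x] Idem_comp[OF fr[OF A x] gr[OF A x]] x] .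
    also have "?e \<cdot> (?d \<cdot> ?e) = ?d \<cdot> ?e"
      using gr[OF A x] fr[OF A x] by (rule Idem_absorb)
    finally show ?thesis
      using TMap_rst[OF g A x] by simp
  qed
  show "Rst (PSh_jr X) g \<cdot>\<^bsub>PSh_jr X\<^esub> Rst (PSh_jr X) f = Rst (PSh_jr X) f \<cdot>\<^bsub>PSh_jr X\<^esub> Rst (PSh_jr X) g"
    by (rule PSh_eqI[OF PSh_comp_Hom[OF rf rg] PSh_comp_Hom[OF rg rf]])
      (simp add: TMap_comp[OF rf] TMap_comp[OF rg] gf fg)
  note grf = PSh_comp_Hom[OF rf g]
  show "Rst (PSh_jr X) (g \<cdot>\<^bsub>PSh_jr X\<^esub> Rst (PSh_jr X) f) = Rst (PSh_jr X) g \<cdot>\<^bsub>PSh_jr X\<^esub> Rst (PSh_jr X) f"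
  proof (rule PSh_eqI[OF PSh_rst_Hom[OF grf] PSh_comp_Hom[OF rf rg]])
    fix A x assume A: "A \<in> Obj X" and x: "x \<in> PEl P A"
    let ?d = "PRst Q A (TMap f A x)" and ?e = "PRst R A (TMap g A x)"
    have "TMap (g \<cdot>\<^bsub>PSh_jr X\<^esub> Rst (PSh_jr X) f) A x = PAct R ?d (TMap g A x)"
      using TMap_comp[OF rf A x] TMap_rst[OF f A x] ge[OF fr[OF A x] x] by simp
    then have "TMap (Rst (PSh_jr X) (g \<cdot>\<^bsub>PSh_jr X\<^esub> Rst (PSh_jr X) f)) A x = PAct P (?e \<cdot> ?d) x"
      using TMap_rst[OF grf A x] R.rst_act_Idem[OF fr[OF A x] PSh_in[OF g A x]] by simp
    also have "?e \<cdot> ?d = ?d \<cdot> ?e"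
      using gr[OF A x] fr[OF A x] by (rule Idem_commute)
    finally show "TMap (Rst (PSh_jr X) (g \<cdot>\<^bsub>PSh_jr X\<^esub> Rst (PSh_jr X) f)) A x
        = TMap (Rst (PSh_jr X) g \<cdot>\<^bsub>PSh_jr X\<^esub> Rst (PSh_jr X) f) A x"
      using gf[OF A x] TMap_comp[OF rf A x] by simp
  qed
next
  fix P Q R f h assume f: "f \<in> Hom (PSh_jr X) P Q" and h: "h \<in> Hom (PSh_jr X) Q R"
  interpret R: jr_sheaf X "PEl R" "PAct R" "PRst R"
    using PSh_HomD(2)[OF h] by (rule jr_sheaf_psh)
  note hf = PSh_comp_Hom[OF f h]
  show "Rst (PSh_jr X) h \<cdot>\<^bsub>PSh_jr X\<^esub> f = f \<cdot>\<^bsub>PSh_jr X\<^esub> Rst (PSh_jr X) (h \<cdot>\<^bsub>PSh_jr X\<^esub> f)"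
  proof (rule PSh_eqI[OF PSh_comp_Hom[OF f PSh_rst_Hom[OF h]] PSh_comp_Hom[OF PSh_rst_Hom[OF hf] f]])
    fix A x assume A: "A \<in> Obj X" and x: "x \<in> PEl P A"
    have y: "TMap f A x \<in> PEl Q A"
      using PSh_in[OF f A x] .
    have e: "PRst R A (TMap h A (TMap f A x)) \<in> Idem X A"
      using R.rst_el[OF A PSh_in[OF h A y]] .
    show "TMap (Rst (PSh_jr X) h \<cdot>\<^bsub>PSh_jr X\<^esub> f) A x
        = TMap (f \<cdot>\<^bsub>PSh_jr X\<^esub> Rst (PSh_jr X) (h \<cdot>\<^bsub>PSh_jr X\<^esub> f)) A x"
      using TMap_comp[OF f A x] TMap_rst[OF h A y] TMap_comp[OF PSh_rst_Hom[OF hf] A x]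
        TMap_rst[OF hf A x] PSh_nat[OF f Idem_Hom[OF e] x] by simp
  qed
qed

text \<open>Stated with gluings and not with order-theoretic joins in \<open>PEl Q A\<close>,
  because gluings are preserved by the action, and that is what makes the pointwise values
  natural.\<close>

definition pointwise_join where
  "pointwise_join P Q S j \<longleftrightarrow> (\<forall>A\<in>Obj X. \<forall>x\<in>PEl P A.
     glued X (PEl Q) (PAct Q) (PRst Q) A ((\<lambda>s. TMap s A x) ` S) (TMap j A x))"

lemma pointwise_join_imp_is_join:
  assumes S: "S \<subseteq> Hom (PSh_jr X) P Q" and j: "j \<in> Hom (PSh_jr X) P Q" and pj: "pointwise_join P Q S j"
  shows "is_join (PSh_jr X) P Q S j"
proof -
  interpret PSh: restriction_category "PSh_jr X"
    by (rule restriction_category_PSh)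
  interpret Q: jr_sheaf X "PEl Q" "PAct Q" "PRst Q"
    using PSh_HomD(2)[OF j] by (rule jr_sheaf_psh)
  have r: "TMap (k \<cdot>\<^bsub>PSh_jr X\<^esub> Rst (PSh_jr X) s) A x = PAct Q (PRst Q A (TMap s A x)) (TMap k A x)"
    if k: "k \<in> Hom (PSh_jr X) P Q" and s: "s \<in> Hom (PSh_jr X) P Q" and A: "A \<in> Obj X"
      and x: "x \<in> PEl P A" for k s A x
    using TMap_comp[OF PSh_rst_Hom[OF s] A x] TMap_rst[OF s A x]
      PSh_nat[OF k Idem_Hom[OF Q.rst_el[OF A PSh_in[OF s A x]]] x] by simp
  \<comment> \<open>The order on maps of presheaves is the pointwise order of their values.\<close>
  have le: "rle (PSh_jr X) s k \<longleftrightarrow>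
      (\<forall>A\<in>Obj X. \<forall>x\<in>PEl P A. TMap s A x = PAct Q (PRst Q A (TMap s A x)) (TMap k A x))"
    if k: "k \<in> Hom (PSh_jr X) P Q" and s: "s \<in> Hom (PSh_jr X) P Q" for k s
    using PSh_eqI[OF s PSh_comp_Hom[OF PSh_rst_Hom[OF s] k]] r[OF k s] by (metis rle_def)
  show ?thesis
    unfolding is_join_def
  proof (intro conjI ballI impI)
    fix s assume s: "s \<in> S"
    then have sH: "s \<in> Hom (PSh_jr X) P Q"
      using S by auto
    show "rle (PSh_jr X) s j"
      using pj s unfolding le[OF j sH] by (auto simp: pointwise_join_def glued_def)
  next
    fix k assume k: "k \<in> Hom (PSh_jr X) P Q" and sk: "\<forall>s\<in>S. rle (PSh_jr X) s k"
    show "rle (PSh_jr X) j k"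
      unfolding le[OF k j]
    proof (intro ballI)
      fix A x assume A: "A \<in> Obj X" and x: "x \<in> PEl P A"
      have SE: "(\<lambda>s. TMap s A x) ` S \<subseteq> PEl Q A"
        using PSh_in[OF _ A x] S by auto
      have "Q.join A ((\<lambda>s. TMap s A x) ` S) (TMap j A x)"
        using Q.glue_imp_join[OF A SE] pj A x by (auto simp: pointwise_join_def)
      moreover have "\<forall>s\<in>S. Q.le A (TMap s A x) (TMap k A x)"
      proof
        fix s assume s: "s \<in> S"
        then have "s \<in> Hom (PSh_jr X) P Q"
          using S by auto
        then show "Q.le A (TMap s A x) (TMap k A x)"
          using le[OF k, of s] sk s A x by (simp add: gle_def)
      qed
      ultimately show "TMap j A x = PAct Q (PRst Q A (TMap j A x)) (TMap k A x)"
        using PSh_in[OF k A x] by (auto simp: gjoin_def gle_def)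
    qed
  qed (use j in auto)
qed

text \<open>Compatible maps take coherent values at every \<open>x\<close>. Naturality of the chosen
  gluings follows from their uniqueness and \<open>glue_act\<close>.\<close>

lemma pointwise_join_exists:
  assumes P: "join_restriction_presheaf X P" and Q: "join_restriction_presheaf X Q"
    and S: "S \<subseteq> Hom (PSh_jr X) P Q" and C: "compatible (PSh_jr X) S"
  shows "\<exists>j\<in>Hom (PSh_jr X) P Q. pointwise_join P Q S j"
proof -
  interpret Q: jr_sheaf X "PEl Q" "PAct Q" "PRst Q"
    using Q by (rule jr_sheaf_psh)
  let ?S = "\<lambda>A x. (\<lambda>s. TMap s A x) ` S"
  have SE: "?S A x \<subseteq> PEl Q A" if "A \<in> Obj X" "x \<in> PEl P A" for A x
    using PSh_in[OF _ that] S by auto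
  have "\<exists>j. Q.glue A (?S A x) j" if A: "A \<in> Obj X" and x: "x \<in> PEl P A" for A x
  proof (rule Q.glue[OF A SE[OF A x]])
    have "PAct Q (PRst Q A (TMap t A x)) (TMap s A x) = PAct Q (PRst Q A (TMap s A x)) (TMap t A x)"
      if st: "s \<in> S" "t \<in> S" for s t
    proof -
      have *: "TMap (s \<cdot>\<^bsub>PSh_jr X\<^esub> Rst (PSh_jr X) t) A x = PAct Q (PRst Q A (TMap t A x)) (TMap s A x)"
        if s: "s \<in> Hom (PSh_jr X) P Q" and t: "t \<in> Hom (PSh_jr X) P Q" for s t
        using TMap_comp[OF PSh_rst_Hom[OF t] A x] TMap_rst[OF t A x]
          PSh_nat[OF s Idem_Hom[OF Q.rst_el[OF A PSh_in[OF t A x]]] x] by simp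
      have "s \<in> Hom (PSh_jr X) P Q" "t \<in> Hom (PSh_jr X) P Q"
        using st S by auto
      then show ?thesis
        using * C st by (metis compatible_def)
    qed
    then show "Q.coherent A (?S A x)"
      by (auto simp: gcompat_def)
  qed
  then obtain j where j: "\<And>A x. A \<in> Obj X \<Longrightarrow> x \<in> PEl P A \<Longrightarrow> Q.glue A (?S A x) (j A x)"
    by metis
  interpret P: jr_sheaf X "PEl P" "PAct P" "PRst P"
    using P by (rule jr_sheaf_psh)
  have "psh_arr X P Q j \<in> Hom (PSh_jr X) P Q"
  proof (rule psh_arrI[OF category_axioms P Q])
    fix A x assume "A \<in> Obj X" "x \<in> PEl P A"
    then show "j A x \<in> PEl Q A"
      using j by (auto simp: glued_def)
  next
    fix A B f x assume f: "f \<in> Hom X B A" and x: "x \<in> PEl P A"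
    have A: "A \<in> Obj X" and B: "B \<in> Obj X"
      using Hom_Obj[OF f] by auto
    have fx: "PAct P f x \<in> PEl P B"
      using P.act_in[OF f x] .
    have "PAct Q f ` ?S A x = ?S B (PAct P f x)"
      unfolding image_image using PSh_nat[OF _ f x] S by (intro image_cong) (auto simp: subset_iff)
    then have "Q.glue B (?S B (PAct P f x)) (PAct Q f (j A x))"
      using Q.glue_act[OF SE[OF A x] j[OF A x] f] by simp
    then show "j B (PAct P f x) = PAct Q f (j A x)"
      using Q.glue_unique[OF B SE[OF B fx] j[OF B fx]] by blast
  qed
  moreover have "pointwise_join P Q S (psh_arr X P Q j)"
    using j by (simp add: pointwise_join_def)
  ultimately show ?thesis
    by blast
qed

lemma is_join_imp_pointwise_join:
  assumes "S \<subseteq> Hom (PSh_jr X) P Q" "compatible (PSh_jr X) S" "is_join (PSh_jr X) P Q S j"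
  shows "pointwise_join P Q S j"
proof -
  have "j \<in> Hom (PSh_jr X) P Q"
    using assms(3) by (simp add: is_join_def)
  then obtain k where k: "k \<in> Hom (PSh_jr X) P Q" "pointwise_join P Q S k"
    using pointwise_join_exists[OF _ _ assms(1,2)] PSh_HomD by blast
  then have "j = k"
    using restriction_category.is_join_unique[OF restriction_category_PSh assms(3)]
      pointwise_join_imp_is_join[OF assms(1)] by blast
  with k show ?thesis
    by simp
qed

lemma join_restriction_category_PSh: "join_restriction_category (PSh_jr X)"
proof (intro join_restriction_category.intro join_restriction_category_axioms.intro
    restriction_category_PSh)
  interpret PSh: restriction_category "PSh_jr X"
    by (rule restriction_category_PSh)
  fix P Q S
  assume PQ: "P \<in> Obj (PSh_jr X)" "Q \<in> Obj (PSh_jr X)" and S: "S \<subseteq> Hom (PSh_jr X) P Q"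
    and C: "compatible (PSh_jr X) S"
  then have P: "join_restriction_presheaf X P" and Q: "join_restriction_presheaf X Q"
    by auto
  show "\<exists>j. is_join (PSh_jr X) P Q S j"
    using pointwise_join_exists[OF P Q S C] pointwise_join_imp_is_join[OF S] by blast
  interpret P: jr_sheaf X "PEl P" "PAct P" "PRst P"
    using P by (rule jr_sheaf_psh)
  interpret Q: jr_sheaf X "PEl Q" "PAct Q" "PRst Q"
    using Q by (rule jr_sheaf_psh)
  fix j assume j: "is_join (PSh_jr X) P Q S j"
  then have jH: "j \<in> Hom (PSh_jr X) P Q"
    by (simp add: is_join_def)
  note pj = is_join_imp_pointwise_join[OF S C j]
  show "is_join (PSh_jr X) P P (Rst (PSh_jr X) ` S) (Rst (PSh_jr X) j)"
  proof (rule pointwise_join_imp_is_join)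
    show "Rst (PSh_jr X) ` S \<subseteq> Hom (PSh_jr X) P P"
      using S PSh_rst_Hom by blast
    show "Rst (PSh_jr X) j \<in> Hom (PSh_jr X) P P"
      using jH by (rule PSh_rst_Hom)
    show "pointwise_join P P (Rst (PSh_jr X) ` S) (Rst (PSh_jr X) j)"
      unfolding pointwise_join_def
    proof (intro ballI)
      fix A x assume A: "A \<in> Obj X" and x: "x \<in> PEl P A"
      let ?D = "PRst Q A ` (\<lambda>s. TMap s A x) ` S"
      have "(\<lambda>s. TMap s A x) ` S \<subseteq> PEl Q A"
        using PSh_in[OF _ A x] S by auto
      then have D: "?D \<subseteq> Idem X A"
        using Q.rst_el[OF A] by blast
      have "is_join X A A ?D (PRst Q A (TMap j A x))"
        using pj A x by (auto simp: pointwise_join_def glued_def)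
      \<comment> \<open>The restriction of a map cuts \<open>x\<close> down to the domain of its
        image, so J1 says that \<open>x\<close> cut down to the join of these domains is glued from
        the pieces.\<close>
      then have "P.glue A ((\<lambda>d. PAct P d x) ` ?D) (PAct P (PRst Q A (TMap j A x)) x)"
        using P.glue_Idem[OF A D _ x] by blast
      moreover have "(\<lambda>d. PAct P d x) ` ?D = (\<lambda>s. TMap s A x) ` Rst (PSh_jr X) ` S"
        unfolding image_image using TMap_rst[OF _ A x] S by (intro image_cong) (auto simp: subset_iff)
      ultimately show "P.glue A ((\<lambda>s. TMap s A x) ` Rst (PSh_jr X) ` S) (TMap (Rst (PSh_jr X) j) A x)"
        using TMap_rst[OF jH A x] by simp
    qed
  qed
  fix g R assume g: "g \<in> Hom (PSh_jr X) R P"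
  show "is_join (PSh_jr X) R Q ((\<lambda>s. s \<cdot>\<^bsub>PSh_jr X\<^esub> g) ` S) (j \<cdot>\<^bsub>PSh_jr X\<^esub> g)"
  proof (rule pointwise_join_imp_is_join)
    show "(\<lambda>s. s \<cdot>\<^bsub>PSh_jr X\<^esub> g) ` S \<subseteq> Hom (PSh_jr X) R Q" "j \<cdot>\<^bsub>PSh_jr X\<^esub> g \<in> Hom (PSh_jr X) R Q"
      using S jH g PSh_comp_Hom by blast+
    show "pointwise_join R Q ((\<lambda>s. s \<cdot>\<^bsub>PSh_jr X\<^esub> g) ` S) (j \<cdot>\<^bsub>PSh_jr X\<^esub> g)"
      unfolding pointwise_join_def
    proof (intro ballI)
      fix A x assume A: "A \<in> Obj X" and x: "x \<in> PEl R A"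
      show "Q.glue A ((\<lambda>s. TMap s A x) ` (\<lambda>s. s \<cdot>\<^bsub>PSh_jr X\<^esub> g) ` S) (TMap (j \<cdot>\<^bsub>PSh_jr X\<^esub> g) A x)"
        using pj A PSh_in[OF g A x] by (simp add: image_image TMap_comp[OF g A x] pointwise_join_def)
    qed
  qed
qed

text \<open>An idempotent \<open>e\<close> splits through the subpresheaf \<open>El\<close> of
  elements that it fixes, with the inclusion as \<open>m\<close> and \<open>e\<close> itself as
  \<open>r\<close>.\<close>

lemma PSh_split: "split_category (PSh_jr X :: (('o, 'a, 'u) psh, _) rcat)"
  unfolding split_category_def
proof (intro allI impI)
  fix e :: "(('o, 'a, 'u) psh, 'o \<Rightarrow> 'u \<Rightarrow> 'u) transf"
  assume "restriction_idempotent (PSh_jr X) e"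
  then have eA: "e \<in> Arr (PSh_jr X)" and er: "Rst (PSh_jr X) e = e"
    by (auto simp: restriction_idempotent_def)
  define P where "P = TDom e"
  have "e \<in> Hom (PSh_jr X) P (TCod e)"
    using Arr_Hom[OF eA] by (simp add: P_def)
  then have e: "e \<in> Hom (PSh_jr X) P P"
    using PSh_rst_Hom er by metis
  then have jP: "join_restriction_presheaf X P"
    by (rule PSh_HomD)
  interpret P: jr_sheaf X "PEl P" "PAct P" "PRst P"
    using jP by (rule jr_sheaf_psh)
  interpret pP: join_restriction_presheaf X P by fact
  have ee: "TMap e A (TMap e A x) = TMap e A x" if "A \<in> Obj X" "x \<in> PEl P A" for A x
    using TMap_comp[OF e that, of e] restriction_category.R1[OF restriction_category_PSh e] er by simp
  define El where "El A = {x \<in> PEl P A. TMap e A x = x}" for A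
  have El: "x \<in> PEl P A" "TMap e A x = x" if "x \<in> El A" for x A
    using that by (auto simp: El_def)
  have act: "PAct P f x \<in> El B" if "f \<in> Hom X B A" "x \<in> El A" for f A B x
    using PSh_nat[OF e that(1)] P.act_in[OF that(1)] that(2) by (auto simp: El_def)
  define Q where "Q = \<lparr>PEl = (\<lambda>A\<in>Obj X. El A), PAct = (\<lambda>f\<in>Arr X. \<lambda>x\<in>El (Cod X f). PAct P f x),
    PRst = (\<lambda>A\<in>Obj X. \<lambda>x\<in>El A. PRst P A x)\<rparr>"
  have Q: "A \<in> Obj X \<Longrightarrow> PEl Q A = El A" "f \<in> Hom X B A \<Longrightarrow> x \<in> El A \<Longrightarrow> PAct Q f x = PAct P f x"
    "A \<in> Obj X \<Longrightarrow> x \<in> El A \<Longrightarrow> PRst Q A x = PRst P A x" for A B f x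
    by (auto simp: Q_def Hom_def)
  have "jr_sheaf X (PEl Q) (PAct Q) (PRst Q)"
  proof
    fix A D c x y
    assume A: "A \<in> Obj X" and D: "D \<subseteq> Idem X A" "is_join X A A D c"
      and xy: "x \<in> PEl Q A" "y \<in> PEl Q A" and eq: "\<And>d. d \<in> D \<Longrightarrow> PAct Q d x = PAct Q d y"
    have xy: "x \<in> El A" "y \<in> El A"
      using xy Q(1)[OF A] by auto
    have "PAct P d x = PAct P d y" if "d \<in> D" for d
      using eq[OF that] Q(2)[OF Idem_Hom] that D xy by (metis subsetD)
    then have "PAct P c x = PAct P c y"
      using P.sep[OF A D] El xy by blast
    then show "PAct Q c x = PAct Q c y"
      using Q(2)[OF Idem_Hom[OF is_join_Idem[OF A D]]] xy by simp
  next
    fix A S assume A: "A \<in> Obj X" and S: "S \<subseteq> PEl Q A" and C: "gcompat (PAct Q) (PRst Q) A S"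
    have SEl: "S \<subseteq> El A"
      using S Q(1)[OF A] by simp
    have SP: "S \<subseteq> PEl P A"
      using SEl El by auto
    have r: "PAct Q (PRst Q A y) x = PAct P (PRst P A y) x" if "x \<in> El A" "y \<in> El A" for x y
      using that Q(2)[OF Idem_Hom[OF P.rst_el[OF A El(1)]]] Q(3)[OF A] by simp
    have "P.coherent A S"
      using C SEl r unfolding gcompat_def by (metis subsetD)
    then obtain j where j: "P.glue A S j"
      using P.glue[OF A SP] by blast
    then have jP: "j \<in> PEl P A" and js: "\<And>s. s \<in> S \<Longrightarrow> PAct P (PRst P A s) j = s"
      and jj: "is_join X A A (PRst P A ` S) (PRst P A j)"
      by (auto simp: glued_def)
    have D: "PRst P A ` S \<subseteq> Idem X A"
      using P.rst_el[OF A] SP by blast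
    have je: "TMap e A j \<in> PEl P A"
      using PSh_in[OF e A jP] .
    have rj: "PRst P A j \<in> Idem X A"
      using A jP by (rule P.rst_el)
    \<comment> \<open>A gluing of fixed elements is fixed: by naturality of \<open>e\<close> both
      sides agree on the domains of the members, which cover the domain of \<open>j\<close>.\<close>
    have "TMap e A j = j"
    proof (rule P.sep_cover[OF A D jj je jP])
      show "PAct P (PRst P A j) j = j"
        using A jP by (rule P.act_rst)
      then show "PAct P (PRst P A j) (TMap e A j) = TMap e A j"
        using PSh_nat[OF e Idem_Hom[OF rj] jP] by simp
      fix d assume "d \<in> PRst P A ` S"
      then obtain s where s: "s \<in> S" "d = PRst P A s"
        by auto
      have "d \<in> Idem X A"
        using s D by blast
      then have "PAct P d (TMap e A j) = TMap e A (PAct P d j)"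
        using PSh_nat[OF e Idem_Hom jP] by simp
      also have "\<dots> = PAct P d j"
        using s js El(2) SEl by auto
      finally show "PAct P d (TMap e A j) = PAct P d j" .
    qed
    then have jE: "j \<in> El A"
      using jP by (simp add: El_def)
    have "PRst Q A ` S = PRst P A ` S"
      using Q(3)[OF A] SEl by (intro image_cong) auto
    then have "glued X (PEl Q) (PAct Q) (PRst Q) A S j"
      using jE js jj r[OF jE] Q SEl A by (auto simp: glued_def subset_iff)
    then show "\<exists>j. glued X (PEl Q) (PAct Q) (PRst Q) A S j" ..
  next
    fix f B A x assume f: "f \<in> Hom X B A" and x: "x \<in> PEl Q A"
    have x: "x \<in> El A"
      using x Q(1) Hom_Obj[OF f] by auto
    show "PAct Q f x \<in> PEl Q B" "PRst Q B (PAct Q f x) = Rst X (PRst Q A x \<cdot> f)"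
      using f x Hom_Obj[OF f] act[OF f x] P.rst_act[OF f El(1)[OF x]] by (simp_all add: Q)
    fix g D assume g: "g \<in> Hom X D B"
    show "PAct Q (f \<cdot> g) x = PAct Q g (PAct Q f x)"
      using Q(2)[OF f x] Q(2)[OF comp_in_Hom[OF g f] x] Q(2)[OF g act[OF f x]]
        P.act_comp[OF g f El(1)[OF x]] by simp
  next
    fix A x assume A: "A \<in> Obj X" and x: "x \<in> PEl Q A"
    have x: "x \<in> El A"
      using x Q(1) A by auto
    show "PAct Q (Idn X A) x = x"
      using Q(2)[OF idn_in_Hom[OF A] x] P.act_idn[OF A El(1)[OF x]] by simp
    show "PRst Q A x \<in> Idem X A" "PAct Q (PRst Q A x) x = x"
      using A x P.rst_el[OF A El(1)[OF x]] P.act_rst[OF A El(1)[OF x]]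
        Q(2)[OF Idem_Hom[OF P.rst_el[OF A El(1)[OF x]]] x] by (simp_all add: Q)
  qed
  moreover have "small TYPE('u) (PEl Q A)" if "A \<in> Obj X" for A
    using pP.PEl_small[OF that] Q(1)[OF that] El(1) by (metis small_subset subsetI)
  ultimately have jQ: "join_restriction_presheaf X Q"
    by (rule join_restriction_presheafI) (auto simp: Q_def cod_in_Obj)
  have m: "psh_arr X Q P (\<lambda>A x. x) \<in> Hom (PSh_jr X) Q P"
    using El by (intro psh_arrI category_axioms jP jQ) (auto simp: Q Hom_Obj)
  have r: "psh_arr X P Q (TMap e) \<in> Hom (PSh_jr X) P Q"
  proof (intro psh_arrI category_axioms jP jQ)
    fix A x assume A: "A \<in> Obj X" "x \<in> PEl P A"
    then show "TMap e A x \<in> PEl Q A"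
      using ee PSh_in[OF e] by (simp add: Q El_def)
  next
    fix A B f x assume f: "f \<in> Hom X B A" and x: "x \<in> PEl P A"
    then have "TMap e A x \<in> El A"
      using ee PSh_in[OF e] Hom_Obj[OF f] by (simp add: Q El_def)
    then show "TMap e B (PAct P f x) = PAct Q f (TMap e A x)"
      using PSh_nat[OF e f x] Q(2)[OF f] by simp
  qed
  have "psh_arr X Q P (\<lambda>A x. x) \<cdot>\<^bsub>PSh_jr X\<^esub> psh_arr X P Q (TMap e) = e"
    by (rule PSh_eqI[OF PSh_comp_Hom[OF r m] e]) (use PSh_in[OF r] in \<open>simp add: TMap_comp[OF r]\<close>)
  moreover have "psh_arr X P Q (TMap e) \<cdot>\<^bsub>PSh_jr X\<^esub> psh_arr X Q P (\<lambda>A x. x) = Idn (PSh_jr X) Q"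
    by (rule PSh_eqI[OF PSh_comp_Hom[OF m r] PSh_idn_Hom[OF jQ]])
      (use El in \<open>simp add: TMap_comp[OF m] TMap_idn Q(1)\<close>)
  moreover have "Dom (PSh_jr X) e = P"
    by (simp add: P_def)
  ultimately show "\<exists>B\<in>Obj (PSh_jr X). \<exists>r\<in>Hom (PSh_jr X) (Dom (PSh_jr X) e) B.
      \<exists>m\<in>Hom (PSh_jr X) B (Dom (PSh_jr X) e).
        m \<cdot>\<^bsub>PSh_jr X\<^esub> r = e \<and> r \<cdot>\<^bsub>PSh_jr X\<^esub> m = Idn (PSh_jr X) B"
    using jQ m r by (intro bexI[of _ Q] bexI[of _ "psh_arr X P Q (TMap e)"]
      bexI[of _ "psh_arr X Q P (\<lambda>A x. x)"]) auto
qed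

lemma PSh_locally_small:
  assumes U: "universe TYPE('u)" and small: "small TYPE('u) (Obj X)"
  shows "locally_small TYPE('u) (PSh_jr X :: (('o, 'a, 'u) psh, _) rcat)"
  unfolding locally_small_def
proof (intro ballI)
  fix P Q :: "('o, 'a, 'u) psh"
  assume "P \<in> Obj (PSh_jr X)" "Q \<in> Obj (PSh_jr X)"
  then interpret P: join_restriction_presheaf X P + Q: join_restriction_presheaf X Q
    by auto
  \<comment> \<open>A map is coded by its graph, a subset of a small sum; no injection into
    \<open>'u\<close> has to be given by hand.\<close>
  define h where "h \<alpha> = {z \<in> Sigma (Obj X) (\<lambda>A. PEl P A \<times> PEl Q A).
    case z of (A, x, y) \<Rightarrow> TMap \<alpha> A x = y}" for \<alpha> :: "(('o, 'a, 'u) psh, 'o \<Rightarrow> 'u \<Rightarrow> 'u) transf"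
  have "inj_on h (Hom (PSh_jr X) P Q)"
  proof (rule inj_onI)
    fix \<alpha> \<beta> assume a: "\<alpha> \<in> Hom (PSh_jr X) P Q" and b: "\<beta> \<in> Hom (PSh_jr X) P Q" and e: "h \<alpha> = h \<beta>"
    show "\<alpha> = \<beta>"
    proof (rule PSh_eqI[OF a b])
      fix A x assume A: "A \<in> Obj X" and x: "x \<in> PEl P A"
      have "(A, x, TMap \<alpha> A x) \<in> h \<alpha>"
        using A x PSh_in[OF a A x] by (simp add: h_def)
      then have "(A, x, TMap \<alpha> A x) \<in> h \<beta>"
        by (simp add: e)
      then show "TMap \<alpha> A x = TMap \<beta> A x"
        by (simp add: h_def)
    qed
  qed
  moreover have "h ` Hom (PSh_jr X) P Q \<subseteq> Pow (Sigma (Obj X) (\<lambda>A. PEl P A \<times> PEl Q A))"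
    by (auto simp: h_def)
  moreover have "small TYPE('u) (Pow (Sigma (Obj X) (\<lambda>A. PEl P A \<times> PEl Q A)))"
    by (intro small_Pow[OF U] small_Sigma[OF U] small_Times[OF U] small P.PEl_small Q.PEl_small)
  ultimately show "small TYPE('u) (Hom (PSh_jr X) P Q)"
    by (rule small_inj_on)
qed

end

section \<open>Colimits of total maps\<close>

lemma Total_simps [simp]:
  "Obj (Total X) = Obj X" "Dom (Total X) = Dom X" "Cod (Total X) = Cod X"
  "Idn (Total X) = Idn X" "Comp (Total X) = Comp X"
  by (simp_all add: Total_def)

lemma Hom_Total: "f \<in> Hom (Total X) A B \<longleftrightarrow> f \<in> Hom X A B \<and> Rst X f = Idn X A"
  by (auto simp: Hom_def Total_def total_def)

lemma Arr_Total: "f \<in> Arr (Total X) \<longleftrightarrow> f \<in> Arr X \<and> Rst X f = Idn X (Dom X f)"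
  by (auto simp: Total_def total_def)

lemma (in restriction_category) category_Total: "category (Total X)"
  by unfold_locales
    (auto simp: Hom_Total Arr_Total dom_in_Obj cod_in_Obj idn_in_Hom rst_idn comp_in_Hom
      rst_comp_total comp_assoc comp_idn_right comp_idn_left)

lemma is_colimitD:
  assumes "is_colimit C J K c leg"
  shows "is_cocone C J K c leg" and "c \<in> Obj C" and "i \<in> Obj J \<Longrightarrow> leg i \<in> Hom C (Fo K i) c"
    and "is_cocone C J K d k \<Longrightarrow> \<exists>h\<in>Hom C c d. \<forall>i\<in>Obj J. h \<cdot>\<^bsub>C\<^esub> leg i = k i"
  using assms is_coconeD(1,2) unfolding is_colimit_def by metis+

lemma is_cocone_postcomp:
  assumes "category C" and c: "is_cocone C J K c leg" and h: "h \<in> Hom C c d"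
    and "category J" and K: "is_functor J C K"
  shows "is_cocone C J K d (\<lambda>i. h \<cdot>\<^bsub>C\<^esub> leg i)"
proof -
  interpret category C by fact
  interpret J: category J by fact
  note D = is_coconeD[OF c]
  show ?thesis
  proof (rule is_coconeI)
    fix u i j assume u: "u \<in> Hom J i j"
    have ij: "i \<in> Obj J" "j \<in> Obj J"
      using J.Hom_Obj[OF u] by auto
    show "h \<cdot>\<^bsub>C\<^esub> leg j \<cdot>\<^bsub>C\<^esub> Fa K u = h \<cdot>\<^bsub>C\<^esub> leg i"
      using comp_assoc[OF is_functorD(2)[OF K u] D(2)[OF ij(2)] h] D(3)[OF u] by simp
  next
    fix i assume "i \<in> Obj J"
    then show "h \<cdot>\<^bsub>C\<^esub> leg i \<in> Hom C (Fo K i) d"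
      using comp_in_Hom[OF D(2) h] by blast
  qed (use Hom_Obj[OF h] in auto)
qed

lemma is_colimit_epi:
  assumes "category C" "is_colimit C J K c leg" "category J" "is_functor J C K"
    and h: "h \<in> Hom C c d" "h' \<in> Hom C c d" "\<And>i. i \<in> Obj J \<Longrightarrow> h \<cdot>\<^bsub>C\<^esub> leg i = h' \<cdot>\<^bsub>C\<^esub> leg i"
  shows "h = h'"
proof -
  have "is_cocone C J K d (\<lambda>i. h \<cdot>\<^bsub>C\<^esub> leg i)"
    using is_cocone_postcomp[OF assms(1) _ h(1) assms(3,4)] assms(2) by (simp add: is_colimit_def)
  then have "\<exists>!g. g \<in> Hom C c d \<and> (\<forall>i\<in>Obj J. g \<cdot>\<^bsub>C\<^esub> leg i = h \<cdot>\<^bsub>C\<^esub> leg i)"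
    using assms(2) by (simp add: is_colimit_def)
  then show ?thesis
    using h by metis
qed

lemma is_colimitI:
  assumes "is_cocone C J K c leg"
    and "\<And>d k. is_cocone C J K d k \<Longrightarrow> \<exists>h\<in>Hom C c d. \<forall>i\<in>Obj J. h \<cdot>\<^bsub>C\<^esub> leg i = k i"
    and "\<And>d h h'. h \<in> Hom C c d \<Longrightarrow> h' \<in> Hom C c d \<Longrightarrow>
           (\<And>i. i \<in> Obj J \<Longrightarrow> h \<cdot>\<^bsub>C\<^esub> leg i = h' \<cdot>\<^bsub>C\<^esub> leg i) \<Longrightarrow> h = h'"
  shows "is_colimit C J K c leg"
  unfolding is_colimit_def
proof (intro conjI allI impI)
  fix d k assume "is_cocone C J K d k"
  then obtain h where h: "h \<in> Hom C c d" "\<forall>i\<in>Obj J. h \<cdot>\<^bsub>C\<^esub> leg i = k i"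
    using assms(2) by blast
  then show "\<exists>!h. h \<in> Hom C c d \<and> (\<forall>i\<in>Obj J. h \<cdot>\<^bsub>C\<^esub> leg i = k i)"
    by (intro ex1I[of _ h]) (auto intro: assms(3))
qed (fact assms(1))

lemma is_colimit_iso:
  assumes C: "category C" and J: "category J" and K: "is_functor J C K"
    and c: "is_colimit C J K c leg" and f: "f \<in> Hom C c c'" and g: "g \<in> Hom C c' c"
    and fg: "f \<cdot>\<^bsub>C\<^esub> g = Idn C c'" "g \<cdot>\<^bsub>C\<^esub> f = Idn C c"
  shows "is_colimit C J K c' (\<lambda>i. f \<cdot>\<^bsub>C\<^esub> leg i)"
proof (rule is_colimitI)
  interpret category C by fact
  note D = is_colimitD[OF c]
  show "is_cocone C J K c' (\<lambda>i. f \<cdot>\<^bsub>C\<^esub> leg i)"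
    by (rule is_cocone_postcomp[OF C D(1) f J K])
  fix d k assume "is_cocone C J K d k"
  then obtain h where h: "h \<in> Hom C c d" "\<forall>i\<in>Obj J. h \<cdot>\<^bsub>C\<^esub> leg i = k i"
    using D(4) by blast
  have "h \<cdot>\<^bsub>C\<^esub> g \<cdot>\<^bsub>C\<^esub> (f \<cdot>\<^bsub>C\<^esub> leg i) = k i" if i: "i \<in> Obj J" for i
  proof -
    have "h \<cdot>\<^bsub>C\<^esub> g \<cdot>\<^bsub>C\<^esub> (f \<cdot>\<^bsub>C\<^esub> leg i) = h \<cdot>\<^bsub>C\<^esub> g \<cdot>\<^bsub>C\<^esub> f \<cdot>\<^bsub>C\<^esub> leg i"
      using comp_assoc[OF D(3)[OF i] f comp_in_Hom[OF g h(1)]] by simp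
    then show ?thesis
      using comp_assoc[OF f g h(1)] fg(2) comp_idn_right[OF h(1)] h(2) i by simp
  qed
  then show "\<exists>h\<in>Hom C c' d. \<forall>i\<in>Obj J. h \<cdot>\<^bsub>C\<^esub> (f \<cdot>\<^bsub>C\<^esub> leg i) = k i"
    using comp_in_Hom[OF g h(1)] by blast
next
  interpret category C by fact
  note D = is_colimitD[OF c]
  fix d h h' assume h: "h \<in> Hom C c' d" "h' \<in> Hom C c' d"
    and eq: "\<And>i. i \<in> Obj J \<Longrightarrow> h \<cdot>\<^bsub>C\<^esub> (f \<cdot>\<^bsub>C\<^esub> leg i) = h' \<cdot>\<^bsub>C\<^esub> (f \<cdot>\<^bsub>C\<^esub> leg i)"
  have "h \<cdot>\<^bsub>C\<^esub> f = h' \<cdot>\<^bsub>C\<^esub> f"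
  proof (rule is_colimit_epi[OF C c J K comp_in_Hom[OF f h(1)] comp_in_Hom[OF f h(2)]])
    fix i assume i: "i \<in> Obj J"
    show "h \<cdot>\<^bsub>C\<^esub> f \<cdot>\<^bsub>C\<^esub> leg i = h' \<cdot>\<^bsub>C\<^esub> f \<cdot>\<^bsub>C\<^esub> leg i"
      using eq[OF i] comp_assoc[OF D(3)[OF i] f h(1)] comp_assoc[OF D(3)[OF i] f h(2)] by simp
  qed
  then have "h \<cdot>\<^bsub>C\<^esub> (f \<cdot>\<^bsub>C\<^esub> g) = h' \<cdot>\<^bsub>C\<^esub> (f \<cdot>\<^bsub>C\<^esub> g)"
    using comp_assoc[OF g f h(1)] comp_assoc[OF g f h(2)] by simp
  then show "h = h'"
    using fg(1) comp_idn_right[OF h(1)] comp_idn_right[OF h(2)] by simp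
qed

context restriction_category
begin

lemma is_functor_Total: "is_functor J (Total X) K \<Longrightarrow> is_functor J X K"
  unfolding is_functor_def by (auto simp: PiE_def Pi_def Arr_Total)

lemma is_cocone_Total:
  "is_cocone (Total X) J K d k \<longleftrightarrow>
     is_cocone X J K d k \<and> (\<forall>i\<in>Obj J. Rst X (k i) = Idn X (Fo K i))"
  by (auto simp: is_cocone_def Hom_Total)

text \<open>By R4 the restriction of \<open>h\<close> passes a leg as the restriction of
  \<open>h\<close> after that leg, which the leg absorbs by R1. So \<open>Rst X h\<close> and the
  identity agree on all legs.\<close>

lemma total_if_legs_total:
  assumes J: "category J" and K: "is_functor J X K" and c: "is_colimit X J K c leg"
    and h: "h \<in> Hom X c d"
    and t: "\<And>i. i \<in> Obj J \<Longrightarrow> Rst X (h \<cdot> leg i) = Rst X (leg i)"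
  shows "Rst X h = Idn X c"
proof (rule is_colimit_epi[OF category_axioms c J K rst_in_Hom[OF h]])
  note D = is_colimitD[OF c]
  show "Idn X c \<in> Hom X c c"
    using D(2) by (rule idn_in_Hom)
  fix i assume i: "i \<in> Obj J"
  show "Rst X h \<cdot> leg i = Idn X c \<cdot> leg i"
    using R4[OF D(3)[OF i] h] t[OF i] R1[OF D(3)[OF i]] comp_idn_left[OF D(3)[OF i]] by simp
qed

lemma is_colimit_imp_Total:
  assumes J: "category J" and K: "is_functor J (Total X) K" and c: "is_colimit X J K c leg"
    and t: "\<And>i. i \<in> Obj J \<Longrightarrow> Rst X (leg i) = Idn X (Fo K i)"
  shows "is_colimit (Total X) J K c leg"
proof (rule is_colimitI)
  note D = is_colimitD[OF c] and K' = is_functor_Total[OF K]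
  show "is_cocone (Total X) J K c leg"
    using D(1) t by (simp add: is_cocone_Total)
  fix d k assume "is_cocone (Total X) J K d k"
  then have k: "is_cocone X J K d k" "\<And>i. i \<in> Obj J \<Longrightarrow> Rst X (k i) = Idn X (Fo K i)"
    by (auto simp: is_cocone_Total)
  then obtain h where h: "h \<in> Hom X c d" "\<forall>i\<in>Obj J. h \<cdot> leg i = k i"
    using D(4) by blast
  have "Rst X h = Idn X c"
    by (rule total_if_legs_total[OF J K' c h(1)]) (use h t k in auto)
  then show "\<exists>h\<in>Hom (Total X) c d. \<forall>i\<in>Obj J. h \<cdot>\<^bsub>Total X\<^esub> leg i = k i"
    using h by (auto simp: Hom_Total)
next
  fix d h h' assume "h \<in> Hom (Total X) c d" "h' \<in> Hom (Total X) c d"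
    "\<And>i. i \<in> Obj J \<Longrightarrow> h \<cdot>\<^bsub>Total X\<^esub> leg i = h' \<cdot>\<^bsub>Total X\<^esub> leg i"
  then show "h = h'"
    using is_colimit_epi[OF category_axioms c J is_functor_Total[OF K]] by (auto simp: Hom_Total)
qed

lemma is_colimit_Total_inclusion:
  assumes J: "category J" and K: "is_functor J (Total X) K" and c: "is_cocone (Total X) J K c leg"
  shows "is_colimit X J (comp_functor J (Total_inclusion X) K) (Fo (Total_inclusion X) c)
      (\<lambda>i. Fa (Total_inclusion X) (leg i)) \<longleftrightarrow> is_colimit X J K c leg"
proof -
  note D = is_coconeD[OF c]
  have c: "Fo (Total_inclusion X) c = c"
    using D(1) by (simp add: Total_inclusion_def)
  show ?thesis
    unfolding c
  proof (rule is_colimit_cong[OF J])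
    fix i assume i: "i \<in> Obj J"
    show "Fo (comp_functor J (Total_inclusion X) K) i = Fo K i \<and> Fa (Total_inclusion X) (leg i) = leg i"
      using i is_functorD(1)[OF K i] HomD(1)[OF D(2)[OF i]] by (simp add: Total_inclusion_def)
  next
    fix u assume u: "u \<in> Arr J"
    show "Fa (comp_functor J (Total_inclusion X) K) u = Fa K u"
      using u HomD(1)[OF is_functorD(2)[OF K Arr_Hom[OF u]]] by (simp add: Total_inclusion_def)
  qed
qed

text \<open>One colimit in \<open>X\<close> with total legs suffices for each diagram. It is also a
  colimit among total maps, and any other colimit among total maps is isomorphic to it by total
  maps, hence again a colimit in \<open>X\<close>.\<close>

lemma cocompleteI:
  assumes "split_category X"
    and ex: "\<And>(J :: ('u, 'u) precat) K. small_category TYPE('u) J \<Longrightarrow> is_functor J (Total X) K \<Longrightarrow>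
      \<exists>c leg. is_colimit X J K c leg \<and> (\<forall>i\<in>Obj J. Rst X (leg i) = Idn X (Fo K i))"
  shows "cocomplete TYPE('u) X"
proof -
  have "cocomplete_category TYPE('u) (Total X)"
    unfolding cocomplete_category_def
  proof (intro allI impI, elim conjE)
    fix J :: "('u, 'u) precat" and K assume J: "small_category TYPE('u) J" and K: "is_functor J (Total X) K"
    then show "\<exists>c leg. is_colimit (Total X) J K c leg"
      using ex[OF J K] is_colimit_imp_Total[OF _ K] J unfolding small_category_def by metis
  qed
  moreover have "preserves_colimits TYPE('u) (Total X) X (Total_inclusion X)"
    unfolding preserves_colimits_def
  proof (intro allI impI, elim conjE)
    fix J :: "('u, 'u) precat" and K c leg
    assume J: "small_category TYPE('u) J" and K: "is_functor J (Total X) K"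
      and c: "is_colimit (Total X) J K c leg"
    have Jc: "category J"
      using J by (simp add: small_category_def)
    obtain c' leg' where c': "is_colimit X J K c' leg'" "\<forall>i\<in>Obj J. Rst X (leg' i) = Idn X (Fo K i)"
      using ex[OF J K] by blast
    have c'T: "is_colimit (Total X) J K c' leg'"
      using is_colimit_imp_Total[OF Jc K c'(1)] c'(2) by blast
    note D = is_colimitD[OF c] and D' = is_colimitD[OF c'T]
    obtain f where f: "f \<in> Hom (Total X) c' c" "\<forall>i\<in>Obj J. f \<cdot> leg' i = leg i"
      using D'(4)[OF D(1)] by auto
    obtain g where g: "g \<in> Hom (Total X) c c'" "\<forall>i\<in>Obj J. g \<cdot> leg i = leg' i"
      using D(4)[OF D'(1)] by auto
    interpret T: category "Total X"
      by (rule category_Total)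
    have "f \<cdot> g = Idn X c"
    proof (rule is_colimit_epi[OF category_Total c Jc K])
      show "f \<cdot> g \<in> Hom (Total X) c c" "Idn X c \<in> Hom (Total X) c c"
        using T.comp_in_Hom[OF g(1) f(1)] T.idn_in_Hom[OF D(2)] by auto
      fix i assume i: "i \<in> Obj J"
      show "f \<cdot> g \<cdot>\<^bsub>Total X\<^esub> leg i = Idn X c \<cdot>\<^bsub>Total X\<^esub> leg i"
        using T.comp_assoc[OF D(3)[OF i] g(1) f(1)] T.comp_idn_left[OF D(3)[OF i]] f(2) g(2) i by simp
    qed
    moreover have "g \<cdot> f = Idn X c'"
    proof (rule is_colimit_epi[OF category_Total c'T Jc K])
      show "g \<cdot> f \<in> Hom (Total X) c' c'" "Idn X c' \<in> Hom (Total X) c' c'"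
        using T.comp_in_Hom[OF f(1) g(1)] T.idn_in_Hom[OF D'(2)] by auto
      fix i assume i: "i \<in> Obj J"
      show "g \<cdot> f \<cdot>\<^bsub>Total X\<^esub> leg' i = Idn X c' \<cdot>\<^bsub>Total X\<^esub> leg' i"
        using T.comp_assoc[OF D'(3)[OF i] f(1) g(1)] T.comp_idn_left[OF D'(3)[OF i]] f(2) g(2) i by simp
    qed
    \<comment> \<open>The inverse maps found among total maps are also inverse in \<open>X\<close>,
      so universality against partial cocones is carried over to \<open>c\<close>.\<close>
    ultimately have "is_colimit X J K c (\<lambda>i. f \<cdot> leg' i)"
      using is_colimit_iso[OF category_axioms Jc is_functor_Total[OF K] c'(1), of f c g] f(1) g(1)
      by (simp add: Hom_Total)
    moreover have "is_colimit X J K c (\<lambda>i. f \<cdot> leg' i) \<longleftrightarrow> is_colimit X J K c leg"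
      by (rule is_colimit_cong[OF Jc]) (use f(2) in auto)
    ultimately show "is_colimit X J (comp_functor J (Total_inclusion X) K) (Fo (Total_inclusion X) c)
      (\<lambda>i. Fa (Total_inclusion X) (leg i))"
      using is_colimit_Total_inclusion[OF Jc K D(1)] by simp
  qed
  ultimately show ?thesis
    using assms(1) by (simp add: cocomplete_def)
qed

lemma cocompleteD:
  assumes C: "cocomplete TYPE('u) X"
    and J: "small_category TYPE('u) (J :: ('i, 'j, 'k) precat_scheme)" and K: "is_functor J (Total X) K"
  shows "\<exists>c leg. is_colimit (Total X) J K c leg"
    and "is_colimit (Total X) J K c leg \<Longrightarrow> is_colimit X J K c leg"
proof -
  have Jc: "category J"
    using J by (simp add: small_category_def)
  show "\<exists>c leg. is_colimit (Total X) J K c leg"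
    using cocomplete_category_small[OF _ J K] C by (simp add: cocomplete_def)
  show "is_colimit (Total X) J K c leg \<Longrightarrow> is_colimit X J K c leg"
  proof -
    assume c: "is_colimit (Total X) J K c leg"
    have "preserves_colimits TYPE('u) (Total X) X (Total_inclusion X)"
      using C by (simp add: cocomplete_def)
    from preserves_colimits_small[OF this J K c] show "is_colimit X J K c leg"
      using is_colimit_Total_inclusion[OF Jc K is_colimitD(1)[OF c]] by blast
  qed
qed

end

section \<open>Colimits of join restriction presheaves\<close>

locale small_jr = join_restriction_category X
  for X :: "('o, 'u, 'c) rcat_scheme" (structure) +
  assumes universe: "universe TYPE('u)"
    and small_Obj: "small TYPE('u) (Obj X)" and small_Arr: "small TYPE('u) (Arr X)"
begin

lemma small_Hom: "small TYPE('u) (Hom X A B)"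
  by (rule small_subset[OF _ small_Arr]) (auto simp: Hom_def)

end

context join_restriction_category
begin

text \<open>Totality means that domains are preserved. The domain of the image is always contained
  in that of \<open>x\<close> (\<open>PSh_rst_le\<close>), and cutting \<open>x\<close> down to it
  leaves \<open>x\<close> fixed only when the two coincide.\<close>

lemma PSh_total_iff:
  assumes a: "\<alpha> \<in> Hom (PSh_jr X) P Q"
  shows "Rst (PSh_jr X) \<alpha> = Idn (PSh_jr X) P \<longleftrightarrow>
    (\<forall>A\<in>Obj X. \<forall>x\<in>PEl P A. PRst Q A (TMap \<alpha> A x) = PRst P A x)"
proof -
  interpret P: jr_sheaf X "PEl P" "PAct P" "PRst P"
    using PSh_HomD(1)[OF a] by (rule jr_sheaf_psh)
  interpret Q: jr_sheaf X "PEl Q" "PAct Q" "PRst Q"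
    using PSh_HomD(2)[OF a] by (rule jr_sheaf_psh)
  have *: "PAct P (PRst Q A (TMap \<alpha> A x)) x = x \<longleftrightarrow> PRst Q A (TMap \<alpha> A x) = PRst P A x"
    if A: "A \<in> Obj X" and x: "x \<in> PEl P A" for A x
  proof
    assume "PAct P (PRst Q A (TMap \<alpha> A x)) x = x"
    then have "PRst P A x = PRst P A x \<cdot> PRst Q A (TMap \<alpha> A x)"
      using P.rst_act_Idem[OF Q.rst_el[OF A PSh_in[OF a A x]] x] by simp
    then show "PRst Q A (TMap \<alpha> A x) = PRst P A x"
      using Idem_commute[OF P.rst_el[OF A x] Q.rst_el[OF A PSh_in[OF a A x]]] PSh_rst_le[OF a A x]
      by simp
  qed (use P.act_rst[OF A x] in simp)
  show ?thesis
  proof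
    assume "Rst (PSh_jr X) \<alpha> = Idn (PSh_jr X) P"
    then show "\<forall>A\<in>Obj X. \<forall>x\<in>PEl P A. PRst Q A (TMap \<alpha> A x) = PRst P A x"
      using TMap_rst[OF a] TMap_idn * by metis
  next
    assume "\<forall>A\<in>Obj X. \<forall>x\<in>PEl P A. PRst Q A (TMap \<alpha> A x) = PRst P A x"
    then show "Rst (PSh_jr X) \<alpha> = Idn (PSh_jr X) P"
      by (intro PSh_eqI[OF PSh_rst_Hom[OF a] PSh_idn_Hom[OF PSh_HomD(1)[OF a]]])
        (simp add: TMap_rst[OF a] TMap_idn P.act_rst)
  qed
qed

text \<open>Transitivity of the topology: refining each member of a cover by a cover of its own
  gives a cover.\<close>

lemma is_join_Union_Idem:
  assumes e: "is_join X A A (e ` S) j" and j: "j \<in> Idem X A"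
    and D: "\<And>s. s \<in> S \<Longrightarrow> D s \<subseteq> Idem X A \<and> e s \<in> Idem X A \<and> is_join X A A (D s) (e s)"
  shows "is_join X A A (\<Union>s\<in>S. D s) j"
  unfolding is_join_def
proof (intro conjI ballI impI)
  fix d assume "d \<in> (\<Union>s\<in>S. D s)"
  then obtain s where s: "s \<in> S" "d \<in> D s"
    by blast
  have d: "d \<in> Idem X A" and es: "e s \<in> Idem X A"
    using D[OF s(1)] s(2) by auto
  have "e s \<cdot> d = d" "j \<cdot> e s = e s"
    using D[OF s(1)] s e rle_Idem[OF d] rle_Idem[OF es] by (auto simp: is_join_def)
  then show "rle X d j"
    using rle_Idem[OF d] comp_assoc[OF Idem_Hom[OF d] Idem_Hom[OF es] Idem_Hom[OF j]] by simp
next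
  fix k assume k: "k \<in> Hom X A A" "\<forall>d\<in>\<Union>s\<in>S. D s. rle X d k"
  then have "rle X (e s) k" if "s \<in> S" for s
    using D[OF that] that by (auto simp: is_join_def)
  then show "rle X j k"
    using e k(1) by (auto simp: is_join_def)
qed (use j Idem_Hom in auto)

end

text \<open>
  An element over A of the colimit is a restriction idempotent together with an element of every
  (not necessarily total) cocone under the diagram, subject to being locally in the image of the
  diagram. Ranging over all cocones makes the universal property a projection and dispenses with
  sheafification; locality keeps the set small.
\<close>

locale psh_diagram = small_jr X
  for X :: "('o, 'u, 'c) rcat_scheme" (structure) +
  fixes J :: "('i, 'j, 'k) precat_scheme"
    and K :: "('i, 'j, ('o, 'u, 'u) psh, (('o, 'u, 'u) psh, 'o \<Rightarrow> 'u \<Rightarrow> 'u) transf) func"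
  assumes J: "small_category TYPE('u) J" and K: "is_functor J (Total (PSh_jr X)) K"
begin

definition Coc where "Coc = {(Q, k). is_cocone (PSh_jr X) J K Q k}"

text \<open>The same pair of an index \<open>i\<close> and an element \<open>x\<close> has to serve
  all cocones simultaneously. This uniformity makes an element of the colimit recoverable from a
  small amount of data.\<close>

definition local_at where
  "local_at A q d \<longleftrightarrow> (\<exists>i\<in>Obj J. \<exists>x\<in>PEl (Fo K i) A. PRst (Fo K i) A x = d \<and>
     (\<forall>z\<in>Coc. PAct (fst z) d (q z) = TMap (snd z i) A x))"

text \<open>The idempotent \<open>e\<close> is stored on its own: cocones may be partial, so the
  components \<open>q z\<close> live over \<open>e\<close> but may have smaller domains.\<close>

definition cEl where
  "cEl A = {(e, q). e \<in> Idem X A \<and> q \<in> extensional Coc \<and>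
     (\<forall>z\<in>Coc. q z \<in> PEl (fst z) A \<and> PAct (fst z) e (q z) = q z) \<and>
     (\<exists>D\<subseteq>Idem X A. is_join X A A D e \<and> (\<forall>d\<in>D. local_at A q d))}"

definition cact where
  "cact f = (\<lambda>(e, q). (Rst X (e \<cdot> f), \<lambda>z\<in>Coc. PAct (fst z) f (q z)))"

lemma category_J: "category J"
  using J by (simp add: small_category_def)

lemma K_PSh: "is_functor J (PSh_jr X) K"
  using K by (rule restriction_category.is_functor_Total[OF restriction_category_PSh])

lemma K_psh: "i \<in> Obj J \<Longrightarrow> join_restriction_presheaf X (Fo K i)"
  using is_functorD(1)[OF K_PSh] by simp

lemma CocD:
  assumes "z \<in> Coc"
  shows "join_restriction_presheaf X (fst z)"
    and "i \<in> Obj J \<Longrightarrow> snd z i \<in> Hom (PSh_jr X) (Fo K i) (fst z)"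
    and "u \<in> Hom J i j \<Longrightarrow> snd z j \<cdot>\<^bsub>PSh_jr X\<^esub> Fa K u = snd z i"
    and "jr_sheaf X (PEl (fst z)) (PAct (fst z)) (PRst (fst z))"
proof -
  have c: "is_cocone (PSh_jr X) J K (fst z) (snd z)"
    using assms by (auto simp: Coc_def)
  show j: "join_restriction_presheaf X (fst z)"
    using is_coconeD(1)[OF c] by simp
  show "jr_sheaf X (PEl (fst z)) (PAct (fst z)) (PRst (fst z))"
    using j by (rule jr_sheaf_psh)
  show "i \<in> Obj J \<Longrightarrow> snd z i \<in> Hom (PSh_jr X) (Fo K i) (fst z)"
    "u \<in> Hom J i j \<Longrightarrow> snd z j \<cdot>\<^bsub>PSh_jr X\<^esub> Fa K u = snd z i"
    using is_coconeD(2,3)[OF c] by auto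
qed

lemma cElD:
  assumes "(e, q) \<in> cEl A"
  shows "e \<in> Idem X A" "q \<in> extensional Coc"
    "z \<in> Coc \<Longrightarrow> q z \<in> PEl (fst z) A" "z \<in> Coc \<Longrightarrow> PAct (fst z) e (q z) = q z"
    "\<exists>D\<subseteq>Idem X A. is_join X A A D e \<and> (\<forall>d\<in>D. local_at A q d)"
  using assms by (auto simp: cEl_def)

text \<open>The index \<open>i\<close> is kept and \<open>x\<close> is replaced by its pullback
  along \<open>f\<close>; naturality of the cocone maps does the rest.\<close>

lemma local_at_act:
  assumes f: "f \<in> Hom X B A" and q: "\<And>z. z \<in> Coc \<Longrightarrow> q z \<in> PEl (fst z) A"
    and d: "d \<in> Idem X A" and l: "local_at A q d"
  shows "local_at B (\<lambda>z\<in>Coc. PAct (fst z) f (q z)) (Rst X (d \<cdot> f))"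
proof -
  obtain i x where i: "i \<in> Obj J" and x: "x \<in> PEl (Fo K i) A" "PRst (Fo K i) A x = d"
    and qx: "\<And>z. z \<in> Coc \<Longrightarrow> PAct (fst z) d (q z) = TMap (snd z i) A x"
    using l by (auto simp: local_at_def)
  interpret Ki: jr_sheaf X "PEl (Fo K i)" "PAct (Fo K i)" "PRst (Fo K i)"
    using K_psh[OF i] by (rule jr_sheaf_psh)
  have "PAct (fst z) (Rst X (d \<cdot> f)) (PAct (fst z) f (q z)) = TMap (snd z i) B (PAct (Fo K i) f x)"
    if z: "z \<in> Coc" for z
  proof -
    interpret Q: jr_sheaf X "PEl (fst z)" "PAct (fst z)" "PRst (fst z)"
      using CocD(4)[OF z] .
    show ?thesis
      using Q.act_rst_act[OF f q[OF z] d] qx[OF z] PSh_nat[OF CocD(2)[OF z i] f x(1)] by simp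
  qed
  then show ?thesis
    unfolding local_at_def using i x Ki.act_in[OF f x(1)] Ki.rst_act[OF f x(1)]
    by (intro bexI[of _ i] bexI[of _ "PAct (Fo K i) f x"]) auto
qed

lemma cact_in:
  assumes f: "f \<in> Hom X B A" and x: "x \<in> cEl A"
  shows "cact f x \<in> cEl B"
proof -
  obtain e q where eq: "x = (e, q)"
    by (cases x)
  note E = cElD[OF x[unfolded eq]]
  obtain D where D: "D \<subseteq> Idem X A" "is_join X A A D e" "\<forall>d\<in>D. local_at A q d"
    using E(5) by blast
  have "Rst X (e \<cdot> f) \<in> Idem X B"
    using rst_Idem[OF comp_in_Hom[OF f Idem_Hom[OF E(1)]]] .
  moreover have "PAct (fst z) f (q z) \<in> PEl (fst z) B"
    "PAct (fst z) (Rst X (e \<cdot> f)) (PAct (fst z) f (q z)) = PAct (fst z) f (q z)" if z: "z \<in> Coc" for z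
  proof -
    interpret Q: jr_sheaf X "PEl (fst z)" "PAct (fst z)" "PRst (fst z)"
      using CocD(4)[OF z] .
    show "PAct (fst z) f (q z) \<in> PEl (fst z) B"
      using Q.act_in[OF f E(3)[OF z]] .
    show "PAct (fst z) (Rst X (e \<cdot> f)) (PAct (fst z) f (q z)) = PAct (fst z) f (q z)"
      using Q.act_rst_act[OF f E(3)[OF z] E(1)] E(4)[OF z] by simp
  qed
  moreover have "(\<lambda>d. Rst X (d \<cdot> f)) ` D \<subseteq> Idem X B"
    using D(1) rst_Idem comp_in_Hom[OF f] Idem_Hom by blast
  moreover have "is_join X B B ((\<lambda>d. Rst X (d \<cdot> f)) ` D) (Rst X (e \<cdot> f))"
    using D(1,2) f by (rule is_join_Idem_comp)
  moreover have "\<forall>d\<in>(\<lambda>d. Rst X (d \<cdot> f)) ` D. local_at B (\<lambda>z\<in>Coc. PAct (fst z) f (q z)) d"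
    using local_at_act[OF f E(3)] D by blast
  ultimately show ?thesis
    unfolding eq cact_def cEl_def by auto
qed

lemma rpresheaf_c: "rpresheaf X cEl cact (\<lambda>A. fst)"
proof
  fix A x assume A: "A \<in> Obj X" and x: "x \<in> cEl A"
  obtain e q where eq: "x = (e, q)"
    by (cases x)
  note E = cElD[OF x[unfolded eq]]
  have "PAct (fst z) (Idn X A) (q z) = q z" if z: "z \<in> Coc" for z
  proof -
    interpret Q: jr_sheaf X "PEl (fst z)" "PAct (fst z)" "PRst (fst z)"
      using CocD(4)[OF z] .
    show ?thesis
      using Q.act_idn[OF A E(3)[OF z]] .
  qed
  then have "(\<lambda>z\<in>Coc. PAct (fst z) (Idn X A) (q z)) = q"
    using E(2) by (intro extensionalityI[of _ Coc]) auto
  then show "cact (Idn X A) x = x"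
    using Idem_rst[OF E(1)] comp_idn_right[OF Idem_Hom[OF E(1)]] by (simp add: eq cact_def)
  have "(\<lambda>z\<in>Coc. PAct (fst z) e (q z)) = q"
    using E(2,4) by (intro extensionalityI[of _ Coc]) auto
  then show "cact (fst x) x = x"
    using Idem_rst[OF E(1)] Idem_idem[OF E(1)] by (simp add: eq cact_def)
  show "fst x \<in> Idem X A"
    using E(1) by (simp add: eq)
next
  fix f B A x assume f: "f \<in> Hom X B A" and x: "x \<in> cEl A"
  obtain e q where eq: "x = (e, q)"
    by (cases x)
  note E = cElD[OF x[unfolded eq]]
  fix g D assume g: "g \<in> Hom X D B"
  have "PAct (fst z) (f \<cdot> g) (q z) = PAct (fst z) g (PAct (fst z) f (q z))" if z: "z \<in> Coc" for z
  proof -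
    interpret Q: jr_sheaf X "PEl (fst z)" "PAct (fst z)" "PRst (fst z)"
      using CocD(4)[OF z] .
    show ?thesis
      using Q.act_comp[OF g f E(3)[OF z]] .
  qed
  then have "(\<lambda>z\<in>Coc. PAct (fst z) (f \<cdot> g) (q z)) = (\<lambda>z\<in>Coc. PAct (fst z) g ((\<lambda>z\<in>Coc. PAct (fst z) f (q z)) z))"
    by (intro extensionalityI[of _ Coc]) auto
  moreover have "Rst X (e \<cdot> (f \<cdot> g)) = Rst X (Rst X (e \<cdot> f) \<cdot> g)"
    using rst_comp_rst[OF g comp_in_Hom[OF f Idem_Hom[OF E(1)]]] comp_assoc[OF g f Idem_Hom[OF E(1)]]
    by simp
  ultimately show "cact (f \<cdot> g) x = cact g (cact f x)"
    by (simp add: eq cact_def)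
qed (auto simp: cact_in, auto simp: cact_def)

text \<open>Idempotents are glued in \<open>X\<close> and components in each cocone vertex
  separately. Locality of the result comes from the union of the local covers of the
  members.\<close>

lemma jr_sheaf_c: "jr_sheaf X cEl cact (\<lambda>A. fst)"
proof -
  interpret c: rpresheaf X cEl cact "\<lambda>A. fst"
    by (rule rpresheaf_c)
  show ?thesis
  proof
    fix A D e x y
    assume A: "A \<in> Obj X" and D: "D \<subseteq> Idem X A" "is_join X A A D e"
      and x: "x \<in> cEl A" and y: "y \<in> cEl A" and eq: "\<And>d. d \<in> D \<Longrightarrow> cact d x = cact d y"
    obtain ex qx ey qy where xy: "x = (ex, qx)" "y = (ey, qy)"
      by (cases x, cases y)
    note Ex = cElD[OF x[unfolded xy]] and Ey = cElD[OF y[unfolded xy]]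
    have r: "Rst X (c \<cdot> d) = c \<cdot> d" if "c \<in> Idem X A" "d \<in> Idem X A" for c d
      using that Idem_comp Idem_rst by blast
    have "ex \<cdot> d = ey \<cdot> d" if "d \<in> D" for d
      using eq[OF that] r[OF Ex(1)] r[OF Ey(1)] D(1) that by (auto simp: xy cact_def subset_iff)
    then have "ex \<cdot> e = ey \<cdot> e"
      using jr_sheaf.sep[OF hom_sheaf[OF A] A D Idem_Hom[OF Ex(1)] Idem_Hom[OF Ey(1)]] by blast
    moreover have "PAct (fst z) e (qx z) = PAct (fst z) e (qy z)" if z: "z \<in> Coc" for z
    proof -
      interpret Q: jr_sheaf X "PEl (fst z)" "PAct (fst z)" "PRst (fst z)"
        using CocD(4)[OF z] .
      have "PAct (fst z) d (qx z) = PAct (fst z) d (qy z)" if "d \<in> D" for d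
        using eq[OF that] z unfolding xy cact_def by (auto dest!: fun_cong[of _ _ z])
      then show ?thesis
        using Q.sep[OF A D Ex(3)[OF z] Ey(3)[OF z]] by blast
    qed
    ultimately show "cact e x = cact e y"
      by (auto simp: xy cact_def intro!: restrict_ext)
  next
    fix A S assume A: "A \<in> Obj X" and S: "S \<subseteq> cEl A" and C: "c.coherent A S"
    define ES where "ES = fst ` S"
    have ESI: "ES \<subseteq> Idem X A"
      using S c.rst_el[OF A] by (auto simp: ES_def)
    obtain e where ej: "is_join X A A ES e"
      using Idem_join_exists[OF A ESI] by blast
    have eI: "e \<in> Idem X A"
      using is_join_Idem[OF A ESI ej] .
    have sE: "fst s \<in> Idem X A" "z \<in> Coc \<Longrightarrow> snd s z \<in> PEl (fst z) A"
      "z \<in> Coc \<Longrightarrow> PAct (fst z) (fst s) (snd s z) = snd s z"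
      "\<exists>D\<subseteq>Idem X A. is_join X A A D (fst s) \<and> (\<forall>d\<in>D. local_at A (snd s) d)"
      if "s \<in> S" for s z
    proof -
      have "(fst s, snd s) \<in> cEl A"
        using that S by auto
      note E = cElD[OF this]
      show "fst s \<in> Idem X A" "z \<in> Coc \<Longrightarrow> snd s z \<in> PEl (fst z) A"
        "z \<in> Coc \<Longrightarrow> PAct (fst z) (fst s) (snd s z) = snd s z"
        "\<exists>D\<subseteq>Idem X A. is_join X A A D (fst s) \<and> (\<forall>d\<in>D. local_at A (snd s) d)"
        using E by blast+
    qed
    have es: "e \<cdot> fst s = fst s" if "s \<in> S" for s
      using ej that rle_Idem[OF sE(1)[OF that]] by (auto simp: is_join_def ES_def)
    have st: "PAct (fst z) (fst t) (snd s z) = PAct (fst z) (fst s) (snd t z)"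
      if z: "z \<in> Coc" and s: "s \<in> S" and t: "t \<in> S" for s t z
    proof -
      have "cact (fst t) s = cact (fst s) t"
        using C s t by (auto simp: gcompat_def)
      then have "snd (cact (fst t) s) z = snd (cact (fst s) t) z"
        by simp
      then show ?thesis
        using z by (simp add: cact_def split_beta)
    qed
    have "\<exists>j\<in>PEl (fst z) A. PAct (fst z) e j = j \<and> (\<forall>s\<in>S. PAct (fst z) (fst s) j = snd s z)"
      if z: "z \<in> Coc" for z
    proof -
      interpret Q: jr_sheaf X "PEl (fst z)" "PAct (fst z)" "PRst (fst z)"
        using CocD(4)[OF z] .
      let ?T = "(\<lambda>s. snd s z) ` S" and ?r = "\<lambda>s. PRst (fst z) A (snd s z)"
      have T: "?T \<subseteq> PEl (fst z) A"
        using sE(2)[OF _ z] by blast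
      have rI: "?r s \<in> Idem X A" if "s \<in> S" for s
        using Q.rst_el[OF A sE(2)[OF that z]] .
      have rs: "?r s = ?r s \<cdot> fst s" if "s \<in> S" for s
        using Q.rst_act_Idem[OF sE(1)[OF that] sE(2)[OF that z]] sE(3)[OF that z] by simp
      \<comment> \<open>Coherence of \<open>S\<close> speaks of the stored idempotents
        \<open>fst t\<close>, while gluing at the vertex needs agreement on the possibly smaller
        true domains \<open>?r t\<close>.\<close>
      have rt: "PAct (fst z) (?r t) (snd s z) = PAct (fst z) (fst s) (snd t z)"
        if s: "s \<in> S" and t: "t \<in> S" for s t
      proof -
        have "PAct (fst z) (?r t) (snd s z) = PAct (fst z) (fst t \<cdot> ?r t) (snd s z)"
          using rs[OF t] Idem_commute[OF rI[OF t] sE(1)[OF t]] by simp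
        also have "\<dots> = PAct (fst z) (?r t) (PAct (fst z) (fst s) (snd t z))"
          using Q.act_Idem_comp[OF sE(1)[OF t] rI[OF t] sE(2)[OF s z]] st[OF z s t] by simp
        also have "\<dots> = PAct (fst z) (fst s) (PAct (fst z) (?r t) (snd t z))"
          using Q.act_Idem_comp[OF sE(1)[OF s] rI[OF t] sE(2)[OF t z]]
            Q.act_Idem_comp[OF rI[OF t] sE(1)[OF s] sE(2)[OF t z]]
            Idem_commute[OF rI[OF t] sE(1)[OF s]] by simp
        finally show ?thesis
          using Q.act_rst[OF A sE(2)[OF t z]] by simp
      qed
      have "Q.coherent A ?T"
        using rt st[OF z] by (auto simp: gcompat_def)
      then obtain j where j: "Q.glue A ?T j"
        using Q.glue[OF A T] by blast
      have jE: "j \<in> PEl (fst z) A" and js: "\<And>s. s \<in> S \<Longrightarrow> PAct (fst z) (?r s) j = snd s z"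
        and jj: "is_join X A A (?r ` S) (PRst (fst z) A j)"
        using j by (auto simp: glued_def image_image)
      have rS: "?r ` S \<subseteq> Idem X A"
        using rI by blast
      let ?rj = "PRst (fst z) A j"
      have rj: "?rj \<in> Idem X A"
        using Q.rst_el[OF A jE] .
      have rjs: "?rj \<cdot> ?r s = ?r s" if "s \<in> S" for s
        using jj that rle_Idem[OF rI[OF that]] by (auto simp: is_join_def)
      have "e \<cdot> ?rj = ?rj"
      proof -
        have "rle X (?r s) e" if "s \<in> S" for s
        proof -
          have "e \<cdot> ?r s = e \<cdot> (fst s \<cdot> ?r s)"
            using rs[OF that] Idem_commute[OF rI[OF that] sE(1)[OF that]] by simp
          also have "\<dots> = fst s \<cdot> ?r s"
            using es[OF that] comp_assoc[OF Idem_Hom[OF rI[OF that]] Idem_Hom[OF sE(1)[OF that]] Idem_Hom[OF eI]]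
            by simp
          finally show ?thesis
            using rs[OF that] Idem_commute[OF rI[OF that] sE(1)[OF that]] rle_Idem[OF rI[OF that]] by simp
        qed
        then have "rle X ?rj e"
          using jj Idem_Hom[OF eI] by (auto simp: is_join_def)
        then show ?thesis
          by (simp add: rle_Idem[OF rj])
      qed
      then have "PAct (fst z) e j = j"
        using Q.act_Idem_comp[OF rj eI jE] Q.act_rst[OF A jE] Idem_commute[OF rj eI] by simp
      \<comment> \<open>By construction \<open>j\<close> restricts to \<open>snd s z\<close> over
        \<open>?r s\<close> only. That the larger idempotent \<open>fst s\<close> gives nothing more
        is seen by separation over the domains of all members, which cover the domain of
        \<open>j\<close>.\<close>
      moreover have "PAct (fst z) (fst s) j = snd s z" if s: "s \<in> S" for s
      proof (rule Q.sep_cover[OF A rS jj])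
        show "PAct (fst z) (fst s) j \<in> PEl (fst z) A" "snd s z \<in> PEl (fst z) A"
          using Q.act_Idem_in[OF sE(1)[OF s] jE] sE(2)[OF s z] .
        have *: "PAct (fst z) d (PAct (fst z) (fst s) j) = PAct (fst z) (fst s) (PAct (fst z) d j)"
          if "d \<in> Idem X A" for d
          using Q.act_Idem_comp[OF that sE(1)[OF s] jE] Q.act_Idem_comp[OF sE(1)[OF s] that jE]
            Idem_commute[OF that sE(1)[OF s]] by simp
        show "PAct (fst z) ?rj (PAct (fst z) (fst s) j) = PAct (fst z) (fst s) j"
          using *[OF rj] Q.act_rst[OF A jE] by simp
        have "PAct (fst z) ?rj (snd s z) = PAct (fst z) (?r s \<cdot> ?rj) j"
          using Q.act_Idem_comp[OF rI[OF s] rj jE] js[OF s] by simp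
        then show "PAct (fst z) ?rj (snd s z) = snd s z"
          using rjs[OF s] Idem_commute[OF rI[OF s] rj] js[OF s] by simp
        fix d assume "d \<in> ?r ` S"
        then obtain t where t: "t \<in> S" "d = ?r t"
          by blast
        show "PAct (fst z) d (PAct (fst z) (fst s) j) = PAct (fst z) d (snd s z)"
          using *[OF rI[OF t(1)]] js[OF t(1)] rt[OF s t(1)] t(2) by simp
      qed
      ultimately show ?thesis
        using jE by blast
    qed
    then obtain j where j: "\<And>z. z \<in> Coc \<Longrightarrow> j z \<in> PEl (fst z) A"
      "\<And>z. z \<in> Coc \<Longrightarrow> PAct (fst z) e (j z) = j z"
      "\<And>z s. z \<in> Coc \<Longrightarrow> s \<in> S \<Longrightarrow> PAct (fst z) (fst s) (j z) = snd s z"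
      by metis
    obtain D where D: "\<And>s. s \<in> S \<Longrightarrow> D s \<subseteq> Idem X A \<and> is_join X A A (D s) (fst s) \<and>
        (\<forall>d\<in>D s. local_at A (snd s) d)"
      using sE(4) by metis
    have "local_at A (restrict j Coc) d" if s: "s \<in> S" and d: "d \<in> D s" for s d
    proof -
      have dI: "d \<in> Idem X A"
        using D[OF s] d by auto
      have "fst s \<cdot> d = d"
        using D[OF s] d rle_Idem[OF dI] by (auto simp: is_join_def)
      then have "PAct (fst z) d (j z) = PAct (fst z) d (snd s z)" if z: "z \<in> Coc" for z
        using rpresheaf.act_Idem_comp[OF jr_sheaf.axioms(1)[OF CocD(4)[OF z]] sE(1)[OF s] dI j(1)[OF z]]
          j(3)[OF z s] by simp
      then show ?thesis
        using D[OF s] d unfolding local_at_def by auto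
    qed
    moreover have "is_join X A A (\<Union>s\<in>S. D s) e"
      using ej eI D sE(1) by (intro is_join_Union_Idem[where e = fst]) (auto simp: ES_def)
    moreover have "(\<Union>s\<in>S. D s) \<subseteq> Idem X A"
      using D by blast
    ultimately have jE: "(e, restrict j Coc) \<in> cEl A"
      using eI j(1,2) unfolding cEl_def by auto
    have "cact (fst s) (e, restrict j Coc) = s" if s: "s \<in> S" for s
    proof -
      have "snd s \<in> extensional Coc"
        using s S cElD(2)[of "fst s" "snd s" A] by auto
      then have "(\<lambda>z\<in>Coc. PAct (fst z) (fst s) (restrict j Coc z)) = snd s"
        using j(3)[OF _ s] by (intro extensionalityI[of _ Coc]) auto
      then show ?thesis
        using es[OF s] Idem_rst[OF sE(1)[OF s]] by (simp add: cact_def)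
    qed
    then have "c.glue A S (e, restrict j Coc)"
      using jE ej by (simp add: glued_def ES_def)
    then show "\<exists>j. c.glue A S j" ..
  qed
qed

text \<open>An element is coded by \<open>e\<close> and the set of pairs \<open>(i, x)\<close> that
  it equals over the domain of \<open>x\<close>. By locality these pairs determine every component
  over a cover of \<open>e\<close>, and separation then determines the component itself.\<close>

lemma small_cEl:
  assumes A: "A \<in> Obj X"
  shows "small TYPE('u) (cEl A)"
proof -
  define h where "h = (\<lambda>(e :: 'u, q). (e, {(i, x) \<in> Sigma (Obj J) (\<lambda>i. PEl (Fo K i) A).
    \<forall>z\<in>Coc. PAct (fst z) (PRst (Fo K i) A x) (q z) = TMap (snd z i) A x}))"
  have "inj_on h (cEl A)"
  proof (rule inj_onI)
    fix x y assume x: "x \<in> cEl A" and y: "y \<in> cEl A" and hh: "h x = h y"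
    obtain e q e' q' where xy: "x = (e, q)" "y = (e', q')"
      by (cases x, cases y)
    have e: "e' = e"
      using hh by (simp add: xy h_def)
    note Ex = cElD[OF x[unfolded xy]] and Ey = cElD[OF y[unfolded xy], unfolded e]
    obtain D where D: "D \<subseteq> Idem X A" "is_join X A A D e" "\<forall>d\<in>D. local_at A q d"
      using Ex(5) by blast
    have "q z = q' z" if z: "z \<in> Coc" for z
    proof -
      interpret Q: jr_sheaf X "PEl (fst z)" "PAct (fst z)" "PRst (fst z)"
        using CocD(4)[OF z] .
      show ?thesis
      proof (rule Q.sep_cover[OF A D(1,2) Ex(3)[OF z] Ey(3)[OF z] Ex(4)[OF z] Ey(4)[OF z]])
        fix d assume d: "d \<in> D"
        obtain i x where i: "i \<in> Obj J" "x \<in> PEl (Fo K i) A" "PRst (Fo K i) A x = d"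
          and qx: "\<forall>z\<in>Coc. PAct (fst z) d (q z) = TMap (snd z i) A x"
          using D(3) d by (auto simp: local_at_def)
        have "(i, x) \<in> snd (h (e, q))"
          using i qx by (simp add: h_def)
        then have "(i, x) \<in> snd (h (e', q'))"
          using hh by (simp add: xy)
        then show "PAct (fst z) d (q z) = PAct (fst z) d (q' z)"
          using qx i(3) z by (simp add: h_def)
      qed
    qed
    then have "q = q'"
      using Ex(2) Ey(2) by (intro extensionalityI[of _ Coc])
    then show "x = y"
      by (simp add: xy e)
  qed
  moreover have "h ` cEl A \<subseteq> Hom X A A \<times> Pow (Sigma (Obj J) (\<lambda>i. PEl (Fo K i) A))"
    by (auto simp: h_def cEl_def Idem_def)
  moreover have "small TYPE('u) (PEl (Fo K i) A)" if i: "i \<in> Obj J" for i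
  proof -
    interpret join_restriction_presheaf X "Fo K i"
      using K_psh[OF i] .
    show ?thesis
      using A by (rule PEl_small)
  qed
  moreover have "small TYPE('u) (Obj J)"
    using J by (simp add: small_category_def)
  ultimately show ?thesis
    by (meson small_inj_on small_Times small_Pow small_Sigma small_Hom universe)
qed

lemma PSh_colimit:
  "\<exists>c leg. is_colimit (PSh_jr X) J K c leg \<and>
     (\<forall>i\<in>Obj J. Rst (PSh_jr X) (leg i) = Idn (PSh_jr X) (Fo K i))"
proof -
  interpret c: jr_sheaf X cEl cact "\<lambda>A. fst"
    by (rule jr_sheaf_c)
  interpret Jc: category J
    by (rule category_J)
  obtain L :: "('o, 'u, 'u) psh" and c where L: "join_restriction_presheaf X L"
    and bij: "\<And>A. A \<in> Obj X \<Longrightarrow> bij_betw (c A) (cEl A) (PEl L A)"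
    and act: "\<And>A B f x. f \<in> Hom X B A \<Longrightarrow> x \<in> cEl A \<Longrightarrow> PAct L f (c A x) = c B (cact f x)"
    and rst: "\<And>A x. A \<in> Obj X \<Longrightarrow> x \<in> cEl A \<Longrightarrow> PRst L A (c A x) = fst x"
    using c.small_psh[OF small_cEl] by blast
  have cL: "c A x \<in> PEl L A" if "A \<in> Obj X" "x \<in> cEl A" for A x
    using bij[OF that(1)] that(2) by (auto simp: bij_betw_def)
  \<comment> \<open>Coordinates of the leg: \<open>x\<close> together with its images under all
    cocones. It is local over its whole domain, so a one-element cover suffices.\<close>
  define l where "l i A x = (PRst (Fo K i) A x, \<lambda>z\<in>Coc. TMap (snd z i) A x)" for i A x
  define leg where "leg i = psh_arr X (Fo K i) L (\<lambda>A x. c A (l i A x))" for i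
  have lE: "l i A x \<in> cEl A" if i: "i \<in> Obj J" and A: "A \<in> Obj X" and x: "x \<in> PEl (Fo K i) A" for i A x
  proof -
    interpret Ki: jr_sheaf X "PEl (Fo K i)" "PAct (Fo K i)" "PRst (Fo K i)"
      using K_psh[OF i] by (rule jr_sheaf_psh)
    let ?d = "PRst (Fo K i) A x"
    have d: "?d \<in> Idem X A"
      using Ki.rst_el[OF A x] .
    have z: "TMap (snd z i) A x \<in> PEl (fst z) A"
      "PAct (fst z) ?d (TMap (snd z i) A x) = TMap (snd z i) A x" if z: "z \<in> Coc" for z
      using PSh_in[OF CocD(2)[OF z i] A x] PSh_nat[OF CocD(2)[OF z i] Idem_Hom[OF d] x]
        Ki.act_rst[OF A x] by auto
    have "is_join X A A {?d} ?d"
      using d Idem_idem[OF d] by (auto simp: is_join_def Idem_Hom rle_Idem)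
    moreover have "local_at A (\<lambda>z\<in>Coc. TMap (snd z i) A x) ?d"
      unfolding local_at_def using i x z by (intro bexI[of _ i] bexI[of _ x]) auto
    ultimately show ?thesis
      using d z unfolding l_def cEl_def by (auto intro!: exI[of _ "{?d}"])
  qed
  have lact: "cact f (l i A x) = l i B (PAct (Fo K i) f x)"
    if i: "i \<in> Obj J" and f: "f \<in> Hom X B A" and x: "x \<in> PEl (Fo K i) A" for i f A B x
  proof -
    interpret Ki: jr_sheaf X "PEl (Fo K i)" "PAct (Fo K i)" "PRst (Fo K i)"
      using K_psh[OF i] by (rule jr_sheaf_psh)
    show ?thesis
      using Ki.rst_act[OF f x] PSh_nat[OF CocD(2)[OF _ i] f x]
      by (auto simp: l_def cact_def intro!: restrict_ext)
  qed
  have leg: "leg i \<in> Hom (PSh_jr X) (Fo K i) L" if i: "i \<in> Obj J" for i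
    unfolding leg_def
  proof (intro psh_arrI category_axioms K_psh[OF i] L)
    fix A B f x assume f: "f \<in> Hom X B A" and x: "x \<in> PEl (Fo K i) A"
    show "c B (l i B (PAct (Fo K i) f x)) = PAct L f (c A (l i A x))"
      using act[OF f lE[OF i _ x]] lact[OF i f x] Hom_Obj[OF f] by simp
  qed (use cL lE i in auto)
  have TMap_leg: "TMap (leg i) A x = c A (l i A x)" if "A \<in> Obj X" "x \<in> PEl (Fo K i) A" for i A x
    using that by (simp add: leg_def)
  have total: "Rst (PSh_jr X) (leg i) = Idn (PSh_jr X) (Fo K i)" if i: "i \<in> Obj J" for i
    unfolding PSh_total_iff[OF leg[OF i]]
    using rst lE[OF i] by (simp add: TMap_leg) (simp add: l_def)
  have "is_colimit (PSh_jr X) J K L leg"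
  proof (rule is_colimitI)
    show "is_cocone (PSh_jr X) J K L leg"
    proof (rule is_coconeI)
      fix u i j assume u: "u \<in> Hom J i j"
      have i: "i \<in> Obj J" and j: "j \<in> Obj J"
        using Jc.Hom_Obj[OF u] by auto
      have Ku: "Fa K u \<in> Hom (PSh_jr X) (Fo K i) (Fo K j)"
        "Rst (PSh_jr X) (Fa K u) = Idn (PSh_jr X) (Fo K i)"
        using is_functorD(2)[OF K u] by (auto simp: Hom_Total)
      show "leg j \<cdot>\<^bsub>PSh_jr X\<^esub> Fa K u = leg i"
      proof (rule PSh_eqI[OF PSh_comp_Hom[OF Ku(1) leg[OF j]] leg[OF i]])
        fix A x assume A: "A \<in> Obj X" and x: "x \<in> PEl (Fo K i) A"
        have "TMap (snd z j) A (TMap (Fa K u) A x) = TMap (snd z i) A x" if z: "z \<in> Coc" for z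
          using CocD(3)[OF z u] TMap_comp[OF Ku(1) A x, of "snd z j"] by simp
        then have "l j A (TMap (Fa K u) A x) = l i A x"
          using Ku(2)[unfolded PSh_total_iff[OF Ku(1)]] A x by (auto simp: l_def intro!: restrict_ext)
        then show "TMap (leg j \<cdot>\<^bsub>PSh_jr X\<^esub> Fa K u) A x = TMap (leg i) A x"
          using TMap_comp[OF Ku(1) A x] TMap_leg[OF A PSh_in[OF Ku(1) A x]] TMap_leg[OF A x] by simp
      qed
    qed (use L leg in auto)
  next
    fix Q k assume k: "is_cocone (PSh_jr X) J K Q k"
    then have z: "(Q, k) \<in> Coc"
      by (simp add: Coc_def)
    \<comment> \<open>The mediating map into \<open>Q\<close> is the projection to the coordinate
      that belongs to the given cocone.\<close>
    define p where "p A y = snd (inv_into (cEl A) (c A) y) (Q, k)" for A y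
    have p: "p A (c A x) = snd x (Q, k)" if "A \<in> Obj X" "x \<in> cEl A" for A x
      using that bij[OF that(1)] by (simp add: p_def bij_betw_def)
    have ex: "\<exists>x\<in>cEl A. y = c A x" if "A \<in> Obj X" "y \<in> PEl L A" for A y
      using bij[OF that(1)] that(2) by (auto simp: bij_betw_def)
    have h: "psh_arr X L Q p \<in> Hom (PSh_jr X) L Q"
    proof (intro psh_arrI category_axioms L)
      show "join_restriction_presheaf X Q"
        using CocD(1)[OF z] by simp
      show "p A y \<in> PEl Q A" if A: "A \<in> Obj X" and y: "y \<in> PEl L A" for A y
        using ex[OF A y] p[OF A] cElD(3)[OF _ z] by fastforce
      fix A B f y assume f: "f \<in> Hom X B A" and y: "y \<in> PEl L A"
      have AB: "A \<in> Obj X" "B \<in> Obj X"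
        using Hom_Obj[OF f] by auto
      obtain x where x: "x \<in> cEl A" "y = c A x"
        using ex[OF AB(1) y] by blast
      show "p B (PAct L f y) = PAct Q f (p A y)"
        using act[OF f x(1)] p[OF AB(1) x(1)] p[OF AB(2) cact_in[OF f x(1)]] x(2) z
        by (simp add: cact_def split_beta)
    qed
    have "psh_arr X L Q p \<cdot>\<^bsub>PSh_jr X\<^esub> leg i = k i" if i: "i \<in> Obj J" for i
    proof (rule PSh_eqI[OF PSh_comp_Hom[OF leg[OF i] h]])
      show "k i \<in> Hom (PSh_jr X) (Fo K i) Q"
        using CocD(2)[OF z i] by simp
      fix A x assume A: "A \<in> Obj X" and x: "x \<in> PEl (Fo K i) A"
      show "TMap (psh_arr X L Q p \<cdot>\<^bsub>PSh_jr X\<^esub> leg i) A x = TMap (k i) A x"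
        using TMap_comp[OF leg[OF i] A x] TMap_leg[OF A x] cL[OF A lE[OF i A x]] p[OF A lE[OF i A x]] A z
        by (simp add: l_def)
    qed
    with h show "\<exists>h\<in>Hom (PSh_jr X) L Q. \<forall>i\<in>Obj J. h \<cdot>\<^bsub>PSh_jr X\<^esub> leg i = k i"
      by blast
  next
    fix Q h h'
    assume h: "h \<in> Hom (PSh_jr X) L Q" and h': "h' \<in> Hom (PSh_jr X) L Q"
      and eq: "\<And>i. i \<in> Obj J \<Longrightarrow> h \<cdot>\<^bsub>PSh_jr X\<^esub> leg i = h' \<cdot>\<^bsub>PSh_jr X\<^esub> leg i"
    interpret L: jr_sheaf X "PEl L" "PAct L" "PRst L"
      using L by (rule jr_sheaf_psh)
    interpret Q: jr_sheaf X "PEl Q" "PAct Q" "PRst Q"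
      using PSh_HomD(2)[OF h] by (rule jr_sheaf_psh)
    show "h = h'"
    proof (rule PSh_eqI[OF h h'])
      fix A y assume A: "A \<in> Obj X" and y: "y \<in> PEl L A"
      have "y \<in> c A ` cEl A"
        using bij[OF A] y by (simp add: bij_betw_def)
      then obtain e q where x: "(e, q) \<in> cEl A" "y = c A (e, q)"
        by auto
      note E = cElD[OF x(1)]
      obtain D where D: "D \<subseteq> Idem X A" "is_join X A A D e" "\<forall>d\<in>D. local_at A q d"
        using E(5) by blast
      have "PRst L A y = e"
        using rst[OF A x(1)] x(2) by simp
      then have ye: "PAct L e y = y"
        using L.act_rst[OF A y] by simp
      show "TMap h A y = TMap h' A y"
      proof (rule Q.sep_cover[OF A D(1,2) PSh_in[OF h A y] PSh_in[OF h' A y]])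
        show "PAct Q e (TMap h A y) = TMap h A y" "PAct Q e (TMap h' A y) = TMap h' A y"
          using PSh_nat[OF h Idem_Hom[OF E(1)] y] PSh_nat[OF h' Idem_Hom[OF E(1)] y] ye by auto
        fix d assume d: "d \<in> D"
        then have dI: "d \<in> Idem X A"
          using D by auto
        obtain i x' where i: "i \<in> Obj J" and x': "x' \<in> PEl (Fo K i) A" "PRst (Fo K i) A x' = d"
          and qx: "\<And>z. z \<in> Coc \<Longrightarrow> PAct (fst z) d (q z) = TMap (snd z i) A x'"
          using D(3) d unfolding local_at_def by blast
        have ed: "e \<cdot> d = d"
          using D(2) d rle_Idem[OF dI] by (auto simp: is_join_def)
        \<comment> \<open>Over \<open>d\<close> the element is literally a value of the leg at
          \<open>i\<close>. Hence maps that agree on legs agree over each member of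
          \<open>D\<close>, and separation in \<open>Q\<close> finishes the uniqueness
          argument.\<close>
        have "cact d (e, q) = l i A x'"
          using ed Idem_rst[OF dI] qx x'(2) by (auto simp: cact_def l_def intro!: restrict_ext)
        then have "PAct L d y = TMap (leg i) A x'"
          using act[OF Idem_Hom[OF dI] x(1)] x(2) TMap_leg[OF A x'(1)] by simp
        then show "PAct Q d (TMap h A y) = PAct Q d (TMap h' A y)"
          using PSh_nat[OF h Idem_Hom[OF dI] y] PSh_nat[OF h' Idem_Hom[OF dI] y]
            TMap_comp[OF leg[OF i] A x'(1), of h] TMap_comp[OF leg[OF i] A x'(1), of h'] eq[OF i] by simp
      qed
    qed
  qed
  with total show ?thesis
    by blast
qed

end

lemma (in small_jr) cocomplete_PSh: "cocomplete TYPE('u) (PSh_jr X :: (('o, 'u, 'u) psh, _) rcat)"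
proof (rule restriction_category.cocompleteI[OF restriction_category_PSh PSh_split])
  fix J :: "('u, 'u) precat" and K
  assume "small_category TYPE('u) J"
    and "is_functor J (Total (PSh_jr X :: (('o, 'u, 'u) psh, _) rcat)) K"
  then interpret psh_diagram X J K
    by unfold_locales
  show "\<exists>c leg. is_colimit (PSh_jr X) J K c leg \<and>
      (\<forall>i\<in>Obj J. Rst (PSh_jr X) (leg i) = Idn (PSh_jr X) (Fo K i))"
    by (rule PSh_colimit)
qed

section \<open>Weighted colimits\<close>

text \<open>
  Cocones under K weighted by a restriction presheaf use partial maps out of the objects K A, so
  that they can be handled without splitting the restriction idempotents of the elements. The
  corresponding ordinary diagram on the category of elements does require these splittings.
\<close>

definition wcocone where
  "wcocone X El act C K d mu \<longleftrightarrow>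
     d \<in> Obj C \<and> (\<forall>A\<in>Obj X. \<forall>x\<in>El A. mu A x \<in> Hom C (Fo K A) d) \<and>
     (\<forall>A B. \<forall>f\<in>Hom X B A. \<forall>x\<in>El A. mu B (act f x) = mu A x \<cdot>\<^bsub>C\<^esub> Fa K f)"

text \<open>The condition on \<open>Rst C (lam A x)\<close> replaces totality of legs: the leg at
  \<open>x\<close> is defined exactly on the image of the domain of \<open>x\<close>. The cocones
  \<open>mu\<close> against which universality is tested are arbitrary partial ones.\<close>

definition wcolim where
  "wcolim X El act rst C K c lam \<longleftrightarrow>
     wcocone X El act C K c lam \<and> (\<forall>A\<in>Obj X. \<forall>x\<in>El A. Rst C (lam A x) = Fa K (rst A x)) \<and>
     (\<forall>d mu. wcocone X El act C K d mu \<longrightarrow>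
       (\<exists>!h. h \<in> Hom C c d \<and> (\<forall>A\<in>Obj X. \<forall>x\<in>El A. h \<cdot>\<^bsub>C\<^esub> lam A x = mu A x)))"

lemma wcoconeD:
  assumes "wcocone X El act C K d mu"
  shows "d \<in> Obj C" and "A \<in> Obj X \<Longrightarrow> x \<in> El A \<Longrightarrow> mu A x \<in> Hom C (Fo K A) d"
    and "f \<in> Hom X B A \<Longrightarrow> x \<in> El A \<Longrightarrow> mu B (act f x) = mu A x \<cdot>\<^bsub>C\<^esub> Fa K f"
  using assms by (auto simp: wcocone_def)

lemma wcolimD:
  assumes "wcolim X El act rst C K c lam"
  shows "wcocone X El act C K c lam" and "c \<in> Obj C"
    and "A \<in> Obj X \<Longrightarrow> x \<in> El A \<Longrightarrow> lam A x \<in> Hom C (Fo K A) c"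
    and "f \<in> Hom X B A \<Longrightarrow> x \<in> El A \<Longrightarrow> lam B (act f x) = lam A x \<cdot>\<^bsub>C\<^esub> Fa K f"
    and "A \<in> Obj X \<Longrightarrow> x \<in> El A \<Longrightarrow> Rst C (lam A x) = Fa K (rst A x)"
    and "wcocone X El act C K d mu \<Longrightarrow>
      \<exists>h\<in>Hom C c d. \<forall>A\<in>Obj X. \<forall>x\<in>El A. h \<cdot>\<^bsub>C\<^esub> lam A x = mu A x"
proof -
  show c: "wcocone X El act C K c lam"
    using assms by (simp add: wcolim_def)
  show "c \<in> Obj C" "A \<in> Obj X \<Longrightarrow> x \<in> El A \<Longrightarrow> lam A x \<in> Hom C (Fo K A) c"
    "f \<in> Hom X B A \<Longrightarrow> x \<in> El A \<Longrightarrow> lam B (act f x) = lam A x \<cdot>\<^bsub>C\<^esub> Fa K f"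
    using wcoconeD[OF c] by auto
  show "A \<in> Obj X \<Longrightarrow> x \<in> El A \<Longrightarrow> Rst C (lam A x) = Fa K (rst A x)"
    using assms by (simp add: wcolim_def)
  assume mu: "wcocone X El act C K d mu"
  have "\<exists>!h. h \<in> Hom C c d \<and> (\<forall>A\<in>Obj X. \<forall>x\<in>El A. h \<cdot>\<^bsub>C\<^esub> lam A x = mu A x)"
    using assms mu by (simp add: wcolim_def)
  then show "\<exists>h\<in>Hom C c d. \<forall>A\<in>Obj X. \<forall>x\<in>El A. h \<cdot>\<^bsub>C\<^esub> lam A x = mu A x"
    by blast
qed

lemma wcocone_postcomp:
  assumes X: "category X" and C: "category C" and K: "is_functor X C K"
    and c: "wcocone X El act C K c lam" and h: "h \<in> Hom C c d"
  shows "wcocone X El act C K d (\<lambda>A x. h \<cdot>\<^bsub>C\<^esub> lam A x)"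
  unfolding wcocone_def
proof (intro conjI ballI allI)
  interpret category C by fact
  note D = wcoconeD[OF c]
  show "d \<in> Obj C"
    using Hom_Obj[OF h] by simp
  show "h \<cdot>\<^bsub>C\<^esub> lam A x \<in> Hom C (Fo K A) d" if "A \<in> Obj X" "x \<in> El A" for A x
    using comp_in_Hom[OF D(2)[OF that] h] .
  fix A B f x assume f: "f \<in> Hom X B A" and x: "x \<in> El A"
  have "A \<in> Obj X"
    using category.Hom_Obj[OF X f] by simp
  then show "h \<cdot>\<^bsub>C\<^esub> lam B (act f x) = h \<cdot>\<^bsub>C\<^esub> lam A x \<cdot>\<^bsub>C\<^esub> Fa K f"
    using D(3)[OF f x] comp_assoc[OF is_functorD(2)[OF K f] D(2)[OF _ x] h] by simp
qed

lemma wcolim_epi: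
  assumes X: "category X" and C: "category C" and K: "is_functor X C K"
    and c: "wcolim X El act rst C K c lam" and h: "h \<in> Hom C c d" "h' \<in> Hom C c d"
    and eq: "\<And>A x. A \<in> Obj X \<Longrightarrow> x \<in> El A \<Longrightarrow> h \<cdot>\<^bsub>C\<^esub> lam A x = h' \<cdot>\<^bsub>C\<^esub> lam A x"
  shows "h = h'"
proof -
  have "wcocone X El act C K d (\<lambda>A x. h \<cdot>\<^bsub>C\<^esub> lam A x)"
    using wcocone_postcomp[OF X C K wcolimD(1)[OF c] h(1)] .
  then have "\<exists>!g. g \<in> Hom C c d \<and> (\<forall>A\<in>Obj X. \<forall>x\<in>El A. g \<cdot>\<^bsub>C\<^esub> lam A x = h \<cdot>\<^bsub>C\<^esub> lam A x)"
    using c by (simp add: wcolim_def)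
  moreover have "\<forall>A\<in>Obj X. \<forall>x\<in>El A. h' \<cdot>\<^bsub>C\<^esub> lam A x = h \<cdot>\<^bsub>C\<^esub> lam A x"
    using eq by simp
  ultimately show ?thesis
    using h by blast
qed

lemma wcolimI:
  assumes "wcocone X El act C K c lam"
    and "\<And>A x. A \<in> Obj X \<Longrightarrow> x \<in> El A \<Longrightarrow> Rst C (lam A x) = Fa K (rst A x)"
    and "\<And>d mu. wcocone X El act C K d mu \<Longrightarrow>
      \<exists>h\<in>Hom C c d. \<forall>A\<in>Obj X. \<forall>x\<in>El A. h \<cdot>\<^bsub>C\<^esub> lam A x = mu A x"
    and "\<And>d h h'. h \<in> Hom C c d \<Longrightarrow> h' \<in> Hom C c d \<Longrightarrow>
      (\<And>A x. A \<in> Obj X \<Longrightarrow> x \<in> El A \<Longrightarrow> h \<cdot>\<^bsub>C\<^esub> lam A x = h' \<cdot>\<^bsub>C\<^esub> lam A x) \<Longrightarrow> h = h'"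
  shows "wcolim X El act rst C K c lam"
  unfolding wcolim_def
proof (intro conjI allI impI ballI)
  fix d mu assume "wcocone X El act C K d mu"
  then obtain h where h: "h \<in> Hom C c d" "\<forall>A\<in>Obj X. \<forall>x\<in>El A. h \<cdot>\<^bsub>C\<^esub> lam A x = mu A x"
    using assms(3) by blast
  show "\<exists>!h. h \<in> Hom C c d \<and> (\<forall>A\<in>Obj X. \<forall>x\<in>El A. h \<cdot>\<^bsub>C\<^esub> lam A x = mu A x)"
  proof (intro ex1I[of _ h] conjI h)
    fix g assume "g \<in> Hom C c d \<and> (\<forall>A\<in>Obj X. \<forall>x\<in>El A. g \<cdot>\<^bsub>C\<^esub> lam A x = mu A x)"
    then show "g = h"
      using assms(4)[of g d h] h by simp
  qed
qed (use assms(1,2) in auto)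

lemma (in restriction_category) wcolim_rst_comp:
  assumes c: "wcolim Y El act rst X K c lam" and h: "h \<in> Hom X c d"
    and A: "A \<in> Obj Y" "x \<in> El A"
  shows "Rst X h \<cdot> lam A x = lam A x \<cdot> Rst X (h \<cdot> lam A x)"
  using R4[OF wcolimD(3)[OF c A] h] .

lemma (in restriction_category) wcolim_total:
  assumes Y: "category Y" and K: "is_functor Y X K"
    and c: "wcolim Y El act rst X K c lam" and h: "h \<in> Hom X c d"
    and t: "\<And>A x. A \<in> Obj Y \<Longrightarrow> x \<in> El A \<Longrightarrow> Rst X (h \<cdot> lam A x) = Rst X (lam A x)"
  shows "Rst X h = Idn X c"
proof (rule wcolim_epi[OF Y category_axioms K c rst_in_Hom[OF h]])
  show "Idn X c \<in> Hom X c c"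
    using wcolimD(2)[OF c] by (rule idn_in_Hom)
  fix A x assume A: "A \<in> Obj Y" "x \<in> El A"
  show "Rst X h \<cdot> lam A x = Idn X c \<cdot> lam A x"
    using wcolim_rst_comp[OF c h A] t[OF A] R1[OF wcolimD(3)[OF c A]]
      comp_idn_left[OF wcolimD(3)[OF c A]] by simp
qed

text \<open>The category of elements. An arrow is coded by \<open>f\<close> and its target element
  \<open>y\<close>; its source is forced to be \<open>act f y\<close>.\<close>

definition elcat ::
  "('o, 'a, 'c) rcat_scheme \<Rightarrow> ('o \<Rightarrow> 'z set) \<Rightarrow> ('a \<Rightarrow> 'z \<Rightarrow> 'z) \<Rightarrow> ('o \<times> 'z, 'a \<times> 'z) precat" where
  "elcat X El act =
     \<lparr>Obj = Sigma (Obj X) El, Arr = Sigma (Arr X) (\<lambda>f. El (Cod X f)),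
      Dom = (\<lambda>(f, y). (Dom X f, act f y)), Cod = (\<lambda>(f, y). (Cod X f, y)),
      Idn = (\<lambda>(A, x). (Idn X A, x)), Comp = (\<lambda>(g, z) (f, y). (g \<cdot>\<^bsub>X\<^esub> f, z))\<rparr>"

lemma elcat_simps [simp]:
  "Obj (elcat X El act) = Sigma (Obj X) El"
  "Arr (elcat X El act) = Sigma (Arr X) (\<lambda>f. El (Cod X f))"
  "Dom (elcat X El act) (f, y) = (Dom X f, act f y)"
  "Cod (elcat X El act) (f, y) = (Cod X f, y)"
  "Idn (elcat X El act) (A, x) = (Idn X A, x)"
  "Comp (elcat X El act) (g, z) (f, y) = (g \<cdot>\<^bsub>X\<^esub> f, z)"
  by (simp_all add: elcat_def)

lemma Hom_elcat:
  "u \<in> Hom (elcat X El act) p q \<longleftrightarrow>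
     (\<exists>A B f y. f \<in> Hom X B A \<and> y \<in> El A \<and> u = (f, y) \<and> p = (B, act f y) \<and> q = (A, y))"
  by (cases u) (auto simp: Hom_def)

lemma (in rpresheaf) category_elcat: "category (elcat X El act)"
proof
  fix p q r s u v w
  assume u: "u \<in> Hom (elcat X El act) p q" and v: "v \<in> Hom (elcat X El act) q r"
  obtain A B f y where f: "f \<in> Hom X B A" "y \<in> El A" "u = (f, y)" "p = (B, act f y)" "q = (A, y)"
    using u unfolding Hom_elcat by blast
  obtain D g z where g: "g \<in> Hom X A D" "z \<in> El D" "v = (g, z)" "act g z = y" "r = (D, z)"
    using v f unfolding Hom_elcat by auto
  have gf: "g \<cdot> f \<in> Hom X B D" "act (g \<cdot> f) z = act f y"
    using f g comp_in_Hom act_comp[OF f(1) g(1,2)] by auto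
  then show "Comp (elcat X El act) v u \<in> Hom (elcat X El act) p r"
    using f g unfolding Hom_elcat by auto
  assume w: "w \<in> Hom (elcat X El act) r s"
  then obtain E h c where h: "h \<in> Hom X D E" "w = (h, c)"
    using g unfolding Hom_elcat by auto
  show "Comp (elcat X El act) (Comp (elcat X El act) w v) u
      = Comp (elcat X El act) w (Comp (elcat X El act) v u)"
    using f g h comp_assoc[OF f(1) g(1) h(1)] by simp
next
  fix p q u assume u: "u \<in> Hom (elcat X El act) p q"
  obtain A B f y where f: "f \<in> Hom X B A" "y \<in> El A" "u = (f, y)" "p = (B, act f y)" "q = (A, y)"
    using u unfolding Hom_elcat by blast
  show "Comp (elcat X El act) u (Idn (elcat X El act) p) = u"
    "Comp (elcat X El act) (Idn (elcat X El act) q) u = u"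
    using f comp_idn_right[OF f(1)] comp_idn_left[OF f(1)] by simp_all
next
  fix p assume "p \<in> Obj (elcat X El act)"
  then obtain A x where p: "p = (A, x)" "A \<in> Obj X" "x \<in> El A"
    by auto
  show "Idn (elcat X El act) p \<in> Hom (elcat X El act) p p"
    unfolding Hom_elcat
    using p idn_in_Hom act_idn by (intro exI[of _ A] exI[of _ "Idn X A"] exI[of _ x]) auto
next
  fix u assume "u \<in> Arr (elcat X El act)"
  then show "Dom (elcat X El act) u \<in> Obj (elcat X El act)"
    "Cod (elcat X El act) u \<in> Obj (elcat X El act)"
    using act_in[OF Arr_Hom] by (auto simp: dom_in_Obj cod_in_Obj)
qed

lemma (in rpresheaf) small_elcat:
  assumes "universe TYPE('u)" "small TYPE('u) (Obj X)" "small TYPE('u) (Arr X)"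
    and "\<And>A. A \<in> Obj X \<Longrightarrow> small TYPE('u) (El A)"
  shows "small_category TYPE('u) (elcat X El act)"
  unfolding small_category_def
  using category_elcat small_Sigma[OF assms(1,2,4)] small_Sigma[OF assms(1,3), of "\<lambda>f. El (Cod X f)"]
    assms(4)[OF cod_in_Obj] by simp

text \<open>\<open>b A x\<close> is the domain of definition of \<open>x\<close> made into an
  object: it splits the idempotent \<open>Fa K (rst A x)\<close>, with inclusion \<open>m\<close>
  and partial retraction \<open>r\<close>.\<close>

locale weighted_diagram = rpresheaf X El act rst + C: restriction_category C
  for X :: "('o, 'a, 'c) rcat_scheme" (structure)
    and El :: "'o \<Rightarrow> 'z set" and act :: "'a \<Rightarrow> 'z \<Rightarrow> 'z" and rst :: "'o \<Rightarrow> 'z \<Rightarrow> 'a"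
    and C :: "('p, 'b, 'd) rcat_scheme" +
  fixes K :: "('o, 'a, 'p, 'b) func" and b :: "'o \<Rightarrow> 'z \<Rightarrow> 'p" and m r :: "'o \<Rightarrow> 'z \<Rightarrow> 'b"
  assumes K: "is_restriction_functor X C K"
    and m_Hom: "A \<in> Obj X \<Longrightarrow> x \<in> El A \<Longrightarrow> m A x \<in> Hom C (b A x) (Fo K A)"
    and r_Hom: "A \<in> Obj X \<Longrightarrow> x \<in> El A \<Longrightarrow> r A x \<in> Hom C (Fo K A) (b A x)"
    and mr: "A \<in> Obj X \<Longrightarrow> x \<in> El A \<Longrightarrow> m A x \<cdot>\<^bsub>C\<^esub> r A x = Fa K (rst A x)"
    and rm: "A \<in> Obj X \<Longrightarrow> x \<in> El A \<Longrightarrow> r A x \<cdot>\<^bsub>C\<^esub> m A x = Idn C (b A x)"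
begin

text \<open>On an arrow this is \<open>Fa K f\<close> cut down to the domains of the two elements;
  it is total although \<open>Fa K f\<close> need not be (\<open>diag_Hom\<close>).\<close>

definition diag where
  "diag = \<lparr>Fo = (\<lambda>(A, x) \<in> Obj (elcat X El act). b A x),
    Fa = (\<lambda>(f, y) \<in> Arr (elcat X El act).
      r (Cod X f) y \<cdot>\<^bsub>C\<^esub> (Fa K f \<cdot>\<^bsub>C\<^esub> m (Dom X f) (act f y)))\<rparr>"

lemma diag_simps [simp]:
  "A \<in> Obj X \<Longrightarrow> x \<in> El A \<Longrightarrow> Fo diag (A, x) = b A x"
  "f \<in> Hom X B A \<Longrightarrow> y \<in> El A \<Longrightarrow>
     Fa diag (f, y) = r A y \<cdot>\<^bsub>C\<^esub> (Fa K f \<cdot>\<^bsub>C\<^esub> m B (act f y))"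
  by (auto simp: diag_def Hom_def)

lemma K_functor: "is_functor X C K"
  using K by (simp add: is_restriction_functor_def)

lemmas KD = is_functorD[OF K_functor]

lemma K_rst: "f \<in> Hom X A B \<Longrightarrow> Fa K (Rst X f) = Rst C (Fa K f)"
  using K by (auto simp: is_restriction_functor_def Hom_def)

lemma m_total: "A \<in> Obj X \<Longrightarrow> x \<in> El A \<Longrightarrow> Rst C (m A x) = Idn C (b A x)"
  using C.total_cancel[OF m_Hom r_Hom] C.rst_idn C.Hom_Obj[OF m_Hom] rm by simp

lemma r_rst: "A \<in> Obj X \<Longrightarrow> x \<in> El A \<Longrightarrow> Rst C (r A x) = Fa K (rst A x)"
  using C.rst_comp_total[OF r_Hom m_Hom m_total] mr K_rst[OF Idem_Hom[OF rst_el]] Idem_rst[OF rst_el]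
  by simp

lemma K_m: "A \<in> Obj X \<Longrightarrow> x \<in> El A \<Longrightarrow> Fa K (rst A x) \<cdot>\<^bsub>C\<^esub> m A x = m A x"
  using C.comp_assoc[OF m_Hom r_Hom m_Hom] C.comp_idn_right[OF m_Hom] mr rm by metis

lemma r_K: "A \<in> Obj X \<Longrightarrow> x \<in> El A \<Longrightarrow> r A x \<cdot>\<^bsub>C\<^esub> Fa K (rst A x) = r A x"
  using C.comp_assoc[OF r_Hom m_Hom r_Hom] C.comp_idn_left[OF r_Hom] mr rm by metis

lemma K_rst_comp:
  assumes f: "f \<in> Hom X B A" and y: "y \<in> El A"
  shows "Fa K (rst A y) \<cdot>\<^bsub>C\<^esub> Fa K f = Fa K f \<cdot>\<^bsub>C\<^esub> Fa K (rst B (act f y))"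
proof -
  have A: "A \<in> Obj X" "B \<in> Obj X"
    using Hom_Obj[OF f] by auto
  note e = rst_el[OF A(1) y] and e' = rst_el[OF A(2) act_in[OF f y]]
  have "rst A y \<cdot> f = f \<cdot> rst B (act f y)"
    using R4[OF f Idem_Hom[OF e]] Idem_rst[OF e] rst_act[OF f y] by simp
  then show ?thesis
    using KD(4)[OF f Idem_Hom[OF e]] KD(4)[OF Idem_Hom[OF e'] f] by simp
qed

lemma K_rst_comp_m:
  assumes f: "f \<in> Hom X B A" and y: "y \<in> El A"
  shows "Fa K (rst A y) \<cdot>\<^bsub>C\<^esub> (Fa K f \<cdot>\<^bsub>C\<^esub> m B (act f y)) = Fa K f \<cdot>\<^bsub>C\<^esub> m B (act f y)"
proof -
  have A: "A \<in> Obj X" "B \<in> Obj X"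
    using Hom_Obj[OF f] by auto
  note fy = act_in[OF f y]
  note e = KD(2)[OF Idem_Hom[OF rst_el[OF A(1) y]]] and e' = KD(2)[OF Idem_Hom[OF rst_el[OF A(2) fy]]]
  show ?thesis
    using C.comp_assoc[OF m_Hom[OF A(2) fy] KD(2)[OF f] e] K_rst_comp[OF f y]
      C.comp_assoc[OF m_Hom[OF A(2) fy] e' KD(2)[OF f]] K_m[OF A(2) fy] by simp
qed

text \<open>Together with \<open>diag_r\<close> this expresses that the inclusions \<open>m\<close>
  and the retractions \<open>r\<close> are natural. The translation between weighted and ordinary
  cocones rests on these two equations.\<close>

lemma m_diag:
  assumes f: "f \<in> Hom X B A" and y: "y \<in> El A"
  shows "m A y \<cdot>\<^bsub>C\<^esub> Fa diag (f, y) = Fa K f \<cdot>\<^bsub>C\<^esub> m B (act f y)"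
proof -
  have A: "A \<in> Obj X" "B \<in> Obj X"
    using Hom_Obj[OF f] by auto
  show ?thesis
    using C.comp_assoc[OF C.comp_in_Hom[OF m_Hom[OF A(2) act_in[OF f y]] KD(2)[OF f]] r_Hom[OF A(1) y] m_Hom[OF A(1) y]]
      K_rst_comp_m[OF f y] mr[OF A(1) y] f y by simp
qed

lemma diag_r:
  assumes f: "f \<in> Hom X B A" and y: "y \<in> El A"
  shows "Fa diag (f, y) \<cdot>\<^bsub>C\<^esub> r B (act f y) = r A y \<cdot>\<^bsub>C\<^esub> Fa K f"
proof -
  have A: "A \<in> Obj X" "B \<in> Obj X"
    using Hom_Obj[OF f] by auto
  note fy = act_in[OF f y]
  note mf = m_Hom[OF A(2) fy] and rf = r_Hom[OF A(2) fy] and ra = r_Hom[OF A(1) y] and Kf = KD(2)[OF f]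
  note e = KD(2)[OF Idem_Hom[OF rst_el[OF A(1) y]]]
  have "Fa diag (f, y) \<cdot>\<^bsub>C\<^esub> r B (act f y) = r A y \<cdot>\<^bsub>C\<^esub> (Fa K f \<cdot>\<^bsub>C\<^esub> Fa K (rst B (act f y)))"
    using C.comp_assoc[OF rf C.comp_in_Hom[OF mf Kf] ra] C.comp_assoc[OF rf mf Kf] mr[OF A(2) fy] f y
    by simp
  also have "\<dots> = r A y \<cdot>\<^bsub>C\<^esub> Fa K (rst A y) \<cdot>\<^bsub>C\<^esub> Fa K f"
    using K_rst_comp[OF f y] C.comp_assoc[OF Kf e ra] by simp
  finally show ?thesis
    using r_K[OF A(1) y] by simp
qed

lemma diag_Hom:
  assumes f: "f \<in> Hom X B A" and y: "y \<in> El A"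
  shows "Fa diag (f, y) \<in> Hom C (b B (act f y)) (b A y)"
    and "Rst C (Fa diag (f, y)) = Idn C (b B (act f y))"
proof -
  have A: "A \<in> Obj X" "B \<in> Obj X"
    using Hom_Obj[OF f] by auto
  note fy = act_in[OF f y]
  note mf = m_Hom[OF A(2) fy] and rf = r_Hom[OF A(2) fy] and ra = r_Hom[OF A(1) y] and Kf = KD(2)[OF f]
  note Kfm = C.comp_in_Hom[OF mf Kf]
  show d: "Fa diag (f, y) \<in> Hom C (b B (act f y)) (b A y)"
    using C.comp_in_Hom[OF Kfm ra] f y by simp
  \<comment> \<open>The domain of \<open>act f y\<close> lies inside that of \<open>f\<close>, so
    \<open>Fa K f\<close> is defined on all of \<open>b B (act f y)\<close>.\<close>
  have e: "Rst X f \<cdot> rst B (act f y) = rst B (act f y)"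
    using rst_comp_le[OF f Idem_Hom[OF rst_el[OF A(1) y]]] rst_act[OF f y]
      Idem_commute[OF rst_Idem[OF f] rst_el[OF A(2) fy]] by simp
  have "Fa K (Rst X f) \<cdot>\<^bsub>C\<^esub> m B (act f y) = Fa K (Rst X f \<cdot> rst B (act f y)) \<cdot>\<^bsub>C\<^esub> m B (act f y)"
    using C.comp_assoc[OF mf KD(2)[OF Idem_Hom[OF rst_el[OF A(2) fy]]] KD(2)[OF rst_in_Hom[OF f]]]
      KD(4)[OF Idem_Hom[OF rst_el[OF A(2) fy]] rst_in_Hom[OF f]] K_m[OF A(2) fy] by simp
  then have *: "Fa K (Rst X f) \<cdot>\<^bsub>C\<^esub> m B (act f y) = m B (act f y)"
    using e K_m[OF A(2) fy] by simp
  have "Rst C (Fa diag (f, y)) = Rst C (m A y \<cdot>\<^bsub>C\<^esub> Fa diag (f, y))"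
    using C.rst_comp_total[OF d m_Hom[OF A(1) y] m_total[OF A(1) y]] by simp
  also have "\<dots> = Rst C (Fa K f \<cdot>\<^bsub>C\<^esub> m B (act f y))"
    using m_diag[OF f y] by simp
  also have "\<dots> = Rst C (Fa K (Rst X f) \<cdot>\<^bsub>C\<^esub> m B (act f y))"
    using C.rst_comp_rst[OF mf Kf] K_rst[OF f] by simp
  also have "\<dots> = Idn C (b B (act f y))"
    using * m_total[OF A(2) fy] by simp
  finally show "Rst C (Fa diag (f, y)) = Idn C (b B (act f y))" .
qed

lemma diag_functor: "is_functor (elcat X El act) (Total C) diag"
proof (rule is_functorI)
  show "Fo diag \<in> extensional (Obj (elcat X El act))" "Fa diag \<in> extensional (Arr (elcat X El act))"
    by (simp_all add: diag_def)
next
  fix p assume "p \<in> Obj (elcat X El act)"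
  then obtain A x where p: "p = (A, x)" "A \<in> Obj X" "x \<in> El A"
    by auto
  show "Fo diag p \<in> Obj (Total C)"
    using p C.Hom_Obj[OF m_Hom[OF p(2,3)]] by simp
  show "Fa diag (Idn (elcat X El act) p) = Idn (Total C) (Fo diag p)"
    using p KD(3)[OF p(2)] act_idn[OF p(2,3)] C.comp_idn_left[OF m_Hom[OF p(2,3)]] rm[OF p(2,3)]
      diag_simps(2)[OF idn_in_Hom[OF p(2)] p(3)] by simp
next
  fix u p q assume "u \<in> Hom (elcat X El act) p q"
  then obtain A B f y where f: "f \<in> Hom X B A" "y \<in> El A" "u = (f, y)" "p = (B, act f y)" "q = (A, y)"
    unfolding Hom_elcat by blast
  then show "Fa diag u \<in> Hom (Total C) (Fo diag p) (Fo diag q)"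
    using diag_Hom[OF f(1,2)] act_in[OF f(1,2)] Hom_Obj[OF f(1)] by (simp add: Hom_Total del: diag_simps(2))
next
  fix u v p q s assume u: "u \<in> Hom (elcat X El act) p q" and v: "v \<in> Hom (elcat X El act) q s"
  obtain A B f y where f: "f \<in> Hom X B A" "y \<in> El A" "u = (f, y)" "p = (B, act f y)" "q = (A, y)"
    using u unfolding Hom_elcat by blast
  obtain D g z where g: "g \<in> Hom X A D" "z \<in> El D" "v = (g, z)" "act g z = y" "s = (D, z)"
    using v f unfolding Hom_elcat by auto
  have A: "A \<in> Obj X" "B \<in> Obj X" "D \<in> Obj X"
    using Hom_Obj[OF f(1)] Hom_Obj[OF g(1)] by auto
  note mf = m_Hom[OF A(2) act_in[OF f(1,2)]] and Kf = KD(2)[OF f(1)] and Kg = KD(2)[OF g(1)]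
    and rz = r_Hom[OF A(3) g(2)] and my = m_Hom[OF A(1) f(2)]
  have "Fa diag v \<cdot>\<^bsub>C\<^esub> Fa diag u = r D z \<cdot>\<^bsub>C\<^esub> (Fa K g \<cdot>\<^bsub>C\<^esub> (m A y \<cdot>\<^bsub>C\<^esub> Fa diag (f, y)))"
    using g f(3) C.comp_assoc[OF diag_Hom(1)[OF f(1,2)] C.comp_in_Hom[OF my Kg] rz]
      C.comp_assoc[OF diag_Hom(1)[OF f(1,2)] my Kg] diag_simps(2)[OF g(1,2)]
    by (simp del: diag_simps(2))
  also have "\<dots> = r D z \<cdot>\<^bsub>C\<^esub> (Fa K (g \<cdot> f) \<cdot>\<^bsub>C\<^esub> m B (act f y))"
    using m_diag[OF f(1,2)] C.comp_assoc[OF mf Kf Kg] KD(4)[OF f(1) g(1)] by simp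
  also have "\<dots> = Fa diag (g \<cdot> f, z)"
    using diag_simps(2)[OF comp_in_Hom[OF f(1) g(1)] g(2)] act_comp[OF f(1) g(1,2)] g(4) by simp
  finally show "Fa diag (Comp (elcat X El act) v u) = Fa diag v \<cdot>\<^bsub>Total C\<^esub> Fa diag u"
    using f(3) g(3) by simp
qed

lemma diag_functor_C: "is_functor (elcat X El act) C diag"
  using diag_functor by (rule C.is_functor_Total)

lemma wcocone_K_rst:
  assumes mu: "wcocone X El act C K d mu" and A: "A \<in> Obj X" "x \<in> El A"
  shows "mu A x \<cdot>\<^bsub>C\<^esub> Fa K (rst A x) = mu A x"
  using wcoconeD(3)[OF mu Idem_Hom[OF rst_el[OF A]] A(2)] act_rst[OF A] by simp

text \<open>Composing with \<open>m\<close> turns weighted cocones into ordinary ones, and composing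
  with \<open>r\<close> turns them back. The passages are mutually inverse by
  \<open>wcocone_m_r\<close> and \<open>is_cocone_r_m\<close>, so universal properties can be
  exchanged.\<close>

lemma is_cocone_of_wcocone:
  assumes mu: "wcocone X El act C K d mu"
  shows "is_cocone C (elcat X El act) diag d (\<lambda>(A, x). mu A x \<cdot>\<^bsub>C\<^esub> m A x)"
proof (rule is_coconeI)
  note D = wcoconeD[OF mu]
  fix u p q assume "u \<in> Hom (elcat X El act) p q"
  then obtain A B f y where f: "f \<in> Hom X B A" "y \<in> El A" "u = (f, y)" "p = (B, act f y)" "q = (A, y)"
    unfolding Hom_elcat by blast
  have A: "A \<in> Obj X" "B \<in> Obj X"
    using Hom_Obj[OF f(1)] by auto
  have "mu A y \<cdot>\<^bsub>C\<^esub> m A y \<cdot>\<^bsub>C\<^esub> Fa diag (f, y) = mu A y \<cdot>\<^bsub>C\<^esub> (Fa K f \<cdot>\<^bsub>C\<^esub> m B (act f y))"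
    using C.comp_assoc[OF diag_Hom(1)[OF f(1,2)] m_Hom[OF A(1) f(2)] D(2)[OF A(1) f(2)]] m_diag[OF f(1,2)]
    by simp
  also have "\<dots> = mu B (act f y) \<cdot>\<^bsub>C\<^esub> m B (act f y)"
    using C.comp_assoc[OF m_Hom[OF A(2) act_in[OF f(1,2)]] KD(2)[OF f(1)] D(2)[OF A(1) f(2)]] D(3)[OF f(1,2)]
    by simp
  finally show "(case q of (A, x) \<Rightarrow> mu A x \<cdot>\<^bsub>C\<^esub> m A x) \<cdot>\<^bsub>C\<^esub> Fa diag u = (case p of (A, x) \<Rightarrow> mu A x \<cdot>\<^bsub>C\<^esub> m A x)"
    using f by (simp del: diag_simps(2))
qed (use wcoconeD[OF mu] C.comp_in_Hom[OF m_Hom wcoconeD(2)[OF mu]] in auto)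

lemma wcocone_of_is_cocone:
  assumes k: "is_cocone C (elcat X El act) diag d k"
  shows "wcocone X El act C K d (\<lambda>A x. k (A, x) \<cdot>\<^bsub>C\<^esub> r A x)"
  unfolding wcocone_def
proof (intro conjI ballI allI)
  note D = is_coconeD[OF k]
  have kH: "k (A, x) \<in> Hom C (b A x) d" if "A \<in> Obj X" "x \<in> El A" for A x
    using D(2)[of "(A, x)"] that by simp
  show "d \<in> Obj C"
    by (rule D(1))
  show "k (A, x) \<cdot>\<^bsub>C\<^esub> r A x \<in> Hom C (Fo K A) d" if "A \<in> Obj X" "x \<in> El A" for A x
    using C.comp_in_Hom[OF r_Hom[OF that] kH[OF that]] .
  fix A B f y assume f: "f \<in> Hom X B A" and y: "y \<in> El A"
  have A: "A \<in> Obj X" "B \<in> Obj X"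
    using Hom_Obj[OF f] by auto
  have "(f, y) \<in> Hom (elcat X El act) (B, act f y) (A, y)"
    using f y unfolding Hom_elcat by blast
  from D(3)[OF this] have "k (B, act f y) \<cdot>\<^bsub>C\<^esub> r B (act f y) = k (A, y) \<cdot>\<^bsub>C\<^esub> Fa diag (f, y) \<cdot>\<^bsub>C\<^esub> r B (act f y)"
    by simp
  also have "\<dots> = k (A, y) \<cdot>\<^bsub>C\<^esub> (r A y \<cdot>\<^bsub>C\<^esub> Fa K f)"
    using C.comp_assoc[OF r_Hom[OF A(2) act_in[OF f y]] diag_Hom(1)[OF f y] kH[OF A(1) y]] diag_r[OF f y]
    by simp
  also have "\<dots> = k (A, y) \<cdot>\<^bsub>C\<^esub> r A y \<cdot>\<^bsub>C\<^esub> Fa K f"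
    using C.comp_assoc[OF KD(2)[OF f] r_Hom[OF A(1) y] kH[OF A(1) y]] by simp
  finally show "k (B, act f y) \<cdot>\<^bsub>C\<^esub> r B (act f y) = k (A, y) \<cdot>\<^bsub>C\<^esub> r A y \<cdot>\<^bsub>C\<^esub> Fa K f" .
qed

lemma wcocone_m_r:
  assumes mu: "wcocone X El act C K d mu" and A: "A \<in> Obj X" "x \<in> El A"
  shows "mu A x \<cdot>\<^bsub>C\<^esub> m A x \<cdot>\<^bsub>C\<^esub> r A x = mu A x"
  using C.comp_assoc[OF r_Hom[OF A] m_Hom[OF A] wcoconeD(2)[OF mu A]] mr[OF A] wcocone_K_rst[OF mu A]
  by simp

lemma is_cocone_r_m:
  assumes k: "is_cocone C (elcat X El act) diag d k" and A: "A \<in> Obj X" "x \<in> El A"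
  shows "k (A, x) \<cdot>\<^bsub>C\<^esub> r A x \<cdot>\<^bsub>C\<^esub> m A x = k (A, x)"
proof -
  have kH: "k (A, x) \<in> Hom C (b A x) d"
    using is_coconeD(2)[OF k, of "(A, x)"] A by simp
  show ?thesis
    using C.comp_assoc[OF m_Hom[OF A] r_Hom[OF A] kH] rm[OF A] C.comp_idn_right[OF kH] by simp
qed

lemma is_colimit_of_wcolim:
  assumes c: "wcolim X El act rst C K c lam"
  shows "is_colimit (Total C) (elcat X El act) diag c (\<lambda>(A, x). lam A x \<cdot>\<^bsub>C\<^esub> m A x)"
proof (rule C.is_colimit_imp_Total[OF category_elcat diag_functor])
  note D = wcolimD[OF c]
  have lm: "Rst C (lam A x \<cdot>\<^bsub>C\<^esub> m A x) = Idn C (b A x)" if A: "A \<in> Obj X" "x \<in> El A" for A x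
    using C.rst_comp_rst[OF m_Hom[OF A] D(3)[OF A]] D(5)[OF A] K_m[OF A] m_total[OF A] by simp
  then show "Rst C (case p of (A, x) \<Rightarrow> lam A x \<cdot>\<^bsub>C\<^esub> m A x) = Idn C (Fo diag p)"
    if "p \<in> Obj (elcat X El act)" for p
    using that by auto
  show "is_colimit C (elcat X El act) diag c (\<lambda>(A, x). lam A x \<cdot>\<^bsub>C\<^esub> m A x)"
  proof (rule is_colimitI)
    show "is_cocone C (elcat X El act) diag c (\<lambda>(A, x). lam A x \<cdot>\<^bsub>C\<^esub> m A x)"
      using D(1) by (rule is_cocone_of_wcocone)
  next
    fix d k assume k: "is_cocone C (elcat X El act) diag d k"
    obtain h where h: "h \<in> Hom C c d" "\<And>A x. A \<in> Obj X \<Longrightarrow> x \<in> El A \<Longrightarrow> h \<cdot>\<^bsub>C\<^esub> lam A x = k (A, x) \<cdot>\<^bsub>C\<^esub> r A x"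
      using D(6)[OF wcocone_of_is_cocone[OF k]] by blast
    have "h \<cdot>\<^bsub>C\<^esub> (lam A x \<cdot>\<^bsub>C\<^esub> m A x) = k (A, x)" if A: "A \<in> Obj X" "x \<in> El A" for A x
      using C.comp_assoc[OF m_Hom[OF A] D(3)[OF A] h(1)] h(2)[OF A] is_cocone_r_m[OF k A] by simp
    then show "\<exists>h\<in>Hom C c d. \<forall>p\<in>Obj (elcat X El act). h \<cdot>\<^bsub>C\<^esub> (case p of (A, x) \<Rightarrow> lam A x \<cdot>\<^bsub>C\<^esub> m A x) = k p"
      using h(1) by auto
  next
    fix d h h' assume h: "h \<in> Hom C c d" "h' \<in> Hom C c d"
      and eq: "\<And>p. p \<in> Obj (elcat X El act) \<Longrightarrow> h \<cdot>\<^bsub>C\<^esub> (case p of (A, x) \<Rightarrow> lam A x \<cdot>\<^bsub>C\<^esub> m A x)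
        = h' \<cdot>\<^bsub>C\<^esub> (case p of (A, x) \<Rightarrow> lam A x \<cdot>\<^bsub>C\<^esub> m A x)"
    show "h = h'"
    proof (rule wcolim_epi[OF category_axioms C.category_axioms K_functor c h])
      fix A x assume A: "A \<in> Obj X" "x \<in> El A"
      have *: "g \<cdot>\<^bsub>C\<^esub> lam A x = g \<cdot>\<^bsub>C\<^esub> (lam A x \<cdot>\<^bsub>C\<^esub> m A x) \<cdot>\<^bsub>C\<^esub> r A x" if g: "g \<in> Hom C c d" for g
        using C.comp_assoc[OF r_Hom[OF A] C.comp_in_Hom[OF m_Hom[OF A] D(3)[OF A]] g] wcocone_m_r[OF D(1) A]
        by simp
      show "h \<cdot>\<^bsub>C\<^esub> lam A x = h' \<cdot>\<^bsub>C\<^esub> lam A x"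
        using *[OF h(1)] *[OF h(2)] eq[of "(A, x)"] A by simp
    qed
  qed
qed

text \<open>The colimit is taken in \<open>C\<close> and not merely among total maps, since the
  weighted cocones to be factored may be partial. Totality of its legs then fixes the restrictions
  of \<open>lam\<close>, because \<open>r\<close> has restriction
  \<open>Fa K (rst A x)\<close>.\<close>

lemma wcolim_of_is_colimit:
  assumes c: "is_colimit C (elcat X El act) diag c leg"
    and t: "\<And>A x. A \<in> Obj X \<Longrightarrow> x \<in> El A \<Longrightarrow> Rst C (leg (A, x)) = Idn C (b A x)"
    and lam: "\<And>A x. A \<in> Obj X \<Longrightarrow> x \<in> El A \<Longrightarrow> lam A x = leg (A, x) \<cdot>\<^bsub>C\<^esub> r A x"
  shows "wcolim X El act rst C K c lam"
proof (rule wcolimI)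
  note D = is_colimitD[OF c]
  have legH: "leg (A, x) \<in> Hom C (b A x) c" if "A \<in> Obj X" "x \<in> El A" for A x
    using D(3)[of "(A, x)"] that by simp
  have "wcocone X El act C K c (\<lambda>A x. leg (A, x) \<cdot>\<^bsub>C\<^esub> r A x)"
    using D(1) by (rule wcocone_of_is_cocone)
  then show W: "wcocone X El act C K c lam"
    using lam act_in Hom_Obj unfolding wcocone_def by metis
  show "Rst C (lam A x) = Fa K (rst A x)" if A: "A \<in> Obj X" "x \<in> El A" for A x
    using C.rst_comp_total[OF r_Hom[OF A] legH[OF A] t[OF A]] lam[OF A] r_rst[OF A] by simp
  fix d
  show "\<exists>h\<in>Hom C c d. \<forall>A\<in>Obj X. \<forall>x\<in>El A. h \<cdot>\<^bsub>C\<^esub> lam A x = mu A x"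
    if mu: "wcocone X El act C K d mu" for mu
  proof -
    obtain h where h: "h \<in> Hom C c d" "\<And>p. p \<in> Obj (elcat X El act) \<Longrightarrow>
        h \<cdot>\<^bsub>C\<^esub> leg p = (case p of (A, x) \<Rightarrow> mu A x \<cdot>\<^bsub>C\<^esub> m A x)"
      using D(4)[OF is_cocone_of_wcocone[OF mu]] by blast
    have "h \<cdot>\<^bsub>C\<^esub> lam A x = mu A x" if A: "A \<in> Obj X" "x \<in> El A" for A x
      using C.comp_assoc[OF r_Hom[OF A] legH[OF A] h(1)] h(2)[of "(A, x)"] wcocone_m_r[OF mu A] lam[OF A] A
      by simp
    then show ?thesis
      using h(1) by blast
  qed
  fix h h' assume h: "h \<in> Hom C c d" "h' \<in> Hom C c d"
    and eq: "\<And>A x. A \<in> Obj X \<Longrightarrow> x \<in> El A \<Longrightarrow> h \<cdot>\<^bsub>C\<^esub> lam A x = h' \<cdot>\<^bsub>C\<^esub> lam A x"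
  show "h = h'"
  proof (rule is_colimit_epi[OF C.category_axioms c category_elcat diag_functor_C h])
    fix p assume "p \<in> Obj (elcat X El act)"
    then obtain A x where p: "p = (A, x)" and A: "A \<in> Obj X" "x \<in> El A"
      by auto
    have *: "g \<cdot>\<^bsub>C\<^esub> leg p = g \<cdot>\<^bsub>C\<^esub> lam A x \<cdot>\<^bsub>C\<^esub> m A x" if g: "g \<in> Hom C c d" for g
      using C.comp_assoc[OF m_Hom[OF A] wcoconeD(2)[OF W A] g] is_cocone_r_m[OF D(1) A] lam[OF A] p by simp
    show "h \<cdot>\<^bsub>C\<^esub> leg p = h' \<cdot>\<^bsub>C\<^esub> leg p"
      using *[OF h(1)] *[OF h(2)] eq[OF A] by simp
  qed
qed

end

lemma (in rpresheaf) weighted_diagram_exists: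
  assumes C: "restriction_category C" "split_category C" and K: "is_restriction_functor X C K"
  obtains b m r where "weighted_diagram X El act rst C K b m r"
proof -
  interpret C: restriction_category C by fact
  have Kf: "is_functor X C K" and Kr: "\<And>f. f \<in> Arr X \<Longrightarrow> Fa K (Rst X f) = Rst C (Fa K f)"
    using K by (auto simp: is_restriction_functor_def)
  define sp where "sp A x z \<longleftrightarrow> (case z of (b, m, r) \<Rightarrow> m \<in> Hom C b (Fo K A) \<and> r \<in> Hom C (Fo K A) b \<and>
      m \<cdot>\<^bsub>C\<^esub> r = Fa K (rst A x) \<and> r \<cdot>\<^bsub>C\<^esub> m = Idn C b)" for A x z
  have "\<exists>z. sp A x z" if "A \<in> Obj X" "x \<in> El A" for A x
  proof -
    have e: "rst A x \<in> Hom X A A" "Rst X (rst A x) = rst A x"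
      using rst_el[OF that] by (auto simp: Idem_def)
    have Ke: "Fa K (rst A x) \<in> Hom C (Fo K A) (Fo K A)"
      using is_functorD(2)[OF Kf e(1)] .
    have "restriction_idempotent C (Fa K (rst A x))"
      using Kr[of "rst A x"] e Ke by (simp add: restriction_idempotent_def HomD(1))
    then have "\<exists>b\<in>Obj C. \<exists>r\<in>Hom C (Dom C (Fa K (rst A x))) b. \<exists>m\<in>Hom C b (Dom C (Fa K (rst A x))).
        m \<cdot>\<^bsub>C\<^esub> r = Fa K (rst A x) \<and> r \<cdot>\<^bsub>C\<^esub> m = Idn C b"
      using C(2) by (simp add: split_category_def)
    then show ?thesis
      unfolding sp_def HomD(2)[OF Ke] by auto
  qed
  then have "sp A x (SOME z. sp A x z)" if "A \<in> Obj X" "x \<in> El A" for A x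
    using that by (meson someI_ex)
  then have "weighted_diagram X El act rst C K (\<lambda>A x. fst (SOME z. sp A x z))
      (\<lambda>A x. fst (snd (SOME z. sp A x z))) (\<lambda>A x. snd (snd (SOME z. sp A x z)))"
    by unfold_locales (auto simp: K sp_def split_beta)
  then show ?thesis
    using that by blast
qed

text \<open>Cocompleteness gives the colimit of \<open>diag\<close> among total maps and, through
  the inclusion, its universality against partial cocones.\<close>

lemma (in rpresheaf) wcolim_exists:
  assumes U: "universe TYPE('u)" "small TYPE('u) (Obj X)" "small TYPE('u) (Arr X)"
    "\<And>A. A \<in> Obj X \<Longrightarrow> small TYPE('u) (El A)"
    and C: "restriction_category C" "cocomplete TYPE('u) C" and K: "is_restriction_functor X C K"
  shows "\<exists>c lam. wcolim X El act rst C K c lam"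
proof -
  interpret C: restriction_category C by fact
  have "split_category C"
    using C(2) by (simp add: cocomplete_def)
  then obtain b m r where "weighted_diagram X El act rst C K b m r"
    using weighted_diagram_exists[OF C(1) _ K] by blast
  then interpret weighted_diagram X El act rst C K b m r .
  note J = small_elcat[OF U]
  obtain c leg where c: "is_colimit (Total C) (elcat X El act) diag c leg"
    using C.cocompleteD(1)[OF C(2) J diag_functor] by blast
  have "wcolim X El act rst C K c (\<lambda>A x. leg (A, x) \<cdot>\<^bsub>C\<^esub> r A x)"
  proof (rule wcolim_of_is_colimit)
    show "is_colimit C (elcat X El act) diag c leg"
      using C.cocompleteD(2)[OF C(2) J diag_functor c] .
    fix A x assume "A \<in> Obj X" "x \<in> El A"
    then show "Rst C (leg (A, x)) = Idn C (b A x)"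
      using is_colimitD(3)[OF c, of "(A, x)"] by (simp add: Hom_Total)
  qed simp
  then show ?thesis
    by blast
qed

lemma (in restriction_category) is_restriction_functor_comp:
  assumes F: "is_restriction_functor X Y F" and G: "is_restriction_functor Y Z G"
  shows "is_restriction_functor X Z (comp_functor X G F)"
  unfolding is_restriction_functor_def
proof (intro conjI ballI)
  have FG: "is_functor X Y F" "is_functor Y Z G"
    using F G by (auto simp: is_restriction_functor_def)
  show "is_functor X Z (comp_functor X G F)"
    using is_functor_comp[OF category_axioms FG] .
  fix f assume f: "f \<in> Arr X"
  then show "Fa (comp_functor X G F) (Rst X f) = Rst Z (Fa (comp_functor X G F) f)"
    using HomD(1)[OF rst_in_Hom[OF Arr_Hom[OF f]]] HomD(1)[OF is_functorD(2)[OF FG(1) Arr_Hom[OF f]]] F G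
    by (simp add: is_restriction_functor_def)
qed

lemma Total_functor_simps [simp]:
  "A \<in> Obj X \<Longrightarrow> Fo (Total_functor X F) A = Fo F A"
  "f \<in> Arr (Total X) \<Longrightarrow> Fa (Total_functor X F) f = Fa F f"
  by (simp_all add: Total_functor_def Total_inclusion_def)

text \<open>\<open>H\<close> preserves the colimit of total maps obtained from
  \<open>D.diag\<close>. Cocompleteness of \<open>E\<close> makes the image universal against
  partial cocones again, so it can be read as a weighted colimit.\<close>

lemma (in rpresheaf) wcolim_preserved:
  assumes U: "universe TYPE('u)" "small TYPE('u) (Obj X)" "small TYPE('u) (Arr X)"
    "\<And>A. A \<in> Obj X \<Longrightarrow> small TYPE('u) (El A)"
    and C: "restriction_category C" "split_category C" and K: "is_restriction_functor X C K"
    and E: "restriction_category E" "cocomplete TYPE('u) E"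
    and H: "is_restriction_functor C E H" "cocontinuous TYPE('u) C E H"
    and c: "wcolim X El act rst C K c lam"
  shows "wcolim X El act rst E (comp_functor X H K) (Fo H c) (\<lambda>A x. Fa H (lam A x))"
proof -
  interpret C: restriction_category C by fact
  interpret E: restriction_category E by fact
  have Hf: "is_functor C E H" and Hr: "\<And>f. f \<in> Arr C \<Longrightarrow> Fa H (Rst C f) = Rst E (Fa H f)"
    using H(1) by (auto simp: is_restriction_functor_def)
  note HD = is_functorD[OF Hf]
  obtain b m r where "weighted_diagram X El act rst C K b m r"
    using weighted_diagram_exists[OF C K] by blast
  then interpret D: weighted_diagram X El act rst C K b m r .
  \<comment> \<open>Splittings are equational, so \<open>H\<close> carries those chosen in
    \<open>C\<close> to splittings in \<open>E\<close>. Taking these images instead of fresh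
    splittings makes \<open>E.diag\<close> equal to the image of \<open>D.diag\<close>.\<close>
  interpret E: weighted_diagram X El act rst E "comp_functor X H K" "\<lambda>A x. Fo H (b A x)"
    "\<lambda>A x. Fa H (m A x)" "\<lambda>A x. Fa H (r A x)"
  proof unfold_locales
    show "is_restriction_functor X E (comp_functor X H K)"
      using is_restriction_functor_comp[OF K H(1)] .
    fix A x assume A: "A \<in> Obj X" "x \<in> El A"
    note m = D.m_Hom[OF A] and r = D.r_Hom[OF A]
    show "Fa H (m A x) \<in> Hom E (Fo H (b A x)) (Fo (comp_functor X H K) A)"
      "Fa H (r A x) \<in> Hom E (Fo (comp_functor X H K) A) (Fo H (b A x))"
      using HD(2)[OF m] HD(2)[OF r] A by auto
    show "Fa H (m A x) \<cdot>\<^bsub>E\<^esub> Fa H (r A x) = Fa (comp_functor X H K) (rst A x)"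
      using HD(4)[OF r m] D.mr[OF A] HomD(1)[OF Idem_Hom[OF rst_el[OF A]]] by simp
    show "Fa H (r A x) \<cdot>\<^bsub>E\<^esub> Fa H (m A x) = Idn E (Fo H (b A x))"
      using HD(4)[OF m r] D.rm[OF A] HD(3)[OF C.Hom_Obj(1)[OF m]] by simp
  qed
  note J = small_elcat[OF U] and lD = wcolimD[OF c]
  let ?J = "elcat X El act" and ?leg = "\<lambda>(A, x). lam A x \<cdot>\<^bsub>C\<^esub> m A x"
  have cT: "is_colimit (Total C) ?J D.diag c ?leg"
    using D.is_colimit_of_wcolim[OF c] .
  have pres: "preserves_colimits TYPE('u) (Total C) (Total E) (Total_functor C H)"
    using H(2) by (simp add: cocontinuous_def)
  have legT: "?leg (A, x) \<in> Hom (Total C) (b A x) c" if "A \<in> Obj X" "x \<in> El A" for A x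
    using is_colimitD(3)[OF cT, of "(A, x)"] that by simp
  have dT: "Fa D.diag u \<in> Arr (Total C)" if "u \<in> Arr ?J" for u
    using HomD(1)[OF is_functorD(2)[OF D.diag_functor Arr_Hom[OF that]]] .
  have "is_colimit (Total E) ?J (comp_functor ?J (Total_functor C H) D.diag) (Fo (Total_functor C H) c)
      (\<lambda>p. Fa (Total_functor C H) (?leg p))"
    using preserves_colimits_small[OF pres J D.diag_functor cT] .
  moreover have "Fo (Total_functor C H) c = Fo H c"
    using lD(2) by simp
  moreover have "is_colimit (Total E) ?J (comp_functor ?J (Total_functor C H) D.diag) (Fo H c)
        (\<lambda>p. Fa (Total_functor C H) (?leg p)) \<longleftrightarrow>
      is_colimit (Total E) ?J E.diag (Fo H c) (\<lambda>p. Fa H (?leg p))"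
  proof (rule is_colimit_cong[OF category_elcat])
    fix p assume "p \<in> Obj ?J"
    then obtain A x where p: "p = (A, x)" and A: "A \<in> Obj X" "x \<in> El A"
      by auto
    show "Fo (comp_functor ?J (Total_functor C H) D.diag) p = Fo E.diag p \<and>
        Fa (Total_functor C H) (?leg p) = Fa H (?leg p)"
      using p A C.Hom_Obj(1)[OF D.m_Hom[OF A]] HomD(1)[OF legT[OF A]] by simp
  next
    fix u assume u: "u \<in> Arr ?J"
    then obtain f y where fy: "u = (f, y)" "f \<in> Arr X" "y \<in> El (Cod X f)"
      by auto
    define A B where "A = Cod X f" and "B = Dom X f"
    have f: "f \<in> Hom X B A" and y: "y \<in> El A"
      using fy by (auto simp: A_def B_def Hom_def)
    have A: "A \<in> Obj X" "B \<in> Obj X"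
      using Hom_Obj[OF f] by auto
    note mf = D.m_Hom[OF A(2) act_in[OF f y]] and Kf = D.KD(2)[OF f] and ra = D.r_Hom[OF A(1) y]
    have "Fa (comp_functor ?J (Total_functor C H) D.diag) u = Fa H (Fa D.diag (f, y))"
      using u dT[OF u] fy(1) by simp
    also have "\<dots> = Fa E.diag (f, y)"
      using D.diag_simps(2)[OF f y] E.diag_simps(2)[OF f y] HD(4)[OF C.comp_in_Hom[OF mf Kf] ra]
        HD(4)[OF mf Kf] HomD(1)[OF f] by simp
    finally show "Fa (comp_functor ?J (Total_functor C H) D.diag) u = Fa E.diag u"
      using fy(1) by simp
  qed
  ultimately have HT: "is_colimit (Total E) ?J E.diag (Fo H c) (\<lambda>p. Fa H (?leg p))"
    by simp
  show ?thesis
  proof (rule E.wcolim_of_is_colimit)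
    show "is_colimit E ?J E.diag (Fo H c) (\<lambda>p. Fa H (?leg p))"
      using E.cocompleteD(2)[OF E(2) J E.diag_functor HT] .
    fix A x assume A: "A \<in> Obj X" "x \<in> El A"
    show "Rst E (Fa H (?leg (A, x))) = Idn E (Fo H (b A x))"
      using is_colimitD(3)[OF HT, of "(A, x)"] A by (simp add: Hom_Total)
    show "Fa H (lam A x) = Fa H (?leg (A, x)) \<cdot>\<^bsub>E\<^esub> Fa H (r A x)"
      using HD(4)[OF D.r_Hom[OF A] C.comp_in_Hom[OF D.m_Hom[OF A] lD(3)[OF A]]]
        D.wcocone_m_r[OF lD(1) A] by simp
  qed
qed

section \<open>The Yoneda embedding\<close>

text \<open>The map from the representable that the Yoneda lemma assigns to \<open>x\<close>. These
  maps are the legs that present \<open>P\<close> as a colimit of representables.\<close>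

definition yel ::
  "('o, 'u, 'c) rcat_scheme \<Rightarrow> ('o, 'u, 'u) psh \<Rightarrow> 'o \<Rightarrow> 'u \<Rightarrow>
     (('o, 'u, 'u) psh, 'o \<Rightarrow> 'u \<Rightarrow> 'u) transf" where
  "yel X P A x = psh_arr X (representable X A) P (\<lambda>B g. PAct P g x)"

lemma rep_simps [simp]:
  "B \<in> Obj X \<Longrightarrow> PEl (representable X A) B = Hom X B A"
  "g \<in> Hom X D B \<Longrightarrow> f \<in> Hom X B A \<Longrightarrow> PAct (representable X A) g f = f \<cdot>\<^bsub>X\<^esub> g"
  "B \<in> Obj X \<Longrightarrow> f \<in> Hom X B A \<Longrightarrow> PRst (representable X A) B f = Rst X f"
  by (auto simp: representable_def Hom_def)

context small_jr
begin

lemma rep_psh: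
  assumes A: "A \<in> Obj X"
  shows "join_restriction_presheaf X (representable X A)"
proof (rule join_restriction_presheafI)
  show "jr_sheaf X (PEl (representable X A)) (PAct (representable X A)) (PRst (representable X A))"
    by (rule jr_sheaf.jr_sheaf_transfer[OF hom_sheaf[OF A], where c = "\<lambda>B f. f"])
      (auto simp: Hom_Obj bij_betw_def)
qed (auto simp: small_Hom representable_def cod_in_Obj)

lemma yel_Hom:
  assumes P: "join_restriction_presheaf X P" and A: "A \<in> Obj X" and x: "x \<in> PEl P A"
  shows "yel X P A x \<in> Hom (PSh_jr X) (representable X A) P"
proof -
  interpret P: jr_sheaf X "PEl P" "PAct P" "PRst P"
    using P by (rule jr_sheaf_psh)
  show ?thesis
    unfolding yel_def
    by (intro psh_arrI category_axioms rep_psh A P)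
      (auto simp: P.act_in x Hom_Obj P.act_comp)
qed

lemma TMap_yel: "B \<in> Obj X \<Longrightarrow> g \<in> Hom X B A \<Longrightarrow> TMap (yel X P A x) B g = PAct P g x"
  by (simp add: yel_def)

lemma yel_eval:
  assumes a: "\<alpha> \<in> Hom (PSh_jr X) (representable X A) P" and g: "g \<in> Hom X B A"
  shows "TMap \<alpha> B g = PAct P g (TMap \<alpha> A (Idn X A))"
proof -
  have A: "A \<in> Obj X"
    using Hom_Obj[OF g] by simp
  show ?thesis
    using PSh_nat[OF a g, of "Idn X A"] idn_in_Hom[OF A] comp_idn_left[OF g] g A by simp
qed

lemma yel_idn:
  assumes P: "join_restriction_presheaf X P" and A: "A \<in> Obj X" and x: "x \<in> PEl P A"
  shows "TMap (yel X P A x) A (Idn X A) = x"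
proof -
  interpret P: jr_sheaf X "PEl P" "PAct P" "PRst P"
    using P by (rule jr_sheaf_psh)
  show ?thesis
    using TMap_yel[OF A idn_in_Hom[OF A]] P.act_idn[OF A x] by simp
qed

lemma yel_eqI:
  assumes a: "\<alpha> \<in> Hom (PSh_jr X) (representable X A) P" and b: "\<beta> \<in> Hom (PSh_jr X) (representable X A) P"
    and eq: "TMap \<alpha> A (Idn X A) = TMap \<beta> A (Idn X A)"
  shows "\<alpha> = \<beta>"
  by (rule PSh_eqI[OF a b]) (use yel_eval[OF a] yel_eval[OF b] eq in simp)

lemma yoneda_Fo: "A \<in> Obj X \<Longrightarrow> Fo (yoneda_jr X) A = representable X A"
  by (simp add: yoneda_jr_def)

text \<open>The Yoneda functor on maps is a special case of \<open>yel\<close>, so composition and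
  restriction need to be computed only for the latter.\<close>

lemma yoneda_Fa:
  assumes f: "f \<in> Hom X A B"
  shows "Fa (yoneda_jr X) f = yel X (representable X B) A f"
  using HomD[OF f] f by (auto simp: yoneda_jr_def yel_def psh_arr_def intro!: restrict_ext)

lemma yoneda_Hom:
  assumes f: "f \<in> Hom X A B"
  shows "Fa (yoneda_jr X) f \<in> Hom (PSh_jr X) (representable X A) (representable X B)"
  unfolding yoneda_Fa[OF f] using Hom_Obj[OF f] f by (intro yel_Hom rep_psh) auto

lemma TMap_yoneda:
  "f \<in> Hom X A B \<Longrightarrow> g \<in> Hom X D A \<Longrightarrow> TMap (Fa (yoneda_jr X) f) D g = f \<cdot> g"
  using Hom_Obj[of g D A] by (simp add: yoneda_Fa TMap_yel)

lemma yoneda_comp: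
  assumes f: "f \<in> Hom X A B" and g: "g \<in> Hom X B D"
  shows "Fa (yoneda_jr X) (g \<cdot> f) = Fa (yoneda_jr X) g \<cdot>\<^bsub>PSh_jr X\<^esub> Fa (yoneda_jr X) f"
proof (rule PSh_eqI[OF yoneda_Hom[OF comp_in_Hom[OF f g]] PSh_comp_Hom[OF yoneda_Hom[OF f] yoneda_Hom[OF g]]])
  fix C x assume C: "C \<in> Obj X" and x: "x \<in> PEl (representable X A) C"
  then have x': "x \<in> Hom X C A"
    by simp
  show "TMap (Fa (yoneda_jr X) (g \<cdot> f)) C x
      = TMap (Fa (yoneda_jr X) g \<cdot>\<^bsub>PSh_jr X\<^esub> Fa (yoneda_jr X) f) C x"
    using TMap_comp[OF yoneda_Hom[OF f] C x] TMap_yoneda[OF f x']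
      TMap_yoneda[OF g comp_in_Hom[OF x' f]] TMap_yoneda[OF comp_in_Hom[OF f g] x'] comp_assoc[OF x' f g]
    by simp
qed

lemma yel_act:
  assumes P: "join_restriction_presheaf X P" and f: "f \<in> Hom X B A" and x: "x \<in> PEl P A"
  shows "yel X P B (PAct P f x) = yel X P A x \<cdot>\<^bsub>PSh_jr X\<^esub> Fa (yoneda_jr X) f"
proof -
  interpret P: jr_sheaf X "PEl P" "PAct P" "PRst P"
    using P by (rule jr_sheaf_psh)
  have AB: "A \<in> Obj X" "B \<in> Obj X"
    using Hom_Obj[OF f] by auto
  note yx = yel_Hom[OF P AB(1) x] and yfx = yel_Hom[OF P AB(2) P.act_in[OF f x]]
  show ?thesis
  proof (rule yel_eqI[OF yfx PSh_comp_Hom[OF yoneda_Hom[OF f] yx]])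
    show "TMap (yel X P B (PAct P f x)) B (Idn X B)
        = TMap (yel X P A x \<cdot>\<^bsub>PSh_jr X\<^esub> Fa (yoneda_jr X) f) B (Idn X B)"
      using yel_idn[OF P AB(2) P.act_in[OF f x]] TMap_comp[OF yoneda_Hom[OF f] AB(2), of "Idn X B"]
        TMap_yoneda[OF f idn_in_Hom[OF AB(2)]] comp_idn_right[OF f] idn_in_Hom[OF AB(2)]
        TMap_yel[OF AB(2) f] AB by simp
  qed
qed

text \<open>At \<open>g\<close> the two sides are \<open>g\<close> after the restriction of the
  pullback of \<open>x\<close>, and the restriction of \<open>x\<close> after \<open>g\<close>; R4
  identifies them. This is the clause on restrictions of legs in \<open>wcolim\<close>.\<close>

lemma yel_rst:
  assumes P: "join_restriction_presheaf X P" and A: "A \<in> Obj X" and x: "x \<in> PEl P A"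
  shows "Rst (PSh_jr X) (yel X P A x) = Fa (yoneda_jr X) (PRst P A x)"
proof -
  interpret P: jr_sheaf X "PEl P" "PAct P" "PRst P"
    using P by (rule jr_sheaf_psh)
  note yx = yel_Hom[OF P A x] and e = P.rst_el[OF A x]
  show ?thesis
  proof (rule PSh_eqI[OF PSh_rst_Hom[OF yx] yoneda_Hom[OF Idem_Hom[OF e]]])
    fix B g assume B: "B \<in> Obj X" and g: "g \<in> PEl (representable X A) B"
    then have g': "g \<in> Hom X B A"
      by simp
    have "PRst P B (PAct P g x) \<in> Hom X B B"
      using Idem_Hom[OF P.rst_el[OF B P.act_in[OF g' x]]] .
    then show "TMap (Rst (PSh_jr X) (yel X P A x)) B g = TMap (Fa (yoneda_jr X) (PRst P A x)) B g"
      using TMap_rst[OF yx B g] TMap_yel[OF B g'] TMap_yoneda[OF Idem_Hom[OF e] g'] g'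
        R4[OF g' Idem_Hom[OF e]] Idem_rst[OF e] P.rst_act[OF g' x] by simp
  qed
qed

lemma yoneda_restriction_functor: "is_restriction_functor X (PSh_jr X) (yoneda_jr X)"
  unfolding is_restriction_functor_def
proof (intro conjI ballI is_functorI)
  show "Fo (yoneda_jr X) \<in> extensional (Obj X)" "Fa (yoneda_jr X) \<in> extensional (Arr X)"
    by (simp_all add: yoneda_jr_def)
next
  fix A assume A: "A \<in> Obj X"
  show "Fo (yoneda_jr X) A \<in> Obj (PSh_jr X)"
    using A rep_psh by (simp add: yoneda_Fo)
  note i = idn_in_Hom[OF A]
  show "Fa (yoneda_jr X) (Idn X A) = Idn (PSh_jr X) (Fo (yoneda_jr X) A)"
    unfolding yoneda_Fo[OF A]
    by (rule PSh_eqI[OF yoneda_Hom[OF i] PSh_idn_Hom[OF rep_psh[OF A]]])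
      (simp add: TMap_idn TMap_yoneda[OF i] comp_idn_left)
next
  fix f A B assume f: "f \<in> Hom X A B"
  show "Fa (yoneda_jr X) f \<in> Hom (PSh_jr X) (Fo (yoneda_jr X) A) (Fo (yoneda_jr X) B)"
    using yoneda_Hom[OF f] Hom_Obj[OF f] by (simp add: yoneda_Fo)
next
  fix f g A B D assume "f \<in> Hom X A B" "g \<in> Hom X B D"
  then show "Fa (yoneda_jr X) (g \<cdot> f) = Fa (yoneda_jr X) g \<cdot>\<^bsub>PSh_jr X\<^esub> Fa (yoneda_jr X) f"
    by (rule yoneda_comp)
next
  fix f assume "f \<in> Arr X"
  then have f: "f \<in> Hom X (Dom X f) (Cod X f)"
    by (rule Arr_Hom)
  show "Fa (yoneda_jr X) (Rst X f) = Rst (PSh_jr X) (Fa (yoneda_jr X) f)"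
    using yel_rst[OF rep_psh, of "Cod X f" "Dom X f" f] Hom_Obj[OF f] f by (simp add: yoneda_Fa)
qed

lemma yoneda_join_restriction_functor: "is_join_restriction_functor X (PSh_jr X) (yoneda_jr X)"
  unfolding is_join_restriction_functor_def
proof (intro conjI ballI allI impI yoneda_restriction_functor)
  fix A B S j
  assume A: "A \<in> Obj X" and B: "B \<in> Obj X"
    and asm: "S \<subseteq> Hom X A B \<and> compatible X S \<and> is_join X A B S j"
  then have S: "S \<subseteq> Hom X A B" and C: "compatible X S" and j: "is_join X A B S j"
    by auto
  have jH: "j \<in> Hom X A B"
    using j by (simp add: is_join_def)
  have "is_join (PSh_jr X) (representable X A) (representable X B) (Fa (yoneda_jr X) ` S) (Fa (yoneda_jr X) j)"
  proof (rule pointwise_join_imp_is_join)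
    show "Fa (yoneda_jr X) ` S \<subseteq> Hom (PSh_jr X) (representable X A) (representable X B)"
      using S yoneda_Hom by auto
    show "Fa (yoneda_jr X) j \<in> Hom (PSh_jr X) (representable X A) (representable X B)"
      using yoneda_Hom[OF jH] .
    show "pointwise_join (representable X A) (representable X B) (Fa (yoneda_jr X) ` S) (Fa (yoneda_jr X) j)"
      unfolding pointwise_join_def
    proof (intro ballI)
      fix D g assume D: "D \<in> Obj X" and "g \<in> PEl (representable X A) D"
      then have g: "g \<in> Hom X D A"
        by simp
      let ?T = "(\<lambda>s. s \<cdot> g) ` S"
      have T: "?T \<subseteq> Hom X D B"
        using S comp_in_Hom[OF g] by auto
      have "is_join X D B ?T (j \<cdot> g)"
        using J2[OF A B S C j g] .
      then have jg: "j \<cdot> g \<in> Hom X D B" "\<And>t. t \<in> ?T \<Longrightarrow> j \<cdot> g \<cdot> Rst X t = t"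
        "is_join X D D (Rst X ` ?T) (Rst X (j \<cdot> g))"
        using glued_hom_iff[OF D B T compatible_comp[OF S C g]] by auto
      have "(\<lambda>s. TMap s D g) ` Fa (yoneda_jr X) ` S = ?T"
        unfolding image_image using S g by (intro image_cong) (auto simp: TMap_yoneda subset_iff)
      moreover have "PRst (representable X B) D ` ?T = Rst X ` ?T"
        using T D by (intro image_cong) auto
      moreover have "PAct (representable X B) (PRst (representable X B) D t) (j \<cdot> g) = t" if t: "t \<in> ?T" for t
      proof -
        have "t \<in> Hom X D B"
          using t T by blast
        then show ?thesis
          using jg(1) jg(2)[OF t] D rep_simps(2)[OF rst_in_Hom jg(1)] by simp
      qed
      ultimately show "glued X (PEl (representable X B)) (PAct (representable X B)) (PRst (representable X B)) D
          ((\<lambda>s. TMap s D g) ` Fa (yoneda_jr X) ` S) (TMap (Fa (yoneda_jr X) j) D g)"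
        using jg D TMap_yoneda[OF jH g] by (simp add: glued_def)
    qed
  qed
  then show "is_join (PSh_jr X) (Fo (yoneda_jr X) A) (Fo (yoneda_jr X) B)
      (Fa (yoneda_jr X) ` S) (Fa (yoneda_jr X) j)"
    using A B by (simp add: yoneda_Fo)
qed

text \<open>The co-Yoneda lemma in weighted form: the map induced by a cocone \<open>mu\<close>
  sends \<open>x\<close> to the value of \<open>mu A x\<close> at the identity.\<close>

lemma wcolim_yoneda:
  assumes P: "join_restriction_presheaf X P"
  shows "wcolim X (PEl P) (PAct P) (PRst P) (PSh_jr X) (yoneda_jr X) P (yel X P)"
proof (rule wcolimI)
  interpret P: jr_sheaf X "PEl P" "PAct P" "PRst P"
    using P by (rule jr_sheaf_psh)
  show "wcocone X (PEl P) (PAct P) (PSh_jr X) (yoneda_jr X) P (yel X P)"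
    unfolding wcocone_def using P yel_Hom[OF P] yel_act[OF P] by (auto simp: yoneda_Fo)
  show "Rst (PSh_jr X) (yel X P A x) = Fa (yoneda_jr X) (PRst P A x)" if "A \<in> Obj X" "x \<in> PEl P A" for A x
    using yel_rst[OF P that] .
  fix Q
  show "\<exists>h\<in>Hom (PSh_jr X) P Q. \<forall>A\<in>Obj X. \<forall>x\<in>PEl P A. h \<cdot>\<^bsub>PSh_jr X\<^esub> yel X P A x = mu A x"
    if mu: "wcocone X (PEl P) (PAct P) (PSh_jr X) (yoneda_jr X) Q mu" for mu
  proof -
    note D = wcoconeD[OF mu]
    have Q: "join_restriction_presheaf X Q"
      using D(1) by simp
    have muH: "mu A x \<in> Hom (PSh_jr X) (representable X A) Q" if "A \<in> Obj X" "x \<in> PEl P A" for A x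
      using D(2)[OF that] that by (simp add: yoneda_Fo)
    have act: "TMap (mu B (PAct P f x)) B (Idn X B) = PAct Q f (TMap (mu A x) A (Idn X A))"
      if f: "f \<in> Hom X B A" and x: "x \<in> PEl P A" for A B f x
    proof -
      have AB: "A \<in> Obj X" "B \<in> Obj X"
        using Hom_Obj[OF f] by auto
      show ?thesis
        using D(3)[OF f x] TMap_comp[OF yoneda_Hom[OF f] AB(2), of "Idn X B" "mu A x"] idn_in_Hom[OF AB(2)] AB
          TMap_yoneda[OF f idn_in_Hom[OF AB(2)]] comp_idn_right[OF f] yel_eval[OF muH[OF AB(1) x] f] by simp
    qed
    let ?h = "psh_arr X P Q (\<lambda>A x. TMap (mu A x) A (Idn X A))"
    have h: "?h \<in> Hom (PSh_jr X) P Q"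
      using act PSh_in[OF muH _] idn_in_Hom by (intro psh_arrI category_axioms P Q) auto
    have "?h \<cdot>\<^bsub>PSh_jr X\<^esub> yel X P A x = mu A x" if A: "A \<in> Obj X" and x: "x \<in> PEl P A" for A x
      by (rule yel_eqI[OF PSh_comp_Hom[OF yel_Hom[OF P A x] h] muH[OF A x]])
        (use TMap_comp[OF yel_Hom[OF P A x] A, of "Idn X A"] yel_idn[OF P A x] idn_in_Hom[OF A] A x in simp)
    then show ?thesis
      using h by blast
  qed
  fix h h' assume h: "h \<in> Hom (PSh_jr X) P Q" "h' \<in> Hom (PSh_jr X) P Q"
    and eq: "\<And>A x. A \<in> Obj X \<Longrightarrow> x \<in> PEl P A \<Longrightarrow>
      h \<cdot>\<^bsub>PSh_jr X\<^esub> yel X P A x = h' \<cdot>\<^bsub>PSh_jr X\<^esub> yel X P A x"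
  show "h = h'"
  proof (rule PSh_eqI[OF h])
    fix A x assume A: "A \<in> Obj X" and x: "x \<in> PEl P A"
    have "TMap (k \<cdot>\<^bsub>PSh_jr X\<^esub> yel X P A x) A (Idn X A) = TMap k A x" for k
      using TMap_comp[OF yel_Hom[OF P A x] A, of "Idn X A" k] yel_idn[OF P A x] idn_in_Hom[OF A] A by simp
    then show "TMap h A x = TMap h' A x"
      using eq[OF A x] by metis
  qed
qed

lemma yel_postcomp:
  assumes a: "\<alpha> \<in> Hom (PSh_jr X) P Q" and A: "A \<in> Obj X" and x: "x \<in> PEl P A"
  shows "\<alpha> \<cdot>\<^bsub>PSh_jr X\<^esub> yel X P A x = yel X Q A (TMap \<alpha> A x)"
proof -
  note P = PSh_HomD(1)[OF a] and Q = PSh_HomD(2)[OF a]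
  show ?thesis
    by (rule yel_eqI[OF PSh_comp_Hom[OF yel_Hom[OF P A x] a] yel_Hom[OF Q A PSh_in[OF a A x]]])
      (use TMap_comp[OF yel_Hom[OF P A x] A, of "Idn X A"] yel_idn[OF P A x] yel_idn[OF Q A PSh_in[OF a A x]]
        idn_in_Hom[OF A] A in simp)
qed

end

section \<open>Cocontinuous functors preserve joins\<close>

text \<open>
  For a join e of restriction idempotents, the splitting of the image of e under the Yoneda
  embedding is the colimit of the representables weighted by the sieve of all maps that factor
  through a member of the join. A cocontinuous functor preserves this colimit, whose legs are
  jointly epic.
\<close>

context small_jr
begin

lemma rpresheaf_sieve:
  assumes D: "D \<subseteq> Idem X A"
  shows "rpresheaf X (\<lambda>B. {f \<in> Hom X B A. \<exists>d\<in>D. d \<cdot> f = f}) (\<lambda>g f. f \<cdot> g) (\<lambda>B. Rst X)"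
proof (cases "A \<in> Obj X")
  case A: True
  interpret h: jr_sheaf X "\<lambda>B. Hom X B A" "\<lambda>g f. f \<cdot> g" "\<lambda>B. Rst X"
    using A by (rule hom_sheaf)
  show ?thesis
  proof
    fix g B C f assume g: "g \<in> Hom X B C" and f: "f \<in> {f \<in> Hom X C A. \<exists>d\<in>D. d \<cdot> f = f}"
    then obtain d where d: "d \<in> D" "d \<cdot> f = f" "f \<in> Hom X C A"
      by auto
    have "d \<in> Hom X A A"
      using d D Idem_Hom by auto
    then have "d \<cdot> (f \<cdot> g) = f \<cdot> g"
      using comp_assoc[OF g d(3)] d(2) by metis
    then show "f \<cdot> g \<in> {f \<in> Hom X B A. \<exists>d\<in>D. d \<cdot> f = f}"
      using d comp_in_Hom[OF g d(3)] by auto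
  qed (use h.act_idn h.act_comp h.rst_el h.act_rst h.rst_act in auto)
next
  case False
  then have "{f \<in> Hom X B A. \<exists>d\<in>D. d \<cdot> f = f} = {}" for B
    using Hom_Obj by blast
  then show ?thesis
    by unfold_locales auto
qed

text \<open>By Yoneda, a cocone under the sieve is a matching family of elements of
  \<open>P\<close>. Its members at the idempotents in \<open>D\<close> glue to \<open>q\<close>, and
  every other member is a pullback of one of these.\<close>

lemma sieve_element:
  assumes A: "A \<in> Obj X" and D: "D \<subseteq> Idem X A"
    and mu: "wcocone X (\<lambda>B. {f \<in> Hom X B A. \<exists>d\<in>D. d \<cdot> f = f}) (\<lambda>g f. f \<cdot> g) (PSh_jr X) (yoneda_jr X) P mu"
  obtains q where "q \<in> PEl P A"
    and "\<And>B f d. f \<in> Hom X B A \<Longrightarrow> d \<in> D \<Longrightarrow> d \<cdot> f = f \<Longrightarrow> mu B f = yel X P B (PAct P f q)"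
proof -
  note M = wcoconeD[OF mu]
  have P: "join_restriction_presheaf X P"
    using M(1) by simp
  interpret P: jr_sheaf X "PEl P" "PAct P" "PRst P"
    using P by (rule jr_sheaf_psh)
  have muH: "mu B f \<in> Hom (PSh_jr X) (representable X B) P"
    if f: "f \<in> Hom X B A" "d \<in> D" "d \<cdot> f = f" for B f d
    using M(2)[of B f] Hom_Obj[OF f(1)] that by (auto simp: yoneda_Fo)
  define p where "p f B = TMap (mu B f) B (Idn X B)" for f B
  have p_in: "p f B \<in> PEl P B" if f: "f \<in> Hom X B A" "d \<in> D" "d \<cdot> f = f" for B f d
    unfolding p_def using PSh_in[OF muH[OF that]] Hom_Obj[OF f(1)] idn_in_Hom by simp
  have mu_p: "mu B f = yel X P B (p f B)" if f: "f \<in> Hom X B A" "d \<in> D" "d \<cdot> f = f" for B f d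
    using yel_eqI[OF muH[OF that] yel_Hom[OF P _ p_in[OF that]]] yel_idn[OF P _ p_in[OF that]] Hom_Obj[OF f(1)]
    by (simp add: p_def)
  have p_act: "p (f \<cdot> g) C = PAct P g (p f B)"
    if g: "g \<in> Hom X C B" and f: "f \<in> Hom X B A" "d \<in> D" "d \<cdot> f = f" for B C f g d
  proof -
    have C: "C \<in> Obj X"
      using Hom_Obj[OF g] by simp
    have "mu C (f \<cdot> g) = mu B f \<cdot>\<^bsub>PSh_jr X\<^esub> Fa (yoneda_jr X) g"
      using M(3)[OF g] f by blast
    then show ?thesis
      using TMap_comp[OF yoneda_Hom[OF g] C, of "Idn X C" "mu B f"] TMap_yoneda[OF g idn_in_Hom[OF C]]
        comp_idn_right[OF g] yel_eval[OF muH[OF f] g] C idn_in_Hom[OF C] by (simp add: p_def)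
  qed
  have DI: "d \<in> Idem X A" "d \<in> Hom X A A" "d \<cdot> d = d" if "d \<in> D" for d
    using that D Idem_Hom Idem_idem by auto
  let ?q = "\<lambda>d. p d A"
  have qE: "?q d \<in> PEl P A" if "d \<in> D" for d
    using p_in[OF DI(2) _ DI(3)] that by blast
  have q_act: "PAct P c (?q d) = ?q (d \<cdot> c)" if "d \<in> D" "c \<in> Idem X A" for c d
    using p_act[OF Idem_Hom[OF that(2)] DI(2)[OF that(1)] that(1) DI(3)[OF that(1)]] by simp
  let ?r = "\<lambda>d. PRst P A (?q d)"
  have rI: "?r d \<in> Idem X A" if "d \<in> D" for d
    using P.rst_el[OF A qE[OF that]] .
  have rd: "?r d = d \<cdot> ?r d" if d: "d \<in> D" for d
    using P.rst_act_Idem[OF DI(1)[OF d] qE[OF d]] q_act[OF d DI(1)[OF d]] DI(3)[OF d]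
      Idem_commute[OF rI[OF d] DI(1)[OF d]] by simp
  \<comment> \<open>\<open>?q c\<close> may be defined on less than \<open>c\<close>; cutting
    \<open>?q d\<close> down to that smaller domain still gives the symmetric expression
    \<open>?q (d \<cdot> c)\<close>, which is what coherence needs.\<close>
  have rq: "PAct P (?r c) (?q d) = ?q (d \<cdot> c)" if d: "d \<in> D" and c: "c \<in> D" for c d
  proof -
    have "PAct P (?r c) (?q d) = PAct P (?r c) (?q (d \<cdot> c))"
      using P.act_Idem_comp[OF DI(1)[OF c] rI[OF c] qE[OF d]] rd[OF c] q_act[OF d DI(1)[OF c]] by simp
    also have "?q (d \<cdot> c) = PAct P d (?q c)"
      using q_act[OF c DI(1)[OF d]] Idem_commute[OF DI(1)[OF d] DI(1)[OF c]] by simp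
    also have "PAct P (?r c) (PAct P d (?q c)) = PAct P d (PAct P (?r c) (?q c))"
      using P.act_Idem_comp[OF DI(1)[OF d] rI[OF c] qE[OF c]] P.act_Idem_comp[OF rI[OF c] DI(1)[OF d] qE[OF c]]
        Idem_commute[OF rI[OF c] DI(1)[OF d]] by simp
    also have "\<dots> = PAct P d (?q c)"
      using P.act_rst[OF A qE[OF c]] by simp
    finally show ?thesis
      using q_act[OF c DI(1)[OF d]] Idem_commute[OF DI(1)[OF d] DI(1)[OF c]] by simp
  qed
  have T: "?q ` D \<subseteq> PEl P A"
    using qE by blast
  have "P.coherent A (?q ` D)"
    unfolding gcompat_def using rq Idem_commute[OF DI(1) DI(1)] by auto
  then obtain q where q: "P.glue A (?q ` D) q"
    using P.glue[OF A T] by blast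
  have q1: "q \<in> PEl P A" "\<And>d. d \<in> D \<Longrightarrow> PAct P (?r d) q = ?q d" "is_join X A A (?r ` D) (PRst P A q)"
    using q by (auto simp: glued_def image_image)
  have rS: "?r ` D \<subseteq> Idem X A"
    using rI by blast
  have rjI: "PRst P A q \<in> Idem X A"
    using P.rst_el[OF A q1(1)] .
  have swap: "PAct P c (PAct P d q) = PAct P d (PAct P c q)" if "c \<in> Idem X A" "d \<in> Idem X A" for c d
    using P.act_Idem_comp[OF that q1(1)] P.act_Idem_comp[OF that(2,1) q1(1)] Idem_commute[OF that] by simp
  \<comment> \<open>Gluing controls \<open>q\<close> over \<open>?r d\<close> only. Separation over
    the domains of all pieces shows that nothing more appears over \<open>d\<close>.\<close>
  have qd: "PAct P d q = ?q d" if d: "d \<in> D" for d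
  proof (rule P.sep_cover[OF A rS q1(3) P.act_Idem_in[OF DI(1)[OF d] q1(1)] qE[OF d]])
    show "PAct P (PRst P A q) (PAct P d q) = PAct P d q"
      using swap[OF rjI DI(1)[OF d]] P.act_rst[OF A q1(1)] by simp
    show "PAct P (PRst P A q) (?q d) = ?q d"
      using swap[OF rjI rI[OF d]] P.act_rst[OF A q1(1)] q1(2)[OF d] by simp
    fix c assume "c \<in> ?r ` D"
    then obtain c' where c: "c' \<in> D" "c = ?r c'"
      by blast
    show "PAct P c (PAct P d q) = PAct P c (?q d)"
      using c swap[OF rI[OF c(1)] DI(1)[OF d]] q1(2)[OF c(1)] rq[OF d c(1)] q_act[OF c(1) DI(1)[OF d]]
        Idem_commute[OF DI(1)[OF d] DI(1)[OF c(1)]] by simp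
  qed
  have "mu B f = yel X P B (PAct P f q)" if f: "f \<in> Hom X B A" and d: "d \<in> D" "d \<cdot> f = f" for B f d
  proof -
    have "p f B = PAct P f (PAct P d q)"
      using p_act[OF f DI(2)[OF d(1)] d(1) DI(3)[OF d(1)]] d(2) qd[OF d(1)] by simp
    also have "\<dots> = PAct P f q"
      using P.act_comp[OF f DI(2)[OF d(1)] q1(1)] d(2) by simp
    finally show ?thesis
      using mu_p[OF f d] by simp
  qed
  then show ?thesis
    using that q1(1) by blast
qed

lemma wcolim_sieve:
  assumes A: "A \<in> Obj X" and D: "D \<subseteq> Idem X A" and e: "is_join X A A D e"
    and r: "r \<in> Hom (PSh_jr X) (representable X A) Q" and m: "m \<in> Hom (PSh_jr X) Q (representable X A)"
    and mr: "m \<cdot>\<^bsub>PSh_jr X\<^esub> r = Fa (yoneda_jr X) e" and rm: "r \<cdot>\<^bsub>PSh_jr X\<^esub> m = Idn (PSh_jr X) Q"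
  shows "wcolim X (\<lambda>B. {f \<in> Hom X B A. \<exists>d\<in>D. d \<cdot> f = f}) (\<lambda>g f. f \<cdot> g) (\<lambda>B. Rst X)
    (PSh_jr X) (yoneda_jr X) Q (\<lambda>B f. r \<cdot>\<^bsub>PSh_jr X\<^esub> Fa (yoneda_jr X) f)"
proof (rule wcolimI)
  interpret PSh: restriction_category "PSh_jr X"
    by (rule restriction_category_PSh)
  have eI: "e \<in> Idem X A"
    using is_join_Idem[OF A D e] .
  note eH = Idem_Hom[OF eI]
  have ef: "e \<cdot> f = f" if f: "f \<in> Hom X B A" "d \<in> D" "d \<cdot> f = f" for f B d
  proof -
    have d: "d \<in> Idem X A"
      using f D by auto
    have "e \<cdot> d = d"
      using e f(2) rle_Idem[OF d] by (auto simp: is_join_def)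
    then show ?thesis
      using comp_assoc[OF f(1) Idem_Hom[OF d] eH] f(3) by simp
  qed
  note yH = yoneda_Hom
  have m_total: "Rst (PSh_jr X) m = Idn (PSh_jr X) Q"
    using PSh.total_cancel[OF m r] rm PSh.rst_idn[OF PSh.Hom_Obj(1)[OF m]] by simp
  have mry: "m \<cdot>\<^bsub>PSh_jr X\<^esub> (r \<cdot>\<^bsub>PSh_jr X\<^esub> Fa (yoneda_jr X) f) = Fa (yoneda_jr X) (e \<cdot> f)"
    if f: "f \<in> Hom X B A" for f B
    using PSh.comp_assoc[OF yH[OF f] r m] mr yoneda_comp[OF f eH] by simp
  show "wcocone X (\<lambda>B. {f \<in> Hom X B A. \<exists>d\<in>D. d \<cdot> f = f}) (\<lambda>g f. f \<cdot> g) (PSh_jr X) (yoneda_jr X) Q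
      (\<lambda>B f. r \<cdot>\<^bsub>PSh_jr X\<^esub> Fa (yoneda_jr X) f)"
    unfolding wcocone_def
  proof (intro conjI ballI allI)
    show "Q \<in> Obj (PSh_jr X)"
      using PSh.Hom_Obj(1)[OF m] .
    fix B f assume "B \<in> Obj X" and "f \<in> {f \<in> Hom X B A. \<exists>d\<in>D. d \<cdot> f = f}"
    then show "r \<cdot>\<^bsub>PSh_jr X\<^esub> Fa (yoneda_jr X) f \<in> Hom (PSh_jr X) (Fo (yoneda_jr X) B) Q"
      using PSh.comp_in_Hom[OF yH r] by (auto simp: yoneda_Fo)
  next
    fix B C g f assume g: "g \<in> Hom X C B" and "f \<in> {f \<in> Hom X B A. \<exists>d\<in>D. d \<cdot> f = f}"
    then have f: "f \<in> Hom X B A"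
      by simp
    show "r \<cdot>\<^bsub>PSh_jr X\<^esub> Fa (yoneda_jr X) (f \<cdot> g)
        = r \<cdot>\<^bsub>PSh_jr X\<^esub> Fa (yoneda_jr X) f \<cdot>\<^bsub>PSh_jr X\<^esub> Fa (yoneda_jr X) g"
      using PSh.comp_assoc[OF yH[OF g] yH[OF f] r] yoneda_comp[OF g f] by simp
  qed
  show "Rst (PSh_jr X) (r \<cdot>\<^bsub>PSh_jr X\<^esub> Fa (yoneda_jr X) f) = Fa (yoneda_jr X) (Rst X f)"
    if B: "B \<in> Obj X" and f: "f \<in> {f \<in> Hom X B A. \<exists>d\<in>D. d \<cdot> f = f}" for B f
  proof -
    have fH: "f \<in> Hom X B A" and "e \<cdot> f = f"
      using f ef by auto
    \<comment> \<open>\<open>m\<close> is total, so composing with it leaves the restriction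
      unchanged and reduces the leg to the image of \<open>f\<close>.\<close>
    then have "Rst (PSh_jr X) (r \<cdot>\<^bsub>PSh_jr X\<^esub> Fa (yoneda_jr X) f) = Rst (PSh_jr X) (Fa (yoneda_jr X) f)"
      using PSh.rst_comp_total[OF PSh.comp_in_Hom[OF yH[OF fH] r] m m_total] mry[OF fH] by simp
    then show ?thesis
      using yoneda_restriction_functor HomD(1)[OF fH] by (simp add: is_restriction_functor_def)
  qed
  fix P
  show "\<exists>h\<in>Hom (PSh_jr X) Q P. \<forall>B\<in>Obj X. \<forall>f\<in>{f \<in> Hom X B A. \<exists>d\<in>D. d \<cdot> f = f}.
      h \<cdot>\<^bsub>PSh_jr X\<^esub> (r \<cdot>\<^bsub>PSh_jr X\<^esub> Fa (yoneda_jr X) f) = mu B f"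
    if mu: "wcocone X (\<lambda>B. {f \<in> Hom X B A. \<exists>d\<in>D. d \<cdot> f = f}) (\<lambda>g f. f \<cdot> g) (PSh_jr X) (yoneda_jr X) P mu"
    for mu
  proof -
    obtain q where q: "q \<in> PEl P A"
      "\<And>B f d. f \<in> Hom X B A \<Longrightarrow> d \<in> D \<Longrightarrow> d \<cdot> f = f \<Longrightarrow> mu B f = yel X P B (PAct P f q)"
      using sieve_element[OF A D mu] by blast
    have P: "join_restriction_presheaf X P"
      using wcoconeD(1)[OF mu] by simp
    note yq = yel_Hom[OF P A q(1)]
    \<comment> \<open>The glued element \<open>q\<close> gives a map from the representable at
      \<open>A\<close>; preceded by the inclusion \<open>m\<close> of the splitting, it is the
      mediating map.\<close>
    have "yel X P A q \<cdot>\<^bsub>PSh_jr X\<^esub> m \<cdot>\<^bsub>PSh_jr X\<^esub> (r \<cdot>\<^bsub>PSh_jr X\<^esub> Fa (yoneda_jr X) f) = mu B f"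
      if f: "f \<in> Hom X B A" "d \<in> D" "d \<cdot> f = f" for f B d
      using PSh.comp_assoc[OF PSh.comp_in_Hom[OF yH[OF f(1)] r] m yq] mry[OF f(1)] ef[OF f]
        yel_act[OF P f(1) q(1)] q(2)[OF f] by simp
    then show ?thesis
      using PSh.comp_in_Hom[OF m yq] by blast
  qed
  fix h h' assume h: "h \<in> Hom (PSh_jr X) Q P" "h' \<in> Hom (PSh_jr X) Q P"
    and eq: "\<And>B f. B \<in> Obj X \<Longrightarrow> f \<in> {f \<in> Hom X B A. \<exists>d\<in>D. d \<cdot> f = f} \<Longrightarrow>
      h \<cdot>\<^bsub>PSh_jr X\<^esub> (r \<cdot>\<^bsub>PSh_jr X\<^esub> Fa (yoneda_jr X) f) = h' \<cdot>\<^bsub>PSh_jr X\<^esub> (r \<cdot>\<^bsub>PSh_jr X\<^esub> Fa (yoneda_jr X) f)"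
  interpret P: jr_sheaf X "PEl P" "PAct P" "PRst P"
    using PSh_HomD(2)[OF h(1)] by (rule jr_sheaf_psh)
  have val: "TMap (k \<cdot>\<^bsub>PSh_jr X\<^esub> (r \<cdot>\<^bsub>PSh_jr X\<^esub> Fa (yoneda_jr X) d)) A (Idn X A)
      = PAct P d (TMap (k \<cdot>\<^bsub>PSh_jr X\<^esub> r) A (Idn X A))"
    if k: "k \<in> Hom (PSh_jr X) Q P" and d: "d \<in> Idem X A" for k d
  proof -
    note dH = Idem_Hom[OF d]
    note kr = PSh.comp_in_Hom[OF r k]
    have "TMap (k \<cdot>\<^bsub>PSh_jr X\<^esub> r \<cdot>\<^bsub>PSh_jr X\<^esub> Fa (yoneda_jr X) d) A (Idn X A)
        = TMap (k \<cdot>\<^bsub>PSh_jr X\<^esub> r) A d"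
      using TMap_comp[OF yH[OF dH] A, of "Idn X A"] TMap_yoneda[OF dH idn_in_Hom[OF A]] comp_idn_right[OF dH]
        idn_in_Hom[OF A] A by simp
    then show ?thesis
      using yel_eval[OF kr dH] PSh.comp_assoc[OF yH[OF dH] r k] by simp
  qed
  have re: "r \<cdot>\<^bsub>PSh_jr X\<^esub> Fa (yoneda_jr X) e = r"
    using PSh.comp_assoc[OF r m r] mr rm PSh.comp_idn_left[OF r] by simp
  have i: "Idn X A \<in> PEl (representable X A) A"
    using A idn_in_Hom by simp
  have v_in: "TMap (k \<cdot>\<^bsub>PSh_jr X\<^esub> r) A (Idn X A) \<in> PEl P A" if k: "k \<in> Hom (PSh_jr X) Q P" for k
    using PSh_in[OF PSh.comp_in_Hom[OF r k] A i] .
  have v_e: "PAct P e (TMap (k \<cdot>\<^bsub>PSh_jr X\<^esub> r) A (Idn X A)) = TMap (k \<cdot>\<^bsub>PSh_jr X\<^esub> r) A (Idn X A)"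
    if k: "k \<in> Hom (PSh_jr X) Q P" for k
    using val[OF k eI] re by simp
  \<comment> \<open>By Yoneda only the value at the identity has to be compared. It lives over
    \<open>e\<close>, and the legs at the members of \<open>D\<close> determine it over a cover of
    \<open>e\<close>.\<close>
  have "TMap (h \<cdot>\<^bsub>PSh_jr X\<^esub> r) A (Idn X A) = TMap (h' \<cdot>\<^bsub>PSh_jr X\<^esub> r) A (Idn X A)"
  proof (rule P.sep_cover[OF A D e v_in[OF h(1)] v_in[OF h(2)] v_e[OF h(1)] v_e[OF h(2)]])
    fix d assume d: "d \<in> D"
    then have dI: "d \<in> Idem X A"
      using D by auto
    have "h \<cdot>\<^bsub>PSh_jr X\<^esub> (r \<cdot>\<^bsub>PSh_jr X\<^esub> Fa (yoneda_jr X) d) = h' \<cdot>\<^bsub>PSh_jr X\<^esub> (r \<cdot>\<^bsub>PSh_jr X\<^esub> Fa (yoneda_jr X) d)"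
      by (rule eq[OF A]) (use d Idem_Hom[OF dI] Idem_idem[OF dI] in auto)
    then show "PAct P d (TMap (h \<cdot>\<^bsub>PSh_jr X\<^esub> r) A (Idn X A)) = PAct P d (TMap (h' \<cdot>\<^bsub>PSh_jr X\<^esub> r) A (Idn X A))"
      using val[OF h(1) dI] val[OF h(2) dI] by simp
  qed
  then have "h \<cdot>\<^bsub>PSh_jr X\<^esub> r = h' \<cdot>\<^bsub>PSh_jr X\<^esub> r"
    by (rule yel_eqI[OF PSh.comp_in_Hom[OF r h(1)] PSh.comp_in_Hom[OF r h(2)]])
  moreover have "k = k \<cdot>\<^bsub>PSh_jr X\<^esub> r \<cdot>\<^bsub>PSh_jr X\<^esub> m" if "k \<in> Hom (PSh_jr X) Q P" for k
    using PSh.comp_assoc[OF m r that] rm PSh.comp_idn_right[OF that] by simp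
  ultimately show "h = h'"
    using h by metis
qed

lemma cocontinuous_preserves_Idem_join:
  fixes H :: "(('o, 'u, 'u) psh, (('o, 'u, 'u) psh, 'o \<Rightarrow> 'u \<Rightarrow> 'u) transf, 'p, 'b) func"
  assumes E: "join_restriction_category E" "cocomplete TYPE('u) E"
    and H: "is_restriction_functor (PSh_jr X) E H" "cocontinuous TYPE('u) (PSh_jr X) E H"
    and A: "A \<in> Obj X" and D: "D \<subseteq> Idem X A" and e: "is_join X A A D e"
  defines "F \<equiv> comp_functor X H (yoneda_jr X)"
  shows "is_join E (Fo F A) (Fo F A) (Fa F ` D) (Fa F e)"
proof -
  interpret PSh: restriction_category "PSh_jr X"
    by (rule restriction_category_PSh)
  interpret E: join_restriction_category E by fact
  have F: "is_restriction_functor X E F"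
    unfolding F_def using is_restriction_functor_comp[OF yoneda_restriction_functor H(1)] .
  have Ff: "is_functor X E F" and Hf: "is_functor (PSh_jr X) E H"
    using F H(1) by (auto simp: is_restriction_functor_def)
  note FD = is_functorD[OF Ff] and HD = is_functorD[OF Hf]
  have FI: "Fa F d \<in> Idem E (Fo F A)" if "d \<in> Idem X A" for d
    using FD(2)[OF Idem_Hom[OF that]] F HomD(1)[OF Idem_Hom[OF that]] Idem_rst[OF that]
    by (auto simp: Idem_def is_restriction_functor_def)
  have FH: "Fa F f = Fa H (Fa (yoneda_jr X) f)" if "f \<in> Hom X B A" for f B
    using HomD(1)[OF that] by (simp add: F_def)
  have FA: "Fo F A = Fo H (representable X A)"
    using A by (simp add: F_def yoneda_Fo)
  have eI: "e \<in> Idem X A"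
    using is_join_Idem[OF A D e] .
  note eH = Idem_Hom[OF eI]
  have "restriction_idempotent (PSh_jr X) (Fa (yoneda_jr X) e)"
    using yoneda_restriction_functor HomD(1)[OF eH] Idem_rst[OF eI] HomD(1)[OF yoneda_Hom[OF eH]]
    by (auto simp: is_restriction_functor_def restriction_idempotent_def)
  then obtain Q r m where r: "r \<in> Hom (PSh_jr X) (representable X A) Q"
    and m: "m \<in> Hom (PSh_jr X) Q (representable X A)"
    and mr: "m \<cdot>\<^bsub>PSh_jr X\<^esub> r = Fa (yoneda_jr X) e" and rm: "r \<cdot>\<^bsub>PSh_jr X\<^esub> m = Idn (PSh_jr X) Q"
    using PSh_split unfolding split_category_def HomD(2)[OF yoneda_Hom[OF eH], symmetric] by blast
  interpret S: rpresheaf X "\<lambda>B. {f \<in> Hom X B A. \<exists>d\<in>D. d \<cdot> f = f}" "\<lambda>g f. f \<cdot> g" "\<lambda>B. Rst X"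
    by (rule rpresheaf_sieve[OF D])
  let ?lam = "\<lambda>B f. r \<cdot>\<^bsub>PSh_jr X\<^esub> Fa (yoneda_jr X) f"
  have Sm: "small TYPE('u) {f \<in> Hom X B A. \<exists>d\<in>D. d \<cdot> f = f}" for B
    by (rule small_subset[OF _ small_Hom[of B A]]) auto
  have HQ: "wcolim X (\<lambda>B. {f \<in> Hom X B A. \<exists>d\<in>D. d \<cdot> f = f}) (\<lambda>g f. f \<cdot> g) (\<lambda>B. Rst X)
      E F (Fo H Q) (\<lambda>B f. Fa H (?lam B f))"
    unfolding F_def
    by (rule S.wcolim_preserved[OF universe small_Obj small_Arr Sm restriction_category_PSh PSh_split
          yoneda_restriction_functor E.restriction_category_axioms E(2) H wcolim_sieve[OF A D e r m mr rm]])
  have FAo: "Fo F A \<in> Obj E"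
    using FD(1)[OF A] .
  have FDI: "Fa F ` D \<subseteq> Idem E (Fo F A)"
    using FI D by blast
  \<comment> \<open>The images of \<open>D\<close> have some join \<open>k\<close> in
    \<open>E\<close>, and the goal becomes that \<open>k\<close> is \<open>Fa F e\<close>. One
    inequality is monotonicity of \<open>F\<close>; the other holds once \<open>k\<close> is seen to
    fix the image of the inclusion \<open>m\<close>.\<close>
  obtain k where k: "is_join E (Fo F A) (Fo F A) (Fa F ` D) k"
    using E.Idem_join_exists[OF FAo FDI] by blast
  have kI: "k \<in> Idem E (Fo F A)"
    using E.is_join_Idem[OF FAo FDI k] .
  note kH = E.Idem_Hom[OF kI]
  have Hm: "Fa H m \<in> Hom E (Fo H Q) (Fo F A)" and Hr: "Fa H r \<in> Hom E (Fo F A) (Fo H Q)"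
    using HD(2)[OF m] HD(2)[OF r] by (simp_all add: FA)
  have Hmr: "Fa H m \<cdot>\<^bsub>E\<^esub> Fa H r = Fa F e"
    using HD(4)[OF r m] mr FH[OF eH] by simp
  have "k \<cdot>\<^bsub>E\<^esub> Fa H m = Fa H m"
  proof (rule wcolim_epi[OF category_axioms E.category_axioms Ff HQ E.comp_in_Hom[OF Hm kH] Hm])
    fix B f assume B: "B \<in> Obj X" and "f \<in> {f \<in> Hom X B A. \<exists>d\<in>D. d \<cdot> f = f}"
    then obtain d where f: "f \<in> Hom X B A" and d: "d \<in> D" "d \<cdot> f = f"
      by auto
    have dI: "d \<in> Idem X A"
      using d D by auto
    note yf = yoneda_Hom[OF f] and Ff' = FD(2)[OF f]
    have "e \<cdot> d = d"
      using e d(1) rle_Idem[OF dI] by (auto simp: is_join_def)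
    then have ef: "e \<cdot> f = f"
      using comp_assoc[OF f Idem_Hom[OF dI] eH] d(2) by simp
    have l: "Fa H (?lam B f) \<in> Hom E (Fo F B) (Fo H Q)"
      using HD(2)[OF PSh.comp_in_Hom[OF yf r]] B by (simp add: F_def yoneda_Fo)
    have "m \<cdot>\<^bsub>PSh_jr X\<^esub> ?lam B f = Fa (yoneda_jr X) f"
      using PSh.comp_assoc[OF yf r m] mr yoneda_comp[OF f eH] ef by simp
    then have *: "Fa H m \<cdot>\<^bsub>E\<^esub> Fa H (?lam B f) = Fa F f"
      using HD(4)[OF PSh.comp_in_Hom[OF yf r] m] FH[OF f] by simp
    \<comment> \<open>On the leg at \<open>f\<close> the map factors through \<open>Fa F d\<close>
      for some \<open>d\<close> in \<open>D\<close>, and \<open>k\<close> absorbs each of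
      these.\<close>
    have "k \<cdot>\<^bsub>E\<^esub> Fa F d = Fa F d"
      using k d(1) E.rle_Idem[OF FI[OF dI]] by (auto simp: is_join_def)
    then have "k \<cdot>\<^bsub>E\<^esub> Fa F f = Fa F f"
      using FD(4)[OF f Idem_Hom[OF dI]] d(2) E.comp_assoc[OF Ff' FD(2)[OF Idem_Hom[OF dI]] kH] by simp
    then show "k \<cdot>\<^bsub>E\<^esub> Fa H m \<cdot>\<^bsub>E\<^esub> Fa H (?lam B f) = Fa H m \<cdot>\<^bsub>E\<^esub> Fa H (?lam B f)"
      using E.comp_assoc[OF l Hm kH] * by simp
  qed
  then have k1: "k \<cdot>\<^bsub>E\<^esub> Fa F e = Fa F e"
    using E.comp_assoc[OF Hr Hm kH] Hmr by simp
  have "rle E k (Fa F e)"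
  proof -
    have "rle E (Fa F d) (Fa F e)" if d: "d \<in> D" for d
    proof -
      have dI: "d \<in> Idem X A"
        using d D by auto
      have "e \<cdot> d = d"
        using e d rle_Idem[OF dI] by (auto simp: is_join_def)
      then show ?thesis
        using E.rle_Idem[OF FI[OF dI]] FD(4)[OF Idem_Hom[OF dI] eH] by simp
    qed
    then show ?thesis
      using k FD(2)[OF eH] by (auto simp: is_join_def)
  qed
  then have "Fa F e \<cdot>\<^bsub>E\<^esub> k = k"
    using E.rle_Idem[OF kI] by simp
  then have "k = Fa F e"
    using k1 E.Idem_commute[OF kI FI[OF eI]] by simp
  then show ?thesis
    using k by simp
qed

text \<open>By \<open>glued_hom_iff\<close> a join of maps is given by equations, which any
  restriction functor respects, and a join of idempotents, which the previous lemma
  preserves.\<close>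

lemma cocontinuous_join_restriction_functor:
  fixes H :: "(('o, 'u, 'u) psh, (('o, 'u, 'u) psh, 'o \<Rightarrow> 'u \<Rightarrow> 'u) transf, 'p, 'b) func"
  assumes E: "join_restriction_category E" "cocomplete TYPE('u) E"
    and H: "is_restriction_functor (PSh_jr X) E H" "cocontinuous TYPE('u) (PSh_jr X) E H"
  shows "is_join_restriction_functor X E (comp_functor X H (yoneda_jr X))"
    (is "is_join_restriction_functor X E ?F")
  unfolding is_join_restriction_functor_def
proof (intro conjI ballI allI impI)
  interpret E: join_restriction_category E by fact
  show F: "is_restriction_functor X E ?F"
    using is_restriction_functor_comp[OF yoneda_restriction_functor H(1)] .
  then have Ff: "is_functor X E ?F" and Fr: "\<And>f. f \<in> Arr X \<Longrightarrow> Fa ?F (Rst X f) = Rst E (Fa ?F f)"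
    by (auto simp: is_restriction_functor_def)
  note FD = is_functorD[OF Ff]
  fix A B S j
  assume A: "A \<in> Obj X" and B: "B \<in> Obj X"
    and asm: "S \<subseteq> Hom X A B \<and> compatible X S \<and> is_join X A B S j"
  then have S: "S \<subseteq> Hom X A B" and C: "compatible X S" and j: "is_join X A B S j"
    by auto
  have j1: "j \<in> Hom X A B" "\<And>s. s \<in> S \<Longrightarrow> j \<cdot> Rst X s = s" "is_join X A A (Rst X ` S) (Rst X j)"
    using glued_hom_iff[OF A B S C] j by auto
  have FS: "Fa ?F ` S \<subseteq> Hom E (Fo ?F A) (Fo ?F B)"
    using S FD(2) by blast
  have comp: "Fa ?F s \<cdot>\<^bsub>E\<^esub> Rst E (Fa ?F t) = Fa ?F (s \<cdot> Rst X t)"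
    if "s \<in> Hom X A B" "t \<in> Hom X A B" for s t
    using FD(4)[OF rst_in_Hom[OF that(2)] that(1)] Fr[OF HomD(1)[OF that(2)]] by simp
  have FC: "compatible E (Fa ?F ` S)"
    using C S comp unfolding compatible_def by (auto simp: subset_iff)
  have "Fa ?F j \<cdot>\<^bsub>E\<^esub> Rst E t = t" if t: "t \<in> Fa ?F ` S" for t
    using t comp[OF j1(1)] j1(2) S by auto
  moreover have "Rst X ` S \<subseteq> Idem X A"
    using S rst_Idem by blast
  then have "is_join E (Fo ?F A) (Fo ?F A) (Fa ?F ` Rst X ` S) (Fa ?F (Rst X j))"
    using cocontinuous_preserves_Idem_join[OF E H A _ j1(3)] by blast
  moreover have "Fa ?F ` Rst X ` S = Rst E ` Fa ?F ` S"
    unfolding image_image using S Fr[OF HomD(1)] by (intro image_cong) (auto simp del: comp_functor_simps)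
  ultimately show "is_join E (Fo ?F A) (Fo ?F B) (Fa ?F ` S) (Fa ?F j)"
    using E.glued_hom_iff[OF FD(1)[OF A] FD(1)[OF B] FS FC] FD(2)[OF j1(1)] Fr[OF HomD(1)[OF j1(1)]] by simp
qed

end

section \<open>Equivalences and functors with a right adjoint\<close>

lemma isomorphismI:
  assumes "f \<in> Hom C A B" "g \<in> Hom C B A" "g \<cdot>\<^bsub>C\<^esub> f = Idn C A" "f \<cdot>\<^bsub>C\<^esub> g = Idn C B"
  shows "isomorphism C f"
  using assms by (auto simp: isomorphism_def Hom_def)

lemma isomorphismD:
  assumes "isomorphism C f" "f \<in> Hom C A B"
  obtains g where "g \<in> Hom C B A" "g \<cdot>\<^bsub>C\<^esub> f = Idn C A" "f \<cdot>\<^bsub>C\<^esub> g = Idn C B"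
  using assms by (auto simp: isomorphism_def Hom_def)

lemma nat_transI:
  assumes "is_functor C D F" "is_functor C D G" "t \<in> extensional (Obj C)"
    and "\<And>A. A \<in> Obj C \<Longrightarrow> t A \<in> Hom D (Fo F A) (Fo G A)"
    and "\<And>f A B. f \<in> Hom C A B \<Longrightarrow> t B \<cdot>\<^bsub>D\<^esub> Fa F f = Fa G f \<cdot>\<^bsub>D\<^esub> t A"
  shows "nat_trans C D F G t"
  using assms unfolding nat_trans_def by (auto simp: PiE_def Pi_def Hom_def)

lemma is_equivalenceI:
  assumes C: "category C" and D: "category D" and F: "is_functor C D F"
    and ff: "\<And>c c' g. c \<in> Obj C \<Longrightarrow> c' \<in> Obj C \<Longrightarrow> g \<in> Hom D (Fo F c) (Fo F c') \<Longrightarrow>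
      \<exists>!f. f \<in> Hom C c c' \<and> Fa F f = g"
    and es: "\<And>d. d \<in> Obj D \<Longrightarrow> \<exists>c\<in>Obj C. \<exists>f\<in>Hom D (Fo F c) d. isomorphism D f"
  shows "is_equivalence C D F"
proof -
  interpret C: category C by fact
  interpret D: category D by fact
  note FD = is_functorD[OF F]
  have "\<exists>z. fst z \<in> Obj C \<and> fst (snd z) \<in> Hom D (Fo F (fst z)) d \<and> snd (snd z) \<in> Hom D d (Fo F (fst z)) \<and>
      snd (snd z) \<cdot>\<^bsub>D\<^esub> fst (snd z) = Idn D (Fo F (fst z)) \<and> fst (snd z) \<cdot>\<^bsub>D\<^esub> snd (snd z) = Idn D d"
    if d: "d \<in> Obj D" for d
  proof -
    obtain c f where c: "c \<in> Obj C" and f: "f \<in> Hom D (Fo F c) d" "isomorphism D f"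
      using es[OF d] by blast
    obtain g where "g \<in> Hom D d (Fo F c)" "g \<cdot>\<^bsub>D\<^esub> f = Idn D (Fo F c)" "f \<cdot>\<^bsub>D\<^esub> g = Idn D d"
      using isomorphismD[OF f(2,1)] by blast
    then show ?thesis
      using c f by (intro exI[of _ "(c, f, g)"]) simp
  qed
  then obtain z where z: "\<And>d. d \<in> Obj D \<Longrightarrow> fst (z d) \<in> Obj C \<and> fst (snd (z d)) \<in> Hom D (Fo F (fst (z d))) d \<and>
      snd (snd (z d)) \<in> Hom D d (Fo F (fst (z d))) \<and>
      snd (snd (z d)) \<cdot>\<^bsub>D\<^esub> fst (snd (z d)) = Idn D (Fo F (fst (z d))) \<and>
      fst (snd (z d)) \<cdot>\<^bsub>D\<^esub> snd (snd (z d)) = Idn D d"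
    by metis
  define g0 eps eps' where "g0 d = fst (z d)" and "eps d = fst (snd (z d))" and "eps' d = snd (snd (z d))" for d
  have g0: "g0 d \<in> Obj C" and eps: "eps d \<in> Hom D (Fo F (g0 d)) d" and eps': "eps' d \<in> Hom D d (Fo F (g0 d))"
    and e1: "eps' d \<cdot>\<^bsub>D\<^esub> eps d = Idn D (Fo F (g0 d))" and e2: "eps d \<cdot>\<^bsub>D\<^esub> eps' d = Idn D d"
    if "d \<in> Obj D" for d
    using z[OF that] by (simp_all add: g0_def eps_def eps'_def)
  define lift where "lift c c' g = (THE f. f \<in> Hom C c c' \<and> Fa F f = g)" for c c' g
  have lift: "lift c c' g \<in> Hom C c c'" "Fa F (lift c c' g) = g"
    if "c \<in> Obj C" "c' \<in> Obj C" "g \<in> Hom D (Fo F c) (Fo F c')" for c c' g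
    using theI'[OF ff[OF that]] by (simp_all add: lift_def)
  have faithful: "f = f'" if "f \<in> Hom C c c'" "f' \<in> Hom C c c'" "Fa F f = Fa F f'" for f f' c c'
    using ff[OF C.Hom_Obj[OF that(1)] FD(2)[OF that(1)]] that by metis
  define conj where "conj g d d' = eps' d' \<cdot>\<^bsub>D\<^esub> (g \<cdot>\<^bsub>D\<^esub> eps d)" for g d d'
  have conj: "conj g d d' \<in> Hom D (Fo F (g0 d)) (Fo F (g0 d'))"
    and eps_conj: "eps d' \<cdot>\<^bsub>D\<^esub> conj g d d' = g \<cdot>\<^bsub>D\<^esub> eps d" if g: "g \<in> Hom D d d'" for g d d'
  proof -
    have d: "d \<in> Obj D" "d' \<in> Obj D"
      using D.Hom_Obj[OF g] by auto
    note ge = D.comp_in_Hom[OF eps[OF d(1)] g]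
    show "conj g d d' \<in> Hom D (Fo F (g0 d)) (Fo F (g0 d'))"
      unfolding conj_def using D.comp_in_Hom[OF ge eps'[OF d(2)]] .
    show "eps d' \<cdot>\<^bsub>D\<^esub> conj g d d' = g \<cdot>\<^bsub>D\<^esub> eps d"
      unfolding conj_def using D.comp_assoc[OF ge eps'[OF d(2)] eps[OF d(2)]] e2[OF d(2)] D.comp_idn_left[OF ge]
      by simp
  qed
  \<comment> \<open>\<open>eps d'\<close> is invertible, so \<open>conj\<close> is the only solution
    of its naturality square. Functoriality of the quasi-inverse follows by comparing
    solutions.\<close>
  have conj_unique: "h = conj g d d'"
    if g: "g \<in> Hom D d d'" and h: "h \<in> Hom D (Fo F (g0 d)) (Fo F (g0 d'))"
      and eq: "eps d' \<cdot>\<^bsub>D\<^esub> h = g \<cdot>\<^bsub>D\<^esub> eps d" for g d d' h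
  proof -
    have d: "d \<in> Obj D" "d' \<in> Obj D"
      using D.Hom_Obj[OF g] by auto
    have "eps' d' \<cdot>\<^bsub>D\<^esub> (eps d' \<cdot>\<^bsub>D\<^esub> h) = h"
      using D.comp_assoc[OF h eps[OF d(2)] eps'[OF d(2)]] e1[OF d(2)] D.comp_idn_left[OF h] by simp
    then show ?thesis
      using eq by (simp add: conj_def)
  qed
  define G where "G = \<lparr>Fo = (\<lambda>d\<in>Obj D. g0 d),
    Fa = (\<lambda>g\<in>Arr D. lift (g0 (Dom D g)) (g0 (Cod D g)) (conj g (Dom D g) (Cod D g)))\<rparr>"
  have Go: "Fo G d = g0 d" if "d \<in> Obj D" for d
    using that by (simp add: G_def)
  have Ga: "Fa G g \<in> Hom C (g0 d) (g0 d')" "Fa F (Fa G g) = conj g d d'" if g: "g \<in> Hom D d d'" for g d d'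
    using lift[OF g0[OF D.Hom_Obj(1)[OF g]] g0[OF D.Hom_Obj(2)[OF g]] conj[OF g]] HomD[OF g]
    by (simp_all add: G_def)
  have G: "is_functor D C G"
  proof (rule is_functorI)
    show "Fo G \<in> extensional (Obj D)" "Fa G \<in> extensional (Arr D)"
      by (simp_all add: G_def)
  next
    fix d assume d: "d \<in> Obj D"
    show "Fo G d \<in> Obj C"
      using Go g0 d by simp
    have "Fa F (Fa G (Idn D d)) = Fa F (Idn C (g0 d))"
      unfolding Ga(2)[OF D.idn_in_Hom[OF d]] FD(3)[OF g0[OF d]]
      by (rule conj_unique[symmetric, OF D.idn_in_Hom[OF d] D.idn_in_Hom[OF FD(1)[OF g0[OF d]]]])
        (simp add: D.comp_idn_right[OF eps[OF d]] D.comp_idn_left[OF eps[OF d]])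
    then show "Fa G (Idn D d) = Idn C (Fo G d)"
      using faithful[OF Ga(1)[OF D.idn_in_Hom[OF d]] C.idn_in_Hom[OF g0[OF d]]] Go[OF d] by simp
  next
    fix g d d' assume g: "g \<in> Hom D d d'"
    show "Fa G g \<in> Hom C (Fo G d) (Fo G d')"
      using Ga(1)[OF g] Go D.Hom_Obj[OF g] by simp
    fix h d'' assume h: "h \<in> Hom D d' d''"
    have d: "d \<in> Obj D" "d' \<in> Obj D" "d'' \<in> Obj D"
      using D.Hom_Obj[OF g] D.Hom_Obj[OF h] by auto
    note cg = conj[OF g] and ch = conj[OF h]
    have "eps d'' \<cdot>\<^bsub>D\<^esub> (conj h d' d'' \<cdot>\<^bsub>D\<^esub> conj g d d') = h \<cdot>\<^bsub>D\<^esub> g \<cdot>\<^bsub>D\<^esub> eps d"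
      using D.comp_assoc[OF cg ch eps[OF d(3)]] eps_conj[OF h] D.comp_assoc[OF cg eps[OF d(2)] h] eps_conj[OF g]
        D.comp_assoc[OF eps[OF d(1)] g h] by simp
    then have "conj h d' d'' \<cdot>\<^bsub>D\<^esub> conj g d d' = conj (h \<cdot>\<^bsub>D\<^esub> g) d d''"
      using conj_unique[OF D.comp_in_Hom[OF g h] D.comp_in_Hom[OF cg ch]] by simp
    then have "Fa F (Fa G h \<cdot>\<^bsub>C\<^esub> Fa G g) = Fa F (Fa G (h \<cdot>\<^bsub>D\<^esub> g))"
      using FD(4)[OF Ga(1)[OF g] Ga(1)[OF h]] Ga(2)[OF g] Ga(2)[OF h] Ga(2)[OF D.comp_in_Hom[OF g h]] by simp
    then show "Fa G (h \<cdot>\<^bsub>D\<^esub> g) = Fa G h \<cdot>\<^bsub>C\<^esub> Fa G g"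
      using faithful[OF C.comp_in_Hom[OF Ga(1)[OF g] Ga(1)[OF h]] Ga(1)[OF D.comp_in_Hom[OF g h]]] by simp
  qed
  have "naturally_isomorphic D D (comp_functor D F G) (id_functor D)"
    unfolding naturally_isomorphic_def
  proof (intro exI[of _ "restrict eps (Obj D)"] conjI ballI)
    show "nat_trans D D (comp_functor D F G) (id_functor D) (restrict eps (Obj D))"
    proof (rule nat_transI[OF is_functor_comp[OF D G F] is_functor_id[OF D]])
      fix g d d' assume g: "g \<in> Hom D d d'"
      show "restrict eps (Obj D) d' \<cdot>\<^bsub>D\<^esub> Fa (comp_functor D F G) g = Fa (id_functor D) g \<cdot>\<^bsub>D\<^esub> restrict eps (Obj D) d"
        using eps_conj[OF g] Ga(2)[OF g] HomD(1)[OF g] D.Hom_Obj[OF g] by simp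
    qed (use eps Go in auto)
    fix d assume d: "d \<in> Obj D"
    show "isomorphism D (restrict eps (Obj D) d)"
      using isomorphismI[OF eps[OF d] eps'[OF d] e1[OF d] e2[OF d]] d by simp
  qed
  moreover have "naturally_isomorphic C C (comp_functor C G F) (id_functor C)"
    unfolding naturally_isomorphic_def
  proof -
    \<comment> \<open>The second natural isomorphism is the lift along the full and faithful
      \<open>F\<close> of the first one at \<open>Fo F c\<close>; lifting \<open>eps'\<close> gives
      its inverse.\<close>
    define eta where "eta c = lift (g0 (Fo F c)) c (eps (Fo F c))" for c
    have eta: "eta c \<in> Hom C (g0 (Fo F c)) c" "Fa F (eta c) = eps (Fo F c)" if c: "c \<in> Obj C" for c
      using lift[OF g0[OF FD(1)[OF c]] c eps[OF FD(1)[OF c]]] by (simp_all add: eta_def)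
    show "\<exists>t. nat_trans C C (comp_functor C G F) (id_functor C) t \<and> (\<forall>A\<in>Obj C. isomorphism C (t A))"
    proof (intro exI[of _ "restrict eta (Obj C)"] conjI ballI)
      show "nat_trans C C (comp_functor C G F) (id_functor C) (restrict eta (Obj C))"
      proof (rule nat_transI[OF is_functor_comp[OF C F G] is_functor_id[OF C]])
        show "restrict eta (Obj C) c \<in> Hom C (Fo (comp_functor C G F) c) (Fo (id_functor C) c)"
          if c: "c \<in> Obj C" for c
          using eta(1)[OF c] Go[OF FD(1)[OF c]] c by simp
        fix f c c' assume f: "f \<in> Hom C c c'"
        have c: "c \<in> Obj C" "c' \<in> Obj C"
          using C.Hom_Obj[OF f] by auto
        note GFf = Ga[OF FD(2)[OF f]]
        have "Fa F (eta c' \<cdot>\<^bsub>C\<^esub> Fa G (Fa F f)) = Fa F (f \<cdot>\<^bsub>C\<^esub> eta c)"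
          using FD(4)[OF GFf(1) eta(1)[OF c(2)]] FD(4)[OF eta(1)[OF c(1)] f] eta(2)[OF c(1)] eta(2)[OF c(2)]
            GFf(2) eps_conj[OF FD(2)[OF f]] by simp
        then have "eta c' \<cdot>\<^bsub>C\<^esub> Fa G (Fa F f) = f \<cdot>\<^bsub>C\<^esub> eta c"
          using faithful[OF C.comp_in_Hom[OF GFf(1) eta(1)[OF c(2)]] C.comp_in_Hom[OF eta(1)[OF c(1)] f]] by simp
        then show "restrict eta (Obj C) c' \<cdot>\<^bsub>C\<^esub> Fa (comp_functor C G F) f = Fa (id_functor C) f \<cdot>\<^bsub>C\<^esub> restrict eta (Obj C) c"
          using c HomD(1)[OF f] by simp
      qed simp
      fix c assume c: "c \<in> Obj C"
      note Fc = FD(1)[OF c]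
      define theta where "theta = lift c (g0 (Fo F c)) (eps' (Fo F c))"
      have theta: "theta \<in> Hom C c (g0 (Fo F c))" "Fa F theta = eps' (Fo F c)"
        using lift[OF c g0[OF Fc] eps'[OF Fc]] by (simp_all add: theta_def)
      have "theta \<cdot>\<^bsub>C\<^esub> eta c = Idn C (g0 (Fo F c))"
        by (rule faithful[OF C.comp_in_Hom[OF eta(1)[OF c] theta(1)] C.idn_in_Hom[OF g0[OF Fc]]])
          (simp add: FD(4)[OF eta(1)[OF c] theta(1)] eta(2)[OF c] theta(2) e1[OF Fc] FD(3)[OF g0[OF Fc]])
      moreover have "eta c \<cdot>\<^bsub>C\<^esub> theta = Idn C c"
        by (rule faithful[OF C.comp_in_Hom[OF theta(1) eta(1)[OF c]] C.idn_in_Hom[OF c]])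
          (simp add: FD(4)[OF theta(1) eta(1)[OF c]] eta(2)[OF c] theta(2) e2[OF Fc] FD(3)[OF c])
      ultimately show "isomorphism C (restrict eta (Obj C) c)"
        using isomorphismI[OF eta(1)[OF c] theta(1)] c by simp
    qed
  qed
  ultimately show ?thesis
    using C D F G by (auto simp: is_equivalence_def)
qed

section \<open>Left adjoints preserve colimits\<close>

lemma is_cocone_functor:
  assumes J: "category J" and K: "is_functor J C K" and F: "is_functor C D F"
    and c: "is_cocone C J K c leg"
  shows "is_cocone D J (comp_functor J F K) (Fo F c) (\<lambda>i. Fa F (leg i))"
proof (rule is_coconeI)
  note cD = is_coconeD[OF c] and FD = is_functorD[OF F]
  show "Fo F c \<in> Obj D"
    using FD(1) cD(1) .
  show "Fa F (leg i) \<in> Hom D (Fo (comp_functor J F K) i) (Fo F c)" if "i \<in> Obj J" for i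
    using FD(2)[OF cD(2)[OF that]] that by simp
  fix u i j assume u: "u \<in> Hom J i j"
  have j: "j \<in> Obj J"
    using category.Hom_Obj[OF J u] by simp
  show "Fa F (leg j) \<cdot>\<^bsub>D\<^esub> Fa (comp_functor J F K) u = Fa F (leg i)"
    using FD(4)[OF is_functorD(2)[OF K u] cD(2)[OF j]] cD(3)[OF u] HomD(1)[OF u] by simp
qed

text \<open>Adjointness is given objectwise, as a representation by \<open>n\<close> of the maps out
  of \<open>F\<close> into each single \<open>d\<close>, so no functor in the other direction has to
  be assembled. Cocones into \<open>d\<close> are moved to cocones into \<open>n\<close> and
  factored there.\<close>

lemma left_adjoint_preserves_colimit:
  assumes C: "category C" and D: "category D" and J: "category J"
    and F: "is_functor C D F" and K: "is_functor J C K" and c: "is_colimit C J K c leg"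
    and adj: "\<And>d. d \<in> Obj D \<Longrightarrow> \<exists>n\<in>Obj C. \<exists>nu.
      (\<forall>a\<in>Obj C. bij_betw (nu a) (Hom D (Fo F a) d) (Hom C a n)) \<and>
      (\<forall>a b. \<forall>\<alpha>\<in>Hom C a b. \<forall>g\<in>Hom D (Fo F b) d. nu a (g \<cdot>\<^bsub>D\<^esub> Fa F \<alpha>) = nu b g \<cdot>\<^bsub>C\<^esub> \<alpha>)"
  shows "is_colimit D J (comp_functor J F K) (Fo F c) (\<lambda>i. Fa F (leg i))"
proof (rule is_colimitI)
  interpret C: category C by fact
  interpret D: category D by fact
  interpret J: category J by fact
  note cD = is_colimitD[OF c] and FD = is_functorD[OF F] and KD = is_functorD[OF K]
  show "is_cocone D J (comp_functor J F K) (Fo F c) (\<lambda>i. Fa F (leg i))"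
    using is_cocone_functor[OF J K F cD(1)] .
  fix d
  show "\<exists>h\<in>Hom D (Fo F c) d. \<forall>i\<in>Obj J. h \<cdot>\<^bsub>D\<^esub> Fa F (leg i) = k i"
    if k: "is_cocone D J (comp_functor J F K) d k" for k
  proof -
    note kD = is_coconeD[OF k]
    obtain n nu where n: "n \<in> Obj C" and bij: "\<And>a. a \<in> Obj C \<Longrightarrow> bij_betw (nu a) (Hom D (Fo F a) d) (Hom C a n)"
      and nat: "\<And>a b \<alpha> g. \<alpha> \<in> Hom C a b \<Longrightarrow> g \<in> Hom D (Fo F b) d \<Longrightarrow> nu a (g \<cdot>\<^bsub>D\<^esub> Fa F \<alpha>) = nu b g \<cdot>\<^bsub>C\<^esub> \<alpha>"
      using adj[OF kD(1)] by blast
    have kH: "k i \<in> Hom D (Fo F (Fo K i)) d" if "i \<in> Obj J" for i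
      using kD(2)[OF that] that by simp
    have "is_cocone C J K n (\<lambda>i. nu (Fo K i) (k i))"
    proof (rule is_coconeI[OF n])
      show "nu (Fo K i) (k i) \<in> Hom C (Fo K i) n" if "i \<in> Obj J" for i
        using bij_betwE[OF bij[OF KD(1)[OF that]]] kH[OF that] by blast
      fix u i j assume u: "u \<in> Hom J i j"
      have j: "j \<in> Obj J"
        using J.Hom_Obj[OF u] by simp
      show "nu (Fo K j) (k j) \<cdot>\<^bsub>C\<^esub> Fa K u = nu (Fo K i) (k i)"
        using nat[OF KD(2)[OF u] kH[OF j]] kD(3)[OF u] HomD(1)[OF u] by simp
    qed
    then obtain h where h: "h \<in> Hom C c n" "\<And>i. i \<in> Obj J \<Longrightarrow> h \<cdot>\<^bsub>C\<^esub> leg i = nu (Fo K i) (k i)"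
      using cD(4) by blast
    have "h \<in> nu c ` Hom D (Fo F c) d"
      using bij[OF cD(2)] h(1) by (simp add: bij_betw_def)
    then obtain g where g: "g \<in> Hom D (Fo F c) d" "h = nu c g"
      by blast
    have "g \<cdot>\<^bsub>D\<^esub> Fa F (leg i) = k i" if i: "i \<in> Obj J" for i
    proof -
      have "nu (Fo K i) (g \<cdot>\<^bsub>D\<^esub> Fa F (leg i)) = nu (Fo K i) (k i)"
        using nat[OF cD(3)[OF i] g(1)] g(2) h(2)[OF i] by simp
      moreover have "inj_on (nu (Fo K i)) (Hom D (Fo F (Fo K i)) d)"
        using bij[OF KD(1)[OF i]] by (simp add: bij_betw_def)
      ultimately show ?thesis
        using D.comp_in_Hom[OF FD(2)[OF cD(3)[OF i]] g(1)] kH[OF i] by (auto dest: inj_onD)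
    qed
    then show ?thesis
      using g(1) by blast
  qed
  fix g g' assume g: "g \<in> Hom D (Fo F c) d" "g' \<in> Hom D (Fo F c) d"
    and eq: "\<And>i. i \<in> Obj J \<Longrightarrow> g \<cdot>\<^bsub>D\<^esub> Fa F (leg i) = g' \<cdot>\<^bsub>D\<^esub> Fa F (leg i)"
  obtain n nu where n: "n \<in> Obj C" and bij: "\<And>a. a \<in> Obj C \<Longrightarrow> bij_betw (nu a) (Hom D (Fo F a) d) (Hom C a n)"
    and nat: "\<And>a b \<alpha> g. \<alpha> \<in> Hom C a b \<Longrightarrow> g \<in> Hom D (Fo F b) d \<Longrightarrow> nu a (g \<cdot>\<^bsub>D\<^esub> Fa F \<alpha>) = nu b g \<cdot>\<^bsub>C\<^esub> \<alpha>"
    using adj[OF D.Hom_Obj(2)[OF g(1)]] by blast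
  note b = bij[OF cD(2)]
  have nuH: "nu c g \<in> Hom C c n" "nu c g' \<in> Hom C c n"
    using bij_betwE[OF b] g by auto
  have "nu c g = nu c g'"
  proof (rule is_colimit_epi[OF C c J K nuH])
    fix i assume i: "i \<in> Obj J"
    show "nu c g \<cdot>\<^bsub>C\<^esub> leg i = nu c g' \<cdot>\<^bsub>C\<^esub> leg i"
      using nat[OF cD(3)[OF i] g(1)] nat[OF cD(3)[OF i] g(2)] eq[OF i] by simp
  qed
  then show "g = g'"
    using b g by (auto simp: bij_betw_def dest: inj_onD)
qed

section \<open>Categories of restriction transformations\<close>

lemma restriction_transformationD:
  assumes "restriction_transformation X Y F G t"
  shows "t \<in> extensional (Obj X)" "A \<in> Obj X \<Longrightarrow> t A \<in> Hom Y (Fo F A) (Fo G A)"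
    "A \<in> Obj X \<Longrightarrow> Rst Y (t A) = Idn Y (Fo F A)"
    "f \<in> Hom X A B \<Longrightarrow> t B \<cdot>\<^bsub>Y\<^esub> Fa F f = Fa G f \<cdot>\<^bsub>Y\<^esub> t A"
    "is_functor X Y F" "is_functor X Y G"
proof -
  show t: "t \<in> extensional (Obj X)" "A \<in> Obj X \<Longrightarrow> t A \<in> Hom Y (Fo F A) (Fo G A)" for A
    using assms by (auto simp: restriction_transformation_def nat_trans_def PiE_def Pi_def)
  show "A \<in> Obj X \<Longrightarrow> Rst Y (t A) = Idn Y (Fo F A)"
    using assms HomD(2)[OF t(2)] by (auto simp: restriction_transformation_def total_def)
  show "f \<in> Hom X A B \<Longrightarrow> t B \<cdot>\<^bsub>Y\<^esub> Fa F f = Fa G f \<cdot>\<^bsub>Y\<^esub> t A" "is_functor X Y F" "is_functor X Y G"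
    using assms by (auto simp: restriction_transformation_def nat_trans_def Hom_def)
qed

lemma restriction_transformationI:
  assumes "is_functor X Y F" "is_functor X Y G" "t \<in> extensional (Obj X)"
    and "\<And>A. A \<in> Obj X \<Longrightarrow> t A \<in> Hom Y (Fo F A) (Fo G A)"
    and "\<And>A. A \<in> Obj X \<Longrightarrow> Rst Y (t A) = Idn Y (Fo F A)"
    and "\<And>f A B. f \<in> Hom X A B \<Longrightarrow> t B \<cdot>\<^bsub>Y\<^esub> Fa F f = Fa G f \<cdot>\<^bsub>Y\<^esub> t A"
  shows "restriction_transformation X Y F G t"
  using nat_transI[OF assms(1-4,6)] assms(5) HomD[OF assms(4)]
  by (simp add: restriction_transformation_def total_def)

lemma transformation_category_simps [simp]:
  "Obj (transformation_category X Y \<F>) = \<F>"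
  "Dom (transformation_category X Y \<F>) = TDom"
  "Cod (transformation_category X Y \<F>) = TCod"
  by (simp_all add: transformation_category_def)

lemma Hom_transformation_category:
  "t \<in> Hom (transformation_category X Y \<F>) F G \<longleftrightarrow>
     F \<in> \<F> \<and> G \<in> \<F> \<and> TDom t = F \<and> TCod t = G \<and> restriction_transformation X Y F G (TMap t)"
  by (auto simp: transformation_category_def Hom_def)

lemma Comp_transformation_category:
  "TDom (s \<cdot>\<^bsub>transformation_category X Y \<F>\<^esub> t) = TDom t"
  "TCod (s \<cdot>\<^bsub>transformation_category X Y \<F>\<^esub> t) = TCod s"
  "TMap (s \<cdot>\<^bsub>transformation_category X Y \<F>\<^esub> t) = (\<lambda>A\<in>Obj X. TMap s A \<cdot>\<^bsub>Y\<^esub> TMap t A)"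
  by (simp_all add: transformation_category_def)

lemma Idn_transformation_category:
  "TDom (Idn (transformation_category X Y \<F>) F) = F"
  "TCod (Idn (transformation_category X Y \<F>) F) = F"
  "TMap (Idn (transformation_category X Y \<F>) F) = (\<lambda>A\<in>Obj X. Idn Y (Fo F A))"
  by (simp_all add: transformation_category_def)

lemma transf_eqI:
  assumes "s \<in> Hom (transformation_category X Y \<F>) F G" "t \<in> Hom (transformation_category X Y \<F>) F G"
    and "\<And>A. A \<in> Obj X \<Longrightarrow> TMap s A = TMap t A"
  shows "s = t"
proof -
  have "TMap s = TMap t"
    using assms restriction_transformationD(1) unfolding Hom_transformation_category
    by (meson extensionalityI)
  then show ?thesis
    using assms(1,2) by (cases s, cases t) (simp add: Hom_transformation_category)
qed

lemma category_transformation_category: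
  assumes X: "category X" and Y: "restriction_category Y"
    and F: "\<And>F. F \<in> \<F> \<Longrightarrow> is_functor X Y F"
  shows "category (transformation_category X Y \<F>)" (is "category ?T")
proof -
  interpret X: category X by fact
  interpret Y: restriction_category Y by fact
  have comp: "s \<cdot>\<^bsub>?T\<^esub> t \<in> Hom ?T F H" if t: "t \<in> Hom ?T F G" and s: "s \<in> Hom ?T G H" for s t F G H
  proof -
    have T: "restriction_transformation X Y F G (TMap t)" and S: "restriction_transformation X Y G H (TMap s)"
      and m: "F \<in> \<F>" "H \<in> \<F>" "TDom t = F" "TCod s = H"
      using s t by (auto simp: Hom_transformation_category)
    note tD = restriction_transformationD[OF T] and sD = restriction_transformationD[OF S]
    have "restriction_transformation X Y F H (\<lambda>A\<in>Obj X. TMap s A \<cdot>\<^bsub>Y\<^esub> TMap t A)"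
    proof (rule restriction_transformationI[OF tD(5) sD(6)])
      fix f A B assume f: "f \<in> Hom X A B"
      have AB: "A \<in> Obj X" "B \<in> Obj X"
        using X.Hom_Obj[OF f] by auto
      have "TMap s B \<cdot>\<^bsub>Y\<^esub> TMap t B \<cdot>\<^bsub>Y\<^esub> Fa F f = Fa H f \<cdot>\<^bsub>Y\<^esub> (TMap s A \<cdot>\<^bsub>Y\<^esub> TMap t A)"
        using Y.comp_assoc[OF is_functorD(2)[OF tD(5) f] tD(2)[OF AB(2)] sD(2)[OF AB(2)]] tD(4)[OF f]
          Y.comp_assoc[OF tD(2)[OF AB(1)] is_functorD(2)[OF tD(6) f] sD(2)[OF AB(2)]] sD(4)[OF f]
          Y.comp_assoc[OF tD(2)[OF AB(1)] sD(2)[OF AB(1)] is_functorD(2)[OF sD(6) f]] by simp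
      then show "(\<lambda>A\<in>Obj X. TMap s A \<cdot>\<^bsub>Y\<^esub> TMap t A) B \<cdot>\<^bsub>Y\<^esub> Fa F f
          = Fa H f \<cdot>\<^bsub>Y\<^esub> (\<lambda>A\<in>Obj X. TMap s A \<cdot>\<^bsub>Y\<^esub> TMap t A) A"
        using AB by simp
    next
      fix A assume A: "A \<in> Obj X"
      show "(\<lambda>A\<in>Obj X. TMap s A \<cdot>\<^bsub>Y\<^esub> TMap t A) A \<in> Hom Y (Fo F A) (Fo H A)"
        "Rst Y ((\<lambda>A\<in>Obj X. TMap s A \<cdot>\<^bsub>Y\<^esub> TMap t A) A) = Idn Y (Fo F A)"
        using A Y.comp_in_Hom[OF tD(2)[OF A] sD(2)[OF A]]
          Y.rst_comp_total[OF tD(2)[OF A] sD(2)[OF A] sD(3)[OF A]] tD(3)[OF A] by simp_all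
    qed simp
    then show ?thesis
      using m by (simp add: Hom_transformation_category Comp_transformation_category)
  qed
  have idn: "Idn ?T F \<in> Hom ?T F F" if Fm: "F \<in> \<F>" for F
  proof -
    note FD = is_functorD[OF F[OF Fm]]
    have "restriction_transformation X Y F F (\<lambda>A\<in>Obj X. Idn Y (Fo F A))"
    proof (rule restriction_transformationI[OF F[OF Fm] F[OF Fm]])
      fix f A B assume f: "f \<in> Hom X A B"
      show "(\<lambda>A\<in>Obj X. Idn Y (Fo F A)) B \<cdot>\<^bsub>Y\<^esub> Fa F f = Fa F f \<cdot>\<^bsub>Y\<^esub> (\<lambda>A\<in>Obj X. Idn Y (Fo F A)) A"
        using X.Hom_Obj[OF f] Y.comp_idn_left[OF FD(2)[OF f]] Y.comp_idn_right[OF FD(2)[OF f]] by simp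
    qed (use Y.idn_in_Hom Y.rst_idn FD(1) in auto)
    then show ?thesis
      using Fm by (simp add: Hom_transformation_category Idn_transformation_category)
  qed
  have tm: "TMap t A \<in> Hom Y (Fo F A) (Fo G A)" if "t \<in> Hom ?T F G" "A \<in> Obj X" for t F G A
    using that restriction_transformationD(2)[of X Y F G "TMap t"] by (simp add: Hom_transformation_category)
  show ?thesis
  proof
    fix t s r F G H I assume t: "t \<in> Hom ?T F G" and s: "s \<in> Hom ?T G H" and r: "r \<in> Hom ?T H I"
    show "r \<cdot>\<^bsub>?T\<^esub> s \<cdot>\<^bsub>?T\<^esub> t = r \<cdot>\<^bsub>?T\<^esub> (s \<cdot>\<^bsub>?T\<^esub> t)"
      by (rule transf_eqI[OF comp[OF t comp[OF s r]] comp[OF comp[OF t s] r]])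
        (simp add: Comp_transformation_category Y.comp_assoc[OF tm[OF t] tm[OF s] tm[OF r]])
  next
    fix t F G assume t: "t \<in> Hom ?T F G"
    then have FG: "F \<in> \<F>" "G \<in> \<F>"
      by (auto simp: Hom_transformation_category)
    show "t \<cdot>\<^bsub>?T\<^esub> Idn ?T F = t"
      by (rule transf_eqI[OF comp[OF idn[OF FG(1)] t] t])
        (simp add: Comp_transformation_category Idn_transformation_category Y.comp_idn_right[OF tm[OF t]])
    show "Idn ?T G \<cdot>\<^bsub>?T\<^esub> t = t"
      by (rule transf_eqI[OF comp[OF t idn[OF FG(2)]] t])
        (simp add: Comp_transformation_category Idn_transformation_category Y.comp_idn_left[OF tm[OF t]])
  next
    show "t \<in> Arr ?T \<Longrightarrow> Dom ?T t \<in> Obj ?T" "t \<in> Arr ?T \<Longrightarrow> Cod ?T t \<in> Obj ?T" for t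
      by (auto simp: transformation_category_def)
  qed (auto simp: comp idn)
qed

lemma precomposition_functor:
  assumes X: "category X" and Y: "category Y" and K: "is_functor X Y K"
    and C: "\<And>F. F \<in> \<F> \<Longrightarrow> comp_functor X F K \<in> \<G>"
    and cat: "category (transformation_category Y Z \<F>)"
  shows "is_functor (transformation_category Y Z \<F>) (transformation_category X Z \<G>)
    (precomposition (transformation_category Y Z \<F>) X K)" (is "is_functor ?A ?B ?P")
    and "t \<in> Hom (transformation_category Y Z \<F>) F G \<Longrightarrow> A \<in> Obj X \<Longrightarrow>
      TMap (Fa (precomposition (transformation_category Y Z \<F>) X K) t) A = TMap t (Fo K A)"
proof -
  interpret A: category ?A by fact
  interpret X: category X by fact
  note KD = is_functorD[OF K]
  show TM: "TMap (Fa ?P t) A = TMap t (Fo K A)" if "t \<in> Hom ?A F G" "A \<in> Obj X" for t F G A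
    using HomD(1)[OF that(1)] that(2) by (simp add: precomposition_def)
  have P: "Fa ?P t \<in> Hom ?B (comp_functor X F K) (comp_functor X G K)" if t: "t \<in> Hom ?A F G" for t F G
  proof -
    have FG: "F \<in> \<F>" "G \<in> \<F>" "TDom t = F" "TCod t = G" and T: "restriction_transformation Y Z F G (TMap t)"
      using t by (auto simp: Hom_transformation_category)
    note tD = restriction_transformationD[OF T]
    have "restriction_transformation X Z (comp_functor X F K) (comp_functor X G K) (\<lambda>A\<in>Obj X. TMap t (Fo K A))"
    proof (rule restriction_transformationI[OF is_functor_comp[OF X K tD(5)] is_functor_comp[OF X K tD(6)]])
      fix f A B assume f: "f \<in> Hom X A B"
      show "(\<lambda>A\<in>Obj X. TMap t (Fo K A)) B \<cdot>\<^bsub>Z\<^esub> Fa (comp_functor X F K) f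
          = Fa (comp_functor X G K) f \<cdot>\<^bsub>Z\<^esub> (\<lambda>A\<in>Obj X. TMap t (Fo K A)) A"
        using tD(4)[OF KD(2)[OF f]] X.Hom_Obj[OF f] HomD(1)[OF f] by simp
    qed (use tD(2,3) KD(1) in auto)
    then show ?thesis
      using C FG HomD(1)[OF t] by (simp add: Hom_transformation_category precomposition_def)
  qed
  have PoF: "Fo ?P F = comp_functor X F K" if "F \<in> \<F>" for F
    using that by (simp add: precomposition_def)
  have m: "F \<in> \<F>" "G \<in> \<F>" if "t \<in> Hom ?A F G" for t F G
    using that by (auto simp: Hom_transformation_category)
  show "is_functor ?A ?B ?P"
  proof (rule is_functorI)
    show "Fo ?P \<in> extensional (Obj ?A)" "Fa ?P \<in> extensional (Arr ?A)"
      by (simp_all add: precomposition_def)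
  next
    fix F assume F: "F \<in> Obj ?A"
    then have Fm: "F \<in> \<F>"
      by simp
    show "Fo ?P F \<in> Obj ?B"
      using Fm C PoF by simp
    note i = A.idn_in_Hom[OF F] and Pi = P[OF A.idn_in_Hom[OF F]]
    have "TDom (Idn ?B (comp_functor X F K)) = TDom (Fa ?P (Idn ?A F))"
      "TCod (Idn ?B (comp_functor X F K)) = TCod (Fa ?P (Idn ?A F))"
      "TMap (Idn ?B (comp_functor X F K)) = TMap (Fa ?P (Idn ?A F))"
    proof -
      show "TDom (Idn ?B (comp_functor X F K)) = TDom (Fa ?P (Idn ?A F))"
        "TCod (Idn ?B (comp_functor X F K)) = TCod (Fa ?P (Idn ?A F))"
        using Pi by (simp_all add: Hom_transformation_category Idn_transformation_category)
      have "TMap (Fa ?P (Idn ?A F)) \<in> extensional (Obj X)"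
        using Pi restriction_transformationD(1) by (auto simp: Hom_transformation_category)
      then show "TMap (Idn ?B (comp_functor X F K)) = TMap (Fa ?P (Idn ?A F))"
        using TM[OF i] KD(1) unfolding Idn_transformation_category
        by (intro extensionalityI[of _ "Obj X"]) auto
    qed
    then show "Fa ?P (Idn ?A F) = Idn ?B (Fo ?P F)"
      unfolding PoF[OF Fm] by (intro transf.equality) simp_all
  next
    fix t F G assume t: "t \<in> Hom ?A F G"
    show "Fa ?P t \<in> Hom ?B (Fo ?P F) (Fo ?P G)"
      using P[OF t] m[OF t] PoF by simp
    fix s H assume s: "s \<in> Hom ?A G H"
    note st = A.comp_in_Hom[OF t s]
    have "TMap (Fa ?P (s \<cdot>\<^bsub>?A\<^esub> t)) = (\<lambda>A\<in>Obj X. TMap (Fa ?P s) A \<cdot>\<^bsub>Z\<^esub> TMap (Fa ?P t) A)"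
    proof (rule extensionalityI[of _ "Obj X"])
      show "TMap (Fa ?P (s \<cdot>\<^bsub>?A\<^esub> t)) \<in> extensional (Obj X)"
        using P[OF st] restriction_transformationD(1) by (auto simp: Hom_transformation_category)
      fix A assume A: "A \<in> Obj X"
      show "TMap (Fa ?P (s \<cdot>\<^bsub>?A\<^esub> t)) A = (\<lambda>A\<in>Obj X. TMap (Fa ?P s) A \<cdot>\<^bsub>Z\<^esub> TMap (Fa ?P t) A) A"
        using A KD(1)[OF A] TM[OF st A] TM[OF t A] TM[OF s A] by (simp add: Comp_transformation_category)
    qed simp
    moreover have "TDom (Fa ?P (s \<cdot>\<^bsub>?A\<^esub> t)) = TDom (Fa ?P t)" "TCod (Fa ?P (s \<cdot>\<^bsub>?A\<^esub> t)) = TCod (Fa ?P s)"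
      using P[OF st] P[OF t] P[OF s] by (simp_all add: Hom_transformation_category)
    ultimately show "Fa ?P (s \<cdot>\<^bsub>?A\<^esub> t) = Fa ?P s \<cdot>\<^bsub>?B\<^esub> Fa ?P t"
      by (intro transf.equality) (simp_all add: Comp_transformation_category)
  qed
qed

section \<open>Restriction along the Yoneda embedding\<close>

lemma (in restriction_category) is_functor_Total_functor:
  assumes Y: "restriction_category Y" and F: "is_restriction_functor X Y F"
  shows "is_functor (Total X) (Total Y) (Total_functor X F)"
proof (rule is_functorI)
  have Ff: "is_functor X Y F" and Fr: "\<And>f. f \<in> Arr X \<Longrightarrow> Fa F (Rst X f) = Rst Y (Fa F f)"
    using F by (auto simp: is_restriction_functor_def)
  note FD = is_functorD[OF Ff]
  show "Fo (Total_functor X F) \<in> extensional (Obj (Total X))"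
    "Fa (Total_functor X F) \<in> extensional (Arr (Total X))"
    by (simp_all add: Total_functor_def del: Total_simps)
  show "Fo (Total_functor X F) A \<in> Obj (Total Y)" if "A \<in> Obj (Total X)" for A
    using that FD(1) by simp
  interpret T: category "Total X"
    by (rule category_Total)
  fix f A B assume f: "f \<in> Hom (Total X) A B"
  then have fH: "f \<in> Hom X A B" "Rst X f = Idn X A"
    by (simp_all add: Hom_Total)
  show "Fa (Total_functor X F) f \<in> Hom (Total Y) (Fo (Total_functor X F) A) (Fo (Total_functor X F) B)"
    using FD(2,3) fH Fr[OF HomD(1)[OF fH(1)]] Hom_Obj[OF fH(1)] HomD(1)[OF f] by (simp add: Hom_Total)
  fix g D assume g: "g \<in> Hom (Total X) B D"
  show "Fa (Total_functor X F) (g \<cdot>\<^bsub>Total X\<^esub> f) = Fa (Total_functor X F) g \<cdot>\<^bsub>Total Y\<^esub> Fa (Total_functor X F) f"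
    using FD(4)[OF fH(1), of g D] g HomD(1)[OF T.comp_in_Hom[OF f g]] HomD(1)[OF f] HomD(1)[OF g]
    by (simp add: Hom_Total)
next
  have Ff: "is_functor X Y F"
    using F by (auto simp: is_restriction_functor_def)
  interpret T: category "Total X"
    by (rule category_Total)
  fix A assume A: "A \<in> Obj (Total X)"
  show "Fa (Total_functor X F) (Idn (Total X) A) = Idn (Total Y) (Fo (Total_functor X F) A)"
    using HomD(1)[OF T.idn_in_Hom[OF A]] A is_functorD(3)[OF Ff] by simp
qed

context small_jr
begin

lemma small_PEl:
  fixes P :: "('o, 'u, 'u) psh"
  assumes "join_restriction_presheaf X P" "A \<in> Obj X"
  shows "small TYPE('u) (PEl P A)"
proof -
  interpret P: join_restriction_presheaf X P by fact
  show ?thesis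
    using assms(2) by (rule P.PEl_small)
qed

text \<open>Density of the representables combined with preservation of weighted colimits: a
  cocontinuous \<open>H\<close> is determined by its values on representables.\<close>

lemma cocontinuous_wcolim:
  fixes H :: "(('o, 'u, 'u) psh, (('o, 'u, 'u) psh, 'o \<Rightarrow> 'u \<Rightarrow> 'u) transf, 'p, 'b) func"
  assumes E: "join_restriction_category E" "cocomplete TYPE('u) E"
    and H: "is_restriction_functor (PSh_jr X) E H" "cocontinuous TYPE('u) (PSh_jr X) E H"
    and P: "join_restriction_presheaf X P"
  shows "wcolim X (PEl P) (PAct P) (PRst P) E (comp_functor X H (yoneda_jr X)) (Fo H P)
    (\<lambda>A x. Fa H (yel X P A x))"
proof -
  interpret P: jr_sheaf X "PEl P" "PAct P" "PRst P"
    using P by (rule jr_sheaf_psh)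
  interpret E: join_restriction_category E by fact
  show ?thesis
    by (rule P.wcolim_preserved[OF universe small_Obj small_Arr small_PEl[OF P] restriction_category_PSh
          PSh_split yoneda_restriction_functor E.restriction_category_axioms E(2) H wcolim_yoneda[OF P]])
qed

text \<open>Fullness of restriction along the Yoneda embedding. Since \<open>Fo H P\<close> is a
  weighted colimit, the component at \<open>P\<close> is induced by the cocone with members
  \<open>Fa H' (yel X P A x)\<close> after \<open>s A\<close>.\<close>

lemma restriction_transformation_extension:
  fixes H :: "(('o, 'u, 'u) psh, (('o, 'u, 'u) psh, 'o \<Rightarrow> 'u \<Rightarrow> 'u) transf, 'p, 'b) func"
  assumes E: "join_restriction_category E" "cocomplete TYPE('u) E"
    and H: "is_restriction_functor (PSh_jr X) E H" "cocontinuous TYPE('u) (PSh_jr X) E H"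
    and H': "is_restriction_functor (PSh_jr X) E H'"
    and s: "restriction_transformation X E (comp_functor X H (yoneda_jr X)) (comp_functor X H' (yoneda_jr X)) s"
  shows "\<exists>t. restriction_transformation (PSh_jr X) E H H' t \<and> (\<forall>A\<in>Obj X. t (representable X A) = s A)"
proof -
  interpret PSh: restriction_category "PSh_jr X"
    by (rule restriction_category_PSh)
  interpret E: join_restriction_category E by fact
  have Hf: "is_functor (PSh_jr X) E H" and Hf': "is_functor (PSh_jr X) E H'"
    using H(1) H' by (auto simp: is_restriction_functor_def)
  note HD = is_functorD[OF Hf] and HD' = is_functorD[OF Hf'] and sD = restriction_transformationD[OF s]
  have Fo: "Fo (comp_functor X H (yoneda_jr X)) A = Fo H (representable X A)"
    "Fo (comp_functor X H' (yoneda_jr X)) A = Fo H' (representable X A)" if "A \<in> Obj X" for A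
    using that by (simp_all add: yoneda_Fo)
  have Fa: "Fa (comp_functor X H (yoneda_jr X)) f = Fa H (Fa (yoneda_jr X) f)"
    "Fa (comp_functor X H' (yoneda_jr X)) f = Fa H' (Fa (yoneda_jr X) f)" if "f \<in> Hom X A B" for f A B
    using HomD(1)[OF that] by simp_all
  have sH: "s A \<in> Hom E (Fo H (representable X A)) (Fo H' (representable X A))" if "A \<in> Obj X" for A
    using sD(2)[OF that] Fo that by simp
  have yH: "Fa H (yel X P A x) \<in> Hom E (Fo H (representable X A)) (Fo H P)"
    "Fa H' (yel X P A x) \<in> Hom E (Fo H' (representable X A)) (Fo H' P)"
    if "join_restriction_presheaf X P" "A \<in> Obj X" "x \<in> PEl P A" for P A x
    using HD(2)[OF yel_Hom[OF that]] HD'(2)[OF yel_Hom[OF that]] .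
  note W = cocontinuous_wcolim[OF E H]
  note epi = wcolim_epi[OF category_axioms E.category_axioms sD(5) W]
  have "\<exists>h\<in>Hom E (Fo H P) (Fo H' P). \<forall>A\<in>Obj X. \<forall>x\<in>PEl P A.
      h \<cdot>\<^bsub>E\<^esub> Fa H (yel X P A x) = Fa H' (yel X P A x) \<cdot>\<^bsub>E\<^esub> s A"
    if P: "join_restriction_presheaf X P" for P
  proof (rule wcolimD(6)[OF W[OF P]])
    show "wcocone X (PEl P) (PAct P) E (comp_functor X H (yoneda_jr X)) (Fo H' P)
        (\<lambda>A x. Fa H' (yel X P A x) \<cdot>\<^bsub>E\<^esub> s A)"
      unfolding wcocone_def
    proof (intro conjI ballI allI)
      show "Fo H' P \<in> Obj E"
        using HD'(1) P by simp
      show "Fa H' (yel X P A x) \<cdot>\<^bsub>E\<^esub> s A \<in> Hom E (Fo (comp_functor X H (yoneda_jr X)) A) (Fo H' P)"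
        if "A \<in> Obj X" "x \<in> PEl P A" for A x
        using E.comp_in_Hom[OF sH[OF that(1)] yH(2)[OF P that]] Fo(1)[OF that(1)] by simp
      fix A B f x assume f: "f \<in> Hom X B A" and x: "x \<in> PEl P A"
      have AB: "A \<in> Obj X" "B \<in> Obj X"
        using Hom_Obj[OF f] by auto
      note yx = yel_Hom[OF P AB(1) x] and yf = yoneda_Hom[OF f]
      have "Fa H' (yel X P B (PAct P f x)) \<cdot>\<^bsub>E\<^esub> s B
          = Fa H' (yel X P A x) \<cdot>\<^bsub>E\<^esub> (Fa H' (Fa (yoneda_jr X) f) \<cdot>\<^bsub>E\<^esub> s B)"
        using yel_act[OF P f x] HD'(4)[OF yf yx] E.comp_assoc[OF sH[OF AB(2)] HD'(2)[OF yf] HD'(2)[OF yx]] by simp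
      also have "\<dots> = Fa H' (yel X P A x) \<cdot>\<^bsub>E\<^esub> s A \<cdot>\<^bsub>E\<^esub> Fa H (Fa (yoneda_jr X) f)"
        using sD(4)[OF f] Fa[OF f] E.comp_assoc[OF HD(2)[OF yf] sH[OF AB(1)] HD'(2)[OF yx]] by simp
      finally show "Fa H' (yel X P B (PAct P f x)) \<cdot>\<^bsub>E\<^esub> s B
          = Fa H' (yel X P A x) \<cdot>\<^bsub>E\<^esub> s A \<cdot>\<^bsub>E\<^esub> Fa (comp_functor X H (yoneda_jr X)) f"
        using Fa(1)[OF f] by simp
    qed
  qed
  then obtain t where tH: "\<And>P. join_restriction_presheaf X P \<Longrightarrow> t P \<in> Hom E (Fo H P) (Fo H' P)"
    and t: "\<And>P A x. join_restriction_presheaf X P \<Longrightarrow> A \<in> Obj X \<Longrightarrow> x \<in> PEl P A \<Longrightarrow>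
      t P \<cdot>\<^bsub>E\<^esub> Fa H (yel X P A x) = Fa H' (yel X P A x) \<cdot>\<^bsub>E\<^esub> s A"
    by metis
  have total: "Rst E (t P) = Idn E (Fo H P)" if P: "join_restriction_presheaf X P" for P
  proof (rule E.wcolim_total[OF category_axioms sD(5) W[OF P] tH[OF P]])
    interpret P: jr_sheaf X "PEl P" "PAct P" "PRst P"
      using P by (rule jr_sheaf_psh)
    fix A x assume A: "A \<in> Obj X" and x: "x \<in> PEl P A"
    note e = Idem_Hom[OF P.rst_el[OF A x]] and yx = yel_Hom[OF P A x]
    have r: "Rst E (Fa H (yel X P A x)) = Fa H (Fa (yoneda_jr X) (PRst P A x))"
      "Rst E (Fa H' (yel X P A x)) = Fa H' (Fa (yoneda_jr X) (PRst P A x))"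
      using H(1) H' HomD(1)[OF yx] yel_rst[OF P A x] by (auto simp: is_restriction_functor_def)
    note Fe = HD(2)[OF yoneda_Hom[OF e]]
    \<comment> \<open>The restriction of the image of \<open>yel\<close> under \<open>H'\<close> is
      the image of an idempotent of \<open>X\<close>. Naturality of \<open>s\<close> moves it to the
      other side, where the total map \<open>s A\<close> drops out.\<close>
    have "Rst E (t P \<cdot>\<^bsub>E\<^esub> Fa H (yel X P A x)) = Rst E (Fa H' (Fa (yoneda_jr X) (PRst P A x)) \<cdot>\<^bsub>E\<^esub> s A)"
      using t[OF P A x] E.rst_comp_rst[OF sH[OF A] yH(2)[OF P A x]] r(2) by simp
    also have "\<dots> = Rst E (s A \<cdot>\<^bsub>E\<^esub> Fa H (Fa (yoneda_jr X) (PRst P A x)))"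
      using sD(4)[OF e] Fa[OF e] by simp
    also have "\<dots> = Rst E (Fa H (Fa (yoneda_jr X) (PRst P A x)))"
      using E.rst_comp_total[OF Fe sH[OF A]] sD(3)[OF A] Fo(1)[OF A] by simp
    also have "\<dots> = Rst E (Fa H (yel X P A x))"
      using r(1) E.rst_rst[OF yH(1)[OF P A x]] by simp
    finally show "Rst E (t P \<cdot>\<^bsub>E\<^esub> Fa H (yel X P A x)) = Rst E (Fa H (yel X P A x))" .
  qed
  have nat: "t Q \<cdot>\<^bsub>E\<^esub> Fa H \<alpha> = Fa H' \<alpha> \<cdot>\<^bsub>E\<^esub> t P" if a: "\<alpha> \<in> Hom (PSh_jr X) P Q" for P Q \<alpha>
  proof -
    note P = PSh_HomD(1)[OF a] and Q = PSh_HomD(2)[OF a]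
    show ?thesis
    proof (rule epi[OF P E.comp_in_Hom[OF HD(2)[OF a] tH[OF Q]] E.comp_in_Hom[OF tH[OF P] HD'(2)[OF a]]])
      fix A x assume A: "A \<in> Obj X" and x: "x \<in> PEl P A"
      note yx = yel_Hom[OF P A x]
      have "t Q \<cdot>\<^bsub>E\<^esub> Fa H \<alpha> \<cdot>\<^bsub>E\<^esub> Fa H (yel X P A x) = Fa H' (yel X Q A (TMap \<alpha> A x)) \<cdot>\<^bsub>E\<^esub> s A"
        using E.comp_assoc[OF HD(2)[OF yx] HD(2)[OF a] tH[OF Q]] HD(4)[OF yx a] yel_postcomp[OF a A x]
          t[OF Q A PSh_in[OF a A x]] by simp
      also have "\<dots> = Fa H' \<alpha> \<cdot>\<^bsub>E\<^esub> (Fa H' (yel X P A x) \<cdot>\<^bsub>E\<^esub> s A)"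
        using HD'(4)[OF yx a] yel_postcomp[OF a A x] E.comp_assoc[OF sH[OF A] HD'(2)[OF yx] HD'(2)[OF a]] by simp
      also have "\<dots> = Fa H' \<alpha> \<cdot>\<^bsub>E\<^esub> t P \<cdot>\<^bsub>E\<^esub> Fa H (yel X P A x)"
        using t[OF P A x] E.comp_assoc[OF HD(2)[OF yx] tH[OF P] HD'(2)[OF a]] by simp
      finally show "t Q \<cdot>\<^bsub>E\<^esub> Fa H \<alpha> \<cdot>\<^bsub>E\<^esub> Fa H (yel X P A x)
          = Fa H' \<alpha> \<cdot>\<^bsub>E\<^esub> t P \<cdot>\<^bsub>E\<^esub> Fa H (yel X P A x)" .
    qed
  qed
  have "t (representable X A) = s A" if A: "A \<in> Obj X" for A
  proof -
    \<comment> \<open>At the universal element the leg is an identity, so the component at a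
      representable is \<open>s A\<close> itself.\<close>
    have i: "yel X (representable X A) A (Idn X A) = Idn (PSh_jr X) (representable X A)"
      using yoneda_Fa[OF idn_in_Hom[OF A]] is_functorD(3)[OF _ A] yoneda_restriction_functor yoneda_Fo[OF A]
      by (metis is_restriction_functor_def)
    have x: "Idn X A \<in> PEl (representable X A) A"
      using A idn_in_Hom by simp
    have o: "representable X A \<in> Obj (PSh_jr X)"
      using rep_psh[OF A] by simp
    show ?thesis
      using t[OF rep_psh[OF A] A x] i HD(3)[OF o] HD'(3)[OF o] E.comp_idn_right[OF tH[OF rep_psh[OF A]]]
        E.comp_idn_left[OF sH[OF A]] by simp
  qed
  moreover have "restriction_transformation (PSh_jr X) E H H' (\<lambda>P\<in>Obj (PSh_jr X). t P)"
  proof (rule restriction_transformationI[OF Hf Hf'])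
    fix \<alpha> and P Q :: "('o, 'u, 'u) psh" assume a: "\<alpha> \<in> Hom (PSh_jr X) P Q"
    show "(\<lambda>P\<in>Obj (PSh_jr X). t P) Q \<cdot>\<^bsub>E\<^esub> Fa H \<alpha> = Fa H' \<alpha> \<cdot>\<^bsub>E\<^esub> (\<lambda>P\<in>Obj (PSh_jr X). t P) P"
      using nat[OF a] PSh.Hom_Obj[OF a] by simp
  qed (use tH total in auto)
  ultimately show ?thesis
    using rep_psh by (intro exI[of _ "\<lambda>P\<in>Obj (PSh_jr X). t P"]) simp
qed

text \<open>Faithfulness: the images of the maps \<open>yel\<close> are jointly epic, and naturality
  reduces each composite with them to a component at a representable.\<close>

lemma restriction_transformation_unique:
  fixes H :: "(('o, 'u, 'u) psh, (('o, 'u, 'u) psh, 'o \<Rightarrow> 'u \<Rightarrow> 'u) transf, 'p, 'b) func"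
  assumes E: "join_restriction_category E" "cocomplete TYPE('u) E"
    and H: "is_restriction_functor (PSh_jr X) E H" "cocontinuous TYPE('u) (PSh_jr X) E H"
    and t: "restriction_transformation (PSh_jr X) E H H' t" "restriction_transformation (PSh_jr X) E H H' t'"
    and eq: "\<And>A. A \<in> Obj X \<Longrightarrow> t (representable X A) = t' (representable X A)"
    and P: "join_restriction_presheaf X P"
  shows "t P = t' P"
proof -
  interpret E: join_restriction_category E by fact
  note tD = restriction_transformationD[OF t(1)] and tD' = restriction_transformationD[OF t(2)]
  have F: "is_functor X E (comp_functor X H (yoneda_jr X))"
    using is_restriction_functor_comp[OF yoneda_restriction_functor H(1)] by (simp add: is_restriction_functor_def)
  have PO: "P \<in> Obj (PSh_jr X)"
    using P by simp
  show ?thesis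
  proof (rule wcolim_epi[OF category_axioms E.category_axioms F cocontinuous_wcolim[OF E H P] tD(2)[OF PO] tD'(2)[OF PO]])
    fix A x assume A: "A \<in> Obj X" and x: "x \<in> PEl P A"
    show "t P \<cdot>\<^bsub>E\<^esub> Fa H (yel X P A x) = t' P \<cdot>\<^bsub>E\<^esub> Fa H (yel X P A x)"
      using tD(4)[OF yel_Hom[OF P A x]] tD'(4)[OF yel_Hom[OF P A x]] eq[OF A] by simp
  qed
qed

end

section \<open>Extension along the Yoneda embedding\<close>

locale yoneda_extension = small_jr X + E: join_restriction_category E
  for X :: "('o, 'u, 'c) rcat_scheme" (structure) and E :: "('p, 'b, 'e) rcat_scheme" +
  fixes F :: "('o, 'u, 'p, 'b) func"
  assumes F: "is_join_restriction_functor X E F"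
    and E_small: "locally_small TYPE('u) E" and E_cocomplete: "cocomplete TYPE('u) E"
begin

lemma F_rst_functor: "is_restriction_functor X E F"
  using F by (simp add: is_join_restriction_functor_def)

lemma F_functor: "is_functor X E F"
  using F_rst_functor by (simp add: is_restriction_functor_def)

lemmas FD = is_functorD[OF F_functor]

lemma F_rst: "f \<in> Hom X A B \<Longrightarrow> Fa F (Rst X f) = Rst E (Fa F f)"
  using F_rst_functor by (auto simp: is_restriction_functor_def Hom_def)

lemma F_Idem: "e \<in> Idem X A \<Longrightarrow> Fa F e \<in> Idem E (Fo F A)"
  using F_rst[OF Idem_Hom, of e A] FD(2)[OF Idem_Hom, of e A] Idem_rst[of e A] by (simp add: Idem_def)

lemma F_join_Idem:
  assumes "A \<in> Obj X" "D \<subseteq> Idem X A" "is_join X A A D e"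
  shows "is_join E (Fo F A) (Fo F A) (Fa F ` D) (Fa F e)"
proof -
  have "D \<subseteq> Hom X A A"
    using assms(2) Idem_Hom by blast
  then show ?thesis
    using F assms compatible_Idem[OF assms(2)] unfolding is_join_restriction_functor_def by blast
qed

text \<open>Vertex and legs are chosen together, since the legs only make sense for the chosen
  vertex. The resulting functor agrees with \<open>F\<close> on representables only up to
  isomorphism.\<close>

definition ext_data :: "('o, 'u, 'u) psh \<Rightarrow> 'p \<times> ('o \<Rightarrow> 'u \<Rightarrow> 'b)" where
  "ext_data P = (SOME z. wcolim X (PEl P) (PAct P) (PRst P) E F (fst z) (snd z))"

definition ext_obj where "ext_obj P = fst (ext_data P)"

definition ext_leg where "ext_leg P = snd (ext_data P)"

lemma wcolim_ext:
  assumes P: "join_restriction_presheaf X P"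
  shows "wcolim X (PEl P) (PAct P) (PRst P) E F (ext_obj P) (ext_leg P)"
proof -
  interpret P: jr_sheaf X "PEl P" "PAct P" "PRst P"
    using P by (rule jr_sheaf_psh)
  obtain c lam where "wcolim X (PEl P) (PAct P) (PRst P) E F c lam"
    using P.wcolim_exists[OF universe small_Obj small_Arr small_PEl[OF P] E.restriction_category_axioms
        E_cocomplete F_rst_functor] by blast
  then have "\<exists>z. wcolim X (PEl P) (PAct P) (PRst P) E F (fst z) (snd z)"
    by (metis fst_conv snd_conv)
  then show ?thesis
    unfolding ext_obj_def ext_leg_def ext_data_def by (rule someI_ex)
qed

lemmas extD = wcolimD[OF wcolim_ext]

lemma ext_epi:
  assumes "join_restriction_presheaf X P" "h \<in> Hom E (ext_obj P) d" "h' \<in> Hom E (ext_obj P) d"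
    and "\<And>A x. A \<in> Obj X \<Longrightarrow> x \<in> PEl P A \<Longrightarrow> h \<cdot>\<^bsub>E\<^esub> ext_leg P A x = h' \<cdot>\<^bsub>E\<^esub> ext_leg P A x"
  shows "h = h'"
  using wcolim_epi[OF category_axioms E.category_axioms F_functor wcolim_ext] assms by blast

definition ext_arr where
  "ext_arr \<alpha> = (SOME h. h \<in> Hom E (ext_obj (TDom \<alpha>)) (ext_obj (TCod \<alpha>)) \<and>
     (\<forall>A\<in>Obj X. \<forall>x\<in>PEl (TDom \<alpha>) A.
        h \<cdot>\<^bsub>E\<^esub> ext_leg (TDom \<alpha>) A x = ext_leg (TCod \<alpha>) A (TMap \<alpha> A x)))"

lemma ext_arr:
  assumes a: "\<alpha> \<in> Hom (PSh_jr X) P Q"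
  shows "ext_arr \<alpha> \<in> Hom E (ext_obj P) (ext_obj Q)"
    and "A \<in> Obj X \<Longrightarrow> x \<in> PEl P A \<Longrightarrow> ext_arr \<alpha> \<cdot>\<^bsub>E\<^esub> ext_leg P A x = ext_leg Q A (TMap \<alpha> A x)"
proof -
  note P = PSh_HomD(1)[OF a] and Q = PSh_HomD(2)[OF a]
  have "wcocone X (PEl P) (PAct P) E F (ext_obj Q) (\<lambda>A x. ext_leg Q A (TMap \<alpha> A x))"
    unfolding wcocone_def
    using extD(2)[OF Q] extD(3)[OF Q _ PSh_in[OF a]] extD(4)[OF Q _ PSh_in[OF a]] PSh_nat[OF a] Hom_Obj
    by (metis (no_types, lifting))
  from extD(6)[OF P this] have "\<exists>h. h \<in> Hom E (ext_obj P) (ext_obj Q) \<and>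
     (\<forall>A\<in>Obj X. \<forall>x\<in>PEl P A. h \<cdot>\<^bsub>E\<^esub> ext_leg P A x = ext_leg Q A (TMap \<alpha> A x))"
    by blast
  then have "ext_arr \<alpha> \<in> Hom E (ext_obj P) (ext_obj Q) \<and>
     (\<forall>A\<in>Obj X. \<forall>x\<in>PEl P A. ext_arr \<alpha> \<cdot>\<^bsub>E\<^esub> ext_leg P A x = ext_leg Q A (TMap \<alpha> A x))"
    unfolding ext_arr_def PSh_HomD(3)[OF a] PSh_HomD(4)[OF a] by (rule someI_ex)
  then show "ext_arr \<alpha> \<in> Hom E (ext_obj P) (ext_obj Q)"
    "A \<in> Obj X \<Longrightarrow> x \<in> PEl P A \<Longrightarrow> ext_arr \<alpha> \<cdot>\<^bsub>E\<^esub> ext_leg P A x = ext_leg Q A (TMap \<alpha> A x)"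
    by auto
qed

definition ext :: "(('o, 'u, 'u) psh, (('o, 'u, 'u) psh, 'o \<Rightarrow> 'u \<Rightarrow> 'u) transf, 'p, 'b) func" where
  "ext = \<lparr>Fo = (\<lambda>P\<in>Obj (PSh_jr X). ext_obj P), Fa = (\<lambda>\<alpha>\<in>Arr (PSh_jr X). ext_arr \<alpha>)\<rparr>"

lemma Fo_ext: "join_restriction_presheaf X P \<Longrightarrow> Fo ext P = ext_obj P"
  by (simp add: ext_def)

lemma Fa_ext: "\<alpha> \<in> Hom (PSh_jr X) P Q \<Longrightarrow> Fa ext \<alpha> = ext_arr \<alpha>"
  using HomD(1) by (fastforce simp: ext_def)

lemma ext_restriction_functor: "is_restriction_functor (PSh_jr X) E ext"
  unfolding is_restriction_functor_def
proof (intro conjI ballI is_functorI)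
  interpret PSh: restriction_category "PSh_jr X"
    by (rule restriction_category_PSh)
  show "Fo ext \<in> extensional (Obj (PSh_jr X))" "Fa ext \<in> extensional (Arr (PSh_jr X))"
    by (simp_all add: ext_def)
  show "Fo ext P \<in> Obj E" if "P \<in> Obj (PSh_jr X)" for P
    using that extD(2) Fo_ext by simp
  show aH: "Fa ext \<alpha> \<in> Hom E (Fo ext P) (Fo ext Q)" if "\<alpha> \<in> Hom (PSh_jr X) P Q" for \<alpha> P Q
    using ext_arr(1)[OF that] Fa_ext[OF that] Fo_ext PSh_HomD(1,2)[OF that] by simp
  show "Fa ext (Idn (PSh_jr X) P) = Idn E (Fo ext P)" if "P \<in> Obj (PSh_jr X)" for P
  proof -
    have P: "join_restriction_presheaf X P"
      using that by simp
    note i = PSh_idn_Hom[OF P]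
    have "ext_arr (Idn (PSh_jr X) P) = Idn E (ext_obj P)"
    proof (rule ext_epi[OF P ext_arr(1)[OF i] E.idn_in_Hom[OF extD(2)[OF P]]])
      fix A x assume A: "A \<in> Obj X" "x \<in> PEl P A"
      show "ext_arr (Idn (PSh_jr X) P) \<cdot>\<^bsub>E\<^esub> ext_leg P A x = Idn E (ext_obj P) \<cdot>\<^bsub>E\<^esub> ext_leg P A x"
        using ext_arr(2)[OF i A] E.comp_idn_left[OF extD(3)[OF P A]] TMap_idn[OF A] by simp
    qed
    then show ?thesis
      using Fa_ext[OF i] Fo_ext[OF P] by simp
  qed
  fix \<alpha> \<beta> and P Q R :: "('o, 'u, 'u) psh" assume a: "\<alpha> \<in> Hom (PSh_jr X) P Q" and b: "\<beta> \<in> Hom (PSh_jr X) Q R"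
  note P = PSh_HomD(1)[OF a] and ab = PSh_comp_Hom[OF a b]
  have "ext_arr (\<beta> \<cdot>\<^bsub>PSh_jr X\<^esub> \<alpha>) = ext_arr \<beta> \<cdot>\<^bsub>E\<^esub> ext_arr \<alpha>"
  proof (rule ext_epi[OF P ext_arr(1)[OF ab] E.comp_in_Hom[OF ext_arr(1)[OF a] ext_arr(1)[OF b]]])
    fix A x assume A: "A \<in> Obj X" "x \<in> PEl P A"
    show "ext_arr (\<beta> \<cdot>\<^bsub>PSh_jr X\<^esub> \<alpha>) \<cdot>\<^bsub>E\<^esub> ext_leg P A x = ext_arr \<beta> \<cdot>\<^bsub>E\<^esub> ext_arr \<alpha> \<cdot>\<^bsub>E\<^esub> ext_leg P A x"
      using ext_arr(2)[OF ab A] ext_arr(2)[OF a A] ext_arr(2)[OF b A(1) PSh_in[OF a A]] TMap_comp[OF a A]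
        E.comp_assoc[OF extD(3)[OF P A] ext_arr(1)[OF a] ext_arr(1)[OF b]] by simp
  qed
  then show "Fa ext (\<beta> \<cdot>\<^bsub>PSh_jr X\<^esub> \<alpha>) = Fa ext \<beta> \<cdot>\<^bsub>E\<^esub> Fa ext \<alpha>"
    using Fa_ext[OF ab] Fa_ext[OF a] Fa_ext[OF b] by simp
next
  fix \<alpha> :: "(('o, 'u, 'u) psh, 'o \<Rightarrow> 'u \<Rightarrow> 'u) transf" assume "\<alpha> \<in> Arr (PSh_jr X)"
  from Arr_Hom[OF this] obtain P Q :: "('o, 'u, 'u) psh" where a: "\<alpha> \<in> Hom (PSh_jr X) P Q"
    by (rule that)
  note P = PSh_HomD(1)[OF a] and Q = PSh_HomD(2)[OF a] and r = PSh_rst_Hom[OF a]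
  interpret P: jr_sheaf X "PEl P" "PAct P" "PRst P"
    using P by (rule jr_sheaf_psh)
  interpret Q: jr_sheaf X "PEl Q" "PAct Q" "PRst Q"
    using Q by (rule jr_sheaf_psh)
  have "ext_arr (Rst (PSh_jr X) \<alpha>) = Rst E (ext_arr \<alpha>)"
  proof (rule ext_epi[OF P ext_arr(1)[OF r] E.rst_in_Hom[OF ext_arr(1)[OF a]]])
    fix A x assume A: "A \<in> Obj X" "x \<in> PEl P A"
    have y: "TMap \<alpha> A x \<in> PEl Q A"
      using PSh_in[OF a A] .
    \<comment> \<open>R4 moves the restriction across the leg, where it becomes the image of the
      domain of the transformed element. The leg absorbs it as an action on \<open>x\<close>, and
      this is how \<open>Rst\<close> of a presheaf map is defined.\<close>
    have "Rst E (ext_arr \<alpha>) \<cdot>\<^bsub>E\<^esub> ext_leg P A x = ext_leg P A x \<cdot>\<^bsub>E\<^esub> Fa F (PRst Q A (TMap \<alpha> A x))"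
      using E.wcolim_rst_comp[OF wcolim_ext[OF P] ext_arr(1)[OF a] A] ext_arr(2)[OF a A] extD(5)[OF Q A(1) y]
      by simp
    also have "\<dots> = ext_leg P A (PAct P (PRst Q A (TMap \<alpha> A x)) x)"
      using extD(4)[OF P Idem_Hom[OF Q.rst_el[OF A(1) y]] A(2)] by simp
    finally show "ext_arr (Rst (PSh_jr X) \<alpha>) \<cdot>\<^bsub>E\<^esub> ext_leg P A x = Rst E (ext_arr \<alpha>) \<cdot>\<^bsub>E\<^esub> ext_leg P A x"
      using ext_arr(2)[OF r A] TMap_rst[OF a A] by simp
  qed
  then show "Fa ext (Rst (PSh_jr X) \<alpha>) = Rst E (Fa ext \<alpha>)"
    using Fa_ext[OF r] Fa_ext[OF a] by simp
qed

text \<open>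
  The right adjoint on total maps sends an object d to the presheaf of partial maps from F A to d
  whose domain of definition is the image of a restriction idempotent of X. The idempotent is part
  of the element because F need not be faithful.
\<close>

definition nEl where
  "nEl d A = {(e, h). e \<in> Idem X A \<and> h \<in> Hom E (Fo F A) d \<and> Rst E h = Fa F e}"

definition nact where
  "nact f = (\<lambda>(e, h). (Rst X (e \<cdot> f), h \<cdot>\<^bsub>E\<^esub> Fa F f))"

lemma rpresheaf_nerve: "rpresheaf X (nEl d) nact (\<lambda>A. fst)"
proof
  fix f B A x assume f: "f \<in> Hom X B A" and x: "x \<in> nEl d A"
  obtain e h where x: "x = (e, h)" and e: "e \<in> Idem X A" and h: "h \<in> Hom E (Fo F A) d" "Rst E h = Fa F e"
    using x by (auto simp: nEl_def)
  note ef = comp_in_Hom[OF f Idem_Hom[OF e]] and hf = E.comp_in_Hom[OF FD(2)[OF f] h(1)]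
  have "Rst E (h \<cdot>\<^bsub>E\<^esub> Fa F f) = Fa F (Rst X (e \<cdot> f))"
    using E.rst_comp_rst[OF FD(2)[OF f] h(1)] h(2) FD(4)[OF f Idem_Hom[OF e]] F_rst[OF ef] by simp
  then show "nact f x \<in> nEl d B"
    using hf rst_Idem[OF ef] by (simp add: x nact_def nEl_def)
  show "fst (nact f x) = Rst X (fst x \<cdot> f)"
    by (simp add: x nact_def)
  fix g D assume g: "g \<in> Hom X D B"
  show "nact (f \<cdot> g) x = nact g (nact f x)"
    using comp_assoc[OF g f Idem_Hom[OF e]] rst_comp_rst[OF g ef] FD(4)[OF g f]
      E.comp_assoc[OF FD(2)[OF g] FD(2)[OF f] h(1)] by (simp add: x nact_def)
next
  fix A x assume A: "A \<in> Obj X" and x: "x \<in> nEl d A"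
  obtain e h where x: "x = (e, h)" and e: "e \<in> Idem X A" and h: "h \<in> Hom E (Fo F A) d" "Rst E h = Fa F e"
    using x by (auto simp: nEl_def)
  show "nact (Idn X A) x = x"
    using comp_idn_right[OF Idem_Hom[OF e]] Idem_rst[OF e] FD(3)[OF A] E.comp_idn_right[OF h(1)]
    by (simp add: x nact_def)
  show "fst x \<in> Idem X A"
    using e by (simp add: x)
  show "nact (fst x) x = x"
    using Idem_idem[OF e] Idem_rst[OF e] E.R1[OF h(1)] h(2) by (simp add: x nact_def)
qed

text \<open>Idempotents are glued in \<open>X\<close> and partial maps in \<open>E\<close>. Both
  separation and gluing need covers in \<open>X\<close> to be sent to covers in \<open>E\<close>,
  and this is where preservation of joins by \<open>F\<close> enters.\<close>

lemma jr_sheaf_nerve: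
  assumes d: "d \<in> Obj E"
  shows "jr_sheaf X (nEl d) nact (\<lambda>A. fst)"
proof -
  interpret n: rpresheaf X "nEl d" nact "\<lambda>A. fst"
    by (rule rpresheaf_nerve)
  show ?thesis
  proof
    fix A D e x y
    assume A: "A \<in> Obj X" and D: "D \<subseteq> Idem X A" "is_join X A A D e"
      and xy: "x \<in> nEl d A" "y \<in> nEl d A" and eq: "\<And>c. c \<in> D \<Longrightarrow> nact c x = nact c y"
    obtain ex hx ey hy where x: "x = (ex, hx)" "ex \<in> Idem X A" "hx \<in> Hom E (Fo F A) d"
      and y: "y = (ey, hy)" "ey \<in> Idem X A" "hy \<in> Hom E (Fo F A) d"
      using xy by (auto simp: nEl_def)
    have r: "Rst X (a \<cdot> b) = a \<cdot> b" if "a \<in> Idem X A" "b \<in> Idem X A" for a b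
      using that Idem_comp Idem_rst by blast
    have "ex \<cdot> c = ey \<cdot> c" if "c \<in> D" for c
      using eq[OF that] r[OF x(2)] r[OF y(2)] D(1) that by (auto simp: x(1) y(1) nact_def subset_iff)
    then have "ex \<cdot> e = ey \<cdot> e"
      using jr_sheaf.sep[OF hom_sheaf[OF A] A D Idem_Hom[OF x(2)] Idem_Hom[OF y(2)]] by blast
    moreover have FD': "Fa F ` D \<subseteq> Idem E (Fo F A)"
      using D(1) F_Idem by blast
    have "hx \<cdot>\<^bsub>E\<^esub> c = hy \<cdot>\<^bsub>E\<^esub> c" if "c \<in> Fa F ` D" for c
      using that eq by (auto simp: x(1) y(1) nact_def)
    then have "hx \<cdot>\<^bsub>E\<^esub> Fa F e = hy \<cdot>\<^bsub>E\<^esub> Fa F e"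
      using jr_sheaf.sep[OF E.hom_sheaf[OF d] FD(1)[OF A] FD' F_join_Idem[OF A D] x(3) y(3)] by blast
    ultimately show "nact e x = nact e y"
      by (simp add: x(1) y(1) nact_def)
  next
    fix A S assume A: "A \<in> Obj X" and S: "S \<subseteq> nEl d A" and C: "n.coherent A S"
    have sE: "fst s \<in> Idem X A" "snd s \<in> Hom E (Fo F A) d" "Rst E (snd s) = Fa F (fst s)" if "s \<in> S" for s
      using that S by (auto simp: nEl_def)
    have I: "fst ` S \<subseteq> Idem X A"
      using sE(1) by blast
    obtain e where e: "is_join X A A (fst ` S) e"
      using Idem_join_exists[OF A I] by blast
    have eI: "e \<in> Idem X A"
      using is_join_Idem[OF A I e] .
    have SH: "snd ` S \<subseteq> Hom E (Fo F A) d"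
      using sE(2) by blast
    have "snd s \<cdot>\<^bsub>E\<^esub> Rst E (snd t) = snd t \<cdot>\<^bsub>E\<^esub> Rst E (snd s)" if s: "s \<in> S" and t: "t \<in> S" for s t
    proof -
      have "nact (fst t) s = nact (fst s) t"
        using C s t by (auto simp: gcompat_def)
      then have "snd (nact (fst t) s) = snd (nact (fst s) t)"
        by simp
      then show ?thesis
        using sE(3)[OF s] sE(3)[OF t] by (simp add: nact_def split_beta)
    qed
    then have SC: "compatible E (snd ` S)"
      by (auto simp: compatible_def)
    obtain j where j: "is_join E (Fo F A) d (snd ` S) j"
      using E.join_exists[OF FD(1)[OF A] d SH SC] by blast
    then have j1: "j \<in> Hom E (Fo F A) d" "\<And>s. s \<in> S \<Longrightarrow> j \<cdot>\<^bsub>E\<^esub> Rst E (snd s) = snd s"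
      "is_join E (Fo F A) (Fo F A) (Rst E ` snd ` S) (Rst E j)"
      using E.glued_hom_iff[OF FD(1)[OF A] d SH SC, of j] by auto
    have "Rst E ` snd ` S = Fa F ` fst ` S"
      unfolding image_image using sE(3) by (intro image_cong) auto
    \<comment> \<open>The glued map is defined on the join of the images, the glued idempotent
      \<open>e\<close> is the join in \<open>X\<close>; \<open>F\<close> identifies the two, so the
      pair is an element of the nerve.\<close>
    then have "Rst E j = Fa F e"
      using E.is_join_unique[OF j1(3)] F_join_Idem[OF A I e] by simp
    then have jE: "(e, j) \<in> nEl d A"
      using eI j1(1) by (simp add: nEl_def)
    moreover have "nact (fst s) (e, j) = s" if s: "s \<in> S" for s
    proof -
      have "e \<cdot> fst s = fst s"
        using e s rle_Idem[OF sE(1)[OF s]] by (auto simp: is_join_def)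
      then show ?thesis
        using j1(2)[OF s] sE(3)[OF s] Idem_rst[OF sE(1)[OF s]] by (simp add: nact_def)
    qed
    ultimately have "n.glue A S (e, j)"
      using e by (simp add: glued_def)
    then show "\<exists>j. n.glue A S j" ..
  qed
qed

text \<open>A total map from a presheaf \<open>P\<close> into the nerve amounts to a weighted cocone
  over \<open>d\<close> whose member at \<open>x\<close> is defined exactly on the image of the
  domain of \<open>x\<close>. Such cocones correspond to total maps out of
  \<open>ext_obj P\<close>.\<close>

lemma ext_adjunction:
  assumes d: "d \<in> Obj (Total E)"
  shows "\<exists>N\<in>Obj (Total (PSh_jr X :: (('o, 'u, 'u) psh, _) rcat)). \<exists>nu.
    (\<forall>P\<in>Obj (Total (PSh_jr X)).
       bij_betw (nu P) (Hom (Total E) (Fo (Total_functor (PSh_jr X) ext) P) d) (Hom (Total (PSh_jr X)) P N)) \<and>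
    (\<forall>P Q. \<forall>\<alpha>\<in>Hom (Total (PSh_jr X)) P Q. \<forall>g\<in>Hom (Total E) (Fo (Total_functor (PSh_jr X) ext) Q) d.
       nu P (g \<cdot>\<^bsub>Total E\<^esub> Fa (Total_functor (PSh_jr X) ext) \<alpha>) = nu Q g \<cdot>\<^bsub>Total (PSh_jr X)\<^esub> \<alpha>)"
proof -
  have dE: "d \<in> Obj E"
    using d by simp
  interpret n: jr_sheaf X "nEl d" nact "\<lambda>A. fst"
    using dE by (rule jr_sheaf_nerve)
  have small: "small TYPE('u) (nEl d A)" if A: "A \<in> Obj X" for A
  proof (rule small_subset)
    show "nEl d A \<subseteq> Hom X A A \<times> Hom E (Fo F A) d"
      by (auto simp: nEl_def Idem_Hom)
    have "small TYPE('u) (Hom E (Fo F A) d)"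
      using E_small FD(1)[OF A] dE by (simp add: locally_small_def)
    then show "small TYPE('u) (Hom X A A \<times> Hom E (Fo F A) d)"
      using small_Times[OF universe small_Hom] by blast
  qed
  obtain N :: "('o, 'u, 'u) psh" and c where N: "join_restriction_presheaf X N"
    and bij: "\<And>A. A \<in> Obj X \<Longrightarrow> bij_betw (c A) (nEl d A) (PEl N A)"
    and act: "\<And>A B f x. f \<in> Hom X B A \<Longrightarrow> x \<in> nEl d A \<Longrightarrow> PAct N f (c A x) = c B (nact f x)"
    and rst: "\<And>A x. A \<in> Obj X \<Longrightarrow> x \<in> nEl d A \<Longrightarrow> PRst N A (c A x) = fst x"
    using n.small_psh[OF small] by blast
  have cN: "c A x \<in> PEl N A" if "A \<in> Obj X" "x \<in> nEl d A" for A x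
    using bij[OF that(1)] that(2) by (auto simp: bij_betw_def)
  have c_inj: "x = y" if "A \<in> Obj X" "x \<in> nEl d A" "y \<in> nEl d A" "c A x = c A y" for A x y
    using bij[OF that(1)] that by (auto simp: bij_betw_def dest: inj_onD)
  have GoT: "Fo (Total_functor (PSh_jr X) ext) P = ext_obj P" if "join_restriction_presheaf X P" for P
    using that Fo_ext by simp
  have GaT: "Fa (Total_functor (PSh_jr X) ext) \<alpha> = ext_arr \<alpha>" if "\<alpha> \<in> Hom (Total (PSh_jr X)) P Q" for \<alpha> P Q
    using HomD(1)[OF that] that Fa_ext[of \<alpha> P Q] by (simp add: Hom_Total)
  \<comment> \<open>The element of the nerve named by \<open>g\<close> at \<open>x\<close>: the
    domain of \<open>x\<close>, and \<open>g\<close> along the leg at \<open>x\<close>. Totality of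
    \<open>g\<close> makes the two components fit together.\<close>
  define l where "l P g A x = (PRst P A x, g \<cdot>\<^bsub>E\<^esub> ext_leg P A x)" for P g A x
  have lE: "l P g A x \<in> nEl d A"
    if P: "join_restriction_presheaf X P" and g: "g \<in> Hom (Total E) (ext_obj P) d" and A: "A \<in> Obj X" "x \<in> PEl P A"
    for P g A x
  proof -
    interpret P: jr_sheaf X "PEl P" "PAct P" "PRst P"
      using P by (rule jr_sheaf_psh)
    have g: "g \<in> Hom E (ext_obj P) d" "Rst E g = Idn E (ext_obj P)"
      using g by (auto simp: Hom_Total)
    show ?thesis
      using P.rst_el[OF A] E.comp_in_Hom[OF extD(3)[OF P A] g(1)] E.rst_comp_total[OF extD(3)[OF P A] g]
        extD(5)[OF P A] by (simp add: l_def nEl_def)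
  qed
  define nu where "nu P g = psh_arr X P N (\<lambda>A x. c A (l P g A x))" for P g
  have nu: "nu P g \<in> Hom (Total (PSh_jr X)) P N"
    if P: "join_restriction_presheaf X P" and g: "g \<in> Hom (Total E) (ext_obj P) d" for P g
  proof -
    interpret P: jr_sheaf X "PEl P" "PAct P" "PRst P"
      using P by (rule jr_sheaf_psh)
    have gH: "g \<in> Hom E (ext_obj P) d"
      using g by (auto simp: Hom_Total)
    have H: "nu P g \<in> Hom (PSh_jr X) P N"
      unfolding nu_def
    proof (intro psh_arrI category_axioms P N)
      show "c A (l P g A x) \<in> PEl N A" if "A \<in> Obj X" "x \<in> PEl P A" for A x
        using cN lE[OF P g] that by blast
      fix A B f x assume f: "f \<in> Hom X B A" and x: "x \<in> PEl P A"
      have A: "A \<in> Obj X"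
        using Hom_Obj[OF f] by simp
      have "nact f (l P g A x) = l P g B (PAct P f x)"
        using P.rst_act[OF f x] extD(4)[OF P f x] E.comp_assoc[OF FD(2)[OF f] extD(3)[OF P A x] gH]
        by (simp add: l_def nact_def)
      then show "c B (l P g B (PAct P f x)) = PAct N f (c A (l P g A x))"
        using act[OF f lE[OF P g A x]] by simp
    qed
    moreover have "Rst (PSh_jr X) (nu P g) = Idn (PSh_jr X) P"
      unfolding PSh_total_iff[OF H] using rst lE[OF P g] by (simp add: nu_def) (simp add: l_def)
    ultimately show ?thesis
      by (simp add: Hom_Total)
  qed
  have nu_map: "TMap (nu P g) A x = c A (l P g A x)" if "A \<in> Obj X" "x \<in> PEl P A" for P g A x
    using that by (simp add: nu_def)
  have "bij_betw (nu P) (Hom (Total E) (ext_obj P) d) (Hom (Total (PSh_jr X)) P N)"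
    if P: "join_restriction_presheaf X P" for P
    unfolding bij_betw_def
  proof (intro conjI inj_onI equalityI subsetI)
    fix g g' assume g: "g \<in> Hom (Total E) (ext_obj P) d" "g' \<in> Hom (Total E) (ext_obj P) d" and eq: "nu P g = nu P g'"
    show "g = g'"
    proof (rule ext_epi[OF P])
      show "g \<in> Hom E (ext_obj P) d" "g' \<in> Hom E (ext_obj P) d"
        using g by (auto simp: Hom_Total)
      fix A x assume A: "A \<in> Obj X" "x \<in> PEl P A"
      have "c A (l P g A x) = c A (l P g' A x)"
        using nu_map[OF A, of g] nu_map[OF A, of g'] eq by simp
      then have "l P g A x = l P g' A x"
        using c_inj lE[OF P] g A by blast
      then show "g \<cdot>\<^bsub>E\<^esub> ext_leg P A x = g' \<cdot>\<^bsub>E\<^esub> ext_leg P A x"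
        by (simp add: l_def)
    qed
  next
    fix h assume "h \<in> nu P ` Hom (Total E) (ext_obj P) d"
    then show "h \<in> Hom (Total (PSh_jr X)) P N"
      using nu[OF P] by blast
  next
    fix h assume hT: "h \<in> Hom (Total (PSh_jr X)) P N"
    then have h: "h \<in> Hom (PSh_jr X) P N" "Rst (PSh_jr X) h = Idn (PSh_jr X) P"
      by (auto simp: Hom_Total)
    interpret P: jr_sheaf X "PEl P" "PAct P" "PRst P"
      using P by (rule jr_sheaf_psh)
    have "\<exists>z\<in>nEl d A. TMap h A x = c A z" if A: "A \<in> Obj X" "x \<in> PEl P A" for A x
      using bij[OF A(1)] PSh_in[OF h(1) A] by (auto simp: bij_betw_def)
    then obtain z where z: "\<And>A x. A \<in> Obj X \<Longrightarrow> x \<in> PEl P A \<Longrightarrow> z A x \<in> nEl d A"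
      "\<And>A x. A \<in> Obj X \<Longrightarrow> x \<in> PEl P A \<Longrightarrow> TMap h A x = c A (z A x)"
      by metis
    \<comment> \<open>Totality of \<open>h\<close> determines the stored idempotents, so only the
      second components carry information; they form the cocone that is factored next.\<close>
    have fz: "fst (z A x) = PRst P A x" if A: "A \<in> Obj X" "x \<in> PEl P A" for A x
      using h(2)[unfolded PSh_total_iff[OF h(1)]] z(2)[OF A] rst[OF A(1) z(1)[OF A]] A
      by metis
    have sz: "snd (z A x) \<in> Hom E (Fo F A) d" "Rst E (snd (z A x)) = Fa F (PRst P A x)"
      if A: "A \<in> Obj X" "x \<in> PEl P A" for A x
      using z(1)[OF A] fz[OF A] by (auto simp: nEl_def)
    have "wcocone X (PEl P) (PAct P) E F d (\<lambda>A x. snd (z A x))"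
      unfolding wcocone_def
    proof (intro conjI ballI allI)
      fix A B f x assume f: "f \<in> Hom X B A" and x: "x \<in> PEl P A"
      have AB: "A \<in> Obj X" "B \<in> Obj X"
        using Hom_Obj[OF f] by auto
      have "c B (z B (PAct P f x)) = c B (nact f (z A x))"
        using z(2)[OF AB(2) P.act_in[OF f x]] PSh_nat[OF h(1) f x] z(2)[OF AB(1) x] act[OF f z(1)[OF AB(1) x]]
        by simp
      then have "z B (PAct P f x) = nact f (z A x)"
        using c_inj[OF AB(2) z(1)[OF AB(2) P.act_in[OF f x]] n.act_in[OF f z(1)[OF AB(1) x]]] by blast
      then show "snd (z B (PAct P f x)) = snd (z A x) \<cdot>\<^bsub>E\<^esub> Fa F f"
        by (simp add: nact_def split_beta)
    qed (use dE sz in auto)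
    then obtain g where g: "g \<in> Hom E (ext_obj P) d"
      "\<And>A x. A \<in> Obj X \<Longrightarrow> x \<in> PEl P A \<Longrightarrow> g \<cdot>\<^bsub>E\<^esub> ext_leg P A x = snd (z A x)"
      using extD(6)[OF P] by blast
    \<comment> \<open>The cocone has the same restrictions as the legs, hence its mediating map is
      total.\<close>
    have "Rst E g = Idn E (ext_obj P)"
      by (rule E.wcolim_total[OF category_axioms F_functor wcolim_ext[OF P] g(1)])
        (use g(2) sz(2) extD(5)[OF P] in simp)
    then have gT: "g \<in> Hom (Total E) (ext_obj P) d"
      using g(1) by (simp add: Hom_Total)
    have "nu P g = h"
    proof (rule PSh_eqI[OF _ h(1)])
      show "nu P g \<in> Hom (PSh_jr X) P N"
        using nu[OF P gT] by (simp add: Hom_Total)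
      fix A x assume A: "A \<in> Obj X" "x \<in> PEl P A"
      have "l P g A x = z A x"
        using g(2)[OF A] fz[OF A] by (simp add: l_def prod_eq_iff)
      then show "TMap (nu P g) A x = TMap h A x"
        using nu_map[OF A] z(2)[OF A] by simp
    qed
    then show "h \<in> nu P ` Hom (Total E) (ext_obj P) d"
      using gT by blast
  qed
  moreover have "nu P (g \<cdot>\<^bsub>E\<^esub> ext_arr \<alpha>) = nu Q g \<cdot>\<^bsub>PSh_jr X\<^esub> \<alpha>"
    if aT: "\<alpha> \<in> Hom (Total (PSh_jr X)) P Q" and gT: "g \<in> Hom (Total E) (ext_obj Q) d" for P Q \<alpha> g
  proof -
    have a: "\<alpha> \<in> Hom (PSh_jr X) P Q" "Rst (PSh_jr X) \<alpha> = Idn (PSh_jr X) P"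
      and g: "g \<in> Hom E (ext_obj Q) d" "Rst E g = Idn E (ext_obj Q)"
      using aT gT by (auto simp: Hom_Total)
    note P = PSh_HomD(1)[OF a(1)] and Q = PSh_HomD(2)[OF a(1)]
    have pr: "PRst Q A (TMap \<alpha> A x) = PRst P A x" if "A \<in> Obj X" "x \<in> PEl P A" for A x
      using a(2)[unfolded PSh_total_iff[OF a(1)]] that by blast
    have nQ: "nu Q g \<in> Hom (PSh_jr X) Q N"
      using nu[OF Q gT] by (simp add: Hom_Total)
    have ga: "g \<cdot>\<^bsub>E\<^esub> ext_arr \<alpha> \<in> Hom E (ext_obj P) d"
      using E.comp_in_Hom[OF ext_arr(1)[OF a(1)] g(1)] .
    have "Rst E (g \<cdot>\<^bsub>E\<^esub> ext_arr \<alpha>) = Idn E (ext_obj P)"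
    proof (rule E.wcolim_total[OF category_axioms F_functor wcolim_ext[OF P] ga])
      fix A x assume A: "A \<in> Obj X" "x \<in> PEl P A"
      note y = PSh_in[OF a(1) A]
      have "g \<cdot>\<^bsub>E\<^esub> ext_arr \<alpha> \<cdot>\<^bsub>E\<^esub> ext_leg P A x = g \<cdot>\<^bsub>E\<^esub> ext_leg Q A (TMap \<alpha> A x)"
        using E.comp_assoc[OF extD(3)[OF P A] ext_arr(1)[OF a(1)] g(1)] ext_arr(2)[OF a(1) A] by simp
      then show "Rst E (g \<cdot>\<^bsub>E\<^esub> ext_arr \<alpha> \<cdot>\<^bsub>E\<^esub> ext_leg P A x) = Rst E (ext_leg P A x)"
        using E.rst_comp_total[OF extD(3)[OF Q A(1) y] g] extD(5)[OF Q A(1) y] extD(5)[OF P A] pr[OF A] by simp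
    qed
    then have gaT: "g \<cdot>\<^bsub>E\<^esub> ext_arr \<alpha> \<in> Hom (Total E) (ext_obj P) d"
      using ga by (simp add: Hom_Total)
    show ?thesis
    proof (rule PSh_eqI[OF _ PSh_comp_Hom[OF a(1) nQ]])
      show "nu P (g \<cdot>\<^bsub>E\<^esub> ext_arr \<alpha>) \<in> Hom (PSh_jr X) P N"
        using nu[OF P gaT] by (simp add: Hom_Total)
      fix A x assume A: "A \<in> Obj X" "x \<in> PEl P A"
      have "l P (g \<cdot>\<^bsub>E\<^esub> ext_arr \<alpha>) A x = l Q g A (TMap \<alpha> A x)"
        using E.comp_assoc[OF extD(3)[OF P A] ext_arr(1)[OF a(1)] g(1)] ext_arr(2)[OF a(1) A] pr[OF A]
        by (simp add: l_def)
      then show "TMap (nu P (g \<cdot>\<^bsub>E\<^esub> ext_arr \<alpha>)) A x = TMap (nu Q g \<cdot>\<^bsub>PSh_jr X\<^esub> \<alpha>) A x"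
        using nu_map[OF A] TMap_comp[OF a(1) A] nu_map[OF A(1) PSh_in[OF a(1) A]] by simp
    qed
  qed
  moreover have cod: "join_restriction_presheaf X Q" if "\<alpha> \<in> Hom (Total (PSh_jr X)) P Q" for \<alpha> P Q
    using that PSh_HomD(2)[of \<alpha> X P Q] by (simp add: Hom_Total)
  moreover have "Fo (Total_functor (PSh_jr X) ext) Q = ext_obj Q" if "\<alpha> \<in> Hom (Total (PSh_jr X)) P Q" for \<alpha> P Q
    using that GoT cod by blast
  ultimately have "(\<forall>P\<in>Obj (Total (PSh_jr X)).
       bij_betw (nu P) (Hom (Total E) (Fo (Total_functor (PSh_jr X) ext) P) d) (Hom (Total (PSh_jr X)) P N)) \<and>
    (\<forall>P Q. \<forall>\<alpha>\<in>Hom (Total (PSh_jr X)) P Q. \<forall>g\<in>Hom (Total E) (Fo (Total_functor (PSh_jr X) ext) Q) d.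
       nu P (g \<cdot>\<^bsub>Total E\<^esub> Fa (Total_functor (PSh_jr X) ext) \<alpha>) = nu Q g \<cdot>\<^bsub>Total (PSh_jr X)\<^esub> \<alpha>)"
    by (auto simp: GoT GaT simp del: Total_functor_simps)
  then show ?thesis
    using N by (intro bexI[of _ N] exI[of _ nu]) simp_all
qed

lemma ext_cocontinuous: "cocontinuous TYPE('u) (PSh_jr X) E ext"
  unfolding cocontinuous_def preserves_colimits_def
proof (intro allI impI, elim conjE)
  fix J :: "('u, 'u) precat" and c leg
    and K :: "('u, 'u, ('o, 'u, 'u) psh, (('o, 'u, 'u) psh, 'o \<Rightarrow> 'u \<Rightarrow> 'u) transf) func"
  assume J: "small_category TYPE('u) J" and K: "is_functor J (Total (PSh_jr X)) K"
    and c: "is_colimit (Total (PSh_jr X)) J K c leg"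
  interpret PSh: restriction_category "PSh_jr X"
    by (rule restriction_category_PSh)
  have Jc: "category J"
    using J by (simp add: small_category_def)
  show "is_colimit (Total E) J (comp_functor J (Total_functor (PSh_jr X) ext) K)
      (Fo (Total_functor (PSh_jr X) ext) c) (\<lambda>i. Fa (Total_functor (PSh_jr X) ext) (leg i))"
    by (rule left_adjoint_preserves_colimit[OF PSh.category_Total E.category_Total Jc
          PSh.is_functor_Total_functor[OF E.restriction_category_axioms ext_restriction_functor] K c ext_adjunction])
qed

text \<open>A representable has the identity as universal element. The maps \<open>Fa F f\<close>
  induce \<open>t\<close> out of the colimit, the leg at the identity gives \<open>u\<close> in the
  other direction, and every leg is that one composed with some \<open>Fa F f\<close>.\<close>

lemma ext_yoneda_iso:
  obtains s s' where "restriction_transformation X E (comp_functor X ext (yoneda_jr X)) F s"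
    and "restriction_transformation X E F (comp_functor X ext (yoneda_jr X)) s'"
    and "\<And>A. A \<in> Obj X \<Longrightarrow> s' A \<cdot>\<^bsub>E\<^esub> s A = Idn E (ext_obj (representable X A))"
    and "\<And>A. A \<in> Obj X \<Longrightarrow> s A \<cdot>\<^bsub>E\<^esub> s' A = Idn E (Fo F A)"
proof -
  let ?Y = "comp_functor X ext (yoneda_jr X)" and ?R = "representable X"
  have Yf: "is_functor X E ?Y"
    using is_restriction_functor_comp[OF yoneda_restriction_functor ext_restriction_functor]
    by (simp add: is_restriction_functor_def)
  have YFo: "Fo ?Y A = ext_obj (?R A)" if "A \<in> Obj X" for A
    using that yoneda_Fo Fo_ext rep_psh by simp
  have YFa: "Fa ?Y f = ext_arr (Fa (yoneda_jr X) f)" if "f \<in> Hom X A B" for f A B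
    using HomD(1)[OF that] Fa_ext[OF yoneda_Hom[OF that]] by simp
  have legH: "ext_leg (?R A) B f \<in> Hom E (Fo F B) (ext_obj (?R A))" if "f \<in> Hom X B A" for A B f
    using extD(3)[OF rep_psh] Hom_Obj[OF that] that by simp
  have leg_comp: "ext_leg (?R A) D (f \<cdot> g) = ext_leg (?R A) B f \<cdot>\<^bsub>E\<^esub> Fa F g"
    if "f \<in> Hom X B A" "g \<in> Hom X D B" for A B D f g
    using extD(4)[OF rep_psh that(2)] Hom_Obj[OF that(1)] that by simp
  have "\<exists>h\<in>Hom E (ext_obj (?R A)) (Fo F A). \<forall>B\<in>Obj X. \<forall>f\<in>PEl (?R A) B. h \<cdot>\<^bsub>E\<^esub> ext_leg (?R A) B f = Fa F f"
    if A: "A \<in> Obj X" for A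
  proof (rule extD(6)[OF rep_psh[OF A]])
    show "wcocone X (PEl (?R A)) (PAct (?R A)) E F (Fo F A) (\<lambda>B. Fa F)"
      unfolding wcocone_def
    proof (intro conjI ballI allI)
      fix B D g f assume g: "g \<in> Hom X D B" and f: "f \<in> PEl (?R A) B"
      then have f: "f \<in> Hom X B A"
        using Hom_Obj[OF g] by simp
      show "Fa F (PAct (?R A) g f) = Fa F f \<cdot>\<^bsub>E\<^esub> Fa F g"
        using FD(4)[OF g f] f g by simp
    qed (use A FD(1,2) in auto)
  qed
  then obtain t where t: "\<And>A. A \<in> Obj X \<Longrightarrow> t A \<in> Hom E (ext_obj (?R A)) (Fo F A)"
    and t_leg: "\<And>A B f. A \<in> Obj X \<Longrightarrow> B \<in> Obj X \<Longrightarrow> f \<in> Hom X B A \<Longrightarrow> t A \<cdot>\<^bsub>E\<^esub> ext_leg (?R A) B f = Fa F f"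
    by (metis rep_simps(1))
  define u where "u A = ext_leg (?R A) A (Idn X A)" for A
  have u: "u A \<in> Hom E (Fo F A) (ext_obj (?R A))" if "A \<in> Obj X" for A
    unfolding u_def using legH[OF idn_in_Hom[OF that]] .
  have u_total: "Rst E (u A) = Idn E (Fo F A)" if "A \<in> Obj X" for A
    using extD(5)[OF rep_psh[OF that] that, of "Idn X A"] idn_in_Hom[OF that] rst_idn[OF that] FD(3)[OF that] that
    by (simp add: u_def)
  have t_total: "Rst E (t A) = Idn E (ext_obj (?R A))" if A: "A \<in> Obj X" for A
  proof (rule E.wcolim_total[OF category_axioms F_functor wcolim_ext[OF rep_psh[OF A]] t[OF A]])
    fix B f assume B: "B \<in> Obj X" and f: "f \<in> PEl (?R A) B"
    then have fH: "f \<in> Hom X B A"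
      by simp
    show "Rst E (t A \<cdot>\<^bsub>E\<^esub> ext_leg (?R A) B f) = Rst E (ext_leg (?R A) B f)"
      using t_leg[OF A B fH] extD(5)[OF rep_psh[OF A] B f] F_rst[OF fH] fH B by simp
  qed
  have tu: "t A \<cdot>\<^bsub>E\<^esub> u A = Idn E (Fo F A)" if A: "A \<in> Obj X" for A
    using t_leg[OF A A idn_in_Hom[OF A]] FD(3)[OF A] by (simp add: u_def)
  have ut: "u A \<cdot>\<^bsub>E\<^esub> t A = Idn E (ext_obj (?R A))" if A: "A \<in> Obj X" for A
  proof (rule ext_epi[OF rep_psh[OF A] E.comp_in_Hom[OF t[OF A] u[OF A]] E.idn_in_Hom[OF extD(2)[OF rep_psh[OF A]]]])
    fix B f assume B: "B \<in> Obj X" and "f \<in> PEl (?R A) B"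
    then have f: "f \<in> Hom X B A"
      by simp
    show "u A \<cdot>\<^bsub>E\<^esub> t A \<cdot>\<^bsub>E\<^esub> ext_leg (?R A) B f = Idn E (ext_obj (?R A)) \<cdot>\<^bsub>E\<^esub> ext_leg (?R A) B f"
      using E.comp_assoc[OF legH[OF f] t[OF A] u[OF A]] t_leg[OF A B f] leg_comp[OF idn_in_Hom[OF A] f]
        comp_idn_left[OF f] E.comp_idn_left[OF legH[OF f]] by (simp add: u_def)
  qed
  have "restriction_transformation X E ?Y F (restrict t (Obj X))"
  proof (rule restriction_transformationI[OF Yf F_functor])
    fix f A B assume f: "f \<in> Hom X A B"
    have AB: "A \<in> Obj X" "B \<in> Obj X"
      using Hom_Obj[OF f] by auto
    note yf = yoneda_Hom[OF f]
    have "t B \<cdot>\<^bsub>E\<^esub> ext_arr (Fa (yoneda_jr X) f) = Fa F f \<cdot>\<^bsub>E\<^esub> t A"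
    proof (rule ext_epi[OF rep_psh[OF AB(1)] E.comp_in_Hom[OF ext_arr(1)[OF yf] t[OF AB(2)]]
          E.comp_in_Hom[OF t[OF AB(1)] FD(2)[OF f]]])
      fix D g assume D: "D \<in> Obj X" and gP: "g \<in> PEl (?R A) D"
      then have g: "g \<in> Hom X D A"
        by simp
      show "t B \<cdot>\<^bsub>E\<^esub> ext_arr (Fa (yoneda_jr X) f) \<cdot>\<^bsub>E\<^esub> ext_leg (?R A) D g = Fa F f \<cdot>\<^bsub>E\<^esub> t A \<cdot>\<^bsub>E\<^esub> ext_leg (?R A) D g"
        using E.comp_assoc[OF legH[OF g] ext_arr(1)[OF yf] t[OF AB(2)]] ext_arr(2)[OF yf D gP] TMap_yoneda[OF f g]
          t_leg[OF AB(2) D comp_in_Hom[OF g f]] E.comp_assoc[OF legH[OF g] t[OF AB(1)] FD(2)[OF f]]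
          t_leg[OF AB(1) D g] FD(4)[OF g f] by simp
    qed
    then show "restrict t (Obj X) B \<cdot>\<^bsub>E\<^esub> Fa ?Y f = Fa F f \<cdot>\<^bsub>E\<^esub> restrict t (Obj X) A"
      using AB YFa[OF f] by (simp del: comp_functor_simps)
  qed (use t t_total YFo in \<open>auto simp del: comp_functor_simps\<close>)
  moreover have "restriction_transformation X E F ?Y (restrict u (Obj X))"
  proof (rule restriction_transformationI[OF F_functor Yf])
    fix f A B assume f: "f \<in> Hom X A B"
    have AB: "A \<in> Obj X" "B \<in> Obj X"
      using Hom_Obj[OF f] by auto
    note yf = yoneda_Hom[OF f]
    have "u B \<cdot>\<^bsub>E\<^esub> Fa F f = ext_arr (Fa (yoneda_jr X) f) \<cdot>\<^bsub>E\<^esub> u A"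
      using leg_comp[OF idn_in_Hom[OF AB(2)] f] comp_idn_left[OF f] ext_arr(2)[OF yf AB(1), of "Idn X A"]
        TMap_yoneda[OF f idn_in_Hom[OF AB(1)]] comp_idn_right[OF f] idn_in_Hom[OF AB(1)] AB(1) by (simp add: u_def)
    then show "restrict u (Obj X) B \<cdot>\<^bsub>E\<^esub> Fa F f = Fa ?Y f \<cdot>\<^bsub>E\<^esub> restrict u (Obj X) A"
      using AB YFa[OF f] by (simp del: comp_functor_simps)
  qed (use u u_total YFo in \<open>auto simp del: comp_functor_simps\<close>)
  ultimately show ?thesis
    using that[of "restrict t (Obj X)" "restrict u (Obj X)"] tu ut by simp
qed

end

section \<open>The free cocompletion\<close>

theorem corollary44:
  fixes X :: "('o, 'u) rcat" and E :: "('p, 'b) rcat"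
  assumes "universe TYPE('u)"
    and "small_join_restriction_category TYPE('u) X"
    and "cocomplete_join_restriction_category TYPE('u) E"
  shows "cocomplete_join_restriction_category TYPE('u)
           (PSh_jr X :: (('o, 'u, 'u) psh, _) rcat)
       \<and> is_join_restriction_functor X (PSh_jr X) (yoneda_jr X)
       \<and> is_equivalence (jrCocomp TYPE('u) (PSh_jr X) E) (jrCat X E)
           (precomposition (jrCocomp TYPE('u) (PSh_jr X) E) X (yoneda_jr X))"
proof -
  interpret join_restriction_category X
    using assms(2) by (simp add: small_join_restriction_category_def)
  interpret small_jr X
    using assms(1,2)
    by unfold_locales (simp_all add: small_join_restriction_category_def small_category_def)
  have E: "join_restriction_category E" "cocomplete TYPE('u) E" "locally_small TYPE('u) E"
    using assms(3) by (simp_all add: cocomplete_join_restriction_category_def)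
  interpret E: join_restriction_category E
    by (fact E)
  interpret PSh: restriction_category "PSh_jr X"
    by (rule restriction_category_PSh)
  have "cocomplete_join_restriction_category TYPE('u) (PSh_jr X :: (('o, 'u, 'u) psh, _) rcat)"
    unfolding cocomplete_join_restriction_category_def
    using join_restriction_category_PSh PSh_locally_small[OF universe small_Obj] cocomplete_PSh by blast
  moreover note yoneda_join_restriction_functor
  moreover have "is_equivalence (jrCocomp TYPE('u) (PSh_jr X) E) (jrCat X E)
      (precomposition (jrCocomp TYPE('u) (PSh_jr X) E) X (yoneda_jr X))"
  proof -
    \<comment> \<open>Naming the two sets of functors puts both hom-categories in the common form
      \<open>transformation_category\<close>.\<close>
    define \<F> :: "(('o, 'u, 'u) psh, (('o, 'u, 'u) psh, 'o \<Rightarrow> 'u \<Rightarrow> 'u) transf, 'p, 'b) func set"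
      where "\<F> = {H. is_restriction_functor (PSh_jr X) E H \<and> cocontinuous TYPE('u) (PSh_jr X) E H}"
    define \<G> where "\<G> = {F. is_join_restriction_functor X E F}"
    let ?A = "transformation_category (PSh_jr X) E \<F>" and ?B = "transformation_category X E \<G>"
    let ?P = "precomposition ?A X (yoneda_jr X)"
    have F: "is_restriction_functor (PSh_jr X) E H" "cocontinuous TYPE('u) (PSh_jr X) E H" if "H \<in> \<F>" for H
      using that by (auto simp: \<F>_def)
    have A: "category ?A"
      by (rule category_transformation_category[OF PSh.category_axioms E.restriction_category_axioms])
        (simp add: \<F>_def is_restriction_functor_def)
    have B: "category ?B"
      by (rule category_transformation_category[OF category_axioms E.restriction_category_axioms])
        (simp add: \<G>_def is_join_restriction_functor_def is_restriction_functor_def)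
    have y: "is_functor X (PSh_jr X) (yoneda_jr X)"
      using yoneda_restriction_functor by (simp add: is_restriction_functor_def)
    have FG: "comp_functor X H (yoneda_jr X) \<in> \<G>" if "H \<in> \<F>" for H
      using cocontinuous_join_restriction_functor[OF E(1,2) F[OF that]] by (simp add: \<G>_def)
    have P: "is_functor ?A ?B ?P"
      by (rule precomposition_functor(1)[OF category_axioms PSh.category_axioms y _ A]) (rule FG)
    have PFo: "Fo ?P H = comp_functor X H (yoneda_jr X)" if "H \<in> \<F>" for H
      using that by (simp add: precomposition_def)
    have "is_equivalence ?A ?B ?P"
    proof (rule is_equivalenceI[OF A B P])
      \<comment> \<open>Full faithfulness: a preimage of \<open>s\<close> is its extension along the
        embedding, and it is unique because \<open>H\<close> is determined by
        representables.\<close>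
      fix H H' s assume H: "H \<in> Obj ?A" "H' \<in> Obj ?A" and s: "s \<in> Hom ?B (Fo ?P H) (Fo ?P H')"
      then have HF: "H \<in> \<F>" "H' \<in> \<F>"
        by auto
      have sT: "restriction_transformation X E (comp_functor X H (yoneda_jr X)) (comp_functor X H' (yoneda_jr X)) (TMap s)"
        using s HF by (simp add: Hom_transformation_category PFo)
      have val: "TMap (Fa ?P t) C = TMap t (representable X C)" if "t \<in> Hom ?A H H'" "C \<in> Obj X" for t C
      proof -
        have "TMap (Fa ?P t) C = TMap t (Fo (yoneda_jr X) C)"
          by (rule precomposition_functor(2)[OF category_axioms PSh.category_axioms y _ A that]) (rule FG)
        then show ?thesis
          using yoneda_Fo that(2) by simp
      qed
      have PH: "Fa ?P t \<in> Hom ?B (Fo ?P H) (Fo ?P H')" if "t \<in> Hom ?A H H'" for t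
        using is_functorD(2)[OF P that] .
      obtain t where t: "restriction_transformation (PSh_jr X) E H H' t" "\<forall>C\<in>Obj X. t (representable X C) = TMap s C"
        using restriction_transformation_extension[OF E(1,2) F[OF HF(1)] F(1)[OF HF(2)] sT] by blast
      let ?t = "\<lparr>TDom = H, TCod = H', TMap = t\<rparr>"
      have tH: "?t \<in> Hom ?A H H'"
        using t(1) HF by (simp add: Hom_transformation_category)
      show "\<exists>!t. t \<in> Hom ?A H H' \<and> Fa ?P t = s"
      proof (intro ex1I[of _ ?t] conjI tH)
        show "Fa ?P ?t = s"
          by (rule transf_eqI[OF PH[OF tH] s]) (use val[OF tH] t(2) in simp)
        fix t' assume t': "t' \<in> Hom ?A H H' \<and> Fa ?P t' = s"
        then have t'H: "t' \<in> Hom ?A H H'" and t's: "Fa ?P t' = s"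
          by auto
        have T': "restriction_transformation (PSh_jr X) E H H' (TMap t')"
          using t'H by (simp add: Hom_transformation_category)
        show "t' = ?t"
        proof (rule transf_eqI[OF t'H tH])
          fix Q :: "('o, 'u, 'u) psh" assume "Q \<in> Obj (PSh_jr X)"
          then have Q: "join_restriction_presheaf X Q"
            by simp
          have "TMap t' (representable X C) = t (representable X C)" if "C \<in> Obj X" for C
            using val[OF t'H that] t(2) t's that by simp
          then show "TMap t' Q = TMap ?t Q"
            using restriction_transformation_unique[OF E(1,2) F[OF HF(1)] T' t(1) _ Q] by simp
        qed
      qed
    next
      \<comment> \<open>Essential surjectivity: \<open>ext\<close> lies over \<open>G\<close> up to
        an isomorphism whose inverse also has total components.\<close>
      fix G assume "G \<in> Obj ?B"
      then have GG: "G \<in> \<G>"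
        by simp
      then interpret yoneda_extension X E G
        by unfold_locales (simp_all add: \<G>_def E)
      have eF: "ext \<in> \<F>"
        using ext_restriction_functor ext_cocontinuous by (simp add: \<F>_def)
      obtain s s' where s: "restriction_transformation X E (comp_functor X ext (yoneda_jr X)) G s"
        and s': "restriction_transformation X E G (comp_functor X ext (yoneda_jr X)) s'"
        and ss: "\<And>C. C \<in> Obj X \<Longrightarrow> s' C \<cdot>\<^bsub>E\<^esub> s C = Idn E (ext_obj (representable X C))"
          "\<And>C. C \<in> Obj X \<Longrightarrow> s C \<cdot>\<^bsub>E\<^esub> s' C = Idn E (Fo G C)"
        using ext_yoneda_iso by blast
      let ?Y = "comp_functor X ext (yoneda_jr X)"
      let ?s = "\<lparr>TDom = ?Y, TCod = G, TMap = s\<rparr>" and ?s' = "\<lparr>TDom = G, TCod = ?Y, TMap = s'\<rparr>"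
      have sH: "?s \<in> Hom ?B ?Y G" and s'H: "?s' \<in> Hom ?B G ?Y"
        using s s' GG FG[OF eF] by (simp_all add: Hom_transformation_category)
      interpret B: category ?B
        by (rule B)
      have "?s' \<cdot>\<^bsub>?B\<^esub> ?s = Idn ?B ?Y"
        by (rule transf_eqI[OF B.comp_in_Hom[OF sH s'H] B.idn_in_Hom])
          (use FG[OF eF] ss(1) Fo_ext rep_psh yoneda_Fo in
            \<open>simp_all add: Comp_transformation_category Idn_transformation_category\<close>)
      moreover have "?s \<cdot>\<^bsub>?B\<^esub> ?s' = Idn ?B G"
        by (rule transf_eqI[OF B.comp_in_Hom[OF s'H sH] B.idn_in_Hom])
          (use GG ss(2) in \<open>simp_all add: Comp_transformation_category Idn_transformation_category\<close>)
      ultimately have "isomorphism ?B ?s"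
        using isomorphismI[OF sH s'H] by blast
      then show "\<exists>H\<in>Obj ?A. \<exists>f\<in>Hom ?B (Fo ?P H) G. isomorphism ?B f"
        using sH eF PFo[OF eF] by (intro bexI[of _ ext] bexI[of _ ?s]) simp_all
    qed
    then show ?thesis
      by (simp add: jrCocomp_def jrCat_def \<F>_def \<G>_def)
  qed
  ultimately show ?thesis
    by blast
qed

end
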